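(* Let $X$ be an analytic normed plane, let $G=(V,E)$ be a graph that is globally rigid in $X$, and let $G'$ be formed from $G$ by a $K_4^-$-extension. Then $G'$ is globally rigid in $X$.
   Context: An analytic normed plane is a 2-dimensional real normed space that is non-Euclidean (norm does not satisfy the parallelogram law) and whose norm is real analytic on $X\setminus\{0\}$. For $p\in X^V$, $(G,p)$ is a framework; $(G,p),(G,q)$ are equivalent if $\|p_v-p_w\|=\|q_v-q_w\|$ for all $vw\in E$ and congruent if $q_v=g(p_v)$ for all $v$ for some isometry $g$ of $X$; $(G,p)$ is globally rigid if every equivalent framework is congruent to it; $G$ is globally rigid in $X$ if the set of $p\in X^V$ with $(G,p)$ globally rigid has non-empty interior. A $K_4^-$-extension deletes an edge $v_1v_2$, adds two new vertices $u_1,u_2$ and the edges $v_1u_1,v_1u_2,v_2u_1,v_2u_2,u_1u_2$. *)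

theory Defs
  imports "HOL-Analysis.Analysis"
begin

section \<open>Analytic normed planes\<close>

text \<open>
  The power series is written in the coordinates of a basis of the plane. Real analyticity does not
  depend on the basis, since an invertible linear change of variables preserves it. The double
  series converges unconditionally (equivalently absolutely).
\<close>

definition real_analytic_on_plane :: "('a::real_normed_vector \<Rightarrow> real) \<Rightarrow> 'a set \<Rightarrow> bool" where
  "real_analytic_on_plane f S \<longleftrightarrow>
     (\<exists>b1 b2. b1 \<noteq> b2 \<and> independent {b1, b2} \<and> span {b1, b2} = UNIV \<and>
       (\<forall>x\<in>S. \<exists>(c :: nat \<Rightarrow> nat \<Rightarrow> real) (r :: real). r > 0 \<and>
         (\<forall>s t. \<bar>s\<bar> < r \<and> \<bar>t\<bar> < r \<longrightarrow>
           ((\<lambda>(i, j). c i j * s ^ i * t ^ j) has_sum f (x + s *\<^sub>R b1 + t *\<^sub>R b2)) UNIV)))"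

definition analytic_normed_plane :: "'a::real_normed_vector itself \<Rightarrow> bool" where
  "analytic_normed_plane X \<longleftrightarrow>
     dim (UNIV :: 'a set) = 2 \<and>
     \<not> (\<forall>x y :: 'a. (norm (x + y))\<^sup>2 + (norm (x - y))\<^sup>2 = 2 * (norm x)\<^sup>2 + 2 * (norm y)\<^sup>2) \<and>
     real_analytic_on_plane (norm :: 'a \<Rightarrow> real) (UNIV - {0})"

section \<open>Graphs\<close>

definition simple_graph :: "'v set \<Rightarrow> 'v set set \<Rightarrow> bool" where
  "simple_graph V E \<longleftrightarrow> finite V \<and> (\<forall>e\<in>E. e \<subseteq> V \<and> card e = 2)"

definition K4_minus_extension ::
  "'v set \<Rightarrow> 'v set set \<Rightarrow> 'v set \<Rightarrow> 'v set set \<Rightarrow> bool" where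
  "K4_minus_extension V E V' E' \<longleftrightarrow>
     (\<exists>v1 v2 u1 u2. {v1, v2} \<in> E \<and> u1 \<notin> V \<and> u2 \<notin> V \<and> u1 \<noteq> u2 \<and>
        V' = V \<union> {u1, u2} \<and>
        E' = (E - {{v1, v2}}) \<union> {{v1, u1}, {v1, u2}, {v2, u1}, {v2, u2}, {u1, u2}})"

section \<open>Frameworks\<close>

text \<open>
  Placements, the elements of \<open>X\<^sup>V\<close>, are the extensional functions \<open>V \<rightarrow>\<^sub>E UNIV\<close>, which is the
  underlying set of the product topology over \<open>V\<close>.
\<close>

definition equivalent_frameworks ::
  "'v set set \<Rightarrow> ('v \<Rightarrow> 'a::real_normed_vector) \<Rightarrow> ('v \<Rightarrow> 'a) \<Rightarrow> bool" where
  "equivalent_frameworks E p q \<longleftrightarrow>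
     (\<forall>v w. {v, w} \<in> E \<longrightarrow> norm (p v - p w) = norm (q v - q w))"

text \<open>Isometries need not be linear; translations are included.\<close>

definition isometry :: "('a::real_normed_vector \<Rightarrow> 'a) \<Rightarrow> bool" where
  "isometry g \<longleftrightarrow> bij g \<and> (\<forall>x y. norm (g x - g y) = norm (x - y))"

definition congruent_frameworks ::
  "'v set \<Rightarrow> ('v \<Rightarrow> 'a::real_normed_vector) \<Rightarrow> ('v \<Rightarrow> 'a) \<Rightarrow> bool" where
  "congruent_frameworks V p q \<longleftrightarrow> (\<exists>g. isometry g \<and> (\<forall>v\<in>V. q v = g (p v)))"

definition globally_rigid_framework ::
  "'v set \<Rightarrow> 'v set set \<Rightarrow> ('v \<Rightarrow> 'a::real_normed_vector) \<Rightarrow> bool" where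
  "globally_rigid_framework V E p \<longleftrightarrow>
     (\<forall>q \<in> V \<rightarrow>\<^sub>E UNIV. equivalent_frameworks E p q \<longrightarrow> congruent_frameworks V p q)"

definition globally_rigid_in ::
  "'a::real_normed_vector itself \<Rightarrow> 'v set \<Rightarrow> 'v set set \<Rightarrow> bool" where
  "globally_rigid_in X V E \<longleftrightarrow>
     product_topology (\<lambda>_. euclidean :: 'a topology) V interior_of
       {p \<in> V \<rightarrow>\<^sub>E (UNIV :: 'a set). globally_rigid_framework V E p} \<noteq> {}"

end

theory Submission
 imports Defs "Jordan_Normal_Form.Determinant"
begin

text \<open>
 Pin one vertex at the origin and write \<open>f\<close> for the edge lengths of \<open>G - v1v2\<close> and \<open>h\<close> for the length of
 \<open>v1v2\<close>. A non-Euclidean plane has only finitely many linear isometries, so on an open set of placements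
 \<open>h\<close> determines the points of a fibre of \<open>f\<close> up to finitely many choices. If \<open>f\<close> had generic rank two or
 more below the dimension, two trajectories inside a fibre would be parametrised by \<open>h\<close> and hence
 coincide. If it had rank one below, then by Sard some fibre is a smooth compact curve, a trajectory on it
 is periodic, and the first return of \<open>h\<close> contradicts the direction in which \<open>h\<close> crosses its initial value.
 So \<open>G - v1v2\<close> has a placement \<open>p\<close> with a nonsingular square subsystem of edge lengths. Every placement
 equivalent to one near \<open>p\<close> and with almost the same \<open>h\<close> is then congruent to it. Putting \<open>u1\<close> close to \<open>v2\<close>
 makes \<open>h\<close> almost constant on equivalent placements, and putting \<open>u2\<close> close to a generic point of the
 segment \<open>v1v2\<close> determines \<open>u2\<close> and then \<open>u1\<close>.
\<close>

section \<open>Power series\<close>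

text \<open>Global rigidity speaks about fibres as sets and says nothing about ranks, so the rank
  has to be read off from curves inside fibres. These are trajectories of one explicit field: in a
  square system of rows that are coordinates or edge lengths, with nonzero Jacobian determinant and
  as many edge rows as possible, the cofactors along a leftover coordinate row. The field is a
  polynomial in derivatives of the norm, hence analytic where no edge has length zero. It vanishes
  exactly where the other rows are dependent, and a linear isometry carries it to a constant
  multiple of itself. Maximality makes it tangent to the fibres near one placement, and the identity
  theorem spreads this to all placements with edges of positive length. That domain is not convex; a
  line through a placement in general position avoids its complement. The one-dimensional case needs
  a whole fibre free of zeros of the field, because only there is a trajectory forced to return:
  this is the purpose of the Sard argument. Strict convexity, which analyticity provides, is what
  ties \<open>u2\<close> to its place on the segment.\<close>

definition analytic_germ :: "(real => real) => bool" where
 "analytic_germ f \<longleftrightarrow> (EX a e. e > 0 & (ALL t. \<bar>t\<bar> < e --> (%n. a n * t ^ n) sums f t))"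

lemma analytic_germ_const: "analytic_germ (%_. c)"
proof -
 have "(%n. (if n = 0 then c else 0) * t ^ n) sums c" for t :: real
  using sums_finite[of "{0}" "%n. (if n = 0 then c else 0) * t ^ n"] by auto
 then show ?thesis
  unfolding analytic_germ_def
  by (intro exI[of _ "%n. if n = 0 then c else 0"] exI[of _ 1]) auto
qed

lemma analytic_germ_affine: "analytic_germ (%t. c + t * d)"
proof -
 have "(%n. (if n = 0 then c else if n = 1 then d else 0) * t ^ n) sums (c + t * d)" for t :: real
 proof -
  have "(%n. (if n = 0 then c else if n = 1 then d else 0) * t ^ n) sums
    (\<Sum>n\<in>{0,1}. (if n = 0 then c else if n = 1 then d else 0) * t ^ n)"
   by (rule sums_finite) auto
  then show ?thesis by (simp add: mult.commute)
 qed
 then show ?thesis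
  unfolding analytic_germ_def
  by (intro exI[of _ "%n. if n = 0 then c else if n = 1 then d else 0"] exI[of _ 1]) auto
qed

lemma analytic_germ_add:
 assumes "analytic_germ f" "analytic_germ g"
 shows "analytic_germ (%t. f t + g t)"
proof -
 obtain a e where a: "e > 0" "!!t. \<bar>t\<bar> < e ==> (%n. a n * t ^ n) sums f t"
  using assms(1) unfolding analytic_germ_def by blast
 obtain b d where b: "d > 0" "!!t. \<bar>t\<bar> < d ==> (%n. b n * t ^ n) sums g t"
  using assms(2) unfolding analytic_germ_def by blast
 have "(%n. (a n + b n) * t ^ n) sums (f t + g t)" if "\<bar>t\<bar> < min d e" for t
  using sums_add[OF a(2) b(2), of t t] that by (simp add: algebra_simps)
 then show ?thesis unfolding analytic_germ_def using a(1) b(1)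
  by (intro exI[of _ "%n. a n + b n"] exI[of _ "min d e"]) auto
qed

lemma analytic_germ_mult:
 assumes "analytic_germ f" "analytic_germ g"
 shows "analytic_germ (%t. f t * g t)"
proof -
 obtain a e where a: "e > 0" "!!t. \<bar>t\<bar> < e ==> (%n. a n * t ^ n) sums f t"
  using assms(1) unfolding analytic_germ_def by blast
 obtain b d where b: "d > 0" "!!t. \<bar>t\<bar> < d ==> (%n. b n * t ^ n) sums g t"
  using assms(2) unfolding analytic_germ_def by blast
 have "(%n. (\<Sum>i\<le>n. a i * b (n - i)) * t ^ n) sums (f t * g t)" if t: "\<bar>t\<bar> < min d e" for t
 proof -
  \<comment> \<open>Convergence at a point strictly beyond |t| gives absolute convergence at
    \<open>t\<close>, as the Cauchy product needs.\<close>
  define s where "s = (\<bar>t\<bar> + min d e) / 2"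
  have s: "\<bar>t\<bar> < s" "s < min d e" using t unfolding s_def by auto
  have "summable (%n. norm (a n * t ^ n))"
   by (rule powser_insidea[of a s]) (use a(2)[of s] s in \<open>auto simp: sums_iff\<close>)
  moreover have "summable (%n. norm (b n * t ^ n))"
   by (rule powser_insidea[of b s]) (use b(2)[of s] s in \<open>auto simp: sums_iff\<close>)
  ultimately have "(%k. \<Sum>i\<le>k. (a i * t ^ i) * (b (k - i) * t ^ (k - i))) sums
   ((\<Sum>k. a k * t ^ k) * (\<Sum>k. b k * t ^ k))"
   by (rule Cauchy_product_sums)
  moreover have "(\<Sum>i\<le>k. (a i * t ^ i) * (b (k - i) * t ^ (k - i))) = (\<Sum>i\<le>k. a i * b (k - i)) * t ^ k" for k
   unfolding sum_distrib_right
  proof (rule sum.cong[OF refl])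
   fix i assume "i \<in> {..k}"
   then have "t ^ k = t ^ i * t ^ (k - i)" by (simp flip: power_add)
   then show "(a i * t ^ i) * (b (k - i) * t ^ (k - i)) = a i * b (k - i) * t ^ k" by simp
  qed
  moreover have "(\<Sum>k. a k * t ^ k) = f t" "(\<Sum>k. b k * t ^ k) = g t"
   using a(2)[of t] b(2)[of t] t by (auto simp: sums_iff)
  ultimately show ?thesis by simp
 qed
 then show ?thesis unfolding analytic_germ_def using a(1) b(1)
  by (intro exI[of _ "%n. \<Sum>i\<le>n. a i * b (n - i)"] exI[of _ "min d e"]) auto
qed

text \<open>Dividing by the lowest power of \<open>t\<close> with nonzero coefficient leaves a
  series that is continuous and nonzero at 0, so zeros cannot accumulate there unless all
  coefficients vanish.\<close>

lemma analytic_germ_isolated_zeros: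
 assumes "analytic_germ f" and zeros: "!!e. e > 0 ==> EX t. t ~= 0 & \<bar>t\<bar> < e & f t = 0"
 shows "EX e>0. ALL t. \<bar>t\<bar> < e --> f t = 0"
proof -
 obtain a e where a: "e > 0" "!!t. \<bar>t\<bar> < e ==> (%n. a n * t ^ n) sums f t"
  using assms(1) unfolding analytic_germ_def by blast
 show ?thesis
 proof (cases "ALL n. a n = 0")
  case True
  then have "f t = 0" if "\<bar>t\<bar> < e" for t using a(2)[OF that] by (simp add: sums_iff)
  then show ?thesis using a(1) by blast
 next
  case False
  define m where "m = (LEAST n. a n ~= 0)"
  have m: "a m ~= 0"
   unfolding m_def by (rule LeastI_ex) (use False in blast)
  have m0: "a n = 0" if "n < m" for n
   using not_less_Least[of n "%n. a n ~= 0"] that unfolding m_def by blast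
  define b where "b n = a (n + m)" for n
  define g where "g t = (\<Sum>n. b n * t ^ n)" for t :: real
  have sums: "(%n. b n * t ^ n) sums (f t / t ^ m)" if t: "\<bar>t\<bar> < e" "t ~= 0" for t
  proof -
   have "(%n. a (n + m) * t ^ (n + m)) sums f t"
    using a(2)[OF t(1)] sums_zero_iff_shift[of m "%n. a n * t ^ n" "f t"] m0 by simp
   then have "(%n. a (n + m) * t ^ (n + m) / t ^ m) sums (f t / t ^ m)"
    by (rule sums_divide)
   then show ?thesis using t(2) by (simp add: b_def power_add)
  qed
  have "summable (%n. b n * (e/2) ^ n)" using sums[of "e/2"] a(1) by (auto simp: sums_iff)
  then have "isCont g 0" unfolding g_def by (rule isCont_powser) (use a(1) in auto)
  moreover have "g 0 = a m" unfolding g_def b_def using powser_zero[of "%n. a (n + m)"] by simp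
  ultimately have "\<forall>\<^sub>F t in at 0. g t ~= 0"
   using m by (metis isCont_def tendsto_imp_eventually_ne)
  then obtain d where d: "d > 0" "!!t. t ~= 0 ==> \<bar>t\<bar> < d ==> g t ~= 0"
   unfolding eventually_at by auto
  obtain t where t: "t ~= 0" "\<bar>t\<bar> < min d e" "f t = 0" using zeros[of "min d e"] d(1) a(1) by auto
  have "g t = f t / t ^ m" unfolding g_def using sums[of t] t by (simp add: sums_iff)
  then show ?thesis using d(2)[of t] t by simp
 qed
qed

text \<open>Termwise differentiation makes the constant coefficient of the series of
  \<open>F m\<close> equal to \<open>fact m\<close> times the coefficient \<open>a m\<close>, so
  vanishing derivatives at 0 kill the whole series.\<close>

lemma analytic_germ_derivs_zero:
 assumes "analytic_germ (F 0)" and "d > 0"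
  and F: "!!m t. \<bar>t\<bar> < d ==> (F m has_real_derivative F (Suc m) t) (at t)"
  and F0: "!!m. F m 0 = 0"
 shows "EX e>0. ALL t. \<bar>t\<bar> < e --> F 0 t = 0"
proof -
 obtain a e where a: "e > 0" "!!t. \<bar>t\<bar> < e ==> (%n. a n * t ^ n) sums F 0 t"
  using assms(1) unfolding analytic_germ_def by blast
 define K where "K = min d e"
 have series: "ALL t. \<bar>t\<bar> < K --> (%n. (diffs ^^ m) a n * t ^ n) sums F m t" for m
 proof (induction m)
  case 0 then show ?case using a(2) by (auto simp: K_def)
 next
  case (Suc m)
  show ?case
  proof (intro allI impI)
   fix t assume t: "\<bar>t\<bar> < K"
   have "(%n. diffs ((diffs ^^ m) a) n * t ^ n) sums F (Suc m) t"
    by (rule termdiffs_sums_strong[where K=K]) (use Suc t F in \<open>auto simp: K_def\<close>)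
   then show "(%n. (diffs ^^ Suc m) a n * t ^ n) sums F (Suc m) t" by simp
  qed
 qed
 have K: "K > 0" using a(1) assms(2) by (simp add: K_def)
 have fac: "(diffs ^^ m) b n * fact n = fact (n + m) * b (n + m)" for m n and b :: "nat => real"
 proof (induction m arbitrary: n)
  case (Suc m)
  have "(diffs ^^ Suc m) b n * fact n = of_nat (Suc n) * (diffs ^^ m) b (Suc n) * fact n"
   by (simp add: diffs_def)
  also have "... = (diffs ^^ m) b (Suc n) * fact (Suc n)" by simp
  also have "... = fact (n + Suc m) * b (n + Suc m)" using Suc[of "Suc n"] by simp
  finally show ?case .
 qed auto
 have "a m = 0" for m
 proof -
  have "(%n. (diffs ^^ m) a n * 0 ^ n) sums 0" using series[of m, rule_format, of 0] K F0[of m] by simp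
  then have "(diffs ^^ m) a 0 = 0" using powser_sums_zero_iff[of "(diffs ^^ m) a" 0] by simp
  then show ?thesis using fac[of m a 0] by simp
 qed
 then have "F 0 t = 0" if "\<bar>t\<bar> < e" for t using a(2)[OF that] by (simp add: sums_iff)
 then show ?thesis using a(1) by blast
qed

text \<open>The points near which \<open>f\<close> vanishes form an open subset of the interval. It
  is closed too, since at a limit point the zeros of \<open>f\<close> accumulate and are therefore
  not isolated; connectedness does the rest.\<close>

lemma analytic_identity:
 fixes f :: "real => real"
 assumes ana: "!!t. t \<in> {a..b} ==> analytic_germ (%s. f (t + s))"
  and t0: "t0 \<in> {a..b}" "e0 > 0" "!!t. \<bar>t - t0\<bar> < e0 ==> f t = 0"
  and t: "t \<in> {a..b}"
 shows "f t = 0"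
proof -
 define Z where "Z = {t\<in>{a..b}. EX e>0. ALL s. \<bar>s\<bar> < e --> f (t + s) = 0}"
 have op: "openin (top_of_set {a..b}) Z"
  unfolding openin_euclidean_subtopology_iff
 proof (intro conjI ballI)
  show "Z \<subseteq> {a..b}" by (auto simp: Z_def)
  fix x assume "x \<in> Z"
  then obtain e where e: "e > 0" "!!s. \<bar>s\<bar> < e ==> f (x + s) = 0" by (auto simp: Z_def)
  have "x' \<in> Z" if x': "x' \<in> {a..b}" "dist x' x < e / 2" for x'
  proof -
   have "f (x' + s) = 0" if "\<bar>s\<bar> < e / 2" for s
   proof -
    have "\<bar>x' - x + s\<bar> < e" using that x'(2) unfolding dist_real_def by arith
    then show ?thesis using e(2)[of "x' - x + s"] by simp
   qed
   then show ?thesis using x'(1) e(1) unfolding Z_def by (auto intro!: exI[of _ "e/2"])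
  qed
  then show "EX e>0. ALL x':{a..b}. dist x' x < e --> x' \<in> Z" using e(1) by (meson half_gt_zero)
 qed
 have cl: "closedin (top_of_set {a..b}) Z"
  unfolding closedin_limpt
 proof (intro conjI allI impI)
  show "Z \<subseteq> {a..b}" by (auto simp: Z_def)
  fix x assume x: "x islimpt Z & x \<in> {a..b}"
  have "EX s. s ~= 0 & \<bar>s\<bar> < e & f (x + s) = 0" if e: "e > 0" for e
  proof -
   obtain z where z: "z \<in> Z" "z ~= x" "dist z x < e" using x e unfolding islimpt_approachable by blast
   then obtain e1 where "e1 > 0" "ALL s. \<bar>s\<bar> < e1 --> f (z + s) = 0" unfolding Z_def by blast
   then have "f z = 0" using spec[of "%s. \<bar>s\<bar> < e1 --> f (z + s) = 0" 0] by simp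
   then show ?thesis using z by (intro exI[of _ "z - x"]) (auto simp: dist_real_def)
  qed
  then show "x \<in> Z" using analytic_germ_isolated_zeros[OF ana[of x]] x by (auto simp: Z_def)
 qed
 have "t0 \<in> Z" unfolding Z_def using t0 by (auto intro!: exI[of _ e0])
 then have "Z = {a..b}" using op cl connected_clopen[of "{a..b}"] by auto
 then have "t \<in> Z" using t by simp
 then obtain e1 where "e1 > 0" "ALL s. \<bar>s\<bar> < e1 --> f (t + s) = 0" unfolding Z_def by blast
 then show ?thesis using spec[of "%s. \<bar>s\<bar> < e1 --> f (t + s) = 0" 0] by simp
qed

section \<open>Double power series\<close>

definition double_series :: "(real => real => real) => (nat => nat => real) => real => bool" where
 "double_series u c r \<longleftrightarrow> (ALL s t. \<bar>s\<bar> < r & \<bar>t\<bar> < r -->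
   ((%(i, j). c i j * s ^ i * t ^ j) has_sum u s t) UNIV)"

text \<open>Coefficients of the formal derivative in the first variable; \<open>shift2\<close> gives
  those in the second.\<close>

definition shift1 :: "(nat => nat => real) => nat => nat => real" where
 "shift1 c = (%i j. real (Suc i) * c (Suc i) j)"

definition shift2 :: "(nat => nat => real) => nat => nat => real" where
 "shift2 c = (%i j. real (Suc j) * c i (Suc j))"

lemma double_series_swap:
 assumes "double_series u c r"
 shows "double_series (%s t. u t s) (%i j. c j i) r"
 unfolding double_series_def
proof (intro allI impI)
 fix s t :: real assume st: "\<bar>s\<bar> < r & \<bar>t\<bar> < r"
 have "((%(i, j). c i j * t ^ i * s ^ j) has_sum u t s) (UNIV \<times> UNIV)"
  using assms st unfolding double_series_def by simp
 then have "((%(x, y). (%(i, j). c i j * t ^ i * s ^ j) (y, x)) has_sum u t s) (UNIV \<times> UNIV)"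
  by (subst (asm) has_sum_swap)
 then show "((%(i, j). c j i * s ^ i * t ^ j) has_sum u t s) UNIV"
  by (simp add: case_prod_unfold mult_ac)
qed

lemma double_series_abs_summable:
 assumes "double_series u c r" "\<bar>s\<bar> < r" "\<bar>t\<bar> < r"
 shows "(%(i, j). \<bar>c i j\<bar> * \<bar>s\<bar> ^ i * \<bar>t\<bar> ^ j) summable_on UNIV"
proof -
 have "(%(i, j). c i j * s ^ i * t ^ j) summable_on UNIV"
  using assms unfolding double_series_def summable_on_def by blast
 then have "(%x. norm ((%(i, j). c i j * s ^ i * t ^ j) x)) summable_on UNIV"
  by (rule iffD1[OF summable_on_iff_abs_summable_on_real])
 then show ?thesis by (simp add: case_prod_unfold abs_mult power_abs)
qed

lemma double_series_bounded:
 assumes "double_series u c r" "0 < rho" "rho < r"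
 shows "EX B. ALL s t. \<bar>s\<bar> <= rho & \<bar>t\<bar> <= rho --> \<bar>u s t\<bar> <= B"
proof (intro exI allI impI)
 fix s t assume st: "\<bar>s\<bar> <= rho & \<bar>t\<bar> <= rho"
 have S: "(%(i, j). \<bar>c i j\<bar> * rho ^ i * rho ^ j) summable_on UNIV"
  using double_series_abs_summable[OF assms(1), of rho rho] assms by simp
 have hs: "((%(i, j). c i j * s ^ i * t ^ j) has_sum u s t) UNIV"
  using assms st unfolding double_series_def by simp
 have le: "norm ((%(i, j). c i j * s ^ i * t ^ j) x) <= (%(i, j). \<bar>c i j\<bar> * rho ^ i * rho ^ j) x" for x
  using st assms(2)
  by (auto simp: case_prod_unfold abs_mult power_abs intro!: mult_mono power_mono)
 have ab: "(%x. norm ((%(i, j). c i j * s ^ i * t ^ j) x)) summable_on UNIV"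
  by (rule Infinite_Sum.abs_summable_on_comparison_test'[OF S le])
 have "\<bar>u s t\<bar> = norm (infsum (%(i, j). c i j * s ^ i * t ^ j) UNIV)"
  using hs by (simp add: infsumI)
 also have "... <= infsum (%x. norm ((%(i, j). c i j * s ^ i * t ^ j) x)) UNIV"
  by (rule Infinite_Sum.norm_infsum_bound[OF ab])
 also have "... <= infsum (%(i, j). \<bar>c i j\<bar> * rho ^ i * rho ^ j) UNIV"
  by (rule infsum_mono[OF ab S le])
 finally show "\<bar>u s t\<bar> <= infsum (%(i, j). \<bar>c i j\<bar> * rho ^ i * rho ^ j) UNIV" .
qed

text \<open>The terms of the differentiated geometric series are bounded inside its disc. This pays
  for the factor \<open>Suc i\<close> produced by differentiation with a slightly larger
  radius.\<close>

lemma Suc_mult_power_bounded: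
 assumes "0 <= (s::real)" "s < K"
 shows "EX M>=0. ALL i. real (Suc i) * s ^ i <= M * K ^ Suc i"
proof -
 have K: "K > 0" using assms by linarith
 have "summable (%n. diffs (%n. 1::real) n * (s / K) ^ n)"
  by (rule termdiff_converges[where K=1]) (use assms K in \<open>auto simp: summable_geometric\<close>)
 then have "Bseq (%n. diffs (%n. 1::real) n * (s / K) ^ n)"
  by (intro convergent_imp_Bseq) (auto simp: convergent_def dest: summable_LIMSEQ_zero)
 then obtain M where M: "M > 0" "!!n. \<bar>real (Suc n) * (s / K) ^ n\<bar> <= M"
  unfolding Bseq_def diffs_def by auto
 have "real (Suc i) * s ^ i <= M / K * K ^ Suc i" for i
 proof -
  have "real (Suc i) * (s / K) ^ i <= M" using M(2)[of i] by linarith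
  then have "real (Suc i) * (s / K) ^ i * K ^ i <= M * K ^ i" using K by (intro mult_right_mono) auto
  then show ?thesis using K by (simp add: power_divide)
 qed
 then show ?thesis using M(1) K by (intro exI[of _ "M / K"]) auto
qed

text \<open>Summing over \<open>j\<close> first leaves an ordinary power series in \<open>s\<close>,
  which is differentiated termwise. The shifted coefficients are absolutely summable by comparison
  at a radius between |s| and \<open>r\<close>, so their double sum may be evaluated in the same
  order and equals the derivative.\<close>

lemma double_series_deriv1:
 assumes u: "double_series u c r"
 shows "double_series (%s t. deriv (%s. u s t) s) (shift1 c) r"
  and "\<bar>s\<bar> < r ==> \<bar>t\<bar> < r ==> ((%s. u s t) has_real_derivative deriv (%s. u s t) s) (at s)"
proof -
 have main: "((%s. u s t) has_real_derivative D) (at s) &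
   ((%(i, j). shift1 c i j * s ^ i * t ^ j) has_sum D) UNIV"
  if st: "\<bar>s\<bar> < r" "\<bar>t\<bar> < r" and D: "D = (\<Sum>n. diffs (%i. infsum (%j. c i j * t ^ j) UNIV) n * s ^ n)"
  for s t D
 proof -
  define b where "b i = infsum (%j. c i j * t ^ j) UNIV" for i
  have inner: "(%j. c i j * t ^ j) summable_on UNIV" for i
  proof -
   \<comment> \<open>At the nonzero point \<open>r/2\<close> the power of the first variable can be
     divided out again, which \<open>s\<close> itself would not allow when it is 0.\<close>
   have r0: "r / 2 > 0" "\<bar>r / 2\<bar> < r" using st by auto
   have "((%(i, j). c i j * (r/2) ^ i * t ^ j) has_sum u (r/2) t) UNIV"
    using u st r0 unfolding double_series_def by blast
   then have "(%(i, j). c i j * (r/2) ^ i * t ^ j) summable_on (UNIV \<times> UNIV)"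
    using has_sum_imp_summable by simp
   then have "(%j. c i j * (r/2) ^ i * t ^ j) summable_on UNIV"
    by (rule summable_on_SigmaD1[where x=i]) auto
   then have "(%j. (1 / (r/2) ^ i) * (c i j * (r/2) ^ i * t ^ j)) summable_on UNIV"
    by (rule summable_on_cmult_right)
   then show ?thesis using r0 by (simp add: field_simps)
  qed
  have ser: "(%i. b i * x ^ i) sums u x t" if x: "\<bar>x\<bar> < r" for x
  proof (rule has_sum_imp_sums, rule has_sum_SigmaD)
   show "((%(i, j). c i j * x ^ i * t ^ j) has_sum u x t) (UNIV \<times> UNIV)"
    using u x st unfolding double_series_def by auto
   fix i :: nat
   show "((%j. (case (i, j) of (i, j) => c i j * x ^ i * t ^ j)) has_sum b i * x ^ i) UNIV"
    using has_sum_cmult_left[OF has_sum_infsum[OF inner[of i]], of "x ^ i"]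
    by (simp add: b_def mult_ac)
  qed
  have der: "((%x. u x t) has_real_derivative D) (at s)"
  proof -
   have "((%z. \<Sum>n. b n * z ^ n) has_field_derivative (\<Sum>n. diffs b n * s ^ n)) (at s)"
    by (rule termdiffs_strong'[where K=r]) (use ser st in \<open>auto simp: sums_iff\<close>)
   moreover have "\<forall>\<^sub>F z in nhds s. (\<Sum>n. b n * z ^ n) = u z t"
   proof -
    have "\<forall>\<^sub>F z in nhds s. \<bar>z\<bar> < r"
     using st(1) by (intro eventually_nhds_in_open[of "{z. \<bar>z\<bar> < r}", simplified] open_Collect_less continuous_intros) auto
    then show ?thesis by eventually_elim (use ser in \<open>auto simp: sums_iff\<close>)
   qed
   ultimately show ?thesis
    using D by (subst (asm) DERIV_cong_ev[OF refl _ refl]) (auto simp: b_def[abs_def])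
  qed
  define K where "K = (\<bar>s\<bar> + r) / 2"
  have K: "\<bar>s\<bar> < K" "K < r" using st unfolding K_def by auto
  obtain M where M: "M >= 0" "!!i. real (Suc i) * \<bar>s\<bar> ^ i <= M * K ^ Suc i"
   using Suc_mult_power_bounded[of "\<bar>s\<bar>" K] K by auto
  have S1: "(%(i, j). \<bar>c i j\<bar> * K ^ i * \<bar>t\<bar> ^ j) summable_on UNIV"
   using double_series_abs_summable[OF u, of K t] K st by simp
  have S2: "(%(i, j). \<bar>c (Suc i) j\<bar> * K ^ Suc i * \<bar>t\<bar> ^ j) summable_on UNIV"
  proof -
   have "(%(i, j). \<bar>c i j\<bar> * K ^ i * \<bar>t\<bar> ^ j) summable_on ((%(i, j). (Suc i, j)) ` UNIV)"
    by (rule summable_on_subset_banach[OF S1]) auto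
   then show ?thesis by (subst (asm) summable_on_reindex) (auto simp: inj_on_def o_def case_prod_unfold)
  qed
  have S3: "(%(i, j). M * (\<bar>c (Suc i) j\<bar> * K ^ Suc i * \<bar>t\<bar> ^ j)) summable_on UNIV"
   using summable_on_cmult_right[OF S2, of M] by (simp add: case_prod_unfold)
  have S4: "(%(i, j). shift1 c i j * s ^ i * t ^ j) summable_on UNIV"
  proof -
   have "norm ((%(i, j). shift1 c i j * s ^ i * t ^ j) x) <= (%(i, j). M * (\<bar>c (Suc i) j\<bar> * K ^ Suc i * \<bar>t\<bar> ^ j)) x" for x
   proof (cases x)
    case (Pair i j)
    have "real (Suc i) * \<bar>s\<bar> ^ i * (\<bar>c (Suc i) j\<bar> * \<bar>t\<bar> ^ j) <= M * K ^ Suc i * (\<bar>c (Suc i) j\<bar> * \<bar>t\<bar> ^ j)"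
     by (rule mult_right_mono[OF M(2)]) auto
    then show ?thesis unfolding Pair by (simp add: shift1_def abs_mult power_abs mult_ac)
   qed
   then have "(%x. norm ((%(i, j). shift1 c i j * s ^ i * t ^ j) x)) summable_on UNIV"
    by (rule Infinite_Sum.abs_summable_on_comparison_test'[OF S3])
   then show ?thesis by (rule iffD2[OF summable_on_iff_abs_summable_on_real])
  qed
  obtain T where T: "((%(i, j). shift1 c i j * s ^ i * t ^ j) has_sum T) UNIV"
   using S4 unfolding summable_on_def by blast
  have "(%i. diffs b i * s ^ i) sums T"
  proof (rule has_sum_imp_sums, rule has_sum_SigmaD)
   show "((%(i, j). shift1 c i j * s ^ i * t ^ j) has_sum T) (UNIV \<times> UNIV)" using T by simp
   fix i :: nat
   show "((%j. (case (i, j) of (i, j) => shift1 c i j * s ^ i * t ^ j)) has_sum diffs b i * s ^ i) UNIV"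
    using has_sum_cmult_left[OF has_sum_infsum[OF inner[of "Suc i"]], of "real (Suc i) * s ^ i"]
    by (simp add: b_def diffs_def shift1_def mult_ac)
  qed
  then have "T = D" using D by (simp add: sums_iff b_def[abs_def])
  then show ?thesis using T der by simp
 qed
 have der: "((%s. u s t) has_real_derivative deriv (%s. u s t) s) (at s) &
   ((%(i, j). shift1 c i j * s ^ i * t ^ j) has_sum deriv (%s. u s t) s) UNIV"
  if "\<bar>s\<bar> < r" "\<bar>t\<bar> < r" for s t
 proof -
  define D where "D = (\<Sum>n. diffs (%i. infsum (%j. c i j * t ^ j) UNIV) n * s ^ n)"
  note m = main[OF that D_def]
  then have "deriv (%s. u s t) s = D" by (intro DERIV_imp_deriv) blast
  then show ?thesis using m by simp
 qed
 show "\<bar>s\<bar> < r ==> \<bar>t\<bar> < r ==> ((%s. u s t) has_real_derivative deriv (%s. u s t) s) (at s)"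
  using der by blast
 show "double_series (%s t. deriv (%s. u s t) s) (shift1 c) r"
  unfolding double_series_def using der by blast
qed

lemma double_series_deriv2:
 assumes u: "double_series u c r"
 shows "double_series (%s t. deriv (%t. u s t) t) (shift2 c) r"
  and "\<bar>s\<bar> < r ==> \<bar>t\<bar> < r ==> ((%t. u s t) has_real_derivative deriv (%t. u s t) t) (at t)"
proof -
 note sw = double_series_deriv1[OF double_series_swap[OF u]]
 show "double_series (%s t. deriv (%t. u s t) t) (shift2 c) r"
  using double_series_swap[OF sw(1)] by (simp add: shift1_def shift2_def)
 show "\<bar>s\<bar> < r ==> \<bar>t\<bar> < r ==> ((%t. u s t) has_real_derivative deriv (%t. u s t) t) (at t)"
  using sw(2)[of t s] by simp
qed

text \<open>Along a line through the origin the terms of total degree \<open>m\<close> combine to a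
  multiple of \<open>tau ^ m\<close>; unconditional summability permits this regrouping.\<close>

lemma double_series_line:
 assumes u: "double_series u c r" and "r > 0"
 shows "analytic_germ (%tau. u (tau * a) (tau * b))"
proof -
 define e where "e = r / (1 + \<bar>a\<bar> + \<bar>b\<bar>)"
 have e: "e > 0" using assms(2) by (simp add: e_def add_pos_nonneg)
 have small: "\<bar>tau * a\<bar> < r & \<bar>tau * b\<bar> < r" if "\<bar>tau\<bar> < e" for tau
 proof -
  have p: "1 + \<bar>a\<bar> + \<bar>b\<bar> > 0" by (simp add: add_pos_nonneg)
  have "\<bar>tau\<bar> * (1 + \<bar>a\<bar> + \<bar>b\<bar>) < r" using that p unfolding e_def by (simp add: field_simps)
  moreover have "\<bar>tau\<bar> * (1 + \<bar>a\<bar> + \<bar>b\<bar>) = \<bar>tau\<bar> + \<bar>tau\<bar> * \<bar>a\<bar> + \<bar>tau\<bar> * \<bar>b\<bar>" by (simp add: algebra_simps)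
  ultimately show ?thesis unfolding abs_mult
   by (smt (verit) abs_ge_zero mult_nonneg_nonneg)
 qed
 define d where "d m = (\<Sum>i\<le>m. c i (m - i) * a ^ i * b ^ (m - i))" for m
 have "(%m. d m * tau ^ m) sums u (tau * a) (tau * b)" if tau: "\<bar>tau\<bar> < e" for tau
 proof -
  let ?f = "%(i, j). c i j * (tau * a) ^ i * (tau * b) ^ j"
  have hs: "(?f has_sum u (tau * a) (tau * b)) UNIV"
   using u small[OF tau] unfolding double_series_def by blast
  have bij: "bij_betw (%(m, i). (i, m - i)) (SIGMA m:UNIV. {..m}) (UNIV :: (nat \<times> nat) set)"
   by (rule bij_betwI[of _ _ _ "%(i, j). (i + j, i)"]) auto
  have "((%x. ?f ((%(m, i). (i, m - i)) x)) has_sum u (tau * a) (tau * b)) (SIGMA m:UNIV. {..m})"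
   using has_sum_reindex_bij_betw[OF bij, of ?f] hs by blast
  then have "((%m. d m * tau ^ m) has_sum u (tau * a) (tau * b)) UNIV"
  proof (rule has_sum_SigmaD)
   fix m :: nat
   have "(\<Sum>i\<le>m. ?f (i, m - i)) = d m * tau ^ m"
    unfolding d_def sum_distrib_right
   proof (rule sum.cong[OF refl])
    fix i assume "i \<in> {..m}"
    then have "tau ^ m = tau ^ i * tau ^ (m - i)" by (simp flip: power_add)
    then show "?f (i, m - i) = c i (m - i) * a ^ i * b ^ (m - i) * tau ^ m"
     by (simp add: power_mult_distrib)
   qed
   then show "((%i. ?f ((%(m, i). (i, m - i)) (m, i))) has_sum d m * tau ^ m) {..m}"
    using has_sum_finite[of "{..m}" "%i. ?f (i, m - i)"] by simp
  qed
  then show ?thesis by (rule has_sum_imp_sums)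
 qed
 then show ?thesis unfolding analytic_germ_def using e by blast
qed

section \<open>Partial derivatives of a function analytic off the origin\<close>

fun partial :: "(real => real => real) => nat => nat => real => real => real" where
 "partial F 0 0 = F"
| "partial F 0 (Suc j) = (%s t. deriv (%t. partial F 0 j s t) t)"
| "partial F (Suc i) j = (%s t. deriv (%s. partial F i j s t) s)"

lemma deriv_translate:
 fixes g :: "real => real"
 shows "deriv (%s. g (x + s)) s = deriv g (x + s)"
proof -
 have "((%s. g (x + s)) has_field_derivative D) (at s) \<longleftrightarrow> (g has_field_derivative D) (at (x + s))" for D
  using DERIV_shift[of g D s x] by (simp add: add.commute)
 then show ?thesis unfolding deriv_def by simp
qed

locale analytic_plane_function =
 fixes F :: "real => real => real"
 assumes local_series: "(x, y) ~= (0, 0) ==> EX c r. r > 0 & double_series (%s t. F (x + s) (y + t)) c r"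
begin

lemma partial_series:
 assumes u: "double_series (%s t. F (x + s) (y + t)) c r"
 shows "double_series (%s t. partial F i j (x + s) (y + t)) ((shift1 ^^ i) ((shift2 ^^ j) c)) r"
proof (induction i)
 case 0
 show ?case
 proof (induction j)
  case (Suc j)
  have "double_series (%s t. deriv (%t. partial F 0 j (x + s) (y + t)) t) (shift2 ((shift2 ^^ j) c)) r"
   using double_series_deriv2(1)[of "%s t. partial F 0 j (x + s) (y + t)"] Suc by simp
  then show ?case by (simp add: deriv_translate)
 qed (use u in simp)
next
 case (Suc i)
 then have "double_series (%s t. deriv (%s. partial F i j (x + s) (y + t)) s)
   (shift1 ((shift1 ^^ i) ((shift2 ^^ j) c))) r"
  using double_series_deriv1(1)[of "%s t. partial F i j (x + s) (y + t)"] by simp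
 moreover have "deriv (%s. partial F i j (x + s) (y + t)) s = deriv (%s. partial F i j s (y + t)) (x + s)" for s t
  using deriv_translate[of "%s. partial F i j s (y + t)" x s] .
 ultimately show ?case by simp
qed

lemma partial_DERIV1:
 assumes u: "double_series (%s t. F (x + s) (y + t)) c r" and st: "\<bar>s\<bar> < r" "\<bar>t\<bar> < r"
 shows "((%s. partial F i j (x + s) (y + t)) has_real_derivative partial F (Suc i) j (x + s) (y + t)) (at s)"
proof -
 have eq: "partial F (Suc i) j (x + s) (y + t) = deriv (%s. partial F i j (x + s) (y + t)) s"
  using deriv_translate[of "%s. partial F i j s (y + t)" x s] by (simp only: partial.simps)
 show ?thesis unfolding eq by (rule double_series_deriv1(2)[OF partial_series[OF u] st])
qed

text \<open>In \<open>partial\<close> the derivatives in the first variable are applied last, so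
  this is the symmetry of mixed derivatives. It holds because the two coefficient shifts commute and
  equal series have equal sums.\<close>

lemma partial_DERIV2:
 assumes u: "double_series (%s t. F (x + s) (y + t)) c r" and st: "\<bar>s\<bar> < r" "\<bar>t\<bar> < r"
 shows "((%t. partial F i j (x + s) (y + t)) has_real_derivative partial F i (Suc j) (x + s) (y + t)) (at t)"
proof -
 have comm: "shift2 ((shift1 ^^ i) a) = (shift1 ^^ i) (shift2 a)" for a
 proof (induction i)
  case (Suc i)
  have "shift2 (shift1 b) = shift1 (shift2 b)" for b
   by (auto simp: shift1_def shift2_def fun_eq_iff)
  then show ?case using Suc by simp
 qed simp
 have "double_series (%s t. deriv (%t. partial F i j (x + s) (y + t)) t)
   (shift2 ((shift1 ^^ i) ((shift2 ^^ j) c))) r"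
  by (rule double_series_deriv2(1)[OF partial_series[OF u]])
 then have "((%(k, l). (shift1 ^^ i) ((shift2 ^^ Suc j) c) k l * s ^ k * t ^ l) has_sum
   deriv (%t. partial F i j (x + s) (y + t)) t) UNIV"
  using st unfolding double_series_def comm by simp
 moreover have "((%(k, l). (shift1 ^^ i) ((shift2 ^^ Suc j) c) k l * s ^ k * t ^ l) has_sum
   partial F i (Suc j) (x + s) (y + t)) UNIV"
  using partial_series[OF u, of i "Suc j"] st unfolding double_series_def by blast
 ultimately have "deriv (%t. partial F i j (x + s) (y + t)) t = partial F i (Suc j) (x + s) (y + t)"
  by (rule has_sum_unique)
 then show ?thesis using double_series_deriv2(2)[OF partial_series[OF u] st, of i j] by simp
qed

lemma partial_line:
 assumes "(x, y) ~= (0, 0)"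
 shows "analytic_germ (%tau. partial F i j (x + tau * a) (y + tau * b))"
proof -
 obtain c r where "r > 0" "double_series (%s t. F (x + s) (y + t)) c r" using local_series[OF assms] by blast
 then show ?thesis using double_series_line[OF partial_series] by blast
qed

lemma mvt_real:
 fixes g :: "real => real"
 assumes "!!s. \<bar>s\<bar> < r ==> (g has_real_derivative g' s) (at s)" "\<bar>a\<bar> < r" "\<bar>b\<bar> < r"
 shows "EX \<xi>. \<bar>\<xi>\<bar> < r & \<bar>\<xi> - a\<bar> <= \<bar>b - a\<bar> & g b - g a = (b - a) * g' \<xi>"
proof (cases a b rule: linorder_cases)
 case less
 then obtain z where "z > a" "z < b" "g b - g a = (b - a) * g' z"
  using MVT2[of a b g g'] assms by force
 then show ?thesis using assms(2,3) by (intro exI[of _ z]) auto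
next
 case greater
 then obtain z where z: "z > b" "z < a" "g a - g b = (a - b) * g' z"
  using MVT2[of b a g g'] assms by force
 then have "g b - g a = (b - a) * g' z" by (simp add: algebra_simps)
 then show ?thesis using assms(2,3) z by (intro exI[of _ z]) auto
qed (use assms in auto)

text \<open>The mean value theorem is applied along two sides of a rectangle, and again to the first
  derivatives at the intermediate points. The bound is uniform in the base point
  \<open>(s, t)\<close>, not only at \<open>(x, y)\<close>; the Lipschitz and inverse function
  estimates depend on that.\<close>

lemma partial_taylor:
 assumes "(x, y) ~= (0, 0)"
 shows "EX r>0. EX C>=0. ALL s t s' t'. \<bar>s - x\<bar> < r & \<bar>t - y\<bar> < r & \<bar>s' - x\<bar> < r & \<bar>t' - y\<bar> < r -->
  \<bar>partial F i j s' t' - partial F i j s t - partial F (Suc i) j s t * (s' - s) - partial F i (Suc j) s t * (t' - t)\<bar>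
   <= C * (\<bar>s' - s\<bar> + \<bar>t' - t\<bar>)\<^sup>2"
proof -
 obtain c r0 where r0: "r0 > 0" and u: "double_series (%s t. F (x + s) (y + t)) c r0"
  using local_series[OF assms] by blast
 define r where "r = r0 / 2"
 have r: "0 < r" "r < r0" using r0 by (auto simp: r_def)
 obtain B where B: "!!k l s t. k \<in> {i, Suc i, Suc (Suc i)} ==> l \<in> {j, Suc j, Suc (Suc j)} ==>
   \<bar>s\<bar> <= r & \<bar>t\<bar> <= r ==> \<bar>partial F k l (x + s) (y + t)\<bar> <= B k l"
  using double_series_bounded[OF partial_series[OF u] r] by metis
 define C where "C = \<bar>B (Suc (Suc i)) j\<bar> + \<bar>B (Suc i) (Suc j)\<bar> + \<bar>B i (Suc (Suc j))\<bar>"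
 have C: "\<bar>partial F k l (x + s) (y + t)\<bar> <= C"
  if "\<bar>s\<bar> < r" "\<bar>t\<bar> < r" "(k, l) \<in> {(Suc (Suc i), j), (Suc i, Suc j), (i, Suc (Suc j))}" for k l s t
  using B[of k l s t] that unfolding C_def by auto
 note D1 = partial_DERIV1[OF u] and D2 = partial_DERIV2[OF u]
 have lip: "\<bar>partial F k l (x + s') (y + t') - partial F k l (x + s) (y + t)\<bar> <= C * (\<bar>s' - s\<bar> + \<bar>t' - t\<bar>)"
  if st: "\<bar>s\<bar> < r" "\<bar>t\<bar> < r" "\<bar>s'\<bar> < r" "\<bar>t'\<bar> < r" and kl: "(k, l) \<in> {(Suc i, j), (i, Suc j)}" for k l s t s' t'
 proof -
  obtain \<xi> where \<xi>: "\<bar>\<xi>\<bar> < r" "partial F k l (x + s') (y + t') - partial F k l (x + s) (y + t')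
    = (s' - s) * partial F (Suc k) l (x + \<xi>) (y + t')"
   using mvt_real[of r "%s. partial F k l (x + s) (y + t')" "%s. partial F (Suc k) l (x + s) (y + t')" s s']
    D1 st r by force
  obtain eta where eta: "\<bar>eta\<bar> < r" "partial F k l (x + s) (y + t') - partial F k l (x + s) (y + t)
    = (t' - t) * partial F k (Suc l) (x + s) (y + eta)"
   using mvt_real[of r "%t. partial F k l (x + s) (y + t)" "%t. partial F k (Suc l) (x + s) (y + t)" t t']
    D2 st r by force
  have "\<bar>(s' - s) * partial F (Suc k) l (x + \<xi>) (y + t')\<bar> <= \<bar>s' - s\<bar> * C"
   unfolding abs_mult by (intro mult_left_mono C) (use st \<xi> kl in auto)
  moreover have "\<bar>(t' - t) * partial F k (Suc l) (x + s) (y + eta)\<bar> <= \<bar>t' - t\<bar> * C"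
   unfolding abs_mult by (intro mult_left_mono C) (use st eta kl in auto)
  ultimately show ?thesis using \<xi>(2) eta(2) by (simp add: algebra_simps)
 qed
 have tay: "\<bar>partial F i j (x + s') (y + t') - partial F i j (x + s) (y + t)
   - partial F (Suc i) j (x + s) (y + t) * (s' - s) - partial F i (Suc j) (x + s) (y + t) * (t' - t)\<bar>
   <= C * (\<bar>s' - s\<bar> + \<bar>t' - t\<bar>)\<^sup>2"
  if st: "\<bar>s\<bar> < r" "\<bar>t\<bar> < r" "\<bar>s'\<bar> < r" "\<bar>t'\<bar> < r" for s t s' t'
 proof -
  obtain \<xi> where \<xi>: "\<bar>\<xi>\<bar> < r" "\<bar>\<xi> - s\<bar> <= \<bar>s' - s\<bar>" "partial F i j (x + s') (y + t') - partial F i j (x + s) (y + t')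
    = (s' - s) * partial F (Suc i) j (x + \<xi>) (y + t')"
   using mvt_real[of r "%s. partial F i j (x + s) (y + t')" "%s. partial F (Suc i) j (x + s) (y + t')" s s']
    D1 st r by force
  obtain eta where eta: "\<bar>eta\<bar> < r" "\<bar>eta - t\<bar> <= \<bar>t' - t\<bar>" "partial F i j (x + s) (y + t') - partial F i j (x + s) (y + t)
    = (t' - t) * partial F i (Suc j) (x + s) (y + eta)"
   using mvt_real[of r "%t. partial F i j (x + s) (y + t)" "%t. partial F i (Suc j) (x + s) (y + t)" t t']
    D2 st r by force
  let ?d = "\<bar>s' - s\<bar> + \<bar>t' - t\<bar>"
  have C0: "C >= 0" by (simp add: C_def)
  have "\<bar>partial F (Suc i) j (x + \<xi>) (y + t') - partial F (Suc i) j (x + s) (y + t)\<bar> <= C * (\<bar>\<xi> - s\<bar> + \<bar>t' - t\<bar>)"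
   by (rule lip) (use st \<xi> in auto)
  also have "... <= C * ?d" using \<xi>(2) C0 by (intro mult_left_mono) auto
  finally have 1: "\<bar>(s' - s) * (partial F (Suc i) j (x + \<xi>) (y + t') - partial F (Suc i) j (x + s) (y + t))\<bar> <= \<bar>s' - s\<bar> * (C * ?d)"
   unfolding abs_mult by (intro mult_left_mono) auto
  have "\<bar>partial F i (Suc j) (x + s) (y + eta) - partial F i (Suc j) (x + s) (y + t)\<bar> <= C * (\<bar>s - s\<bar> + \<bar>eta - t\<bar>)"
   by (rule lip) (use st eta in auto)
  also have "... <= C * ?d" using eta(2) C0 by (intro mult_left_mono) auto
  finally have 2: "\<bar>(t' - t) * (partial F i (Suc j) (x + s) (y + eta) - partial F i (Suc j) (x + s) (y + t))\<bar> <= \<bar>t' - t\<bar> * (C * ?d)"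
   unfolding abs_mult by (intro mult_left_mono) auto
  have "partial F i j (x + s') (y + t') - partial F i j (x + s) (y + t)
   - partial F (Suc i) j (x + s) (y + t) * (s' - s) - partial F i (Suc j) (x + s) (y + t) * (t' - t)
   = (s' - s) * (partial F (Suc i) j (x + \<xi>) (y + t') - partial F (Suc i) j (x + s) (y + t))
   + (t' - t) * (partial F i (Suc j) (x + s) (y + eta) - partial F i (Suc j) (x + s) (y + t))"
   using \<xi>(3) eta(3) by (simp add: algebra_simps)
  moreover have "\<bar>s' - s\<bar> * (C * ?d) + \<bar>t' - t\<bar> * (C * ?d) = C * ?d\<^sup>2"
   by (simp add: power2_eq_square algebra_simps)
  ultimately show ?thesis using 1 2 by linarith
 qed
 have "\<bar>partial F i j s' t' - partial F i j s t - partial F (Suc i) j s t * (s' - s) - partial F i (Suc j) s t * (t' - t)\<bar>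
   <= C * (\<bar>s' - s\<bar> + \<bar>t' - t\<bar>)\<^sup>2"
  if "\<bar>s - x\<bar> < r & \<bar>t - y\<bar> < r & \<bar>s' - x\<bar> < r & \<bar>t' - y\<bar> < r" for s t s' t'
  using tay[of "s - x" "t - y" "s' - x" "t' - y"] that by simp
 moreover have "C >= 0" by (simp add: C_def)
 ultimately show ?thesis using r(1) by blast
qed

end

section \<open>Determinants\<close>

text \<open>Determinant of the upper left \<open>n\<close> by \<open>n\<close> block of an infinite
  array, so that a row is replaced by a plain function update.\<close>

definition ddet :: "nat => (nat => nat => real) => real" where
 "ddet n A = Determinant.det (Matrix.mat n n (%(i, j). A i j))"

definition unit_coord :: "nat => nat => real" where
 "unit_coord k = (%l. if l = k then 1 else 0)"

lemma ddet_cong: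
 assumes "!!i j. i < n ==> j < n ==> A i j = B i j"
 shows "ddet n A = ddet n B"
 unfolding ddet_def by (rule arg_cong[where f=Determinant.det], rule eq_matI) (use assms in auto)

lemma ddet_leibniz:
 "ddet n A = (\<Sum>p\<in>{p. p permutes {0..<n}}. signof p * (\<Prod>i = 0..<n. A i (p i)))"
proof -
 have "ddet n A = (\<Sum>p\<in>{p. p permutes {0..<n}}. signof p *
   (\<Prod>i = 0..<n. Matrix.mat n n (%(i, j). A i j) $$ (i, p i)))"
  unfolding ddet_def by (rule det_def') simp
 also have "... = (\<Sum>p\<in>{p. p permutes {0..<n}}. signof p * (\<Prod>i = 0..<n. A i (p i)))"
 proof (rule sum.cong[OF refl], rule arg_cong[where f="%x. _ * x"], rule prod.cong[OF refl])
  fix p i assume "p \<in> {p. p permutes {0..<n}}" "i \<in> {0..<n}"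
  then have "i < n" "p i < n" using permutes_in_image[of p "{0..<n}" i] by auto
  then show "Matrix.mat n n (%(i, j). A i j) $$ (i, p i) = A i (p i)" by simp
 qed
 finally show ?thesis .
qed

text \<open>Cofactors along row \<open>j\<close> do not depend on that row, and each is itself a
  determinant with a unit row. In this form they later become the components of a vector
  field.\<close>

lemma ddet_row_expand:
 assumes "j < n"
 shows "ddet n (A(j := eta)) = (\<Sum>k<n. eta k * ddet n (A(j := unit_coord k)))"
proof -
 let ?M = "%eta. Matrix.mat n n (%(i, l). (A(j := eta)) i l)"
 define cof where "cof k = cofactor (?M (%_. 0)) j k" for k
 have del: "mat_delete (?M eta) j k = mat_delete (?M (%_. 0)) j k" for eta k
  unfolding mat_delete_def by (rule eq_matI) auto
 have expand: "ddet n (A(j := eta)) = (\<Sum>k<n. eta k * cof k)" for eta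
 proof -
  have "ddet n (A(j := eta)) = (\<Sum>k<n. ?M eta $$ (j, k) * cofactor (?M eta) j k)"
   unfolding ddet_def by (rule laplace_expansion_row) (use assms in auto)
  also have "... = (\<Sum>k<n. eta k * cof k)"
  proof (rule sum.cong[OF refl])
   fix k assume "k \<in> {..<n}"
   then have "?M eta $$ (j, k) = eta k" using assms by simp
   moreover have "cofactor (?M eta) j k = cof k" unfolding cof_def cofactor_def del[of eta] ..
   ultimately show "?M eta $$ (j, k) * cofactor (?M eta) j k = eta k * cof k" by simp
  qed
  finally show ?thesis .
 qed
 have "ddet n (A(j := unit_coord k)) = cof k" if "k < n" for k
 proof -
  have "(\<Sum>l<n. unit_coord k l * cof l) = (\<Sum>l<n. if l = k then cof l else 0)"
   by (rule sum.cong) (auto simp: unit_coord_def)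
  then show ?thesis using expand[of "unit_coord k"] that by simp
 qed
 then show ?thesis using expand[of eta] by simp
qed

text \<open>\<open>B\<close> is the adjugate divided by the determinant.\<close>

lemma ddet_left_inverse:
 assumes "ddet n A ~= 0"
 shows "EX B. ALL u. ALL k<n. u k = (\<Sum>i<n. B k i * (\<Sum>l<n. A i l * u l))"
proof -
 let ?A = "Matrix.mat n n (%(i, j). A i j)"
 have A: "?A \<in> carrier_mat n n" by simp
 define B where "B k i = adj_mat ?A $$ (k, i) / ddet n A" for k i
 have BA: "(\<Sum>i<n. B k i * A i l) = (if k = l then 1 else 0)" if kl: "k < n" "l < n" for k l
 proof -
  have "(adj_mat ?A * ?A) $$ (k, l) = (\<Sum>i<n. adj_mat ?A $$ (k, i) * A i l)"
   using kl adj_mat(1)[OF A]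
   by (auto simp: times_mat_def scalar_prod_def atLeast0LessThan intro!: sum.cong)
  moreover have "(adj_mat ?A * ?A) $$ (k, l) = (if k = l then ddet n A else 0)"
   unfolding adj_mat(3)[OF A] using kl by (simp add: ddet_def)
  ultimately have "(\<Sum>i<n. adj_mat ?A $$ (k, i) * A i l) = (if k = l then ddet n A else 0)" by metis
  then have "(\<Sum>i<n. adj_mat ?A $$ (k, i) * A i l) / ddet n A = (if k = l then 1 else 0)"
   using assms by (cases "k = l") simp_all
  then show ?thesis by (simp add: B_def sum_divide_distrib)
 qed
 have "u k = (\<Sum>i<n. B k i * (\<Sum>l<n. A i l * u l))" if "k < n" for u k
 proof -
  have "(\<Sum>i<n. B k i * (\<Sum>l<n. A i l * u l)) = (\<Sum>i<n. \<Sum>l<n. B k i * A i l * u l)"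
   by (simp add: sum_distrib_left mult.assoc)
  also have "... = (\<Sum>l<n. \<Sum>i<n. B k i * A i l * u l)" by (rule sum.swap)
  also have "... = (\<Sum>l<n. (\<Sum>i<n. B k i * A i l) * u l)" by (simp add: sum_distrib_right)
  also have "... = (\<Sum>l<n. if l = k then u l else 0)"
   by (rule sum.cong) (use BA that in auto)
  finally show ?thesis using that by simp
 qed
 then show ?thesis by blast
qed

lemma ddet_0_imp_dependent_rows:
 assumes "ddet n A = 0"
 shows "EX c. (EX i<n. c i ~= 0) & (ALL j<n. (\<Sum>i<n. c i * A i j) = 0)"
proof -
 let ?A = "Matrix.mat n n (%(i, j). A i j)"
 have "Determinant.det (transpose_mat ?A) = 0"
  using assms det_transpose[of ?A n] by (simp add: ddet_def)
 then obtain v where v: "v \<in> carrier_vec n" "v ~= 0\<^sub>v n" "transpose_mat ?A *\<^sub>v v = 0\<^sub>v n"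
  using det_0_iff_vec_prod_zero_field[of "transpose_mat ?A" n] by auto
 have "EX i<n. Matrix.vec_index v i ~= 0" using v(1,2) by (metis eq_vecI carrier_vecD index_zero_vec)
 moreover have "(\<Sum>i<n. Matrix.vec_index v i * A i j) = 0" if "j < n" for j
 proof -
  have "Matrix.vec_index (transpose_mat ?A *\<^sub>v v) j = (\<Sum>i<n. A i j * Matrix.vec_index v i)"
   using that v(1) by (auto simp: scalar_prod_def atLeast0LessThan intro!: sum.cong)
  then show ?thesis using v(3) that by (simp add: mult.commute)
 qed
 ultimately show ?thesis by (intro exI[of _ "%i. Matrix.vec_index v i"]) auto
qed

lemma ddet_mult: "ddet n (%i j. \<Sum>k<n. A i k * B k j) = ddet n A * ddet n B"
proof -
 have "Matrix.mat n n (%(i, j). \<Sum>k<n. A i k * B k j) =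
   Matrix.mat n n (%(i, j). A i j) * Matrix.mat n n (%(i, j). B i j)"
  by (rule eq_matI) (auto simp: scalar_prod_def atLeast0LessThan intro!: sum.cong)
 then show ?thesis unfolding ddet_def using det_mult[of "Matrix.mat n n (%(i, j). A i j)" n] by simp
qed

lemma ddet_unit: "ddet n unit_coord = 1"
proof -
 have "Matrix.mat n n (%(i, j). unit_coord i j) = 1\<^sub>m n"
  by (rule eq_matI) (auto simp: unit_coord_def)
 then show ?thesis by (simp add: ddet_def)
qed

lemma ddet_identical_rows:
 assumes "i < n" "j < n" "i ~= j" "!!k. k < n ==> A i k = A j k"
 shows "ddet n A = 0"
 unfolding ddet_def
 by (rule det_identical_rows[of _ n i j]) (use assms in \<open>auto simp: Matrix.row_def\<close>)

section \<open>Analytic expressions in the coordinates\<close>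

declare partial.simps [simp del]

text \<open>The functions that occur: polynomials in the coordinates and in the partial derivatives
  of \<open>F\<close> at edge vectors. Vertex \<open>a\<close> has coordinates \<open>2*a\<close>
  and \<open>2*a+1\<close>, and \<open>Der i j a b\<close> refers to the difference of vertices
  \<open>a\<close> and \<open>b\<close>. The family is closed under the directional derivative
  \<open>Du\<close>, so estimates and analyticity follow by structural induction.\<close>

datatype expr = Const real | Coord nat | Der nat nat nat nat | Add expr expr | Mul expr expr

primrec eval :: "(real => real => real) => expr => (nat => real) => real" where
 "eval F (Const c) y = c"
| "eval F (Coord k) y = y k"
| "eval F (Der i j a b) y = partial F i j (y (2*a) - y (2*b)) (y (2*a+1) - y (2*b+1))"
| "eval F (Add e1 e2) y = eval F e1 y + eval F e2 y"
| "eval F (Mul e1 e2) y = eval F e1 y * eval F e2 y"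

primrec Du :: "(nat => real) => expr => expr" where
 "Du u (Const c) = Const 0"
| "Du u (Coord k) = Const (u k)"
| "Du u (Der i j a b) = Add (Mul (Const (u (2*a) - u (2*b))) (Der (Suc i) j a b))
   (Mul (Const (u (2*a+1) - u (2*b+1))) (Der i (Suc j) a b))"
| "Du u (Add e1 e2) = Add (Du u e1) (Du u e2)"
| "Du u (Mul e1 e2) = Add (Mul (Du u e1) e2) (Mul e1 (Du u e2))"

primrec edges_in :: "(nat \<times> nat) set => expr => bool" where
 "edges_in E (Const c) \<longleftrightarrow> True"
| "edges_in E (Coord k) \<longleftrightarrow> True"
| "edges_in E (Der i j a b) \<longleftrightarrow> (a, b) \<in> E"
| "edges_in E (Add e1 e2) \<longleftrightarrow> edges_in E e1 & edges_in E e2"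
| "edges_in E (Mul e1 e2) \<longleftrightarrow> edges_in E e1 & edges_in E e2"

definition edge_nonzero :: "(nat \<times> nat) set => (nat => real) set" where
 "edge_nonzero E = {y. ALL (a, b):E. (y (2*a) - y (2*b), y (2*a+1) - y (2*b+1)) ~= (0, 0)}"

text \<open>Placements are sequences that vanish from index \<open>N\<close> on. For even
  \<open>N\<close> the vertices below \<open>N div 2\<close> are free, and vertex
  \<open>N div 2\<close> sits at the origin: it is the pinned one.\<close>

definition supp_below :: "nat => (nat => real) set" where
 "supp_below N = {y. ALL i>=N. y i = 0}"

definition nbox :: "nat => (nat => real) => real => (nat => real) set" where
 "nbox N y r = {w\<in>supp_below N. ALL i<N. \<bar>w i - y i\<bar> < r}"

lemma edges_in_Du [simp]: "edges_in E e ==> edges_in E (Du u e)"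
 by (induction e) auto

lemma supp_below_add [simp]:
 "y \<in> supp_below N ==> u \<in> supp_below N ==> (%i. y i + t * u i) \<in> supp_below N"
 "y \<in> supp_below N ==> u \<in> supp_below N ==> (%i. y i - u i) \<in> supp_below N"
 by (auto simp: supp_below_def)

lemma unit_coord_supp [simp]: "k < N ==> unit_coord k \<in> supp_below N"
 by (auto simp: supp_below_def unit_coord_def)

lemma eval_Du_linear:
 assumes "u \<in> supp_below N"
 shows "eval F (Du u e) y = (\<Sum>k<N. u k * eval F (Du (unit_coord k) e) y)"
proof -
 have u: "(\<Sum>k<N. u k * unit_coord k l) = u l" for l
 proof -
  have "(\<Sum>k<N. u k * unit_coord k l) = (\<Sum>k<N. if k = l then u k else 0)"
   by (rule sum.cong) (auto simp: unit_coord_def)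
  also have "... = u l" using assms by (auto simp: supp_below_def)
  finally show ?thesis .
 qed
 have u2: "(\<Sum>k<N. u k * ((unit_coord k l - unit_coord k m) * c)) = (u l - u m) * c" for l m c
  using u[of l] u[of m] by (simp add: algebra_simps sum_subtractf flip: sum_distrib_left)
 show ?thesis
 proof (induction e)
  case (Coord l) then show ?case using u[of l] by simp
 next
  case (Der i j a b)
  then show ?case by (simp add: distrib_left sum.distrib u2)
 next
  case (Mul e1 e2)
  then show ?case by (simp add: algebra_simps sum.distrib sum_distrib_left sum_distrib_right)
 qed (auto simp: algebra_simps sum.distrib)
qed

context analytic_plane_function begin

lemma partial_has_derivative:
 assumes "(x, y) ~= (0, 0)"
 shows "((%p. partial F i j (fst p) (snd p)) has_derivative
   (%h. partial F (Suc i) j x y * fst h + partial F i (Suc j) x y * snd h)) (at (x, y))"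
proof -
 let ?f = "%p. partial F i j (fst p) (snd p)"
 let ?D = "%h. partial F (Suc i) j x y * fst h + partial F i (Suc j) x y * snd h"
 obtain r C where r: "r > 0" "C >= 0" and
  T: "!!s t s' t'. \<bar>s - x\<bar> < r & \<bar>t - y\<bar> < r & \<bar>s' - x\<bar> < r & \<bar>t' - y\<bar> < r ==>
  \<bar>partial F i j s' t' - partial F i j s t - partial F (Suc i) j s t * (s' - s) - partial F i (Suc j) s t * (t' - t)\<bar>
   <= C * (\<bar>s' - s\<bar> + \<bar>t' - t\<bar>)\<^sup>2"
  using partial_taylor[OF assms, of i j] by blast
 have bl: "bounded_linear ?D"
  by (intro bounded_linear_add bounded_linear_const_mult bounded_linear_fst bounded_linear_snd)
 have bound: "norm (?f ((x, y) + h) - ?f (x, y) - ?D h) / norm h <= 4 * C * norm h"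
  if h: "norm h < r" for h
 proof -
  have f: "\<bar>fst h\<bar> <= norm h" "\<bar>snd h\<bar> <= norm h"
   using norm_fst_le[of "fst h" "snd h"] norm_snd_le[of "snd h" "fst h"] by auto
  have "norm (?f ((x, y) + h) - ?f (x, y) - ?D h) <= C * (\<bar>fst h\<bar> + \<bar>snd h\<bar>)\<^sup>2"
   using T[of x y "x + fst h" "y + snd h"] f h r(1) by (simp add: algebra_simps)
  also have "... <= C * (2 * norm h)\<^sup>2"
   by (intro mult_left_mono power_mono) (use f r in auto)
  also have "... = 4 * C * norm h * norm h" by (simp add: power2_eq_square)
  finally show ?thesis by (cases "norm h = 0") (auto simp: divide_le_eq)
 qed
 have "((%h. norm (?f ((x, y) + h) - ?f (x, y) - ?D h) / norm h) \<longlongrightarrow> 0) (at 0)"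
 proof (rule tendsto_sandwich[where f="%_. 0" and h="%h. 4 * C * norm h"])
  show "\<forall>\<^sub>F h in at 0. norm (?f ((x, y) + h) - ?f (x, y) - ?D h) / norm h <= 4 * C * norm h"
   unfolding eventually_at using bound r(1) by (intro exI[of _ r]) auto
  show "((%h::real \<times> real. 4 * C * norm h) \<longlongrightarrow> 0) (at 0)"
   by (auto intro!: tendsto_eq_intros)
 qed auto
 then show ?thesis using bl unfolding has_derivative_at by blast
qed

lemma eval_has_derivative_curve:
 assumes "edges_in E e" "x t \<in> edge_nonzero E"
  and "!!k. ((%s. x s k) has_real_derivative x' k) (at t)"
 shows "((%s. eval F e (x s)) has_real_derivative eval F (Du x' e) (x t)) (at t)"
 using assms(1)
proof (induction e)
 case (Der i j a b)
 let ?p = "%s. (x s (2*a) - x s (2*b), x s (2*a+1) - x s (2*b+1))"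
 have nz: "(x t (2*a) - x t (2*b), x t (2*a+1) - x t (2*b+1)) ~= (0, 0)"
  using Der assms(2) unfolding edge_nonzero_def by auto
 have p: "(?p has_derivative (%h. ((x' (2*a) - x' (2*b)) * h, (x' (2*a+1) - x' (2*b+1)) * h))) (at t)"
  using assms(3)
  by (intro has_derivative_Pair) (auto intro!: derivative_eq_intros simp flip: has_field_derivative_def)
 have "((%s. partial F i j (fst (?p s)) (snd (?p s))) has_derivative
   (%h. partial F (Suc i) j (fst (?p t)) (snd (?p t)) * fst ((x' (2*a) - x' (2*b)) * h, (x' (2*a+1) - x' (2*b+1)) * h)
     + partial F i (Suc j) (fst (?p t)) (snd (?p t)) * snd ((x' (2*a) - x' (2*b)) * h, (x' (2*a+1) - x' (2*b+1)) * h))) (at t)"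
  by (rule has_derivative_compose[OF p, of "%p. partial F i j (fst p) (snd p)"])
   (use partial_has_derivative[OF nz] in simp)
 then have "((%s. eval F (Der i j a b) (x s)) has_derivative (*) (eval F (Du x' (Der i j a b)) (x t))) (at t)"
  unfolding fst_conv snd_conv eval.simps by (rule has_derivative_eq_rhs) (auto simp: fun_eq_iff algebra_simps)
 then show ?case by (simp only: has_field_derivative_def)
next
 case (Mul e1 e2)
 have "((%s. eval F e1 (x s) * eval F e2 (x s)) has_real_derivative
   eval F (Du x' e1) (x t) * eval F e2 (x t) + eval F (Du x' e2) (x t) * eval F e1 (x t)) (at t)"
  by (rule DERIV_mult) (use Mul in auto)
 then show ?case by (simp add: mult.commute)
qed (auto intro!: derivative_eq_intros assms(3))

lemma eval_line_DERIV:
 assumes "edges_in E e" "(%i. y i + t * u i) \<in> edge_nonzero E"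
 shows "((%s. eval F e (%i. y i + s * u i)) has_real_derivative eval F (Du u e) (%i. y i + t * u i)) (at t)"
 by (rule eval_has_derivative_curve[where x="%s i. y i + s * u i", OF assms])
  (auto intro!: derivative_eq_intros)

lemma eval_line_analytic:
 assumes "edges_in E e" "y \<in> edge_nonzero E"
 shows "analytic_germ (%s. eval F e (%i. y i + s * u i))"
 using assms(1)
proof (induction e)
 case (Der i j a b)
 have "(y (2*a) - y (2*b), y (2*a+1) - y (2*b+1)) ~= (0, 0)"
  using Der assms(2) unfolding edge_nonzero_def by auto
 from partial_line[OF this, of i j "u (2*a) - u (2*b)" "u (2*a+1) - u (2*b+1)"]
 show ?case by (simp add: algebra_simps)
qed (auto intro: analytic_germ_const analytic_germ_affine analytic_germ_add analytic_germ_mult)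

lemma partial_bounded:
 assumes "(x, y) ~= (0, 0)"
 shows "EX r>0. EX C>=0. ALL s t. \<bar>s - x\<bar> < r & \<bar>t - y\<bar> < r --> \<bar>partial F i j s t\<bar> <= C"
proof -
 obtain c r0 where r0: "r0 > 0" and u: "double_series (%s t. F (x + s) (y + t)) c r0"
  using local_series[OF assms] by blast
 obtain B where B: "!!s t. \<bar>s\<bar> <= r0/2 & \<bar>t\<bar> <= r0/2 ==> \<bar>partial F i j (x + s) (y + t)\<bar> <= B"
  using double_series_bounded[OF partial_series[OF u], of "r0/2" i j] r0 by auto
 have "\<bar>partial F i j s t\<bar> <= \<bar>B\<bar>" if "\<bar>s - x\<bar> < r0/2 & \<bar>t - y\<bar> < r0/2" for s t
  using B[of "s - x" "t - y"] that by simp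
 then show ?thesis using r0 by (intro exI[of _ "r0/2"] conjI exI[of _ "\<bar>B\<bar>"]) auto
qed

text \<open>The size of \<open>e\<close>, its linear term and its second order remainder are bounded
  together because the remainder of a product involves all three for its factors. Both
  \<open>a\<close> and \<open>b\<close> vary, so the expansion may be made at any point near
  \<open>y\<close>.\<close>

lemma eval_taylor:
 assumes "edges_in E e" "y \<in> edge_nonzero E"
 shows "EX r>0. EX C>=0. ALL a b dlt. (ALL i. \<bar>a i - y i\<bar> < r) & (ALL i. \<bar>b i - y i\<bar> < r) & dlt <= 1 & (ALL i. \<bar>b i - a i\<bar> <= dlt) -->
   \<bar>eval F e a\<bar> <= C & \<bar>eval F (Du (%i. b i - a i) e) a\<bar> <= C * dlt &
   \<bar>eval F e b - eval F e a - eval F (Du (%i. b i - a i) e) a\<bar> <= C * dlt\<^sup>2"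
 using assms(1)
proof (induction e)
 case (Const c)
 then show ?case
  by (intro exI[of _ 1] conjI exI[of _ "\<bar>c\<bar>"]) (auto intro!: mult_nonneg_nonneg elim: order_trans[rotated])
next
 case (Coord k)
 have "\<bar>a k\<bar> <= (\<bar>y k\<bar> + 1) & \<bar>b k - a k\<bar> <= (\<bar>y k\<bar> + 1) * dlt & 0 <= (\<bar>y k\<bar> + 1) * dlt\<^sup>2"
  if "ALL i. \<bar>a i - y i\<bar> < 1" "ALL i. \<bar>b i - a i\<bar> <= dlt" for a b dlt
 proof -
  have "\<bar>a k - y k\<bar> < 1" "\<bar>b k - a k\<bar> <= dlt" using that by auto
  moreover from this have "1 * dlt <= (\<bar>y k\<bar> + 1) * dlt" by (intro mult_right_mono) auto
  ultimately show ?thesis by auto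
 qed
 then show ?case by (intro exI[of _ 1] conjI exI[of _ "\<bar>y k\<bar> + 1"]) auto
next
 case (Der i j p q)
 let ?x = "%y. y (2*p) - y (2*q) :: real" and ?z = "%y. y (2*p+1) - y (2*q+1) :: real"
 have nz: "(?x y, ?z y) ~= (0, 0)"
  using Der assms(2) unfolding edge_nonzero_def by auto
 obtain r0 C0 where 0: "r0 > 0" "C0 >= 0" "!!s t. \<bar>s - ?x y\<bar> < r0 & \<bar>t - ?z y\<bar> < r0 ==> \<bar>partial F i j s t\<bar> <= C0"
  using partial_bounded[OF nz, of i j] by blast
 obtain r1 C1 where 1: "r1 > 0" "C1 >= 0" "!!s t. \<bar>s - ?x y\<bar> < r1 & \<bar>t - ?z y\<bar> < r1 ==> \<bar>partial F (Suc i) j s t\<bar> <= C1"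
  using partial_bounded[OF nz, of "Suc i" j] by blast
 obtain r2 C2 where 2: "r2 > 0" "C2 >= 0" "!!s t. \<bar>s - ?x y\<bar> < r2 & \<bar>t - ?z y\<bar> < r2 ==> \<bar>partial F i (Suc j) s t\<bar> <= C2"
  using partial_bounded[OF nz, of i "Suc j"] by blast
 obtain r3 C3 where 3: "r3 > 0" "C3 >= 0" "!!s t s' t'. \<bar>s - ?x y\<bar> < r3 & \<bar>t - ?z y\<bar> < r3 & \<bar>s' - ?x y\<bar> < r3 & \<bar>t' - ?z y\<bar> < r3 ==>
  \<bar>partial F i j s' t' - partial F i j s t - partial F (Suc i) j s t * (s' - s) - partial F i (Suc j) s t * (t' - t)\<bar>
   <= C3 * (\<bar>s' - s\<bar> + \<bar>t' - t\<bar>)\<^sup>2"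
  using partial_taylor[OF nz, of i j] by blast
 define r where "r = min (min r0 r1) (min r2 r3) / 2"
 \<comment> \<open>A difference of two coordinates changes by at most \<open>2 * dlt\<close>; hence
   the factors 2 for the first derivatives and 16, the square of 4, for the remainder.\<close>
 define C where "C = C0 + 2 * C1 + 2 * C2 + 16 * C3"
 have C: "C >= 0" using 0 1 2 3 by (simp add: C_def)
 have main: "\<bar>eval F (Der i j p q) a\<bar> <= C & \<bar>eval F (Du (%i. b i - a i) (Der i j p q)) a\<bar> <= C * dlt &
   \<bar>eval F (Der i j p q) b - eval F (Der i j p q) a - eval F (Du (%i. b i - a i) (Der i j p q)) a\<bar> <= C * dlt\<^sup>2"
  if A: "ALL i. \<bar>a i - y i\<bar> < r" "ALL i. \<bar>b i - y i\<bar> < r" "ALL i. \<bar>b i - a i\<bar> <= dlt" for a b dlt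
 proof -
  have near: "\<bar>(v k - v l) - (y k - y l)\<bar> < 2 * r" if "ALL i. \<bar>v i - y i\<bar> < r" for v k l
   using spec[OF that, of k] spec[OF that, of l] by arith
  have d: "\<bar>(b k - b l) - (a k - a l)\<bar> <= 2 * dlt" for k l
   using spec[OF A(3), of k] spec[OF A(3), of l] by arith
  have dlt: "dlt >= 0" using A(3) abs_ge_zero order_trans by blast
  note na = near[OF A(1)] and nb = near[OF A(2)]
  have rr: "2 * r <= r0" "2 * r <= r1" "2 * r <= r2" "2 * r <= r3" by (auto simp: r_def)
  have b0: "\<bar>partial F i j (?x a) (?z a)\<bar> <= C0"
   using na[of "2*p" "2*q"] na[of "2*p+1" "2*q+1"] rr by (intro 0(3)) linarith
  have b1: "\<bar>partial F (Suc i) j (?x a) (?z a)\<bar> <= C1"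
   using na[of "2*p" "2*q"] na[of "2*p+1" "2*q+1"] rr by (intro 1(3)) linarith
  have b2: "\<bar>partial F i (Suc j) (?x a) (?z a)\<bar> <= C2"
   using na[of "2*p" "2*q"] na[of "2*p+1" "2*q+1"] rr by (intro 2(3)) linarith
  have b3: "\<bar>partial F i j (?x b) (?z b) - partial F i j (?x a) (?z a) - partial F (Suc i) j (?x a) (?z a) * (?x b - ?x a)
    - partial F i (Suc j) (?x a) (?z a) * (?z b - ?z a)\<bar> <= C3 * (\<bar>?x b - ?x a\<bar> + \<bar>?z b - ?z a\<bar>)\<^sup>2"
   using na[of "2*p" "2*q"] na[of "2*p+1" "2*q+1"] nb[of "2*p" "2*q"] nb[of "2*p+1" "2*q+1"] rr
   by (intro 3(3)) linarith
  also have "... <= C3 * (4 * dlt)\<^sup>2"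
   using d[of "2*p" "2*q"] d[of "2*p+1" "2*q+1"] 3(2) by (intro mult_left_mono power_mono) auto
  also have "... = 16 * C3 * dlt\<^sup>2" by (simp add: power2_eq_square)
  also have "... <= C * dlt\<^sup>2" using 0 1 2 3 by (intro mult_right_mono) (auto simp: C_def)
  finally have t3: "\<bar>partial F i j (?x b) (?z b) - partial F i j (?x a) (?z a) - partial F (Suc i) j (?x a) (?z a) * (?x b - ?x a)
    - partial F i (Suc j) (?x a) (?z a) * (?z b - ?z a)\<bar> <= C * dlt\<^sup>2" .
  have "\<bar>(?x b - ?x a) * partial F (Suc i) j (?x a) (?z a)\<bar> <= (2 * dlt) * C1"
   unfolding abs_mult using d[of "2*p" "2*q"] b1 dlt by (intro mult_mono) auto
  moreover have "\<bar>(?z b - ?z a) * partial F i (Suc j) (?x a) (?z a)\<bar> <= (2 * dlt) * C2"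
   unfolding abs_mult using d[of "2*p+1" "2*q+1"] b2 dlt by (intro mult_mono) auto
  moreover have "(2 * dlt) * C1 + (2 * dlt) * C2 <= C * dlt"
  proof -
   have "(2 * C1 + 2 * C2) * dlt <= C * dlt" using 0 3 dlt by (intro mult_right_mono) (auto simp: C_def)
   then show ?thesis by (simp add: algebra_simps)
  qed
  ultimately have t2: "\<bar>(?x b - ?x a) * partial F (Suc i) j (?x a) (?z a) + (?z b - ?z a) * partial F i (Suc j) (?x a) (?z a)\<bar> <= C * dlt"
   by linarith
  have "C0 <= C" using 1 2 3 by (simp add: C_def)
  then show ?thesis using b0 t2 t3 by (simp add: algebra_simps)
 qed
 have "r > 0" using 0 1 2 3 by (simp add: r_def)
 then show ?case using main C by blast
next
 case (Add e1 e2)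
 obtain r1 C1 where 1: "r1 > 0" "C1 >= 0" "!!a b dlt. (ALL i. \<bar>a i - y i\<bar> < r1) & (ALL i. \<bar>b i - y i\<bar> < r1) & dlt <= 1 & (ALL i. \<bar>b i - a i\<bar> <= dlt) ==>
   \<bar>eval F e1 a\<bar> <= C1 & \<bar>eval F (Du (%i. b i - a i) e1) a\<bar> <= C1 * dlt &
   \<bar>eval F e1 b - eval F e1 a - eval F (Du (%i. b i - a i) e1) a\<bar> <= C1 * dlt\<^sup>2"
  using Add by auto
 obtain r2 C2 where 2: "r2 > 0" "C2 >= 0" "!!a b dlt. (ALL i. \<bar>a i - y i\<bar> < r2) & (ALL i. \<bar>b i - y i\<bar> < r2) & dlt <= 1 & (ALL i. \<bar>b i - a i\<bar> <= dlt) ==>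
   \<bar>eval F e2 a\<bar> <= C2 & \<bar>eval F (Du (%i. b i - a i) e2) a\<bar> <= C2 * dlt &
   \<bar>eval F e2 b - eval F e2 a - eval F (Du (%i. b i - a i) e2) a\<bar> <= C2 * dlt\<^sup>2"
  using Add by auto
 show ?case
 proof (rule exI[of _ "min r1 r2"], intro conjI exI[of _ "C1 + C2"] allI impI)
  fix a b :: "nat => real" and dlt
  assume A: "(ALL i. \<bar>a i - y i\<bar> < min r1 r2) & (ALL i. \<bar>b i - y i\<bar> < min r1 r2) & dlt <= 1 & (ALL i. \<bar>b i - a i\<bar> <= dlt)"
  have B1: "\<bar>eval F e1 a\<bar> <= C1 & \<bar>eval F (Du (%i. b i - a i) e1) a\<bar> <= C1 * dlt &
   \<bar>eval F e1 b - eval F e1 a - eval F (Du (%i. b i - a i) e1) a\<bar> <= C1 * dlt\<^sup>2" by (rule 1(3)) (use A in auto)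
  have B2: "\<bar>eval F e2 a\<bar> <= C2 & \<bar>eval F (Du (%i. b i - a i) e2) a\<bar> <= C2 * dlt &
   \<bar>eval F e2 b - eval F e2 a - eval F (Du (%i. b i - a i) e2) a\<bar> <= C2 * dlt\<^sup>2" by (rule 2(3)) (use A in auto)
  show "\<bar>eval F (Add e1 e2) a\<bar> <= C1 + C2" unfolding eval.simps using B1 B2 by linarith
  show "\<bar>eval F (Du (%i. b i - a i) (Add e1 e2)) a\<bar> <= (C1 + C2) * dlt"
   unfolding Du.simps eval.simps distrib_right using B1 B2 by linarith
  show "\<bar>eval F (Add e1 e2) b - eval F (Add e1 e2) a - eval F (Du (%i. b i - a i) (Add e1 e2)) a\<bar> <= (C1 + C2) * dlt\<^sup>2"
   unfolding Du.simps eval.simps distrib_right using B1 B2 by linarith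
 qed (use 1 2 in auto)
next
 case (Mul e1 e2)
 obtain r1 C1 where 1: "r1 > 0" "C1 >= 0" "!!a b dlt. (ALL i. \<bar>a i - y i\<bar> < r1) & (ALL i. \<bar>b i - y i\<bar> < r1) & dlt <= 1 & (ALL i. \<bar>b i - a i\<bar> <= dlt) ==>
   \<bar>eval F e1 a\<bar> <= C1 & \<bar>eval F (Du (%i. b i - a i) e1) a\<bar> <= C1 * dlt &
   \<bar>eval F e1 b - eval F e1 a - eval F (Du (%i. b i - a i) e1) a\<bar> <= C1 * dlt\<^sup>2"
  using Mul by auto
 obtain r2 C2 where 2: "r2 > 0" "C2 >= 0" "!!a b dlt. (ALL i. \<bar>a i - y i\<bar> < r2) & (ALL i. \<bar>b i - y i\<bar> < r2) & dlt <= 1 & (ALL i. \<bar>b i - a i\<bar> <= dlt) ==>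
   \<bar>eval F e2 a\<bar> <= C2 & \<bar>eval F (Du (%i. b i - a i) e2) a\<bar> <= C2 * dlt &
   \<bar>eval F e2 b - eval F e2 a - eval F (Du (%i. b i - a i) e2) a\<bar> <= C2 * dlt\<^sup>2"
  using Mul by auto
 show ?case
 proof (rule exI[of _ "min r1 r2"], intro conjI exI[of _ "4 * C1 * C2"] allI impI)
  fix a b :: "nat => real" and dlt
  assume A: "(ALL i. \<bar>a i - y i\<bar> < min r1 r2) & (ALL i. \<bar>b i - y i\<bar> < min r1 r2) & dlt <= 1 & (ALL i. \<bar>b i - a i\<bar> <= dlt)"
  let ?u = "%i. b i - a i"
  have dlt: "dlt >= 0" "dlt <= 1" using A abs_ge_zero order_trans by blast+
  have dlt2: "dlt\<^sup>2 <= dlt" using dlt by (simp add: power2_eq_square mult_left_le)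
  have B1: "\<bar>eval F e1 a\<bar> <= C1" "\<bar>eval F (Du ?u e1) a\<bar> <= C1 * dlt"
   "\<bar>eval F e1 b - eval F e1 a - eval F (Du ?u e1) a\<bar> <= C1 * dlt\<^sup>2" using 1(3)[of a b dlt] A by auto
  have B2: "\<bar>eval F e2 a\<bar> <= C2" "\<bar>eval F (Du ?u e2) a\<bar> <= C2 * dlt"
   "\<bar>eval F e2 b - eval F e2 a - eval F (Du ?u e2) a\<bar> <= C2 * dlt\<^sup>2" using 2(3)[of a b dlt] A by auto
  have b2: "\<bar>eval F e2 b\<bar> <= C2" using 2(3)[of b b dlt] A dlt by auto
  have CC: "C1 * C2 >= 0" using 1(2) 2(2) by simp
  have "\<bar>eval F (Mul e1 e2) a\<bar> <= C1 * C2" using B1(1) B2(1) 1(2) by (simp add: abs_mult mult_mono)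
  then show "\<bar>eval F (Mul e1 e2) a\<bar> <= 4 * C1 * C2" using CC by linarith
  have m1: "\<bar>eval F (Du ?u e1) a * eval F e2 a\<bar> <= (C1 * dlt) * C2"
   unfolding abs_mult using B1 B2 1 dlt by (intro mult_mono) auto
  have m2: "\<bar>eval F e1 a * eval F (Du ?u e2) a\<bar> <= C1 * (C2 * dlt)"
   unfolding abs_mult using B1 B2 1 dlt by (intro mult_mono) auto
  have "C1 * C2 * dlt >= 0" using CC dlt by simp
  then show "\<bar>eval F (Du ?u (Mul e1 e2)) a\<bar> <= 4 * C1 * C2 * dlt"
   using m1 m2 by (simp add: algebra_simps)
  have "C2 * dlt\<^sup>2 <= C2 * dlt" using dlt2 2(2) by (rule mult_left_mono)
  then have lip2: "\<bar>eval F e2 b - eval F e2 a\<bar> <= 2 * C2 * dlt" using B2 by linarith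
  have n1: "\<bar>(eval F e1 b - eval F e1 a - eval F (Du ?u e1) a) * eval F e2 b\<bar> <= (C1 * dlt\<^sup>2) * C2"
   unfolding abs_mult using B1 b2 1 dlt by (intro mult_mono) auto
  have n2: "\<bar>eval F e1 a * (eval F e2 b - eval F e2 a - eval F (Du ?u e2) a)\<bar> <= C1 * (C2 * dlt\<^sup>2)"
   unfolding abs_mult using B1 B2 1 dlt by (intro mult_mono) auto
  have n3: "\<bar>eval F (Du ?u e1) a * (eval F e2 b - eval F e2 a)\<bar> <= (C1 * dlt) * (2 * C2 * dlt)"
   unfolding abs_mult using B1 lip2 1 dlt by (intro mult_mono) auto
  \<comment> \<open>The remainder of a product: remainder times value, value times remainder, and a
    linear term times an increment, which is quadratic as well.\<close>
  have "eval F (Mul e1 e2) b - eval F (Mul e1 e2) a - eval F (Du ?u (Mul e1 e2)) a =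
    (eval F e1 b - eval F e1 a - eval F (Du ?u e1) a) * eval F e2 b
    + eval F e1 a * (eval F e2 b - eval F e2 a - eval F (Du ?u e2) a)
    + eval F (Du ?u e1) a * (eval F e2 b - eval F e2 a)" by (simp add: algebra_simps)
  moreover have "(C1 * dlt\<^sup>2) * C2 + C1 * (C2 * dlt\<^sup>2) + (C1 * dlt) * (2 * C2 * dlt) = 4 * C1 * C2 * dlt\<^sup>2"
   by (simp add: power2_eq_square)
  ultimately show "\<bar>eval F (Mul e1 e2) b - eval F (Mul e1 e2) a - eval F (Du ?u (Mul e1 e2)) a\<bar> <= 4 * C1 * C2 * dlt\<^sup>2"
   using n1 n2 n3 by linarith
 qed (use 1 2 in auto)
qed

end

section \<open>Boxes of placements and conditions of general position\<close>

definition valid_edges :: "nat => (nat \<times> nat) set => bool" where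
 "valid_edges N E \<longleftrightarrow> finite E & even N & (ALL (a, b):E. a ~= b & 2 * a <= N & 2 * b <= N)"

lemma nboxD: "w \<in> nbox N y r ==> y \<in> supp_below N ==> r > 0 ==> \<bar>w i - y i\<bar> < r"
 by (cases "i < N") (auto simp: nbox_def supp_below_def)

lemma nbox_supp: "w \<in> nbox N y r ==> w \<in> supp_below N"
 by (simp add: nbox_def)

lemma nbox_self: "y \<in> supp_below N ==> r > 0 ==> y \<in> nbox N y r"
 by (simp add: nbox_def)

lemma nbox_subset:
 assumes "w \<in> nbox N y r"
 shows "EX s>0. nbox N w s \<subseteq> nbox N y r"
proof -
 define s where "s = Min (insert 1 ((%i. r - \<bar>w i - y i\<bar>) ` {..<N}))"
 have s: "s > 0" "!!i. i < N ==> s <= r - \<bar>w i - y i\<bar>"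
  using assms unfolding s_def nbox_def by (auto simp: Min_gr_iff)
 have "nbox N w s \<subseteq> nbox N y r"
 proof
  fix v assume v: "v \<in> nbox N w s"
  have "\<bar>v i - y i\<bar> < r" if "i < N" for i
  proof -
   have "\<bar>v i - w i\<bar> < s" using v that unfolding nbox_def by blast
   then show ?thesis using s(2)[OF that] by linarith
  qed
  then show "v \<in> nbox N y r" using v by (simp add: nbox_def)
 qed
 then show ?thesis using s by blast
qed

lemma nbox_mono: "r <= s ==> nbox N y r \<subseteq> nbox N y s"
 by (auto simp: nbox_def intro: less_le_trans)

lemma edge_nonzero_open:
 assumes "finite E" "y \<in> edge_nonzero E"
 shows "EX r>0. ALL w. (ALL i. \<bar>w i - y i\<bar> < r) --> w \<in> edge_nonzero E"
 using assms
proof (induction E rule: finite_induct)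
 case empty then show ?case by (auto simp: edge_nonzero_def intro: exI[of _ 1])
next
 case (insert e E)
 obtain a b where e: "e = (a, b)" by force
 obtain r where r: "r > 0" "!!w. (ALL i. \<bar>w i - y i\<bar> < r) ==> w \<in> edge_nonzero E"
  using insert by (auto simp: edge_nonzero_def)
 obtain k l where kl: "y k - y l ~= 0" "(k = 2*a & l = 2*b) \<or> (k = 2*a+1 & l = 2*b+1)"
  using insert.prems e by (force simp: edge_nonzero_def)
 define s where "s = min r (\<bar>y k - y l\<bar> / 2)"
 have "w \<in> edge_nonzero (insert e E)" if w: "ALL i. \<bar>w i - y i\<bar> < s" for w
 proof -
  have "w \<in> edge_nonzero E" by (rule r(2)) (use w in \<open>auto simp: s_def\<close>)
  moreover have "w k - w l ~= 0"
  proof -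
   have "\<bar>w k - y k\<bar> < \<bar>y k - y l\<bar> / 2" "\<bar>w l - y l\<bar> < \<bar>y k - y l\<bar> / 2"
    using spec[OF w, of k] spec[OF w, of l] by (simp_all add: s_def)
   moreover have "\<bar>(w l - y l) - (w k - y k)\<bar> <= \<bar>w l - y l\<bar> + \<bar>w k - y k\<bar>" by (rule abs_triangle_ineq4)
   moreover have "(w l - y l) - (w k - y k) = y k - y l" if "w k - w l = 0" using that by simp
   ultimately show ?thesis by force
  qed
  ultimately show ?thesis using kl(2) e by (auto simp: edge_nonzero_def)
 qed
 then show ?case using r(1) kl(1) by (intro exI[of _ s]) (auto simp: s_def)
qed

lemma edge_nonzero_line_open:
 assumes "finite E" "(%i. y i + t * u i) \<in> edge_nonzero E"
 shows "\<forall>\<^sub>F s in nhds t. (%i. y i + s * u i) \<in> edge_nonzero E"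
proof -
 have ev: "\<forall>\<^sub>F s in nhds t. (%(a, b). let w = (%i. y i + s * u i) in (w (2*a) - w (2*b), w (2*a+1) - w (2*b+1)) ~= (0, 0)) e"
  if "e \<in> E" for e
 proof -
  obtain a b where e: "e = (a, b)" by force
  let ?p = "%s. ((y (2*a) + s * u (2*a)) - (y (2*b) + s * u (2*b)), (y (2*a+1) + s * u (2*a+1)) - (y (2*b+1) + s * u (2*b+1)))"
  have "(?p \<longlongrightarrow> ?p t) (nhds t)" by (intro tendsto_intros filterlim_ident)
  moreover have "?p t ~= (0, 0)" using assms(2) that e unfolding edge_nonzero_def by force
  ultimately have "\<forall>\<^sub>F s in nhds t. ?p s ~= (0, 0)" by (rule tendsto_imp_eventually_ne)
  then show ?thesis by (simp add: e)
 qed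
 have "\<forall>\<^sub>F s in nhds t. ALL e:E. (%(a, b). let w = (%i. y i + s * u i) in (w (2*a) - w (2*b), w (2*a+1) - w (2*b+1)) ~= (0, 0)) e"
  by (rule eventually_ball_finite[OF assms(1)]) (use ev in blast)
 then show ?thesis by (rule eventually_mono) (auto simp: edge_nonzero_def Let_def)
qed

text \<open>Openness and density relative to \<open>supp_below N\<close>, kept as a predicate on
  conditions so that finitely many of them can be met at once.\<close>

definition dense_open :: "nat => ((nat => real) => bool) => bool" where
 "dense_open N Q \<longleftrightarrow> (ALL w:supp_below N. Q w --> (EX r>0. ALL v:nbox N w r. Q v)) &
   (ALL w:supp_below N. ALL r>0. EX v:nbox N w r. Q v)"

lemma dense_open_conj:
 assumes "dense_open N P" "dense_open N Q"
 shows "dense_open N (%w. P w & Q w)"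
 unfolding dense_open_def
proof (intro conjI ballI allI impI)
 fix w assume w: "w \<in> supp_below N" "P w & Q w"
 then obtain r s where "r > 0" "ALL v:nbox N w r. P v" "s > 0" "ALL v:nbox N w s. Q v"
  using assms unfolding dense_open_def by meson
 then show "EX r>0. ALL v:nbox N w r. P v & Q v"
  using nbox_mono[of "min r s" r N w] nbox_mono[of "min r s" s N w]
  by (intro exI[of _ "min r s"]) auto
next
 fix w and r :: real assume w: "w \<in> supp_below N" "r > 0"
 then obtain v where v: "v \<in> nbox N w r" "P v" using assms(1) unfolding dense_open_def by meson
 obtain s where s: "s > 0" "ALL v':nbox N v s. P v'"
  using assms(1) v nbox_supp unfolding dense_open_def by meson
 obtain s' where s': "s' > 0" "nbox N v s' \<subseteq> nbox N w r" using nbox_subset[OF v(1)] by blast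
 obtain v' where v': "v' \<in> nbox N v (min s s')" "Q v'"
  using assms(2) nbox_supp[OF v(1)] s(1) s'(1) unfolding dense_open_def by (meson min_less_iff_conj)
 then have "v' \<in> nbox N v s" "v' \<in> nbox N v s'"
  using nbox_mono[of "min s s'" s N v] nbox_mono[of "min s s'" s' N v] by auto
 then show "EX v:nbox N w r. P v & Q v" using s s' v'(2) by blast
qed

lemma dense_open_ball:
 assumes "finite S" "!!s. s \<in> S ==> dense_open N (Q s)"
 shows "dense_open N (%w. ALL s:S. Q s w)"
 using assms
proof (induction S rule: finite_induct)
 case empty
 then show ?case by (auto simp: dense_open_def intro: nbox_self exI[of _ 1])
next
 case (insert s S)
 then show ?case using dense_open_conj[of N "Q s" "%w. ALL s:S. Q s w"] by simp
qed

text \<open>Openness comes from the Lipschitz bound, density from a small step along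
  \<open>u\<close>, which changes \<open>l\<close> by a nonzero amount.\<close>

lemma dense_open_affine:
 fixes l :: "(nat => real) => real"
 assumes lip: "!!w v dlt. (!!i. \<bar>w i - v i\<bar> <= dlt) ==> \<bar>l w - l v\<bar> <= L * dlt"
  and u: "u \<in> supp_below N" "!!i. \<bar>u i\<bar> <= 1" and c: "!!w t. l (%i. w i + t * u i) = l w + t * c" "c ~= 0"
 shows "dense_open N (%w. l w ~= 0)"
 unfolding dense_open_def
proof (intro conjI ballI allI impI)
 fix w assume w: "w \<in> supp_below N" "l w ~= 0"
 define r where "r = \<bar>l w\<bar> / (\<bar>L\<bar> + 1)"
 have r: "r > 0" "\<bar>L\<bar> * r < \<bar>l w\<bar>"
  using w(2) by (auto simp: r_def field_simps add_pos_nonneg)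
 have "l v ~= 0" if "v \<in> nbox N w r" for v
 proof -
  have "\<bar>l v - l w\<bar> <= L * r" by (rule lip) (use nboxD[OF that w(1) r(1)] less_imp_le in blast)
  also have "... <= \<bar>L\<bar> * r" using r(1) by (intro mult_right_mono) auto
  finally show ?thesis using r(2) by auto
 qed
 then show "EX r>0. ALL v:nbox N w r. l v ~= 0" using r(1) by blast
next
 fix w and r :: real assume w: "w \<in> supp_below N" "r > 0"
 show "EX v:nbox N w r. l v ~= 0"
 proof (cases "l w = 0")
  case True
  have "(%i. w i + r / 2 * u i) \<in> nbox N w r"
   unfolding nbox_def
  proof (intro CollectI conjI allI impI)
   show "(%i. w i + r / 2 * u i) \<in> supp_below N" using w(1) u(1) by (simp add: supp_below_def)
   fix i
   have "\<bar>r / 2 * u i\<bar> <= r / 2 * 1" unfolding abs_mult using u(2)[of i] w(2) by (intro mult_mono) auto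
   then show "\<bar>w i + r / 2 * u i - w i\<bar> < r" using w(2) by simp
  qed
  moreover have "l (%i. w i + r / 2 * u i) ~= 0" unfolding c(1) using c(2) w(2) True by simp
  ultimately show ?thesis by blast
 qed (use nbox_self w in blast)
qed

text \<open>At most one end of the edge is pinned, so a coordinate of the other can be moved; this
  changes the cross product of the edge vector with \<open>(z1, z2)\<close> linearly.\<close>

lemma dense_open_cross:
 assumes "a ~= b" "2 * a <= N" "2 * b <= N" "even N" "(z1, z2) ~= (0, 0)"
 shows "dense_open N (%w. (w (2*a) - w (2*b)) * z2 - (w (2*a+1) - w (2*b+1)) * z1 ~= 0)"
proof -
 obtain v where v: "(v = a \<or> v = b) & 2 * v + 1 < N"
 proof -
  have "2 * a + 1 < N \<or> 2 * b + 1 < N" using assms(1-4) by (auto elim!: evenE)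
  then show ?thesis using that by auto
 qed
 define sig where "sig = (if v = a then 1 else - 1 :: real)"
 \<comment> \<open>The first coordinate of the edge enters with coefficient \<open>z2\<close>, the
   second with \<open>- z1\<close>; one of the two is nonzero.\<close>
 define k where "k = (if z2 ~= 0 then 2 * v else 2 * v + 1)"
 define c where "c = (if z2 ~= 0 then sig * z2 else - sig * z1)"
 have eo: "2 * i ~= Suc (2 * j)" "Suc (2 * j) ~= 2 * i" for i j :: nat by presburger+
 show ?thesis
 proof (rule dense_open_affine[where u="unit_coord k" and c=c and L="2 * \<bar>z2\<bar> + 2 * \<bar>z1\<bar>"])
  fix w v :: "nat => real" and dlt assume *: "!!i. \<bar>w i - v i\<bar> <= dlt"
  have "\<bar>((w (2*a) - w (2*b)) - (v (2*a) - v (2*b))) * z2\<bar> <= (2 * dlt) * \<bar>z2\<bar>"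
   unfolding abs_mult using *[of "2*a"] *[of "2*b"] by (intro mult_right_mono) auto
  moreover have "\<bar>((w (2*a+1) - w (2*b+1)) - (v (2*a+1) - v (2*b+1))) * z1\<bar> <= (2 * dlt) * \<bar>z1\<bar>"
   unfolding abs_mult using *[of "2*a+1"] *[of "2*b+1"] by (intro mult_right_mono) auto
  ultimately show "\<bar>(w (2*a) - w (2*b)) * z2 - (w (2*a+1) - w (2*b+1)) * z1 -
    ((v (2*a) - v (2*b)) * z2 - (v (2*a+1) - v (2*b+1)) * z1)\<bar> <= (2 * \<bar>z2\<bar> + 2 * \<bar>z1\<bar>) * dlt"
   by (simp add: algebra_simps)
 next
  show "unit_coord k \<in> supp_below N" using v by (auto simp: k_def)
  show "\<bar>unit_coord k i\<bar> <= 1" for i by (simp add: unit_coord_def)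
  show "c ~= 0" using assms(5) by (auto simp: c_def sig_def)
  fix w t
  show "(w (2*a) + t * unit_coord k (2*a) - (w (2*b) + t * unit_coord k (2*b))) * z2 -
   (w (2*a+1) + t * unit_coord k (2*a+1) - (w (2*b+1) + t * unit_coord k (2*b+1))) * z1 =
   (w (2*a) - w (2*b)) * z2 - (w (2*a+1) - w (2*b+1)) * z1 + t * c"
   using v assms(1) by (auto simp: unit_coord_def k_def c_def sig_def eo algebra_simps)
 qed
qed

text \<open>Density comes from the stronger condition that the first coordinates of the two ends
  differ, which is a nonzero cross product with \<open>(0, 1)\<close>.\<close>

lemma dense_open_edge_nonzero:
 assumes "valid_edges N E"
 shows "dense_open N (%w. w \<in> edge_nonzero E)"
proof -
 have fin: "finite E" using assms by (simp add: valid_edges_def)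
 have "dense_open N (%w. ALL e:E. (w (2 * fst e) - w (2 * snd e)) * 1 - (w (2 * fst e+1) - w (2 * snd e+1)) * 0 ~= 0)"
  by (rule dense_open_ball[OF fin], rule dense_open_cross) (use assms in \<open>auto simp: valid_edges_def\<close>)
 then have *: "EX v:nbox N w r. ALL e:E. (v (2 * fst e) - v (2 * snd e)) * 1 - (v (2 * fst e+1) - v (2 * snd e+1)) * 0 ~= 0"
  if "w \<in> supp_below N" "r > 0" for w r
  using that unfolding dense_open_def by blast
 have "EX v:nbox N w r. v \<in> edge_nonzero E" if wr: "w \<in> supp_below N" "r > 0" for w r
 proof -
  obtain v where v: "v \<in> nbox N w r"
   "!!e. e \<in> E ==> (v (2 * fst e) - v (2 * snd e)) * 1 - (v (2 * fst e+1) - v (2 * snd e+1)) * 0 ~= 0"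
   using *[OF wr] by blast
  have "v \<in> edge_nonzero E"
   unfolding edge_nonzero_def using v(2) by (auto split: prod.split)
  then show ?thesis using v(1) by blast
 qed
 moreover have "EX r>0. ALL v:nbox N w r. v \<in> edge_nonzero E" if "w \<in> supp_below N" "w \<in> edge_nonzero E" for w
  using edge_nonzero_open[OF fin that(2)] nboxD[OF _ that(1)] by meson
 ultimately show ?thesis unfolding dense_open_def by blast
qed

text \<open>If an edge points in independent directions in \<open>y\<close> and in \<open>z\<close>,
  no affine combination of the two vectors vanishes. Hence the whole line through \<open>y\<close>
  and \<open>z\<close> stays in the domain of analyticity.\<close>

lemma segment_edge_nonzero:
 assumes cross: "!!a b. (a, b) \<in> E ==> (y (2*a) - y (2*b)) * (z (2*a+1) - z (2*b+1)) - (y (2*a+1) - y (2*b+1)) * (z (2*a) - z (2*b)) ~= 0"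
 shows "(%i. y i + t * (z i - y i)) \<in> edge_nonzero E"
 unfolding edge_nonzero_def
proof (clarsimp)
 fix a b assume ab: "(a, b) \<in> E"
  and 1: "y (2*a) + t * (z (2*a) - y (2*a)) = y (2*b) + t * (z (2*b) - y (2*b))"
  and 2: "y (Suc (2*a)) + t * (z (Suc (2*a)) - y (Suc (2*a))) = y (Suc (2*b)) + t * (z (Suc (2*b)) - y (Suc (2*b)))"
 define p q p' q' where d: "p = y (2*a) - y (2*b)" "q = y (Suc (2*a)) - y (Suc (2*b))"
  "p' = z (2*a) - z (2*b)" "q' = z (Suc (2*a)) - z (Suc (2*b))"
 have e1: "(1 - t) * p + t * p' = 0" and e2: "(1 - t) * q + t * q' = 0"
  using 1 2 by (auto simp: d algebra_simps)
 have ne: "p * q' - q * p' ~= 0" using cross[OF ab] by (simp add: d)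
 have "(1 - t) * (p * q' - q * p') = ((1 - t) * p + t * p') * q' - ((1 - t) * q + t * q') * p'"
  by (simp add: algebra_simps)
 then have "t = 1" using e1 e2 ne by simp
 then show False using e1 e2 ne by simp
qed

section \<open>The identity theorem for expressions\<close>

context analytic_plane_function begin

definition iter_partial :: "nat list => expr => expr" where
 "iter_partial ks e = foldr (%k. Du (unit_coord k)) ks e"

lemma edges_in_iter_partial [simp]: "edges_in E e ==> edges_in E (iter_partial ks e)"
 unfolding iter_partial_def by (induction ks) auto

text \<open>Combinations of iterated coordinate derivatives with constant coefficients. If all those
  derivatives vanish at a point, so does every such combination; directional derivatives of any
  order are of this form.\<close>

inductive lin_comb :: "nat => expr => ((nat => real) => real) => bool" for N e where
 lin_comb_0: "lin_comb N e (%_. 0)"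
| lin_comb_add: "lin_comb N e g ==> set ks \<subseteq> {..<N} ==> lin_comb N e (%y. g y + c * eval F (iter_partial ks e) y)"

lemma lin_comb_deriv:
 assumes "lin_comb N e g" "edges_in E e" "u \<in> supp_below N"
 shows "EX g'. lin_comb N e g' & (ALL y t. (%i. y i + t * u i) \<in> edge_nonzero E -->
   ((%s. g (%i. y i + s * u i)) has_real_derivative g' (%i. y i + t * u i)) (at t))"
 using assms(1)
proof (induction rule: lin_comb.induct)
 case lin_comb_0
 then show ?case by (intro exI[of _ "%_. 0"]) (auto intro: lin_comb.lin_comb_0)
next
 case (lin_comb_add g ks c)
 then obtain g' where g': "lin_comb N e g'" "!!y t. (%i. y i + t * u i) \<in> edge_nonzero E ==>
   ((%s. g (%i. y i + s * u i)) has_real_derivative g' (%i. y i + t * u i)) (at t)" by blast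
 have "lin_comb N e (%y. g' y + (\<Sum>k<M. c * u k * eval F (iter_partial (k # ks) e) y))" if "M <= N" for M
  using that
 proof (induction M)
  case 0 then show ?case using g'(1) by simp
 next
  case (Suc M)
  have "lin_comb N e (%y. (g' y + (\<Sum>k<M. c * u k * eval F (iter_partial (k # ks) e) y)) + (c * u M) * eval F (iter_partial (M # ks) e) y)"
   by (rule lin_comb.lin_comb_add) (use Suc lin_comb_add in auto)
  then show ?case by (simp add: algebra_simps)
 qed
 from this[OF order_refl]
 have l: "lin_comb N e (%y. g' y + (\<Sum>k<N. c * u k * eval F (iter_partial (k # ks) e) y))" .
 have eq: "(\<Sum>k<N. c * u k * eval F (iter_partial (k # ks) e) y) = c * eval F (Du u (iter_partial ks e)) y" for y
  unfolding eval_Du_linear[OF assms(3), of F "iter_partial ks e" y]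
  by (simp add: iter_partial_def sum_distrib_left mult.assoc)
 show ?case
 proof (rule exI, rule conjI[OF l], intro allI impI)
  fix y t assume yt: "(%i. y i + t * u i) \<in> edge_nonzero E"
  show "((%s. g (%i. y i + s * u i) + c * eval F (iter_partial ks e) (%i. y i + s * u i)) has_real_derivative
   g' (%i. y i + t * u i) + (\<Sum>k<N. c * u k * eval F (iter_partial (k # ks) e) (%i. y i + t * u i))) (at t)"
   unfolding eq
   by (intro DERIV_add DERIV_cmult g'(2)[OF yt] eval_line_DERIV[OF _ yt] edges_in_iter_partial assms(2))
 qed
qed

text \<open>The \<open>m\<close>-th derivative and its combination agree on the open domain, so
  their derivatives along \<open>u\<close> agree there by uniqueness; no algebraic expansion of
  \<open>(Du u ^^ m) e\<close> is carried out.\<close>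

lemma Du_iter_lin_comb:
 assumes "finite E" "edges_in E e" "u \<in> supp_below N"
 shows "EX g. lin_comb N e g & (ALL y:edge_nonzero E. eval F ((Du u ^^ m) e) y = g y)"
proof (induction m)
 case 0
 have "lin_comb N e (%y. 0 + 1 * eval F (iter_partial [] e) y)"
  by (rule lin_comb.intros(2)[OF lin_comb.intros(1)]) simp
 then show ?case by (auto simp: iter_partial_def)
next
 case (Suc m)
 then obtain g where g: "lin_comb N e g" "!!y. y \<in> edge_nonzero E ==> eval F ((Du u ^^ m) e) y = g y" by blast
 obtain g' where g': "lin_comb N e g'" "!!y t. (%i. y i + t * u i) \<in> edge_nonzero E ==>
   ((%s. g (%i. y i + s * u i)) has_real_derivative g' (%i. y i + t * u i)) (at t)"
  using lin_comb_deriv[OF g(1) assms(2,3)] by blast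
 have ed: "edges_in E ((Du u ^^ m) e)" for m using assms(2) by (induction m) auto
 have "eval F ((Du u ^^ Suc m) e) y = g' y" if y: "y \<in> edge_nonzero E" for y
 proof -
  have y0: "(%i. y i + 0 * u i) \<in> edge_nonzero E" using y by simp
  have 1: "((%s. eval F ((Du u ^^ m) e) (%i. y i + s * u i)) has_real_derivative
    eval F (Du u ((Du u ^^ m) e)) (%i. y i + 0 * u i)) (at 0)"
   by (rule eval_line_DERIV[OF ed y0])
  have "\<forall>\<^sub>F s in nhds 0. eval F ((Du u ^^ m) e) (%i. y i + s * u i) = g (%i. y i + s * u i)"
   using edge_nonzero_line_open[OF assms(1) y0] by (rule eventually_mono) (rule g(2))
  from DERIV_cong_ev[OF refl this refl] 1
  have "((%s. g (%i. y i + s * u i)) has_real_derivative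
    eval F (Du u ((Du u ^^ m) e)) (%i. y i + 0 * u i)) (at 0)" by blast
  from DERIV_unique[OF this g'(2)[OF y0]] show ?thesis by simp
 qed
 then show ?case using g'(1) by blast
qed

text \<open>Restricted to the line from \<open>y\<close> to \<open>z\<close>, the expression has a
  vanishing Taylor series at \<open>y\<close>, hence is zero near \<open>y\<close> and along the
  whole segment.\<close>

lemma identity_derivs:
 assumes E: "finite E" "edges_in E e" and yz: "y \<in> supp_below N" "z \<in> supp_below N"
  and seg: "!!t. (%i. y i + t * (z i - y i)) \<in> edge_nonzero E"
  and van: "!!ks. set ks \<subseteq> {..<N} ==> eval F (iter_partial ks e) y = 0"
 shows "eval F e z = 0"
proof -
 let ?u = "%i. z i - y i"
 have u: "?u \<in> supp_below N" using yz by simp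
 have ed: "edges_in E ((Du ?u ^^ m) e)" for m using E(2) by (induction m) auto
 have zero: "eval F ((Du ?u ^^ m) e) y = 0" for m
 proof -
  obtain g where g: "lin_comb N e g" "!!y. y \<in> edge_nonzero E ==> eval F ((Du ?u ^^ m) e) y = g y"
   using Du_iter_lin_comb[OF E u] by blast
  have "g y = 0" using g(1) by (induction rule: lin_comb.induct) (use van in auto)
  then show ?thesis using g(2)[of y] seg[of 0] by simp
 qed
 define f where "f t = eval F e (%i. y i + t * ?u i)" for t
 have ana: "analytic_germ (%s. f (t + s))" for t
 proof -
  have "analytic_germ (%s. eval F e (%i. (y i + t * ?u i) + s * ?u i))"
   by (rule eval_line_analytic[OF E(2) seg])
  then show ?thesis by (simp add: f_def algebra_simps)
 qed
 have "EX e'>0. ALL t. \<bar>t\<bar> < e' --> (%m t. eval F ((Du ?u ^^ m) e) (%i. y i + t * ?u i)) 0 t = 0"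
 proof (rule analytic_germ_derivs_zero[where d=1])
  show "analytic_germ (%t. eval F ((Du ?u ^^ 0) e) (%i. y i + t * ?u i))" using ana[of 0] by (simp add: f_def)
  show "((%t. eval F ((Du ?u ^^ m) e) (%i. y i + t * ?u i)) has_real_derivative
    eval F ((Du ?u ^^ Suc m) e) (%i. y i + t * ?u i)) (at t)" for m t
   using eval_line_DERIV[OF ed seg] by simp
  show "eval F ((Du ?u ^^ m) e) (%i. y i + 0 * ?u i) = 0" for m using zero by simp
 qed simp
 then obtain e' where e': "e' > 0" "!!t. \<bar>t\<bar> < e' ==> f t = 0" by (auto simp: f_def)
 have "f 1 = 0" by (rule analytic_identity[of 0 1 f 0 e']) (use ana e' in auto)
 then show ?thesis by (simp add: f_def)
qed

lemma identity_open:
 assumes E: "edges_in E e" and yz: "y \<in> supp_below N" "z \<in> supp_below N"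
  and seg: "!!t. (%i. y i + t * (z i - y i)) \<in> edge_nonzero E"
  and r: "r > 0" "!!w. w \<in> nbox N y r ==> eval F e w = 0"
 shows "eval F e z = 0"
proof -
 let ?u = "%i. z i - y i"
 define f where "f t = eval F e (%i. y i + t * ?u i)" for t
 have ana: "analytic_germ (%s. f (t + s))" for t
 proof -
  have "analytic_germ (%s. eval F e (%i. (y i + t * ?u i) + s * ?u i))"
   by (rule eval_line_analytic[OF E seg])
  then show ?thesis by (simp add: f_def algebra_simps)
 qed
 \<comment> \<open>\<open>B\<close> bounds the coordinates of the direction, so parameters below
   \<open>r / B\<close> remain in the box.\<close>
 define B where "B = Max (insert 1 ((%i. \<bar>?u i\<bar>) ` {..<N}))"
 have B: "B >= 1" "!!i. i < N ==> \<bar>?u i\<bar> <= B" unfolding B_def by auto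
 have zero: "f t = 0" if "\<bar>t - 0\<bar> < r / B" for t
  unfolding f_def
 proof (rule r(2), unfold nbox_def, intro CollectI conjI allI impI)
  show "(%i. y i + t * ?u i) \<in> supp_below N" using yz by (auto simp: supp_below_def)
  fix i assume "i < N"
  have "\<bar>t\<bar> * \<bar>?u i\<bar> <= \<bar>t\<bar> * B" using B(2)[OF \<open>i < N\<close>] by (intro mult_left_mono) auto
  also have "... < r" using that B(1) by (simp add: field_simps)
  finally show "\<bar>y i + t * ?u i - y i\<bar> < r" by (simp add: abs_mult)
 qed
 have "f 1 = 0"
  by (rule analytic_identity[of 0 1 f 0 "r / B", OF ana _ _ zero]) (use r(1) B(1) in auto)
 then show ?thesis by (simp add: f_def)
qed

lemma eval_local_lipschitz:
 assumes "edges_in E e" "y \<in> edge_nonzero E"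
 shows "EX r>0. EX C>=0. ALL a b dlt. (ALL i. \<bar>a i - y i\<bar> < r) & (ALL i. \<bar>b i - y i\<bar> < r) & (ALL i. \<bar>b i - a i\<bar> <= dlt) -->
   \<bar>eval F e b - eval F e a\<bar> <= C * dlt"
proof -
 obtain r C where r: "r > 0" "C >= 0" "!!a b dlt. (ALL i. \<bar>a i - y i\<bar> < r) & (ALL i. \<bar>b i - y i\<bar> < r) & dlt <= 1 & (ALL i. \<bar>b i - a i\<bar> <= dlt) ==>
   \<bar>eval F e a\<bar> <= C & \<bar>eval F (Du (%i. b i - a i) e) a\<bar> <= C * dlt &
   \<bar>eval F e b - eval F e a - eval F (Du (%i. b i - a i) e) a\<bar> <= C * dlt\<^sup>2"
  using eval_taylor[OF assms] by blast
 have "\<bar>eval F e b - eval F e a\<bar> <= 2 * C * dlt"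
  if A: "(ALL i. \<bar>a i - y i\<bar> < r) & (ALL i. \<bar>b i - y i\<bar> < r) & (ALL i. \<bar>b i - a i\<bar> <= dlt)" for a b dlt
 proof (cases "dlt <= 1")
  case True
  have "dlt >= 0" using A abs_ge_zero order_trans by blast
  then have "C * dlt\<^sup>2 <= C * dlt" using True r(2) by (intro mult_left_mono) (auto simp: power2_eq_square mult_left_le)
  then show ?thesis using r(3)[of a b dlt] A True by auto
 next
  case False
  \<comment> \<open>The Taylor estimate covers increments up to 1; a longer one is absorbed by the
    bound on the values.\<close>
  have "\<bar>eval F e a\<bar> <= C" "\<bar>eval F e b\<bar> <= C" using r(3)[of a a 1] r(3)[of b b 1] A by auto
  moreover have "2 * C * 1 <= 2 * C * dlt" using False r(2) by (intro mult_left_mono) auto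
  ultimately show ?thesis by linarith
 qed
 moreover have "2 * C >= 0" using r(2) by simp
 ultimately show ?thesis using r(1) by blast
qed

lemma eval_nonzero_open:
 assumes "edges_in E e" "y \<in> edge_nonzero E" "y \<in> supp_below N" "eval F e y ~= 0"
 shows "EX r>0. ALL w:nbox N y r. eval F e w ~= 0"
proof -
 obtain r C where r: "r > 0" "C >= 0" "!!a b dlt. (ALL i. \<bar>a i - y i\<bar> < r) & (ALL i. \<bar>b i - y i\<bar> < r) & (ALL i. \<bar>b i - a i\<bar> <= dlt) ==>
   \<bar>eval F e b - eval F e a\<bar> <= C * dlt" using eval_local_lipschitz[OF assms(1,2)] by blast
 define s where "s = min r (\<bar>eval F e y\<bar> / (C + 1))"
 have s: "s > 0" using r assms(4) by (simp add: s_def)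
 have Cs: "C * s < \<bar>eval F e y\<bar>"
 proof -
  have "s <= \<bar>eval F e y\<bar> / (C + 1)" by (simp add: s_def)
  then have "(C + 1) * s <= \<bar>eval F e y\<bar>" using r(2) by (simp add: pos_le_divide_eq mult.commute)
  then show ?thesis using s by (simp add: algebra_simps)
 qed
 have "eval F e w ~= 0" if "w \<in> nbox N y s" for w
 proof -
  have "\<bar>w i - y i\<bar> < s" for i by (rule nboxD[OF that assms(3) s])
  then have "\<bar>eval F e w - eval F e y\<bar> <= C * s"
   using r(1) by (intro r(3)) (auto simp: s_def less_imp_le)
  then show ?thesis using Cs by auto
 qed
 then show ?thesis using s by blast
qed

lemma dense_open_segment:
 assumes "valid_edges N E" "z \<in> edge_nonzero E"
 shows "dense_open N (%w. ALL e:E. (w (2 * fst e) - w (2 * snd e)) * (z (2 * fst e+1) - z (2 * snd e+1))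
   - (w (2 * fst e+1) - w (2 * snd e+1)) * (z (2 * fst e) - z (2 * snd e)) ~= 0)"
proof (rule dense_open_ball)
 show "finite E" using assms(1) by (simp add: valid_edges_def)
 fix e assume e: "e \<in> E"
 obtain a b where ab: "e = (a, b)" by force
 have "a ~= b" "2 * a <= N" "2 * b <= N" "even N" using assms(1) e ab by (auto simp: valid_edges_def)
 moreover have "(z (2 * a) - z (2 * b), z (2 * a + 1) - z (2 * b + 1)) ~= (0, 0)"
  using assms(2) e ab unfolding edge_nonzero_def by blast
 ultimately show "dense_open N (%w. (w (2 * fst e) - w (2 * snd e)) * (z (2 * fst e+1) - z (2 * snd e+1))
   - (w (2 * fst e+1) - w (2 * snd e+1)) * (z (2 * fst e) - z (2 * snd e)) ~= 0)"
  unfolding ab fst_conv snd_conv by (rule dense_open_cross)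
qed

text \<open>The domain \<open>edge_nonzero E\<close> is not convex, so the base point is first moved
  inside the box until none of its edges is parallel to the corresponding edge of \<open>z\<close>;
  the line to \<open>z\<close> then stays in the domain.\<close>

lemma identity_global:
 assumes E: "valid_edges N E" "edges_in E e" and y0: "y0 \<in> supp_below N" "r0 > 0"
  and zero: "!!w. w \<in> nbox N y0 r0 ==> w \<in> edge_nonzero E ==> eval F e w = 0"
  and z: "z \<in> supp_below N" "z \<in> edge_nonzero E"
 shows "eval F e z = 0"
proof -
 obtain y where y: "y \<in> nbox N y0 r0" "!!a b. (a, b) \<in> E ==>
   (y (2*a) - y (2*b)) * (z (2*a+1) - z (2*b+1)) - (y (2*a+1) - y (2*b+1)) * (z (2*a) - z (2*b)) ~= 0"
  using dense_open_segment[OF E(1) z(2)] y0 unfolding dense_open_def by fastforce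
 have seg: "(%i. y i + t * (z i - y i)) \<in> edge_nonzero E" for t
  by (rule segment_edge_nonzero[OF y(2)])
 have ys: "y \<in> supp_below N" using nbox_supp[OF y(1)] .
 have "y \<in> edge_nonzero E" using seg[of 0] by simp
 then obtain s where s: "s > 0" "!!v. v \<in> nbox N y s ==> v \<in> edge_nonzero E"
  using dense_open_edge_nonzero[OF E(1)] ys unfolding dense_open_def by meson
 obtain s' where s': "s' > 0" "nbox N y s' \<subseteq> nbox N y0 r0" using nbox_subset[OF y(1)] by blast
 have "eval F e w = 0" if "w \<in> nbox N y (min s s')" for w
  using that nbox_mono[of "min s s'" s N y] nbox_mono[of "min s s'" s' N y] s s' by (intro zero) auto
 then show ?thesis using identity_open[OF E(2) ys z(1) seg, of "min s s'"] s(1) s'(1) by auto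
qed

text \<open>If all derivatives vanished at \<open>y\<close>, the expression would vanish at points
  near \<open>p\<close> in general position with respect to \<open>y\<close>, while by continuity it
  is nonzero near \<open>p\<close>. So a nontrivial expression has only zeros of finite
  order.\<close>

lemma exists_nonzero_derivative:
 assumes E: "valid_edges N E" "edges_in E e"
  and p: "p \<in> supp_below N" "p \<in> edge_nonzero E" "eval F e p ~= 0"
  and y: "y \<in> supp_below N" "y \<in> edge_nonzero E"
 shows "EX ks. set ks \<subseteq> {..<N} & eval F (iter_partial ks e) y ~= 0"
proof (rule ccontr)
 assume "\<not> ?thesis"
 then have van: "!!ks. set ks \<subseteq> {..<N} ==> eval F (iter_partial ks e) y = 0" by blast
 obtain r where r: "r > 0" "!!w. w \<in> nbox N p r ==> eval F e w ~= 0"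
  using eval_nonzero_open[OF E(2) p(2,1,3)] by blast
 obtain z where z: "z \<in> nbox N p r" "!!a b. (a, b) \<in> E ==>
   (z (2*a) - z (2*b)) * (y (2*a+1) - y (2*b+1)) - (z (2*a+1) - z (2*b+1)) * (y (2*a) - y (2*b)) ~= 0"
  using dense_open_segment[OF E(1) y(2)] p(1) r(1) unfolding dense_open_def by fastforce
 have seg: "(%i. y i + t * (z i - y i)) \<in> edge_nonzero E" for t
 proof (rule segment_edge_nonzero)
  fix a b assume "(a, b) \<in> E"
  moreover have "(y (2*a) - y (2*b)) * (z (2*a+1) - z (2*b+1)) - (y (2*a+1) - y (2*b+1)) * (z (2*a) - z (2*b)) =
    - ((z (2*a) - z (2*b)) * (y (2*a+1) - y (2*b+1)) - (z (2*a+1) - z (2*b+1)) * (y (2*a) - y (2*b)))"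
   by (simp add: algebra_simps)
  ultimately show "(y (2*a) - y (2*b)) * (z (2*a+1) - z (2*b+1)) - (y (2*a+1) - y (2*b+1)) * (z (2*a) - z (2*b)) ~= 0"
   using z(2)[of a b] by linarith
 qed
 have fin: "finite E" using E(1) by (simp add: valid_edges_def)
 show False using identity_derivs[OF fin E(2) y(1) nbox_supp[OF z(1)] seg van] r(2)[OF z(1)] by blast
qed

text \<open>Lets determinants and cofactors be treated as expressions without writing down the
  terms.\<close>

definition representable :: "(nat \<times> nat) set => ((nat => real) => real) => bool" where
 "representable E u \<longleftrightarrow> (EX e. edges_in E e & (ALL y. eval F e y = u y))"

lemma representable_const: "representable E (%_. c)"
 unfolding representable_def by (rule exI[of _ "Const c"]) simp

lemma representable_add: "representable E f ==> representable E g ==> representable E (%y. f y + g y)"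
proof -
 assume "representable E f" "representable E g"
 then obtain e1 e2 where "edges_in E e1" "!!y. eval F e1 y = f y" "edges_in E e2" "!!y. eval F e2 y = g y"
  unfolding representable_def by blast
 then show ?thesis unfolding representable_def by (intro exI[of _ "Add e1 e2"]) simp
qed

lemma representable_mult: "representable E f ==> representable E g ==> representable E (%y. f y * g y)"
proof -
 assume "representable E f" "representable E g"
 then obtain e1 e2 where "edges_in E e1" "!!y. eval F e1 y = f y" "edges_in E e2" "!!y. eval F e2 y = g y"
  unfolding representable_def by blast
 then show ?thesis unfolding representable_def by (intro exI[of _ "Mul e1 e2"]) simp
qed

lemma representable_eval: "edges_in E e ==> representable E (eval F e)"
 unfolding representable_def by blast

lemma representable_sum: "(!!i. i \<in> I ==> representable E (f i)) ==> representable E (%y. \<Sum>i\<in>I. f i y)"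
 by (induction I rule: infinite_finite_induct) (auto intro: representable_const representable_add)

lemma representable_prod: "(!!i. i \<in> I ==> representable E (f i)) ==> representable E (%y. \<Prod>i\<in>I. f i y)"
 by (induction I rule: infinite_finite_induct) (auto intro: representable_const representable_mult)

lemma representable_ddet:
 assumes "!!i j. i < n ==> j < n ==> representable E (%y. A y i j)"
 shows "representable E (%y. ddet n (A y))"
 unfolding ddet_leibniz
proof (intro representable_sum representable_mult representable_const representable_prod)
 fix p i assume "p \<in> {p. p permutes {0..<n}}" "i \<in> {0..<n}"
 then show "representable E (%y. A y i (p i))"
  using permutes_in_image[of p "{0..<n}" i] by (intro assms) auto
qed

end

section \<open>Jacobians\<close>

lemma finite_uniform_bounds:
 fixes P :: "'a => real => real => bool"
 assumes "finite X" "!!e. e \<in> X ==> EX r>0. EX C>=0. P e r C"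
  and mono: "!!e r C r' C'. P e r C ==> r' <= r ==> C <= C' ==> P e r' C'"
 shows "EX r>0. EX C>=0. ALL e:X. P e r C"
 using assms(1,2)
proof (induction X rule: finite_induct)
 case empty then show ?case by (auto intro: exI[of _ 1])
next
 case (insert x X)
 obtain r C where 1: "r > 0" "C >= 0" "ALL e:X. P e r C" using insert by auto
 obtain r' C' where 2: "r' > 0" "C' >= 0" "P x r' C'" using insert by blast
 have "ALL e:insert x X. P e (min r r') (max C C')"
  using 1(3) 2(3) mono by (metis insert_iff max.cobounded1 max.cobounded2 min.cobounded1 min.cobounded2)
 then show ?case using 1 2 by (intro exI[of _ "min r r'"] conjI exI[of _ "max C C'"]) auto
qed

context analytic_plane_function begin

definition second_order :: "(nat => real) => expr => real => real => bool" where
 "second_order y e r C \<longleftrightarrow> (ALL a b dlt. (ALL i. \<bar>a i - y i\<bar> < r) & (ALL i. \<bar>b i - y i\<bar> < r) & dlt <= 1 & (ALL i. \<bar>b i - a i\<bar> <= dlt) -->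
   \<bar>eval F e a\<bar> <= C & \<bar>eval F (Du (%i. b i - a i) e) a\<bar> <= C * dlt &
   \<bar>eval F e b - eval F e a - eval F (Du (%i. b i - a i) e) a\<bar> <= C * dlt\<^sup>2)"

lemma second_order_mono:
 assumes so: "second_order y e r C" and "r' <= r" "C <= C'"
 shows "second_order y e r' C'"
 unfolding second_order_def
proof (intro allI impI)
 fix a b dlt assume A: "(ALL i. \<bar>a i - y i\<bar> < r') & (ALL i. \<bar>b i - y i\<bar> < r') & dlt <= 1 & (ALL i. \<bar>b i - a i\<bar> <= dlt)"
 have dlt: "dlt >= 0" using A abs_ge_zero order_trans by blast
 have "(ALL i. \<bar>a i - y i\<bar> < r) & (ALL i. \<bar>b i - y i\<bar> < r) & dlt <= 1 & (ALL i. \<bar>b i - a i\<bar> <= dlt)"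
  using A assms(2) less_le_trans by blast
 then have "\<bar>eval F e a\<bar> <= C & \<bar>eval F (Du (%i. b i - a i) e) a\<bar> <= C * dlt &
   \<bar>eval F e b - eval F e a - eval F (Du (%i. b i - a i) e) a\<bar> <= C * dlt\<^sup>2"
  using so unfolding second_order_def by blast
 moreover have "C * dlt <= C' * dlt" "C * dlt\<^sup>2 <= C' * dlt\<^sup>2" using dlt assms(3) by (auto intro: mult_right_mono)
 ultimately show "\<bar>eval F e a\<bar> <= C' & \<bar>eval F (Du (%i. b i - a i) e) a\<bar> <= C' * dlt &
   \<bar>eval F e b - eval F e a - eval F (Du (%i. b i - a i) e) a\<bar> <= C' * dlt\<^sup>2"
  using assms(3) by linarith
qed

lemma second_order_uniform:
 assumes "finite X" "!!e. e \<in> X ==> edges_in E e" "y \<in> edge_nonzero E"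
 shows "EX r>0. EX C>=0. ALL e:X. second_order y e r C"
proof (rule finite_uniform_bounds[OF assms(1)])
 show "EX r>0. EX C>=0. second_order y e r C" if "e \<in> X" for e
  unfolding second_order_def by (rule eval_taylor[OF assms(2)[OF that] assms(3)])
qed (rule second_order_mono)

definition jac :: "(nat => expr) => (nat => real) => nat => nat => real" where
 "jac rw y i k = eval F (Du (unit_coord k) (rw i)) y"

text \<open>A quantitative inverse function theorem. The increment \<open>u\<close> is recovered by
  a left inverse of the Jacobian at \<open>y\<close> from its linear image, which differs from the
  increment of the rows by at most a small multiple of the size of \<open>u\<close>; that multiple
  is absorbed.\<close>

lemma local_bi_lipschitz:
 assumes rw: "!!i. i < N ==> edges_in E (rw i)"
  and y: "y \<in> supp_below N" "y \<in> edge_nonzero E" and det: "ddet N (jac rw y) ~= 0"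
 shows "EX r>0. EX C>0. ALL a:nbox N y r. ALL b:nbox N y r. ALL k.
  \<bar>a k - b k\<bar> <= C * (\<Sum>i<N. \<bar>eval F (rw i) a - eval F (rw i) b\<bar>)"
proof -
 obtain B where B: "!!u k. k < N ==> u k = (\<Sum>i<N. B k i * (\<Sum>l<N. jac rw y i l * u l))"
  using ddet_left_inverse[OF det] by blast
 define X where "X = rw ` {..<N} \<union> (%(i, l). Du (unit_coord l) (rw i)) ` ({..<N} \<times> {..<N})"
 have "finite X" "!!e. e \<in> X ==> edges_in E e" unfolding X_def using rw by auto
 then obtain r0 C where r0: "r0 > 0" "C >= 0" "!!e. e \<in> X ==> second_order y e r0 C"
  using second_order_uniform[OF _ _ y(2)] by meson
 define BB where "BB = 1 + (\<Sum>k<N. \<Sum>i<N. \<bar>B k i\<bar>)"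
 have BB: "BB >= 1" by (simp add: BB_def sum_nonneg)
 \<comment> \<open>The first order error of a row has two sources: the Taylor remainder, with factor
   \<open>2 * real N * C\<close>, and the change of the Jacobian, with factor \<open>2 * C\<close>,
   each times \<open>r * S\<close>. \<open>K\<close> dominates their sum.\<close>
 define K where "K = C * (4 * real N + 2)"
 have K: "K >= 0" using r0(2) by (simp add: K_def)
 \<comment> \<open>The second bound keeps the total increment below 1; the third makes the error at
   most half of it.\<close>
 define r where "r = min (min r0 (1 / (4 * (real N + 1)))) (1 / (2 * BB * real N * K + 1))"
 have den: "2 * BB * real N * K + 1 > 0" using BB K by (intro add_nonneg_pos mult_nonneg_nonneg) auto
 have r: "r > 0" "r <= r0" "2 * real N * r <= 1" "BB * (real N * (K * r)) <= 1/2"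
 proof -
  show "r > 0" using r0(1) den by (simp add: r_def)
  show "r <= r0" by (simp add: r_def)
  have "r <= 1 / (4 * (real N + 1))" by (simp add: r_def)
  then have "r * (4 * (real N + 1)) <= 1" by (simp add: pos_le_divide_eq)
  then show "2 * real N * r <= 1" using \<open>r > 0\<close> by (simp add: algebra_simps)
  have "r <= 1 / (2 * BB * real N * K + 1)" by (simp add: r_def)
  then have "r * (2 * BB * real N * K + 1) <= 1" using den by (simp add: pos_le_divide_eq)
  then show "BB * (real N * (K * r)) <= 1/2" using \<open>r > 0\<close> by (simp add: algebra_simps)
 qed
 have main: "\<bar>a k - b k\<bar> <= 2 * BB * (\<Sum>i<N. \<bar>eval F (rw i) a - eval F (rw i) b\<bar>)"
  if ab: "a \<in> nbox N y r" "b \<in> nbox N y r" for a b k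
 proof -
  define u where "u = (%i. b i - a i)"
  have us: "u \<in> supp_below N" using ab nbox_supp by (simp add: u_def)
  define S where "S = (\<Sum>l<N. \<bar>u l\<bar>)"
  have uS: "\<bar>u l\<bar> <= S" for l
  proof (cases "l < N")
   case True then show ?thesis unfolding S_def by (intro member_le_sum) auto
  next
   case False then show ?thesis using us by (auto simp: supp_below_def S_def sum_nonneg)
  qed
  have S0: "S >= 0" by (simp add: S_def sum_nonneg)
  note na = nboxD[OF ab(1) y(1) r(1)] and nb = nboxD[OF ab(2) y(1) r(1)]
  have u2r: "\<bar>u l\<bar> <= 2 * r" for l using na[of l] nb[of l] unfolding u_def by linarith
  have "S <= (\<Sum>l<N. 2 * r)" unfolding S_def by (rule sum_mono) (rule u2r)
  then have S2r: "S <= 2 * real N * r" by simp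
  then have S1: "S <= 1" using r(3) by linarith
  have r1: "r <= 1"
  proof -
   have "1 / (4 * (real N + 1)) <= 1" by (simp add: field_simps)
   moreover have "r <= 1 / (4 * (real N + 1))" by (simp add: r_def)
   ultimately show ?thesis by linarith
  qed
  have D: "\<bar>\<Sum>l<N. jac rw y i l * u l\<bar> <= \<bar>eval F (rw i) a - eval F (rw i) b\<bar> + K * r * S" if i: "i < N" for i
  proof -
   have so: "second_order y (rw i) r0 C" by (rule r0(3)) (use i in \<open>auto simp: X_def\<close>)
   have t: "\<bar>eval F (rw i) b - eval F (rw i) a - eval F (Du u (rw i)) a\<bar> <= C * S\<^sup>2"
    using so na nb r(2) uS S1 unfolding second_order_def u_def by (meson less_le_trans)
   have "\<bar>jac rw y i l - jac rw a i l\<bar> <= 2 * C * r" if True: "l < N" for l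
   proof -
    have so': "second_order y (Du (unit_coord l) (rw i)) r0 C" by (rule r0(3)) (use i True in \<open>auto simp: X_def\<close>)
    have "ALL i. \<bar>a i - y i\<bar> < r0" using na r(2) less_le_trans by blast
    moreover have "ALL i. \<bar>y i - y i\<bar> < r0" using r0(1) by simp
    moreover have "ALL i. \<bar>a i - y i\<bar> <= r" using na less_imp_le by blast
    ultimately have 1: "\<bar>eval F (Du (%i. a i - y i) (Du (unit_coord l) (rw i))) y\<bar> <= C * r"
     and 2: "\<bar>eval F (Du (unit_coord l) (rw i)) a - eval F (Du (unit_coord l) (rw i)) y
       - eval F (Du (%i. a i - y i) (Du (unit_coord l) (rw i))) y\<bar> <= C * r\<^sup>2"
     using so'[unfolded second_order_def, rule_format, of y a r] r1 by auto
    have "C * r\<^sup>2 <= C * r" using r(1) r1 r0(2) by (intro mult_left_mono) (auto simp: power2_eq_square mult_left_le)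
    then show ?thesis using 1 2 unfolding jac_def by linarith
   qed
   then have "\<bar>\<Sum>l<N. (jac rw y i l - jac rw a i l) * u l\<bar> <= (\<Sum>l<N. 2 * C * r * \<bar>u l\<bar>)"
    by (intro order_trans[OF sum_abs sum_mono]) (auto simp: abs_mult intro: mult_right_mono)
   also have "... = 2 * C * r * S" by (simp add: S_def sum_distrib_left)
   finally have j: "\<bar>\<Sum>l<N. (jac rw y i l - jac rw a i l) * u l\<bar> <= 2 * C * r * S" .
   have "eval F (Du u (rw i)) a = (\<Sum>l<N. jac rw a i l * u l)"
    unfolding eval_Du_linear[OF us, of F "rw i" a] jac_def by (simp add: mult.commute)
   then have "(\<Sum>l<N. jac rw y i l * u l) = eval F (Du u (rw i)) a + (\<Sum>l<N. (jac rw y i l - jac rw a i l) * u l)"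
    by (simp add: left_diff_distrib sum_subtractf)
   moreover have "C * S\<^sup>2 <= C * (2 * real N * r * S)"
    using S2r S0 r0(2) by (intro mult_left_mono) (auto simp: power2_eq_square intro: mult_right_mono)
   moreover have "C * (2 * real N * r * S) + 2 * C * r * S <= K * r * S"
   proof -
    have "(C * (2 * real N) + 2 * C) * (r * S) <= K * (r * S)"
     using r0(2) r(1) S0 by (intro mult_right_mono) (auto simp: K_def algebra_simps)
    then show ?thesis by (simp add: algebra_simps)
   qed
   ultimately show ?thesis using t j by linarith
  qed
  let ?f = "%i. \<bar>eval F (rw i) a - eval F (rw i) b\<bar>"
  have uk: "\<bar>u k\<bar> <= (\<Sum>i<N. \<bar>B k i\<bar> * (?f i + K * r * S))" if "k < N" for k
  proof -
   have "\<bar>u k\<bar> <= (\<Sum>i<N. \<bar>B k i * (\<Sum>l<N. jac rw y i l * u l)\<bar>)"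
    unfolding B[OF that, of u] by (rule sum_abs)
   also have "... <= (\<Sum>i<N. \<bar>B k i\<bar> * (?f i + K * r * S))"
    by (rule sum_mono) (use D in \<open>auto simp: abs_mult intro: mult_left_mono\<close>)
   finally show ?thesis .
  qed
  define f where "f = (\<Sum>i<N. ?f i)"
  have fi: "?f i <= f" if "i < N" for i unfolding f_def using that by (intro member_le_sum) auto
  have f0: "f >= 0" by (simp add: f_def sum_nonneg)
  have KrS: "K * r * S >= 0" using K r(1) S0 by simp
  have "S <= (\<Sum>k<N. \<Sum>i<N. \<bar>B k i\<bar> * (f + K * r * S))"
   unfolding S_def
  proof (rule sum_mono, fold S_def)
   fix k assume "k \<in> {..<N}"
   then have "\<bar>u k\<bar> <= (\<Sum>i<N. \<bar>B k i\<bar> * (?f i + K * r * S))" using uk by simp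
   also have "... <= (\<Sum>i<N. \<bar>B k i\<bar> * (f + K * r * S))"
    by (rule sum_mono) (use fi in \<open>auto intro: mult_left_mono\<close>)
   finally show "\<bar>u k\<bar> <= (\<Sum>i<N. \<bar>B k i\<bar> * (f + K * r * S))" .
  qed
  also have "... = (BB - 1) * (f + K * r * S)" by (simp add: BB_def sum_distrib_right)
  also have "... <= BB * (f + K * r * S)" using f0 KrS by (intro mult_right_mono) auto
  finally have "S <= BB * f + BB * (K * r * S)" by (simp add: distrib_left)
  moreover have "BB * (K * r * S) <= 1/2 * S"
  proof (cases "N = 0")
   case False
   have "BB * (K * r) * 1 <= BB * (K * r) * real N" using False BB K r(1) by (intro mult_left_mono) auto
   then have "BB * (K * r) <= 1/2" using r(4) by (simp add: algebra_simps)
   then have "BB * (K * r) * S <= 1/2 * S" using S0 by (rule mult_right_mono)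
   then show ?thesis by (simp add: mult.assoc)
  qed (simp add: S_def)
  ultimately have "S <= 2 * BB * f" by linarith
  moreover have "\<bar>a k - b k\<bar> <= S" using uS[of k] by (simp add: u_def abs_minus_commute)
  ultimately show ?thesis by (simp add: f_def)
 qed
 have "2 * BB > 0" using BB by simp
 then show ?thesis using main r(1) by blast
qed

text \<open>The cofactors along row \<open>j\<close>: the generalized cross product of the remaining
  \<open>N - 1\<close> gradients, which does not involve row \<open>j\<close>.\<close>

definition cofv :: "nat => (nat => expr) => nat => (nat => real) => nat => real" where
 "cofv N rw j y k = (if k < N then ddet N ((jac rw y)(j := unit_coord k)) else 0)"

lemma cofv_supp [simp]: "cofv N rw j y \<in> supp_below N"
 by (simp add: cofv_def supp_below_def)

lemma cofv_dot:
 assumes "j < N"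
 shows "(\<Sum>k<N. eta k * cofv N rw j y k) = ddet N ((jac rw y)(j := eta))"
 by (subst ddet_row_expand[OF assms]) (simp add: cofv_def)

text \<open>Laplace expansion along row \<open>j\<close>. A determinant that vanishes identically
  thus makes \<open>e\<close> stationary along the field, and for \<open>e\<close> a coordinate the
  formula returns a component of the field.\<close>

lemma eval_Du_cofv:
 assumes "j < N"
 shows "eval F (Du (cofv N rw j y) e) y = ddet N (jac (rw(j := e)) y)"
proof -
 have "eval F (Du (cofv N rw j y) e) y = (\<Sum>k<N. eval F (Du (unit_coord k) e) y * cofv N rw j y k)"
  unfolding eval_Du_linear[OF cofv_supp] by (simp add: mult.commute)
 also have "... = ddet N ((jac rw y)(j := (%k. eval F (Du (unit_coord k) e) y)))"
  by (rule cofv_dot[OF assms])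
 also have "... = ddet N (jac (rw(j := e)) y)" by (rule ddet_cong) (auto simp: jac_def)
 finally show ?thesis .
qed

lemma eval_Du_cofv_row:
 assumes "j < N" "i < N" "i ~= j"
 shows "eval F (Du (cofv N rw j y) (rw i)) y = 0"
 unfolding eval_Du_cofv[OF assms(1)]
proof (rule ddet_identical_rows[OF assms(2,1,3)])
 show "jac (rw(j := rw i)) y i k = jac (rw(j := rw i)) y j k" for k
  using assms(3) by (simp add: jac_def)
qed

lemma representable_cofv:
 assumes "!!i. i < N ==> edges_in E (rw i)"
 shows "representable E (%y. cofv N rw j y k)"
proof (cases "k < N")
 case True
 have "representable E (%y. ddet N ((jac rw y)(j := unit_coord k)))"
 proof (rule representable_ddet)
  fix i l assume "i < N" "l < N"
  then show "representable E (%y. ((jac rw y)(j := unit_coord k)) i l)"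
  proof (cases "i = j")
   case True
   then show ?thesis using representable_const[of E "unit_coord k l"] by simp
  next
   case False
   then have "(%y. ((jac rw y)(j := unit_coord k)) i l) = eval F (Du (unit_coord l) (rw i))"
    by (simp add: jac_def fun_eq_iff)
   then show ?thesis using representable_eval[OF edges_in_Du[OF assms[OF \<open>i < N\<close>]]] by simp
  qed
 qed
 then show ?thesis using True by (simp add: cofv_def)
qed (simp add: cofv_def representable_const)

text \<open>Where the field is nonzero the other rows have a one-dimensional common kernel: a
  nonzero component \<open>k0\<close> means that these rows together with coordinate
  \<open>k0\<close> are independent, and all of them annihilate \<open>u\<close> minus a suitable
  multiple of the field.\<close>

lemma cofv_kernel:
 assumes j: "j < N" and nz: "cofv N rw j y k0 ~= 0" and u: "u \<in> supp_below N"
  and ker: "!!i. i < N ==> i ~= j ==> eval F (Du u (rw i)) y = 0"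
 shows "u = (%k. u k0 / cofv N rw j y k0 * cofv N rw j y k)"
proof -
 let ?v = "cofv N rw j y" and ?A = "(jac rw y)(j := unit_coord k0)"
 have k0: "k0 < N" using nz unfolding cofv_def by (metis (full_types))
 then have det: "ddet N ?A ~= 0" using nz by (simp add: cofv_def)
 obtain B where B: "!!u k. k < N ==> u k = (\<Sum>i<N. B k i * (\<Sum>l<N. ?A i l * u l))"
  using ddet_left_inverse[OF det] by blast
 define w where "w k = u k - u k0 / ?v k0 * ?v k" for k
 have dot: "(\<Sum>l<N. jac rw y i l * x l) = eval F (Du x (rw i)) y" if "x \<in> supp_below N" for x i
  unfolding eval_Du_linear[OF that, of F "rw i" y] jac_def by (simp add: mult.commute)
 have "(\<Sum>l<N. ?A i l * w l) = 0" if i: "i < N" for i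
 proof (cases "i = j")
  case True
  have "(\<Sum>l<N. ?A i l * w l) = (\<Sum>l<N. if l = k0 then w l else 0)"
   using True by (intro sum.cong) (auto simp: unit_coord_def)
  also have "... = w k0" using k0 by simp
  also have "... = 0" using nz by (simp add: w_def)
  finally show ?thesis .
 next
  case False
  have "(\<Sum>l<N. ?A i l * w l) = (\<Sum>l<N. jac rw y i l * u l) - u k0 / ?v k0 * (\<Sum>l<N. jac rw y i l * ?v l)"
   using False by (simp add: w_def right_diff_distrib sum_subtractf sum_distrib_left mult_ac)
  then show ?thesis using dot[OF u] dot[OF cofv_supp] ker[OF i False] eval_Du_cofv_row[OF j i False] by simp
 qed
 then have "w k = 0" if "k < N" for k using B[OF that, of w] by simp
 moreover have "w k = 0" if "\<not> k < N" for k using that u by (simp add: w_def cofv_def supp_below_def)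
 ultimately have w0: "w k = 0" for k by blast
 show ?thesis
 proof
  fix k show "u k = u k0 / ?v k0 * ?v k" using w0[of k] unfolding w_def by linarith
 qed
qed

text \<open>Each matrix with row \<open>j\<close> replaced by a unit row has dependent rows. If the
  unit row is absent from one of these dependences, the remaining rows are dependent. Otherwise they
  span every unit row, which is impossible for \<open>N - 1\<close> rows.\<close>

lemma cofv_zero_dependent:
 assumes j: "j < N" and z: "!!k. k < N ==> cofv N rw j y k = 0"
 shows "EX c. (EX i:{..<N} - {j}. c i ~= 0) & (ALL k<N. (\<Sum>i\<in>{..<N} - {j}. c i * jac rw y i k) = 0)"
proof -
 let ?A = "%k. (jac rw y)(j := unit_coord k)"
 have "EX c. (EX i<N. c i ~= 0) & (ALL l<N. (\<Sum>i<N. c i * ?A k i l) = 0)" if "k < N" for k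
 proof (rule ddet_0_imp_dependent_rows)
  have "cofv N rw j y k = ddet N (?A k)" unfolding cofv_def using that by (rule if_P)
  from trans[OF sym[OF this] z[OF that]] show "ddet N (?A k) = 0" .
 qed
 then obtain c where c: "!!k. k < N ==> EX i<N. c k i ~= 0" "!!k l. k < N ==> l < N ==> (\<Sum>i<N. c k i * ?A k i l) = 0"
  using that[of "%k. SOME c. (EX i<N. c i ~= 0) & (ALL l<N. (\<Sum>i<N. c i * ?A k i l) = 0)"]
   someI_ex[of "%c. (EX i<N. c i ~= 0) & (ALL l<N. (\<Sum>i<N. c i * ?A k i l) = 0)" for k]
  by blast
 have split: "(\<Sum>i<N. g i) = g j + (\<Sum>i\<in>{..<N} - {j}. g i)" for g :: "nat => real"
  using j by (simp add: sum.remove)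
 have c2: "c k j * unit_coord k l + (\<Sum>i\<in>{..<N} - {j}. c k i * jac rw y i l) = 0" if "k < N" "l < N" for k l
  using c(2)[OF that] split[of "%i. c k i * ?A k i l"] by simp
 show ?thesis
 proof (cases "EX k<N. c k j = 0")
  case True
  then obtain k where k: "k < N" "c k j = 0" by blast
  obtain i where i: "i < N" "c k i ~= 0" using c(1)[OF k(1)] by blast
  then have "i \<in> {..<N} - {j}" using k(2) by auto
  moreover have "(\<Sum>i\<in>{..<N} - {j}. c k i * jac rw y i l) = 0" if "l < N" for l
   using c2[OF k(1) that] k(2) by simp
  ultimately show ?thesis using i(2) by blast
 next
  case False
  \<comment> \<open>\<open>D\<close> writes the unit rows in terms of the others and
    \<open>J\<close> has row \<open>j\<close> cleared, so \<open>D\<close> times \<open>J\<close>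
    would be the identity although \<open>J\<close> is singular.\<close>
  define D where "D k i = - c k i / c k j" for k i
  define J where "J = (jac rw y)(j := (%_. 0))"
  have "(\<Sum>i<N. D k i * J i l) = unit_coord k l" if kl: "k < N" "l < N" for k l
  proof -
   have "(\<Sum>i<N. D k i * J i l) = (\<Sum>i\<in>{..<N} - {j}. - (c k i * jac rw y i l) / c k j)"
    using split[of "%i. D k i * J i l"] by (simp add: D_def J_def)
   also have "... = - (\<Sum>i\<in>{..<N} - {j}. c k i * jac rw y i l) / c k j"
    by (simp add: sum_negf sum_divide_distrib)
   also have "- (\<Sum>i\<in>{..<N} - {j}. c k i * jac rw y i l) = c k j * unit_coord k l"
    using c2[OF kl] by linarith
   also have "c k j * unit_coord k l / c k j = unit_coord k l" using False kl by simp
   finally show ?thesis .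
  qed
  then have "ddet N (%k l. \<Sum>i<N. D k i * J i l) = ddet N unit_coord" by (intro ddet_cong) auto
  then have "ddet N D * ddet N J = 1" by (simp add: ddet_mult ddet_unit)
  moreover have "ddet N J = 0" unfolding J_def by (subst ddet_row_expand[OF j]) simp
  ultimately show ?thesis by simp
 qed
qed

end

section \<open>Analytic normed planes\<close>

locale plane_basis =
 fixes b1 b2 :: "'a::real_normed_vector"
 assumes basis: "b1 ~= b2" "independent {b1, b2}" "span {b1, b2} = UNIV"
begin

definition pt :: "real => real => 'a" where "pt s t = s *\<^sub>R b1 + t *\<^sub>R b2"

lemma pt_surj: "EX s t. x = pt s t"
proof -
 have "x \<in> span (insert b1 {b2})" using basis(3) by simp
 then obtain s where "x - s *\<^sub>R b1 \<in> span {b2}" using span_breakdown_eq by blast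
 then obtain t where "x - s *\<^sub>R b1 = t *\<^sub>R b2" by (auto simp: span_singleton)
 then have "x = pt s t" by (simp add: pt_def algebra_simps)
 then show ?thesis by blast
qed

lemma pt_eq_0: assumes "pt s t = 0" shows "s = 0 & t = 0"
proof (rule ccontr)
 assume "\<not> ?thesis"
 then consider "s ~= 0" | "s = 0" "t ~= 0" by blast
 then show False
 proof cases
  case 1
  have "s *\<^sub>R b1 = (- t) *\<^sub>R b2" using assms by (simp add: pt_def eq_neg_iff_add_eq_0)
  then have "(1 / s) *\<^sub>R (s *\<^sub>R b1) = (1 / s) *\<^sub>R ((- t) *\<^sub>R b2)" by simp
  then have "b1 = (- t / s) *\<^sub>R b2" using 1 by simp
  then have "b1 \<in> span ({b1, b2} - {b1})"
   using basis(1) by (metis Diff_insert_absorb insert_absorb insert_iff singleton_iff span_base span_scale)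
  then show False using basis(2) unfolding dependent_def by blast
 next
  case 2
  then have "b2 = 0" using assms by (simp add: pt_def)
  then show False using basis(2) dependent_zero by blast
 qed
qed

definition co1 :: "'a => real" where "co1 x = (SOME s. EX t. x = pt s t)"
definition co2 :: "'a => real" where "co2 x = (SOME t. x = pt (co1 x) t)"

lemma pt_co [simp]: "pt (co1 x) (co2 x) = x"
proof -
 have "EX t. x = pt (co1 x) t" unfolding co1_def by (rule someI_ex[OF pt_surj])
 then show ?thesis unfolding co2_def by (metis (mono_tags, lifting) someI_ex)
qed

lemma pt_add: "pt s t + pt s' t' = pt (s + s') (t + t')"
 and pt_diff: "pt s t - pt s' t' = pt (s - s') (t - t')"
 and pt_scale: "r *\<^sub>R pt s t = pt (r * s) (r * t)"
 and pt_0 [simp]: "pt 0 0 = 0"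
 by (simp_all add: pt_def algebra_simps)

lemma pt_inj: "pt s t = pt s' t' \<longleftrightarrow> s = s' & t = t'"
 using pt_eq_0[of "s - s'" "t - t'"] pt_diff[of s t s' t'] by auto

lemma co_pt [simp]: "co1 (pt s t) = s" "co2 (pt s t) = t"
 using pt_co[of "pt s t"] pt_inj by blast+

lemma co_simps: "co1 (x + y) = co1 x + co1 y" "co2 (x + y) = co2 x + co2 y"
 "co1 (x - y) = co1 x - co1 y" "co2 (x - y) = co2 x - co2 y"
 "co1 (r *\<^sub>R x) = r * co1 x" "co2 (r *\<^sub>R x) = r * co2 x" "co1 0 = 0" "co2 0 = 0"
 "co1 (- x) = - co1 x" "co2 (- x) = - co2 x"
proof -
 show "co1 (x + y) = co1 x + co1 y" "co2 (x + y) = co2 x + co2 y"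
  using pt_add[of "co1 x" "co2 x" "co1 y" "co2 y"] co_pt by (metis pt_co)+
 show "co1 (x - y) = co1 x - co1 y" "co2 (x - y) = co2 x - co2 y"
  using pt_diff[of "co1 x" "co2 x" "co1 y" "co2 y"] co_pt by (metis pt_co)+
 show "co1 (r *\<^sub>R x) = r * co1 x" "co2 (r *\<^sub>R x) = r * co2 x"
  using pt_scale[of r "co1 x" "co2 x"] co_pt by (metis pt_co)+
 show "co1 0 = 0" "co2 0 = 0" using co_pt[of 0 0] by simp_all
 show "co1 (- x) = - co1 x" "co2 (- x) = - co2 x"
  using pt_scale[of "-1" "co1 x" "co2 x"] co_pt[of "- co1 x" "- co2 x"] by simp_all
qed

lemma co_eqI: "co1 x = co1 y ==> co2 x = co2 y ==> x = y"
 by (metis pt_co)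

text \<open>The determinant of two vectors in basis coordinates; it vanishes exactly for parallel
  vectors.\<close>

definition cr :: "'a => 'a => real" where "cr x y = co1 x * co2 y - co2 x * co1 y"

lemma cramer: "cr u v *\<^sub>R y = cr y v *\<^sub>R u + cr u y *\<^sub>R v"
 by (rule co_eqI) (simp_all add: cr_def co_simps algebra_simps)

lemma cr_eq_0:
 assumes "cr x y = 0" "x ~= 0"
 shows "EX c. y = c *\<^sub>R x"
proof (cases "co1 x = 0")
 case True
 have "co2 x ~= 0"
 proof
  assume "co2 x = 0"
  then have "x = 0" using True by (intro co_eqI) (simp_all add: co_simps)
  then show False using assms(2) by simp
 qed
 then have "y = (co2 y / co2 x) *\<^sub>R x"
  using True assms(1) by (intro co_eqI) (auto simp: co_simps cr_def)
 then show ?thesis by blast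
next
 case False
 then have "y = (co1 y / co1 x) *\<^sub>R x"
  using assms(1) by (intro co_eqI) (auto simp: co_simps cr_def field_simps)
 then show ?thesis by blast
qed

lemma cr_simps: "cr x x = 0" "cr x (r *\<^sub>R y) = r * cr x y" "cr (r *\<^sub>R x) y = r * cr x y"
 "cr x (y + z) = cr x y + cr x z" "cr (x + y) z = cr x z + cr y z"
 "cr x (y - z) = cr x y - cr x z" "cr (x - y) z = cr x z - cr y z" "cr x y = - cr y x" "cr 0 x = 0" "cr x 0 = 0"
 by (simp_all add: cr_def co_simps algebra_simps)

text \<open>The norm has a positive minimum on the unit circle of the coordinates; scaling yields
  the bound.\<close>

lemma coords_bounded: "EX k>0. ALL x. \<bar>co1 x\<bar> + \<bar>co2 x\<bar> <= k * norm x"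
proof -
 let ?S = "sphere (0 :: real \<times> real) 1"
 have cont: "continuous_on ?S (%p. norm (pt (fst p) (snd p)))"
  unfolding pt_def by (intro continuous_intros)
 have "?S ~= {}" using norm_Pair[of 1 "0::real"] by (auto intro!: exI[of _ 1] exI[of _ 0])
 then obtain p where p: "p \<in> ?S" "!!q. q \<in> ?S ==> norm (pt (fst p) (snd p)) <= norm (pt (fst q) (snd q))"
  using continuous_attains_inf[OF compact_sphere _ cont] by blast
 define m where "m = norm (pt (fst p) (snd p))"
 have "p ~= 0" using p(1) by auto
 then have "pt (fst p) (snd p) ~= 0" using pt_eq_0[of "fst p" "snd p"] by (auto simp: prod_eq_iff)
 then have m: "m > 0" by (simp add: m_def)
 have "\<bar>co1 x\<bar> + \<bar>co2 x\<bar> <= (2 / m) * norm x" for x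
 proof (cases "x = 0")
  case False
  define q where "q = (co1 x, co2 x)"
  have "q ~= 0"
  proof
   assume "q = 0"
   then have "x = 0" by (intro co_eqI) (simp_all add: co_simps q_def zero_prod_def)
   then show False using False by simp
  qed
  then have nq: "norm q > 0" by simp
  have "(1 / norm q) *\<^sub>R q \<in> ?S" using nq by simp
  from p(2)[OF this] have "m <= norm (pt (fst ((1 / norm q) *\<^sub>R q)) (snd ((1 / norm q) *\<^sub>R q)))"
   by (simp add: m_def)
  also have "pt (fst ((1 / norm q) *\<^sub>R q)) (snd ((1 / norm q) *\<^sub>R q)) = (1 / norm q) *\<^sub>R x"
   by (simp add: q_def flip: pt_scale) (metis pt_co pt_scale divide_inverse mult.commute mult_1)
  finally have "m <= norm x / norm q" using nq by (simp add: divide_inverse mult.commute)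
  then have "m * norm q <= norm x" using nq by (simp add: field_simps)
  moreover have "\<bar>co1 x\<bar> <= norm q" "\<bar>co2 x\<bar> <= norm q"
   using norm_fst_le[of "co1 x" "co2 x"] norm_snd_le[of "co2 x" "co1 x"] by (simp_all add: q_def)
  moreover have "norm q <= norm x / m" using \<open>m * norm q <= norm x\<close> m by (simp add: field_simps)
  moreover have "(2 / m) * norm x = norm x / m + norm x / m" by simp
  ultimately show ?thesis by linarith
 qed (simp add: co_simps)
 then show ?thesis using m by (intro exI[of _ "2 / m"]) auto
qed

lemma norm_pt_le: "norm (pt s t) <= \<bar>s\<bar> * norm b1 + \<bar>t\<bar> * norm b2"
 unfolding pt_def using norm_triangle_ineq[of "s *\<^sub>R b1" "t *\<^sub>R b2"] by simp

end

locale analytic_plane = plane_basis b1 b2 for b1 b2 :: "'a::real_normed_vector" +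
 assumes series: "x ~= 0 ==> EX (c :: nat => nat => real) r. r > 0 & (ALL s t. \<bar>s\<bar> < r & \<bar>t\<bar> < r -->
    ((%(i, j). c i j * s ^ i * t ^ j) has_sum norm (x + s *\<^sub>R b1 + t *\<^sub>R b2)) UNIV)"
  and non_euclidean: "\<not> (ALL x y :: 'a. (norm (x + y))\<^sup>2 + (norm (x - y))\<^sup>2 = 2 * (norm x)\<^sup>2 + 2 * (norm y)\<^sup>2)"
begin

definition NF :: "real => real => real" where "NF s t = norm (pt s t)"

sublocale analytic_plane_function NF
proof
 fix x y :: real assume "(x, y) ~= (0, 0)"
 then have "pt x y ~= 0" using pt_eq_0 by blast
 from series[OF this] obtain c :: "nat => nat => real" and r where "r > 0" "ALL s t. \<bar>s\<bar> < r & \<bar>t\<bar> < r -->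
    ((%(i, j). c i j * s ^ i * t ^ j) has_sum norm (pt x y + s *\<^sub>R b1 + t *\<^sub>R b2)) UNIV" by blast
 moreover have "pt x y + s *\<^sub>R b1 + t *\<^sub>R b2 = pt (x + s) (y + t)" for s t
  by (simp add: pt_def algebra_simps)
 ultimately show "EX c r. r > 0 & double_series (%s t. NF (x + s) (y + t)) c r"
  unfolding double_series_def NF_def by auto
qed

lemma norm_line_analytic:
 fixes x d :: 'a
 assumes "x ~= 0"
 shows "analytic_germ (%tau. norm (x + tau *\<^sub>R d))"
proof -
 have "(co1 x, co2 x) ~= (0, 0)"
 proof
  assume z: "(co1 x, co2 x) = (0, 0)"
  then have "x = 0" by (intro co_eqI) (simp_all add: co_simps)
  then show False using assms by simp
 qed
 from partial_line[OF this, of 0 0 "co1 d" "co2 d"]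
 have "analytic_germ (%tau. norm (pt (co1 x + tau * co1 d) (co2 x + tau * co2 d)))" by (simp add: NF_def partial.simps)
 moreover have "pt (co1 x + tau * co1 d) (co2 x + tau * co2 d) = x + tau *\<^sub>R d" for tau
  by (rule co_eqI) (simp_all add: co_simps)
 ultimately show ?thesis by simp
qed

text \<open>Analyticity in one variable along lines that avoid the origin. The cases of interest are
  \<open>r = 0\<close>, a constant norm, and \<open>r = 1\<close> with \<open>c = 0\<close>, equal
  norms.\<close>

lemma norm_lines_identity:
 fixes x y d d' :: 'a
 assumes "!!t. x + t *\<^sub>R d ~= 0" "!!t. y + t *\<^sub>R d' ~= 0" and "e > 0"
  and "!!t. \<bar>t - t0\<bar> < e ==> norm (x + t *\<^sub>R d) = r * norm (y + t *\<^sub>R d') + c"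
 shows "norm (x + t *\<^sub>R d) = r * norm (y + t *\<^sub>R d') + c"
proof -
 define f where "f t = norm (x + t *\<^sub>R d) + ((- r) * norm (y + t *\<^sub>R d') + (- c))" for t
 have "analytic_germ (%s. f (t + s))" for t
 proof -
  have "f (t + s) = norm ((x + t *\<^sub>R d) + s *\<^sub>R d) + ((- r) * norm ((y + t *\<^sub>R d') + s *\<^sub>R d') + (- c))" for s
   by (simp add: f_def scaleR_left_distrib add.assoc)
  then show ?thesis
   by (simp only:) (intro analytic_germ_add analytic_germ_mult analytic_germ_const norm_line_analytic assms(1,2))
 qed
 then have "f t = 0"
  using analytic_identity[of "min t t0" "max t t0" f t0 e t] assms(3,4) by (auto simp: f_def)
 then show ?thesis by (simp add: f_def)
qed

text \<open>If the midpoint were as long as the ends, convexity would make the norm constant on the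
  segment between them, and analyticity would make it constant on the whole line, where it is
  unbounded.\<close>

lemma strictly_convex:
 fixes x y :: 'a
 assumes "norm x = norm y" "x ~= y"
 shows "norm ((1/2) *\<^sub>R (x + y)) < norm x"
proof (rule ccontr)
 assume "\<not> ?thesis"
 then have ge: "norm x <= norm ((1/2) *\<^sub>R (x + y))" by simp
 have le: "norm ((1/2) *\<^sub>R (x + y)) <= norm x" using norm_triangle_ineq[of x y] assms(1) by simp
 define f where "f t = norm (x + t *\<^sub>R (y - x))" for t
 have conv: "f ((1 - u) * s + u * t) <= (1 - u) * f s + u * f t" if "0 <= u" "u <= 1" for s t u
 proof -
  have "x + ((1 - u) * s + u * t) *\<^sub>R (y - x) = (1 - u) *\<^sub>R (x + s *\<^sub>R (y - x)) + u *\<^sub>R (x + t *\<^sub>R (y - x))"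
   by (simp add: algebra_simps)
  then show ?thesis unfolding f_def
   using norm_triangle_ineq[of "(1 - u) *\<^sub>R (x + s *\<^sub>R (y - x))" "u *\<^sub>R (x + t *\<^sub>R (y - x))"] that by simp
 qed
 have f0: "f 0 = norm x" by (simp add: f_def)
 have f1: "f 1 = norm x" by (simp add: f_def assms(1))
 have "x + (1/2) *\<^sub>R (y - x) = (1/2) *\<^sub>R (x + y)" by (simp add: algebra_simps flip: scaleR_left_distrib)
 then have fh: "f (1/2) = norm x" using ge le by (simp add: f_def)
 have const: "f t = norm x" if "0 < t" "t < 1" for t
 proof -
  have "f t <= norm x"
   using conv[of t 0 1] that f0 f1 by (simp add: algebra_simps)
  moreover have "norm x <= f t"
  proof (cases "t <= 1/2")
   case True
   define u where "u = (1/2 - t) / (1 - t)"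
   have ut: "u * (1 - t) = 1/2 - t" using that by (simp add: u_def)
   have u: "0 <= u" "u < 1" using that True by (auto simp: u_def field_simps)
   have u3: "(1 - u) * t + u * 1 = 1/2" using ut by (simp add: algebra_simps)
   have "norm x <= (1 - u) * f t + u * norm x" using conv[of u t 1] u unfolding u3 fh f1 by simp
   then have "(1 - u) * norm x <= (1 - u) * f t" by (simp add: algebra_simps)
   then show ?thesis using u(2) by simp
  next
   case False
   define u where "u = (1/2) / t"
   have u: "0 < u" "u <= 1" using that False by (auto simp: u_def field_simps)
   have u3: "(1 - u) * 0 + u * t = 1/2" using that by (simp add: u_def)
   have "norm x <= (1 - u) * norm x + u * f t" using conv[of u 0 t] u unfolding u3 fh f0 by simp
   then have "u * norm x <= u * f t" by (simp add: algebra_simps)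
   then show ?thesis using u(1) by simp
  qed
  ultimately show ?thesis by simp
 qed
 have nz: "x + t *\<^sub>R (y - x) ~= 0" for t
 proof
  assume z: "x + t *\<^sub>R (y - x) = 0"
  then have e: "(1 - t) *\<^sub>R x = (- t) *\<^sub>R y" by (simp add: algebra_simps)
  then have "\<bar>1 - t\<bar> * norm x = \<bar>t\<bar> * norm y" by (metis abs_minus_cancel norm_scaleR)
  moreover have "norm x ~= 0" using assms by auto
  ultimately have "\<bar>1 - t\<bar> = \<bar>t\<bar>" using assms(1) by simp
  \<comment> \<open>Equal lengths force \<open>t = 1/2\<close>, but the midpoint is as long as
    \<open>x\<close> and thus not 0.\<close>
  then have "t = 1/2" by linarith
  moreover have "f t = 0" using z by (simp add: f_def)
  ultimately have "f (1/2) = 0" by metis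
  then show False using fh \<open>norm x ~= 0\<close> by simp
 qed
 have all: "norm (x + t *\<^sub>R (y - x)) = norm x" for t
 proof -
  have "norm (x + t *\<^sub>R (y - x)) = 0 * norm (x + t *\<^sub>R (y - x)) + norm x"
  proof (rule norm_lines_identity[where x=x and d="y - x" and y=x and d'="y - x" and e="1/2" and ?t0.0="1/2" and r=0 and c="norm x" and t=t])
   fix s :: real assume "\<bar>s - 1/2\<bar> < 1/2"
   then have "0 < s" "s < 1" unfolding abs_less_iff by auto
   then show "norm (x + s *\<^sub>R (y - x)) = 0 * norm (x + s *\<^sub>R (y - x)) + norm x"
    using const[of s] by (simp add: f_def)
  qed (use nz in auto)
  then show ?thesis by simp
 qed
 define T where "T = (2 * norm x + 1) / norm (y - x)"
 have "norm (y - x) > 0" using assms(2) by simp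
 then have "norm (T *\<^sub>R (y - x)) = 2 * norm x + 1" by (simp add: T_def)
 moreover have "norm (T *\<^sub>R (y - x)) <= norm (x + T *\<^sub>R (y - x)) + norm x"
  using norm_triangle_ineq4[of "x + T *\<^sub>R (y - x)" x] by simp
 ultimately show False using all[of T] by simp
qed

definition lin_iso :: "('a => 'a) => bool" where
 "lin_iso g \<longleftrightarrow> linear g & (ALL x. norm (g x) = norm x)"

text \<open>Mazur--Ulam: by strict convexity the midpoint is determined by distances.\<close>

lemma isometry_fixing_0_linear:
 assumes "isometry g" "g 0 = 0"
 shows "lin_iso g"
proof -
 have iso: "norm (g x - g y) = norm (x - y)" for x y using assms(1) by (simp add: isometry_def)
 have mid: "g ((1/2) *\<^sub>R (x + y)) = (1/2) *\<^sub>R (g x + g y)" for x y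
 proof (rule ccontr)
  let ?m = "(1/2) *\<^sub>R (x + y)"
  let ?p = "g ?m - g x" and ?q = "g y - g ?m"
  assume ne: "g ?m ~= (1/2) *\<^sub>R (g x + g y)"
  have "?p ~= ?q"
  proof
   assume "?p = ?q"
   then have "2 *\<^sub>R g ?m = g x + g y" by (simp add: algebra_simps scaleR_2)
   then have "(1/2) *\<^sub>R (2 *\<^sub>R g ?m) = (1/2) *\<^sub>R (g x + g y)" by simp
   then show False using ne by simp
  qed
  have "?m - x = (1/2) *\<^sub>R (y - x)" "y - ?m = (1/2) *\<^sub>R (y - x)"
   using scaleR_half_double[of x] scaleR_half_double[of y]
   by (simp_all add: algebra_simps)
  then have n: "norm ?p = norm (y - x) / 2" "norm ?q = norm (y - x) / 2" unfolding iso by simp_all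
  have "norm ((1/2) *\<^sub>R (?p + ?q)) < norm ?p" by (rule strictly_convex) (use n \<open>?p ~= ?q\<close> in auto)
  then show False using n iso[of y x] by simp
 qed
 have half: "g ((1/2) *\<^sub>R x) = (1/2) *\<^sub>R g x" for x using mid[of x 0] assms(2) by simp
 have add: "g (x + y) = g x + g y" for x y
 proof -
  have "(1/2) *\<^sub>R g (x + y) = (1/2) *\<^sub>R (g x + g y)" using mid[of x y] half[of "x + y"] by simp
  then show ?thesis by simp
 qed
 have "g (r *\<^sub>R x) = r *\<^sub>R g x" for r x
 proof -
  \<comment> \<open>\<open>h\<close> measures the failure of homogeneity. It is additive, vanishes
    at the integers and is bounded on [-1, 1], hence bounded everywhere; as \<open>n\<close> times
    \<open>h r\<close> is again a value of \<open>h\<close>, it is zero.\<close>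
  define h where "h r = g (r *\<^sub>R x) - r *\<^sub>R g x" for r
  have hadd: "h (r + s) = h r + h s" for r s by (simp add: h_def scaleR_left_distrib add)
  have h1: "h 1 = 0" "h 0 = 0" using assms(2) by (simp_all add: h_def)
  have hb: "norm (h r) <= 2 * norm x" if "\<bar>r\<bar> <= 1" for r
  proof -
   have "norm (g (r *\<^sub>R x)) = \<bar>r\<bar> * norm x" "norm (r *\<^sub>R g x) = \<bar>r\<bar> * norm x"
    using iso[of "r *\<^sub>R x" 0] iso[of x 0] assms(2) by auto
   moreover have "\<bar>r\<bar> * norm x <= 1 * norm x" using that by (intro mult_right_mono) auto
   ultimately show ?thesis using norm_triangle_ineq4[of "g (r *\<^sub>R x)" "r *\<^sub>R g x"] unfolding h_def by linarith
  qed
  have hn: "h (real n * r) = real n *\<^sub>R h r" for n r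
   by (induction n) (auto simp: h1 hadd distrib_right scaleR_left_distrib add.commute)
  have hneg: "h (- r) = - h r" for r using hadd[of r "- r"] h1 by (simp add: eq_neg_iff_add_eq_0 add.commute)
  have hint: "h (of_int k) = 0" for k
  proof (cases k rule: int_cases2)
   case (nonneg n) then show ?thesis using hn[of n 1] h1 by simp
  next
   case (nonpos n) then show ?thesis using hn[of n 1] hneg[of "real n"] h1 by simp
  qed
  have "real n * norm (h r) <= 2 * norm x" for n
  proof -
   have "h (real n * r) = h (frac (real n * r)) + h (of_int \<lfloor>real n * r\<rfloor>)"
    unfolding hadd[symmetric] by (simp add: frac_def)
   then have "real n *\<^sub>R h r = h (frac (real n * r))" using hn hint by simp
   then have "real n * norm (h r) = norm (h (frac (real n * r)))" by (metis norm_scaleR abs_of_nat)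
   also have "... <= 2 * norm x"
    by (rule hb) (use frac_lt_1[of "real n * r"] frac_ge_0[of "real n * r"] in linarith)
   finally show ?thesis .
  qed
  then have "norm (h r) = 0"
   by (metis norm_ge_zero less_eq_real_def reals_Archimedean3 not_le)
  then show ?thesis by (simp add: h_def)
 qed
 moreover have "norm (g x) = norm x" for x using iso[of x 0] assms(2) by simp
 ultimately show ?thesis unfolding lin_iso_def using add by (auto intro: linearI)
qed

end

section \<open>Finiteness of the group of linear isometries\<close>

context analytic_plane begin

lemma lin_isoD: "lin_iso g ==> linear g" "lin_iso g ==> norm (g x) = norm x"
 by (auto simp: lin_iso_def)

lemma lin_iso_comp: "lin_iso g ==> lin_iso h ==> lin_iso (g \<circ> h)"
 by (auto simp: lin_iso_def linear_compose)

lemma lin_iso_id: "lin_iso id"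
 using linear_id by (simp add: lin_iso_def)

lemma lin_iso_power: "lin_iso g ==> lin_iso (g ^^ n)"
 by (induction n) (auto simp: lin_iso_id[unfolded id_def] id_def intro: lin_iso_comp)

lemma co_basis: "co1 b1 = 1" "co2 b1 = 0" "co1 b2 = 0" "co2 b2 = 1"
 using co_pt[of 1 0] co_pt[of 0 1] by (simp_all add: pt_def)

lemma lin_iso_pt: "lin_iso g ==> g (pt s t) = s *\<^sub>R g b1 + t *\<^sub>R g b2"
 unfolding pt_def by (simp add: lin_isoD linear_add linear_scale)

lemma lin_iso_eqI: "lin_iso g ==> lin_iso h ==> g b1 = h b1 ==> g b2 = h b2 ==> g = h"
proof
 fix x assume "lin_iso g" "lin_iso h" "g b1 = h b1" "g b2 = h b2"
 then show "g x = h x" using lin_iso_pt[of g "co1 x" "co2 x"] lin_iso_pt[of h "co1 x" "co2 x"] by simp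
qed

lemma cr_lin_iso:
 assumes "lin_iso g"
 shows "cr (g x) (g y) = cr x y * cr (g b1) (g b2)"
proof -
 have "g x = co1 x *\<^sub>R g b1 + co2 x *\<^sub>R g b2" "g y = co1 y *\<^sub>R g b1 + co2 y *\<^sub>R g b2"
  using lin_iso_pt[OF assms, of "co1 x" "co2 x"] lin_iso_pt[OF assms, of "co1 y" "co2 y"] by simp_all
 then show ?thesis by (simp add: cr_def co_simps algebra_simps)
qed

lemma lin_iso_det_nonzero:
 assumes "lin_iso g"
 shows "cr (g b1) (g b2) ~= 0"
proof
 assume "cr (g b1) (g b2) = 0"
 moreover have "b1 ~= 0" using pt_eq_0[of 1 0] by (auto simp: pt_def)
 moreover have "g b1 ~= 0" using lin_isoD(2)[OF assms, of b1] \<open>b1 ~= 0\<close> by (metis norm_eq_zero)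
 ultimately obtain c where "g b2 = c *\<^sub>R g b1" using cr_eq_0 by blast
 then have "g (b2 - c *\<^sub>R b1) = 0" using lin_isoD(1)[OF assms] by (simp add: linear_diff linear_scale)
 moreover have "pt (- c) 1 = b2 - c *\<^sub>R b1" by (simp add: pt_def)
 ultimately have "pt (- c) 1 = 0" using lin_isoD(2)[OF assms, of "b2 - c *\<^sub>R b1"] by simp
 then show False using pt_eq_0[of "- c" 1] by simp
qed

lemma lin_iso_inj: "lin_iso g ==> g x = g y ==> x = y"
 using lin_isoD(2)[of g "x - y"] lin_isoD(1)[of g] by (simp add: linear_diff)

lemma lin_iso_inverse:
 assumes "lin_iso g"
 shows "EX h. lin_iso h & (ALL x. g (h x) = x) & (ALL x. h (g x) = x)"
proof -
 define D where "D = cr (g b1) (g b2)"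
 have D: "D ~= 0" using lin_iso_det_nonzero[OF assms] by (simp add: D_def)
 define h where "h y = pt (cr y (g b2) / D) (cr (g b1) y / D)" for y
 have gh: "g (h y) = y" for y
 proof -
  have "D *\<^sub>R g (h y) = D *\<^sub>R y"
   unfolding h_def lin_iso_pt[OF assms] using cramer[of "g b1" "g b2" y] D
   by (simp add: D_def scaleR_right_distrib)
  then show ?thesis using D by simp
 qed
 have hg: "h (g x) = x" for x using gh[of "g x"] lin_iso_inj[OF assms] by blast
 have "linear h"
 proof (rule linearI)
  show "h (x + y) = h x + h y" for x y
   by (rule lin_iso_inj[OF assms]) (simp add: gh linear_add[OF lin_isoD(1)[OF assms]])
  show "h (r *\<^sub>R x) = r *\<^sub>R h x" for r x
   by (rule lin_iso_inj[OF assms]) (simp add: gh linear_scale[OF lin_isoD(1)[OF assms]])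
 qed
 moreover have "norm (h x) = norm x" for x using lin_isoD(2)[OF assms, of "h x"] gh by simp
 ultimately show ?thesis using gh hg by (auto simp: lin_iso_def)
qed

lemma cr_bounded: "EX C>0. ALL x y. \<bar>cr x y\<bar> <= C * norm x * norm y"
proof -
 obtain k where k: "k > 0" "!!x. \<bar>co1 x\<bar> + \<bar>co2 x\<bar> <= k * norm x" using coords_bounded by blast
 have "\<bar>cr x y\<bar> <= k\<^sup>2 * norm x * norm y" for x y
 proof -
  have "\<bar>cr x y\<bar> <= \<bar>co1 x\<bar> * \<bar>co2 y\<bar> + \<bar>co2 x\<bar> * \<bar>co1 y\<bar>"
   unfolding cr_def by (metis abs_mult abs_triangle_ineq4)
  also have "... <= (\<bar>co1 x\<bar> + \<bar>co2 x\<bar>) * (\<bar>co1 y\<bar> + \<bar>co2 y\<bar>)" by (simp add: algebra_simps)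
  also have "... <= (k * norm x) * (k * norm y)" using k by (intro mult_mono) auto
  finally show ?thesis by (simp add: power2_eq_square mult_ac)
 qed
 then show ?thesis using k(1) by (intro exI[of _ "k\<^sup>2"]) auto
qed

text \<open>Powers of an isometry stay bounded while their determinants are powers of its
  determinant, so this is at most 1 in absolute value; the same holds for the inverse.\<close>

lemma lin_iso_det:
 assumes "lin_iso g"
 shows "\<bar>cr (g b1) (g b2)\<bar> = 1"
proof -
 obtain C where C: "C > 0" "!!x y. \<bar>cr x y\<bar> <= C * norm x * norm y" using cr_bounded by blast
 have le: "\<bar>cr (g b1) (g b2)\<bar> <= 1" if g: "lin_iso g" for g
 proof (rule ccontr)
  assume "\<not> ?thesis"
  then obtain n where n: "C * norm b1 * norm b2 < \<bar>cr (g b1) (g b2)\<bar> ^ n" using real_arch_pow by force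
  have "cr ((g ^^ n) b1) ((g ^^ n) b2) = cr (g b1) (g b2) ^ n"
  proof (induction n)
   case 0 then show ?case by (simp add: co_basis cr_def)
  next
   case (Suc n) then show ?case using cr_lin_iso[OF g, of "(g ^^ n) b1" "(g ^^ n) b2"] by simp
  qed
  moreover have "\<bar>cr ((g ^^ n) b1) ((g ^^ n) b2)\<bar> <= C * norm b1 * norm b2"
   using C(2)[of "(g ^^ n) b1" "(g ^^ n) b2"] lin_isoD(2)[OF lin_iso_power[OF g]] by simp
  ultimately show False using n by (simp add: power_abs)
 qed
 obtain h where h: "lin_iso h" "!!x. g (h x) = x" using lin_iso_inverse[OF assms] by blast
 have "cr (g (h b1)) (g (h b2)) = cr (h b1) (h b2) * cr (g b1) (g b2)" by (rule cr_lin_iso[OF assms])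
 then have "\<bar>cr (h b1) (h b2)\<bar> * \<bar>cr (g b1) (g b2)\<bar> = 1"
  by (simp add: h(2) co_basis cr_def flip: abs_mult)
 moreover have "\<bar>cr (h b1) (h b2)\<bar> * \<bar>cr (g b1) (g b2)\<bar> <= 1 * \<bar>cr (g b1) (g b2)\<bar>"
  by (rule mult_right_mono) (use le[OF h(1)] in auto)
 ultimately show ?thesis using le[OF assms] by linarith
qed

text \<open>Near the identity the determinant is 1, so an isometry satisfies its characteristic
  equation with trace \<open>tau\<close> close to 2. Bounded powers exclude \<open>tau > 2\<close>,
  where the traces grow, and \<open>tau = 2\<close>, where a nontrivial \<open>k\<close> has
  linearly growing powers. What remains is \<open>tau = 2 * cos tht\<close> with a small
  angle.\<close>

lemma near_identity_rotation:
 assumes "!!eps. eps > 0 ==> EX k. lin_iso k & k ~= id & norm (k b1 - b1) < eps & norm (k b2 - b2) < eps"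
  and dlt: "0 < dlt" "dlt < pi"
 shows "EX k tht. lin_iso k & 0 < tht & tht < dlt & (ALL x. k (k x) = (2 * cos tht) *\<^sub>R k x - x)"
proof -
 obtain C where C: "C > 0" "!!x y. \<bar>cr x y\<bar> <= C * norm x * norm y" using cr_bounded by blast
 obtain K where K: "K > 0" "!!x. \<bar>co1 x\<bar> + \<bar>co2 x\<bar> <= K * norm x" using coords_bounded by blast
 have cd: "cos dlt < 1" using dlt cos_monotone_0_pi[of 0 dlt] by simp
 \<comment> \<open>The three bounds make, in turn, the determinant positive, the trace positive and
   the angle smaller than \<open>dlt\<close>.\<close>
 define eps where "eps = min (1 / (C * (norm b1 + norm b2) + 1)) (min (1 / (K + 1)) ((1 - cos dlt) / (K + 1)))"
 have pos: "C * (norm b1 + norm b2) + 1 > 0" using C(1) by (simp add: add_nonneg_pos)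
 have eps: "eps > 0" using pos K(1) cd by (simp add: eps_def)
 obtain k where k: "lin_iso k" "k ~= id" "norm (k b1 - b1) < eps" "norm (k b2 - b2) < eps"
  using assms(1)[OF eps] by blast
 have lin: "linear k" using lin_isoD(1)[OF k(1)] .
 define a c b d where abcd: "a = co1 (k b1)" "c = co2 (k b1)" "b = co1 (k b2)" "d = co2 (k b2)"
 have D1: "a * d - c * b = 1"
 proof -
  have "cr (k b1) (k b2) = 1 + cr (k b1 - b1) b2 + cr (k b1) (k b2 - b2)"
   by (simp add: cr_def co_simps co_basis algebra_simps)
  moreover have "\<bar>cr (k b1 - b1) b2\<bar> <= C * eps * norm b2"
   using C k(3) by (intro order_trans[OF C(2)] mult_right_mono mult_left_mono) auto
  moreover have "\<bar>cr (k b1) (k b2 - b2)\<bar> <= C * norm b1 * eps"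
   using C k(4) lin_isoD(2)[OF k(1), of b1] by (intro order_trans[OF C(2)] mult_mono) auto
  moreover have "C * eps * norm b2 + C * norm b1 * eps < 1"
  proof -
   have "eps <= 1 / (C * (norm b1 + norm b2) + 1)" by (simp add: eps_def)
   then have "eps * (C * (norm b1 + norm b2) + 1) <= 1" using pos by (simp add: pos_le_divide_eq)
   then show ?thesis using eps by (simp add: algebra_simps)
  qed
  ultimately have "cr (k b1) (k b2) > 0" by linarith
  then have "cr (k b1) (k b2) = 1" using lin_iso_det[OF k(1)] by simp
  then show ?thesis by (simp add: cr_def abcd)
 qed
 define tau where "tau = a + d"
 have kpt: "k x = pt (a * co1 x + b * co2 x) (c * co1 x + d * co2 x)" for x
  using lin_iso_pt[OF k(1), of "co1 x" "co2 x"]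
  by (intro co_eqI) (simp_all add: co_simps abcd mult.commute)
 have CH: "k (k x) = tau *\<^sub>R k x - x" for x
 proof (rule co_eqI)
  have D: "co1 x * (a * d) = co1 x * (1 + c * b)" "co2 x * (a * d) = co2 x * (1 + c * b)" using D1 by simp_all
  have 1: "co1 (k x) = a * co1 x + b * co2 x" "co2 (k x) = c * co1 x + d * co2 x" for x using kpt[of x] by (metis co_pt)+
  show "co1 (k (k x)) = co1 (tau *\<^sub>R k x - x)" "co2 (k (k x)) = co2 (tau *\<^sub>R k x - x)"
   using D by (simp_all add: 1 co_simps tau_def algebra_simps)
 qed
 have CHn: "(k ^^ Suc (Suc n)) x = tau *\<^sub>R (k ^^ Suc n) x - (k ^^ n) x" for n x using CH[of "(k ^^ n) x"] by simp
 have close: "\<bar>tau - 2\<bar> <= 2 * (K * eps)"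
 proof -
  have "\<bar>co1 (k b1 - b1)\<bar> <= K * eps" "\<bar>co2 (k b2 - b2)\<bar> <= K * eps"
   using K(2)[of "k b1 - b1"] K(2)[of "k b2 - b2"] k(3,4) K(1)
    mult_left_mono[of "norm (k b1 - b1)" eps K] mult_left_mono[of "norm (k b2 - b2)" eps K] by linarith+
  then show ?thesis by (simp add: tau_def abcd co_simps co_basis)
 qed
 have Keps: "K * eps < 1" "K * eps < 1 - cos dlt"
 proof -
  have "eps <= 1 / (K + 1)" "eps <= (1 - cos dlt) / (K + 1)" by (simp_all add: eps_def)
  then have "eps * (K + 1) <= 1" "eps * (K + 1) <= 1 - cos dlt" using K(1) by (simp_all add: pos_le_divide_eq)
  then show "K * eps < 1" "K * eps < 1 - cos dlt" using eps by (simp_all add: algebra_simps)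
 qed
 have normk: "norm ((k ^^ n) x) = norm x" for n x by (rule lin_isoD(2)[OF lin_iso_power[OF k(1)]])
 have "tau < 2"
 proof (rule ccontr)
  assume "\<not> tau < 2"
  then have tau2: "tau >= 2" by simp
  \<comment> \<open>\<open>T n\<close> is the trace of the \<open>n\<close>-th power of
    \<open>k\<close>.\<close>
  define T where "T n = co1 ((k ^^ n) b1) + co2 ((k ^^ n) b2)" for n
  have T0: "T 0 = 2" "T 1 = tau" by (simp_all add: T_def co_basis tau_def abcd)
  have Tn: "T (Suc (Suc n)) = tau * T (Suc n) - T n" for n unfolding T_def CHn by (simp add: co_simps algebra_simps)
  have "T n >= 2 & T (Suc n) - T n >= tau - 2" for n
  proof (induction n)
   case 0 then show ?case using T0 by simp
  next
   case (Suc n)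
   then have S: "T (Suc n) >= 2" using tau2 by linarith
   then have "2 * T (Suc n) <= tau * T (Suc n)" using tau2 by (intro mult_right_mono) auto
   then show ?case using Suc S Tn[of n] by linarith
  qed
  then have grow: "T n >= 2 + real n * (tau - 2)" for n
  proof (induction n)
   case (Suc n)
   then have "T (Suc n) - T n >= tau - 2" "T n >= 2 + real n * (tau - 2)" by auto
   then show ?case by (simp add: algebra_simps)
  qed (use T0 in simp)
  have bound: "T n <= K * norm b1 + K * norm b2" for n
   using K(2)[of "(k ^^ n) b1"] K(2)[of "(k ^^ n) b2"] normk unfolding T_def by simp
  have "tau = 2"
  proof (rule ccontr)
   assume "tau ~= 2"
   then have "tau - 2 > 0" using tau2 by simp
   then obtain n where "K * norm b1 + K * norm b2 < real n * (tau - 2)" using reals_Archimedean3 by blast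
   then show False using grow[of n] bound[of n] by linarith
  qed
  have step: "(k ^^ n) x = x + real n *\<^sub>R (k x - x)" for n x
  proof (induction n rule: less_induct)
   case (less n)
   show ?case
   proof (cases n)
    case 0 then show ?thesis by simp
   next
    case (Suc m)
    show ?thesis
    proof (cases m)
     case 0 then show ?thesis using Suc by simp
    next
     case (Suc l)
     then have "(k ^^ n) x = 2 *\<^sub>R (k ^^ Suc l) x - (k ^^ l) x"
      using CHn[of l x] \<open>n = Suc m\<close> \<open>tau = 2\<close> by simp
     also have "... = 2 *\<^sub>R (x + real (Suc l) *\<^sub>R (k x - x)) - (x + real l *\<^sub>R (k x - x))"
      using less.IH[of "Suc l"] less.IH[of l] Suc \<open>n = Suc m\<close> by simp
     also have "... = x + real n *\<^sub>R (k x - x)"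
      by (rule co_eqI) (simp_all add: co_simps Suc \<open>n = Suc m\<close> algebra_simps)
     finally show ?thesis .
    qed
   qed
  qed
  have "k x = x" for x
  proof (rule ccontr)
   assume "k x ~= x"
   then have "norm (k x - x) > 0" by simp
   then obtain n where n: "2 * norm x < real n * norm (k x - x)" using reals_Archimedean3 by blast
   have "real n * norm (k x - x) = norm ((k ^^ n) x - x)" unfolding step by simp
   also have "... <= 2 * norm x" using norm_triangle_ineq4[of "(k ^^ n) x" x] normk by simp
   finally show False using n by simp
  qed
  then show False using k(2) by (auto simp: fun_eq_iff)
 qed
 define tht where "tht = arccos (tau / 2)"
 have range: "-1 <= tau / 2" "tau / 2 <= 1" using close Keps(1) \<open>tau < 2\<close> by linarith+
 have cos: "cos tht = tau / 2" unfolding tht_def by (rule cos_arccos) (use range in auto)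
 have tht: "0 <= tht" "tht <= pi" unfolding tht_def using arccos_lbound arccos_ubound range by auto
 have "tht ~= 0" using cos \<open>tau < 2\<close> by auto
 moreover have "tht < dlt"
 proof (rule ccontr)
  assume "\<not> tht < dlt"
  then have "cos tht <= cos dlt" using dlt tht by (intro cos_monotone_0_pi_le) auto
  then show False using cos close Keps(2) by linarith
 qed
 ultimately show ?thesis using k(1) tht CH cos by (intro exI[of _ k] exI[of _ tht]) auto
qed

text \<open>A small rotation \<open>k\<close> defines \<open>A\<close> with
  \<open>A (A x) = - x\<close>, and its powers are the rotations by multiples of \<open>tht\<close>.
  These are so dense that every rotation changes norms by a factor within \<open>eps\<close> of 1,
  so the squared norm is close to a Euclidean quadratic form. The parallelogram law then holds up to
  \<open>eps\<close> times a quantity that depends on \<open>x\<close> and \<open>y\<close>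
  alone.\<close>

lemma near_rotations_euclidean:
 fixes x y :: 'a
 assumes rot: "!!dlt. 0 < dlt ==> dlt < pi ==> EX k tht. lin_iso k & 0 < tht & tht < dlt & (ALL x. k (k x) = (2 * cos tht) *\<^sub>R k x - x)"
 shows "(norm (x + y))\<^sup>2 + (norm (x - y))\<^sup>2 = 2 * (norm x)\<^sup>2 + 2 * (norm y)\<^sup>2"
proof (cases "x = 0")
 case False
 have approx: "\<bar>(norm (x + y))\<^sup>2 + (norm (x - y))\<^sup>2 - 2 * (norm x)\<^sup>2 - 2 * (norm y)\<^sup>2\<bar> <= eps * (6 * (norm x)\<^sup>2 + 48 * (norm y)\<^sup>2)"
  if eps: "0 < eps" "eps <= 1/2" for eps
 proof -
  \<comment> \<open>Rounding an angle to a multiple of \<open>tht\<close> costs at most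
    \<open>tht\<close> times the sum of \<open>norm x\<close> and \<open>norm (A x)\<close>, and
    that sum is at most \<open>5 * norm x\<close>.\<close>
  have "0 < eps / 5" "eps / 5 < pi" using eps pi_gt3 by linarith+
  from rot[OF this] obtain k tht where k: "lin_iso k" "0 < tht" "tht < eps / 5" "!!x. k (k x) = (2 * cos tht) *\<^sub>R k x - x" by blast
  have lin: "linear k" using lin_isoD(1)[OF k(1)] .
  have tht: "tht < pi / 4" using k(3) eps pi_gt3 by linarith
  have sin: "sin tht > 0" using k(2) tht pi_gt3 by (intro sin_gt_zero) auto
  define A where "A x = (1 / sin tht) *\<^sub>R (k x - cos tht *\<^sub>R x)" for x
  have kA: "k x = cos tht *\<^sub>R x + sin tht *\<^sub>R A x" for x using sin by (simp add: A_def)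
  have linA: "A (u + v) = A u + A v" "A (r *\<^sub>R u) = r *\<^sub>R A u" for u v r
   unfolding A_def by (simp_all add: linear_add[OF lin] linear_scale[OF lin] algebra_simps)
  have AA: "A (A x) = - x" for x
  proof -
   have "sin tht *\<^sub>R (sin tht *\<^sub>R A (A x)) = sin tht *\<^sub>R (k (A x) - cos tht *\<^sub>R A x)" using kA[of "A x"] by simp
   also have "sin tht *\<^sub>R k (A x) = k (sin tht *\<^sub>R A x)" by (simp add: linear_scale[OF lin])
   then have "sin tht *\<^sub>R (k (A x) - cos tht *\<^sub>R A x) = k (k x - cos tht *\<^sub>R x) - cos tht *\<^sub>R (k x - cos tht *\<^sub>R x)"
    using kA[of x] by (simp add: scaleR_diff_right mult.commute)
   also have "... = - (1 - (cos tht)\<^sup>2) *\<^sub>R x"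
    by (rule co_eqI) (simp_all add: linear_diff[OF lin] linear_scale[OF lin] k(4) co_simps power2_eq_square algebra_simps)
   also have "1 - (cos tht)\<^sup>2 = sin tht * sin tht" using sin_squared_eq[of tht] by (simp add: power2_eq_square)
   finally have "(sin tht * sin tht) *\<^sub>R A (A x) = (sin tht * sin tht) *\<^sub>R (- x)" by simp
   then have "A (A x) = - x \<or> sin tht * sin tht = 0" unfolding scaleR_cancel_left by blast
   then show ?thesis using sin by simp
  qed
  have pow: "(k ^^ j) x = cos (real j * tht) *\<^sub>R x + sin (real j * tht) *\<^sub>R A x" for j x
  proof (induction j)
   case (Suc j)
   have "(k ^^ Suc j) x = k (cos (real j * tht) *\<^sub>R x + sin (real j * tht) *\<^sub>R A x)" using Suc by simp
   also have "... = cos (real (Suc j) * tht) *\<^sub>R x + sin (real (Suc j) * tht) *\<^sub>R A x"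
    by (rule co_eqI) (simp_all add: linear_add[OF lin] linear_scale[OF lin] kA[of x] kA[of "A x"] AA co_simps
      distrib_right cos_add sin_add algebra_simps)
   finally show ?case .
  qed simp
  have normk: "norm ((k ^^ n) x) = norm x" for n x by (rule lin_isoD(2)[OF lin_iso_power[OF k(1)]])
  have Ab: "norm (A x) <= 4 * norm x" for x
  proof -
   \<comment> \<open>Some multiple of \<open>tht\<close> lies between pi/4 and pi/2, where the sine
     is at least 1/2; solving the formula for that power for \<open>A x\<close> gives the factor
     4.\<close>
   define j where "j = nat \<lceil>pi / 4 / tht\<rceil>"
   have j: "pi / 4 / tht <= real j" "real j < pi / 4 / tht + 1"
    using k(2) unfolding j_def by (auto simp: of_nat_nat) linarith+
   have j1: "pi / 4 <= real j * tht" "real j * tht < pi / 4 + tht"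
    using j k(2) by (simp_all add: field_simps)
   have "sin (pi / 4) <= sin (real j * tht)" by (rule sin_monotone_2pi_le) (use j1 tht in auto)
   moreover have "1 <= sqrt (2::real)" by simp
   ultimately have s: "sin (real j * tht) >= 1/2" unfolding sin_45 by linarith
   have "1/2 * norm (A x) <= sin (real j * tht) * norm (A x)" using s by (rule mult_right_mono) simp
   also have "... = norm ((k ^^ j) x - cos (real j * tht) *\<^sub>R x)" unfolding pow using s by simp
   also have "... <= norm x + \<bar>cos (real j * tht)\<bar> * norm x"
    using norm_triangle_ineq4[of "(k ^^ j) x" "cos (real j * tht) *\<^sub>R x"] normk by simp
   also have "... <= norm x + 1 * norm x" by (intro add_left_mono mult_right_mono) auto
   finally show ?thesis by simp
  qed
  have rotn: "\<bar>norm (cos psi *\<^sub>R x + sin psi *\<^sub>R A x) - norm x\<bar> <= eps * norm x" if "psi >= 0" for psi x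
  proof -
   define j where "j = nat \<lfloor>psi / tht\<rfloor>"
   have "real j <= psi / tht" "psi / tht < real j + 1" using that k(2) by (simp_all add: j_def of_nat_nat)
   then have j: "real j * tht <= psi" "psi < real j * tht + tht" using k(2) by (simp_all add: field_simps)
   have c: "\<bar>cos psi - cos (real j * tht)\<bar> <= tht"
   proof -
    have "norm (cos psi - cos (real j * tht)) <= 1 * norm (psi - real j * tht)"
     by (rule field_differentiable_bound[where S=UNIV and f'="%t. - sin t"]) (auto intro!: derivative_eq_intros)
    then show ?thesis using j by simp
   qed
   have s: "\<bar>sin psi - sin (real j * tht)\<bar> <= tht"
   proof -
    have "norm (sin psi - sin (real j * tht)) <= 1 * norm (psi - real j * tht)"
     by (rule field_differentiable_bound[where S=UNIV and f'=cos]) (auto intro!: derivative_eq_intros)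
    then show ?thesis using j by simp
   qed
   have "norm (cos psi *\<^sub>R x + sin psi *\<^sub>R A x - (k ^^ j) x) =
     norm ((cos psi - cos (real j * tht)) *\<^sub>R x + (sin psi - sin (real j * tht)) *\<^sub>R A x)"
    unfolding pow by (simp add: algebra_simps)
   also have "... <= \<bar>cos psi - cos (real j * tht)\<bar> * norm x + \<bar>sin psi - sin (real j * tht)\<bar> * norm (A x)"
    by (rule order_trans[OF norm_triangle_ineq]) simp
   also have "... <= tht * norm x + tht * (4 * norm x)"
    using c s Ab[of x] k(2) by (intro add_mono mult_mono) auto
   also have "... = 5 * tht * norm x" by simp
   also have "... <= eps * norm x" using k(3) by (intro mult_right_mono) auto
   finally show ?thesis
    using norm_triangle_ineq3[of "cos psi *\<^sub>R x + sin psi *\<^sub>R A x" "(k ^^ j) x"] normk[of j x] by linarith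
  qed
  \<comment> \<open>Polar coordinates for \<open>alp\<close> and \<open>bet\<close> reduce a general
    combination to a rotation. The second estimate later trades coordinates, which depend on
    \<open>k\<close>, for norms.\<close>
  have gen: "\<bar>(norm (alp *\<^sub>R x + bet *\<^sub>R A x))\<^sup>2 - (alp\<^sup>2 + bet\<^sup>2) * (norm x)\<^sup>2\<bar> <= 3 * eps * ((alp\<^sup>2 + bet\<^sup>2) * (norm x)\<^sup>2)
    & (alp\<^sup>2 + bet\<^sup>2) * (norm x)\<^sup>2 <= 4 * (norm (alp *\<^sub>R x + bet *\<^sub>R A x))\<^sup>2" for alp bet
  proof -
   define r where "r = sqrt (alp\<^sup>2 + bet\<^sup>2)"
   have r: "r >= 0" "r\<^sup>2 = alp\<^sup>2 + bet\<^sup>2" by (simp_all add: r_def)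
   obtain psi where psi: "0 <= psi" "alp = r * cos psi" "bet = r * sin psi"
   proof (cases "r = 0")
    case True
    then have "alp = 0 & bet = 0" using r(2) by (simp add: sum_power2_eq_zero_iff)
    then show ?thesis using that[of 0] True by simp
   next
    case nz: False
    have "(alp / r)\<^sup>2 + (bet / r)\<^sup>2 = 1" 
    proof -
     have "(alp / r)\<^sup>2 + (bet / r)\<^sup>2 = r\<^sup>2 / r\<^sup>2" unfolding r(2) power_divide add_divide_distrib[symmetric] ..
     then show ?thesis using nz by simp
    qed
    then obtain psi where "0 <= psi" "alp / r = cos psi" "bet / r = sin psi" using sincos_total_2pi by metis
    then show ?thesis using that[of psi] nz by (auto simp: field_simps)
   qed
   let ?z = "cos psi *\<^sub>R x + sin psi *\<^sub>R A x"
   have z: "alp *\<^sub>R x + bet *\<^sub>R A x = r *\<^sub>R ?z" by (simp add: psi scaleR_right_distrib)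
   have nz: "(norm (alp *\<^sub>R x + bet *\<^sub>R A x))\<^sup>2 = r\<^sup>2 * (norm ?z)\<^sup>2" unfolding z using r by (simp add: power_mult_distrib)
   define q where "q = norm ?z - norm x"
   have q: "\<bar>q\<bar> <= eps * norm x" using rotn[OF psi(1)] by (simp add: q_def)
   have zq: "norm ?z = norm x + q" by (simp add: q_def)
   have "\<bar>(norm ?z)\<^sup>2 - (norm x)\<^sup>2\<bar> = \<bar>q\<bar> * \<bar>2 * norm x + q\<bar>"
    unfolding zq by (simp add: power2_eq_square algebra_simps flip: abs_mult)
   also have "... <= (eps * norm x) * (3 * norm x)"
   proof (rule mult_mono[OF q])
    have "eps * norm x <= 1 * norm x" using eps by (intro mult_right_mono) auto
    then show "\<bar>2 * norm x + q\<bar> <= 3 * norm x" using q by linarith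
   qed (use eps in auto)
   finally have 1: "\<bar>(norm ?z)\<^sup>2 - (norm x)\<^sup>2\<bar> <= 3 * eps * (norm x)\<^sup>2" by (simp add: power2_eq_square mult_ac)
   have "\<bar>r\<^sup>2 * (norm ?z)\<^sup>2 - r\<^sup>2 * (norm x)\<^sup>2\<bar> = r\<^sup>2 * \<bar>(norm ?z)\<^sup>2 - (norm x)\<^sup>2\<bar>"
    by (simp add: abs_mult flip: right_diff_distrib)
   also have "... <= r\<^sup>2 * (3 * eps * (norm x)\<^sup>2)" using 1 by (rule mult_left_mono) simp
   finally have A1: "\<bar>(norm (alp *\<^sub>R x + bet *\<^sub>R A x))\<^sup>2 - r\<^sup>2 * (norm x)\<^sup>2\<bar> <= 3 * eps * (r\<^sup>2 * (norm x)\<^sup>2)"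
    unfolding nz by (simp add: mult_ac)
   have "norm x <= 2 * norm ?z"
   proof -
    have "eps * norm x <= 1/2 * norm x" using eps by (intro mult_right_mono) auto
    then show ?thesis using q zq by linarith
   qed
   then have "(norm x)\<^sup>2 <= (2 * norm ?z)\<^sup>2" by (rule power_mono) simp
   then have "r\<^sup>2 * (norm x)\<^sup>2 <= r\<^sup>2 * (2 * norm ?z)\<^sup>2" by (rule mult_left_mono) simp
   then have "r\<^sup>2 * (norm x)\<^sup>2 <= 4 * (norm (alp *\<^sub>R x + bet *\<^sub>R A x))\<^sup>2" unfolding nz by (simp add: power_mult_distrib mult_ac)
   then show ?thesis using A1 unfolding r(2) by blast
  qed
  have crne: "cr x (A x) ~= 0"
  proof
   assume "cr x (A x) = 0"
   then obtain c where c: "A x = c *\<^sub>R x" using cr_eq_0 False by blast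
   then have "A (A x) = (c * c) *\<^sub>R x" using linA(2) by simp
   then have "(c * c) *\<^sub>R x + x = - x + x" using AA[of x] by (simp only:)
   then have "(c * c + 1) *\<^sub>R x = 0" by (simp add: scaleR_left_distrib)
   moreover have "c * c + 1 > 0" by (simp add: add_nonneg_pos)
   ultimately show False using False by simp
  qed
  define alp where "alp = cr y (A x) / cr x (A x)"
  define bet where "bet = cr x y / cr x (A x)"
  have "cr x (A x) *\<^sub>R y = cr x (A x) *\<^sub>R (alp *\<^sub>R x + bet *\<^sub>R A x)"
   using cramer[of x "A x" y] crne by (simp add: alp_def bet_def scaleR_right_distrib)
  then have y: "y = alp *\<^sub>R x + bet *\<^sub>R A x" using crne by (simp only: scaleR_cancel_left) blast
  define X where "X = (norm x)\<^sup>2"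
  define Y where "Y = (alp\<^sup>2 + bet\<^sup>2) * X"
  have p: "x + y = (1 + alp) *\<^sub>R x + bet *\<^sub>R A x" "x - y = (1 - alp) *\<^sub>R x + (- bet) *\<^sub>R A x"
   unfolding y by (simp_all add: algebra_simps)
  have g1: "\<bar>(norm (x + y))\<^sup>2 - ((1 + alp)\<^sup>2 + bet\<^sup>2) * X\<bar> <= 3 * eps * (((1 + alp)\<^sup>2 + bet\<^sup>2) * X)"
   using gen[of "1 + alp" bet] unfolding p X_def by blast
  have g2: "\<bar>(norm (x - y))\<^sup>2 - ((1 - alp)\<^sup>2 + bet\<^sup>2) * X\<bar> <= 3 * eps * (((1 - alp)\<^sup>2 + bet\<^sup>2) * X)"
   using gen[of "1 - alp" "- bet"] unfolding p X_def by simp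
  have g3: "\<bar>(norm y)\<^sup>2 - Y\<bar> <= 3 * eps * Y" "Y <= 4 * (norm y)\<^sup>2"
   using gen[of alp bet] unfolding y X_def Y_def by blast+
  have s: "((1 + alp)\<^sup>2 + bet\<^sup>2) * X + ((1 - alp)\<^sup>2 + bet\<^sup>2) * X = 2 * X + 2 * Y"
   by (simp add: Y_def power2_eq_square algebra_simps)
  have s2: "3 * eps * (((1 + alp)\<^sup>2 + bet\<^sup>2) * X) + 3 * eps * (((1 - alp)\<^sup>2 + bet\<^sup>2) * X) = 3 * eps * (2 * X + 2 * Y)"
   unfolding s[symmetric] by (simp add: algebra_simps)
  have "\<bar>(norm (x + y))\<^sup>2 + (norm (x - y))\<^sup>2 - 2 * X - 2 * (norm y)\<^sup>2\<bar> <= 3 * eps * (2 * X + 2 * Y) + 2 * (3 * eps * Y)"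
   using g1 g2 g3(1) s s2 by linarith
  also have "... = eps * (6 * X + 12 * Y)" by (simp add: algebra_simps)
  also have "... <= eps * (6 * X + 48 * (norm y)\<^sup>2)" using g3(2) eps by (intro mult_left_mono) auto
  finally show ?thesis by (simp add: X_def)
 qed
 define Z where "Z = \<bar>(norm (x + y))\<^sup>2 + (norm (x - y))\<^sup>2 - 2 * (norm x)\<^sup>2 - 2 * (norm y)\<^sup>2\<bar>"
 define W where "W = 6 * (norm x)\<^sup>2 + 48 * (norm y)\<^sup>2"
 have W: "W > 0" using False by (simp add: W_def add_pos_nonneg)
 have "Z <= 0"
 proof (rule ccontr)
  assume "\<not> Z <= 0"
  then have Z: "Z > 0" by simp
  define eps where "eps = min (1/2) (Z / (2 * W))"
  have "Z <= eps * W" using approx[of eps] Z W unfolding Z_def[symmetric] W_def[symmetric] by (simp add: eps_def)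
  also have "... <= Z / (2 * W) * W" using W by (intro mult_right_mono) (auto simp: eps_def)
  also have "... = Z / 2" using W by simp
  finally show False using Z by simp
 qed
 then show ?thesis by (simp add: Z_def)
qed simp

text \<open>Infinitely many isometries in a bounded set of matrices accumulate, and the quotient of
  two close ones is a nontrivial isometry close to the identity. Arbitrarily small rotations would
  make the plane Euclidean.\<close>

theorem finite_lin_iso: "finite {g. lin_iso g}"
proof (rule ccontr)
 assume inf: "infinite {g. lin_iso g}"
 obtain K where K: "K > 0" "!!x. \<bar>co1 x\<bar> + \<bar>co2 x\<bar> <= K * norm x" using coords_bounded by blast
 define m where "m g = ((co1 (g b1), co2 (g b1)), (co1 (g b2), co2 (g b2)))" for g :: "'a => 'a"
 have inj: "inj_on m {g. lin_iso g}"
  by (rule inj_onI) (auto simp: m_def intro: lin_iso_eqI co_eqI)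
 then have infm: "infinite (m ` {g. lin_iso g})" using inf finite_imageD by blast
 define R where "R = K * norm b1 + K * norm b2"
 have sub: "m ` {g. lin_iso g} \<subseteq> cball 0 (2 * R)"
 proof
  fix p assume "p \<in> m ` {g. lin_iso g}"
  then obtain g where g: "lin_iso g" "p = m g" by blast
  have 1: "\<bar>co1 (g b1)\<bar> + \<bar>co2 (g b1)\<bar> <= K * norm b1" "\<bar>co1 (g b2)\<bar> + \<bar>co2 (g b2)\<bar> <= K * norm b2"
   using K(2)[of "g b1"] K(2)[of "g b2"] lin_isoD(2)[OF g(1)] by simp_all
  have "norm (m g) <= norm (co1 (g b1), co2 (g b1)) + norm (co1 (g b2), co2 (g b2))"
   unfolding m_def by (rule norm_Pair_le)
  also have "... <= (\<bar>co1 (g b1)\<bar> + \<bar>co2 (g b1)\<bar>) + (\<bar>co1 (g b2)\<bar> + \<bar>co2 (g b2)\<bar>)"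
   using norm_Pair_le[of "co1 (g b1)" "co2 (g b1)"] norm_Pair_le[of "co1 (g b2)" "co2 (g b2)"] by simp
  also have "... <= 2 * R" using 1 K(1) by (simp add: R_def)
  finally show "p \<in> cball 0 (2 * R)" using g by simp
 qed
 obtain l where l: "l islimpt m ` {g. lin_iso g}"
  using compact_eq_Bolzano_Weierstrass[of "cball (0 :: (real \<times> real) \<times> (real \<times> real)) (2 * R)"] compact_cball infm sub by blast
 have near: "EX k. lin_iso k & k ~= id & norm (k b1 - b1) < eps & norm (k b2 - b2) < eps" if eps: "eps > 0" for eps
 proof -
  define eta where "eta = eps / (4 * (norm b1 + norm b2 + 1))"
  have nb: "norm b1 + norm b2 + 1 > 0" by (simp add: add_nonneg_pos)
  have eta: "eta > 0" using eps nb by (simp add: eta_def)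
  obtain p where p: "p \<in> m ` {g. lin_iso g}" "p ~= l" "dist p l < eta" using l eta unfolding islimpt_approachable by blast
  have "dist p l > 0" using p(2) by simp
  \<comment> \<open>Choosing \<open>q\<close> closer to \<open>l\<close> than \<open>p\<close> makes
    the two isometries different.\<close>
  then obtain q where q: "q \<in> m ` {g. lin_iso g}" "q ~= l" "dist q l < min eta (dist p l)"
   using l eta unfolding islimpt_approachable by (meson min_less_iff_conj)
  obtain g h where gh: "lin_iso g" "lin_iso h" "p = m g" "q = m h" using p q by blast
  have ne: "g ~= h" using gh q(3) by auto
  have d: "dist (m g) (m h) < 2 * eta" using dist_triangle2[of p q l] p(3) q(3) gh by simp
  obtain g' where g': "lin_iso g'" "!!x. g (g' x) = x" "!!x. g' (g x) = x" using lin_iso_inverse[OF gh(1)] by blast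
  define k where "k = g' \<circ> h"
  have k: "lin_iso k" unfolding k_def by (rule lin_iso_comp[OF g'(1) gh(2)])
  have "k ~= id"
  proof
   assume "k = id"
   then have "g' (h x) = x" for x by (metis k_def comp_apply id_apply)
   then have "h x = g x" for x using g'(2)[of "h x"] by simp
   then show False using ne by auto
  qed
  moreover have kb: "norm (k x - x) = norm (h x - g x)" for x
  proof -
   have "norm (k x - x) = norm (g (k x - x))" by (simp add: lin_isoD(2)[OF gh(1)])
   also have "g (k x - x) = h x - g x" by (simp add: linear_diff[OF lin_isoD(1)[OF gh(1)]] k_def g'(2))
   finally show ?thesis .
  qed
  have small: "norm (h b - g b) < eps" if b: "\<bar>co1 (h b - g b)\<bar> < 2 * eta" "\<bar>co2 (h b - g b)\<bar> < 2 * eta" for b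
  proof -
   have "norm (h b - g b) = norm (pt (co1 (h b - g b)) (co2 (h b - g b)))" by simp
   also have "... <= \<bar>co1 (h b - g b)\<bar> * norm b1 + \<bar>co2 (h b - g b)\<bar> * norm b2" by (rule norm_pt_le)
   also have "... <= (2 * eta) * norm b1 + (2 * eta) * norm b2" using b by (intro add_mono mult_right_mono) auto
   also have "... = 2 * eta * (norm b1 + norm b2)" by (simp add: algebra_simps)
   also have "... < 2 * eta * (2 * (norm b1 + norm b2 + 1))" using eta by (intro mult_strict_left_mono) (auto simp: add_pos_nonneg add_nonneg_pos)
   also have "... = eps"
   proof -
    have "0 < 4 * (norm b1 + norm b2 + 1)" using nb by (intro mult_pos_pos) simp_all
    then have "4 * (norm b1 + norm b2 + 1) ~= 0" by (rule less_imp_neq[THEN not_sym])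
    then have "eta * (4 * (norm b1 + norm b2 + 1)) = eps" unfolding eta_def by (rule nonzero_divide_eq_eq[THEN iffD1, OF _ refl, symmetric])
    then show ?thesis by (simp add: algebra_simps)
   qed
   finally show ?thesis .
  qed
  have comps: "\<bar>co1 (g b1) - co1 (h b1)\<bar> < 2 * eta" "\<bar>co2 (g b1) - co2 (h b1)\<bar> < 2 * eta"
   "\<bar>co1 (g b2) - co1 (h b2)\<bar> < 2 * eta" "\<bar>co2 (g b2) - co2 (h b2)\<bar> < 2 * eta"
   using d dist_fst_le[of "m g" "m h"] dist_snd_le[of "m g" "m h"]
    dist_fst_le[of "fst (m g)" "fst (m h)"] dist_snd_le[of "fst (m g)" "fst (m h)"]
    dist_fst_le[of "snd (m g)" "snd (m h)"] dist_snd_le[of "snd (m g)" "snd (m h)"]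
   by (auto simp: m_def dist_real_def)
  have "norm (h b1 - g b1) < eps" "norm (h b2 - g b2) < eps"
   using comps by (auto intro!: small simp: co_simps abs_minus_commute)
  ultimately show ?thesis using k kb by (intro exI[of _ k]) auto
 qed
 have "EX k tht. lin_iso k & 0 < tht & tht < dlt & (ALL x. k (k x) = (2 * cos tht) *\<^sub>R k x - x)"
  if "0 < dlt" "dlt < pi" for dlt by (rule near_identity_rotation[OF near that])
 from near_rotations_euclidean[OF this] show False using non_euclidean by blast
qed

end

section \<open>Fibres of the edge length map\<close>

lemma finite_coordinates_subsequence:
 fixes X :: "nat => nat => real"
 assumes "!!n i. i < N ==> \<bar>X n i\<bar> <= B"
 shows "EX l r. strict_mono (r :: nat => nat) & (ALL i<N. (%n. X (r n) i) \<longlonglongrightarrow> l i)"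
 using assms
proof (induction N)
 case 0 show ?case by (intro exI[of _ "%_. 0"] exI[of _ id]) (simp add: strict_mono_def)
next
 case (Suc N)
 then obtain l r where lr: "strict_mono (r :: nat => nat)" "!!i. i < N ==> (%n. X (r n) i) \<longlonglongrightarrow> l i" by (metis less_SucI)
 have "bounded (range (%n. X (r n) N))" using Suc.prems[of N] by (auto simp: bounded_iff)
 from bounded_imp_convergent_subsequence[OF this] obtain l' s where
  s: "strict_mono (s :: nat => nat)" "((%n. X (r n) N) \<circ> s) \<longlonglongrightarrow> l'" by blast
 have "(%n. X ((r \<circ> s) n) i) \<longlonglongrightarrow> (l(N := l')) i" if "i < Suc N" for i
 proof (cases "i = N")
  case False
  then have "i < N" using that by simp
  from LIMSEQ_subseq_LIMSEQ[OF lr(2)[OF this] s(1)] show ?thesis using False by (simp add: comp_def)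
 qed (use s(2) in \<open>simp add: comp_def\<close>)
 then show ?case using strict_mono_o[OF lr(1) s(1)] by blast
qed

lemma config_tendsto_uniform:
 assumes "!!i. (%n. X n i) \<longlonglongrightarrow> l i" "!!n. X n \<in> supp_below N" "l \<in> supp_below N" "r > 0"
 shows "\<forall>\<^sub>F n in sequentially. ALL i. \<bar>X n i - l i\<bar> < r"
proof -
 have "\<forall>\<^sub>F n in sequentially. ALL i:{..<N}. \<bar>X n i - l i\<bar> < r"
  using tendstoD[OF assms(1) assms(4)] by (intro eventually_ball_finite) (auto simp: dist_real_def)
 then show ?thesis
 proof eventually_elim
  case (elim n)
  show ?case
  proof
   fix i show "\<bar>X n i - l i\<bar> < r"
   proof (cases "i < N")
    case False then show ?thesis using assms(2)[of n] assms(3,4) by (simp add: supp_below_def)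
   qed (use elim in auto)
  qed
 qed
qed

context analytic_plane_function begin

lemma eval_tendsto:
 assumes "edges_in E e" "l \<in> edge_nonzero E" "!!i. (%n. X n i) \<longlonglongrightarrow> l i" "!!n. X n \<in> supp_below N" "l \<in> supp_below N"
 shows "(%n. eval F e (X n)) \<longlonglongrightarrow> eval F e l"
proof (rule tendstoI)
 fix eps :: real assume eps: "eps > 0"
 obtain r C where r: "r > 0" "C >= 0" and L: "!!a b dlt. (ALL i. \<bar>a i - l i\<bar> < r) & (ALL i. \<bar>b i - l i\<bar> < r) & (ALL i. \<bar>b i - a i\<bar> <= dlt) ==>
   \<bar>eval F e b - eval F e a\<bar> <= C * dlt" using eval_local_lipschitz[OF assms(1,2)] by blast
 define s where "s = min r (eps / (2 * (C + 1)))"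
 have s: "s > 0" "s <= r" using r eps by (simp_all add: s_def)
 have "C * s <= C * (eps / (2 * (C + 1)))" using r by (intro mult_left_mono) (simp_all add: s_def)
 also have "... = eps * (C / (2 * (C + 1)))" by simp
 also have "... < eps * 1" using r eps by (intro mult_strict_left_mono) (simp_all add: divide_less_eq)
 also have "... = eps" by simp
 finally have Cs: "C * s < eps" .
 show "\<forall>\<^sub>F n in sequentially. dist (eval F e (X n)) (eval F e l) < eps"
  using config_tendsto_uniform[OF assms(3,4,5) s(1)]
 proof eventually_elim
  case (elim n)
  have "\<bar>eval F e (X n) - eval F e l\<bar> <= C * s"
   by (rule L) (use elim s r in \<open>auto intro: less_imp_le less_le_trans\<close>)
  then show ?case using Cs by (simp add: dist_real_def)
 qed
qed

end

text \<open>Connectedness of the graph, expressed by paths to the pinned vertex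
  \<open>N div 2\<close>.\<close>

definition pinned_connected :: "nat => (nat \<times> nat) set => bool" where
 "pinned_connected N E \<longleftrightarrow> (ALL a. 2 * a < N --> (a, N div 2) \<in> {(a, b). (a, b) \<in> E \<or> (b, a) \<in> E}\<^sup>*)"

definition ed :: "nat \<times> nat => expr" where "ed e = Der 0 0 (fst e) (snd e)"

lemma edges_in_ed: "edges_in E (ed e) \<longleftrightarrow> e \<in> E"
 by (simp add: ed_def)

context analytic_plane begin

definition pos :: "nat => (nat => real) => 'a" where "pos a y = pt (y (2*a)) (y (2*a+1))"

lemma eval_ed: "eval NF (ed e) y = norm (pos (fst e) y - pos (snd e) y)"
 by (simp add: ed_def pos_def NF_def pt_diff partial.simps)

lemma pos_pinned: "y \<in> supp_below N ==> 2 * a >= N ==> pos a y = 0"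
 by (simp add: pos_def supp_below_def)

lemma pos_eqI: "(!!a. pos a y = pos a z) ==> y = z"
proof
 fix i assume eq: "!!a. pos a y = pos a z"
 have "y (2 * a) = z (2 * a) & y (2 * a + 1) = z (2 * a + 1)" for a using eq[of a] by (simp add: pos_def pt_inj)
 from this[of "i div 2"] show "y i = z i" by (cases "even i") auto
qed

lemma edge_nonzero_iff: "y \<in> edge_nonzero E \<longleftrightarrow> (ALL e:E. pos (fst e) y ~= pos (snd e) y)"
 by (auto simp: edge_nonzero_def pos_def pt_inj split: prod.splits)

lemma edge_nonzero_iff_ed: "y \<in> edge_nonzero E \<longleftrightarrow> (ALL e:E. eval NF (ed e) y > 0)"
 by (simp add: edge_nonzero_iff eval_ed)

lemma pos_tendsto: "(!!i. ((%n. X n i) \<longlongrightarrow> l i) G) ==> ((%n. pos a (X n)) \<longlongrightarrow> pos a l) G"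
 unfolding pos_def pt_def by (intro tendsto_intros) auto

lemma pos_diff_le:
 assumes "!!i. \<bar>y i - z i\<bar> <= r"
 shows "norm (pos a y - pos a z) <= r * (norm b1 + norm b2)"
proof -
 have "norm (pos a y - pos a z) <= \<bar>y (2*a) - z (2*a)\<bar> * norm b1 + \<bar>y (2*a+1) - z (2*a+1)\<bar> * norm b2"
  unfolding pos_def pt_diff by (rule norm_pt_le)
 also have "... <= r * norm b1 + r * norm b2" using assms by (intro add_mono mult_right_mono) auto
 finally show ?thesis by (simp add: algebra_simps)
qed

lemma coordinate_le: "EX K>0. ALL y i. \<bar>y i\<bar> <= K * norm (pos (i div 2) y)"
proof -
 obtain K where K: "K > 0" "!!x. \<bar>co1 x\<bar> + \<bar>co2 x\<bar> <= K * norm x" using coords_bounded by blast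
 have "\<bar>y i\<bar> <= K * norm (pos (i div 2) y)" for y i
 proof -
  have "\<bar>y (2 * (i div 2))\<bar> + \<bar>y (2 * (i div 2) + 1)\<bar> <= K * norm (pos (i div 2) y)"
   using K(2)[of "pos (i div 2) y"] by (simp add: pos_def)
  then show ?thesis by (cases "even i") auto
 qed
 then show ?thesis using K(1) by blast
qed

text \<open>The diagonal action of a map of the plane on placements, written in coordinates.\<close>

definition act :: "('a => 'a) => (nat => real) => nat => real" where
 "act g y i = (if even i then co1 (g (pos (i div 2) y)) else co2 (g (pos (i div 2) y)))"

lemma pos_act [simp]: "pos a (act g y) = g (pos a y)"
 by (simp add: pos_def[of a "act g y"] act_def)

lemma act_supp:
 assumes "lin_iso g" "y \<in> supp_below N" "even N"
 shows "act g y \<in> supp_below N"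
proof -
 have "g 0 = 0" using lin_isoD(1)[OF assms(1)] linear_0 by blast
 have "act g y i = 0" if "i >= N" for i
 proof -
  have "2 * (i div 2) >= N" using that assms(3) by (cases "even i") (auto elim!: evenE oddE)
  from pos_pinned[OF assms(2) this] show ?thesis using \<open>g 0 = 0\<close> by (simp add: act_def co_simps)
 qed
 then show ?thesis by (simp add: supp_below_def)
qed

lemma lin_iso_diff: "lin_iso g ==> g x - g y = g (x - y)"
 using lin_isoD(1) by (simp add: linear_diff)

lemma eval_ed_act: "lin_iso g ==> eval NF (ed e) (act g y) = eval NF (ed e) y"
 by (simp add: eval_ed lin_iso_diff lin_isoD(2))

end

locale connected_framework = analytic_plane b1 b2 for b1 b2 :: "'a::real_normed_vector" +
 fixes N :: nat and E :: "(nat \<times> nat) set"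
 assumes valid: "valid_edges N E" and conn: "pinned_connected N E"
begin

lemma finite_E: "finite E" and even_N: "even N"
 using valid by (simp_all add: valid_edges_def)

text \<open>A vertex is no farther from the origin than the sum of the edge lengths along a path to
  the pinned vertex.\<close>

lemma bounded_by_edges: "EX c>0. ALL y M i. y \<in> supp_below N --> M >= 0 --> (ALL e:E. eval NF (ed e) y <= M) --> \<bar>y i\<bar> <= c * M"
proof -
 define ok where "ok y M \<longleftrightarrow> y \<in> supp_below N & M >= 0 & (ALL e:E. eval NF (ed e) y <= M)" for y M
 have vert: "EX c. ALL y M. ok y M --> norm (pos a y) <= c * M" if "(a, N div 2) \<in> {(a, b). (a, b) \<in> E \<or> (b, a) \<in> E}\<^sup>*" for a
  using that
 proof (induction rule: converse_rtrancl_induct)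
  case base
  have "norm (pos (N div 2) y) <= 0 * M" if "ok y M" for y M
   using pos_pinned[of y N "N div 2"] that even_N by (simp add: ok_def)
  then show ?case by blast
 next
  case (step a b)
  then obtain c where c: "!!y M. ok y M ==> norm (pos b y) <= c * M" by blast
  have "norm (pos a y) <= (c + 1) * M" if k: "ok y M" for y M
  proof -
   have "norm (pos a y - pos b y) <= M"
    using step(1) k eval_ed[of "(a, b)" y] eval_ed[of "(b, a)" y] by (auto simp: ok_def norm_minus_commute)
   then show ?thesis using c[OF k] norm_triangle_sub[of "pos a y" "pos b y"] by (simp add: algebra_simps)
  qed
  then show ?case by blast
 qed
 obtain K where K: "K > 0" "!!y i. \<bar>y i\<bar> <= K * norm (pos (i div 2) y)" using coordinate_le by blast
 have "EX c. ALL y M. ok y M --> norm (pos a y) <= c * M" if "a < N" for a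
 proof (cases "2 * a < N")
  case True then show ?thesis using vert conn by (auto simp: pinned_connected_def)
 next
  case False
  have "norm (pos a y) <= 0 * M" if "ok y M" for y M
   using pos_pinned[of y N a] that False by (simp add: ok_def)
  then show ?thesis by blast
 qed
 then obtain c where c: "!!a y M. a < N ==> ok y M ==> norm (pos a y) <= c a * M" by metis
 define c' where "c' = (\<Sum>a<N. \<bar>c a\<bar>) + 1"
 have c': "c' > 0" unfolding c'_def by (intro add_nonneg_pos sum_nonneg) auto
 have "\<bar>y i\<bar> <= K * c' * M" if k: "ok y M" for y M i
 proof (cases "i < N")
  case True
  then have i: "i div 2 < N" by (meson div_le_dividend le_less_trans)
  have "\<bar>c (i div 2)\<bar> <= (\<Sum>a<N. \<bar>c a\<bar>)" using i by (intro member_le_sum) auto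
  then have "c (i div 2) * M <= c' * M" using k by (intro mult_right_mono) (auto simp: c'_def ok_def)
  then have "norm (pos (i div 2) y) <= c' * M" using c[OF i k] by linarith
  then have "K * norm (pos (i div 2) y) <= K * (c' * M)" using K(1) by (intro mult_left_mono) auto
  then show ?thesis using K(2)[of y i] by (simp add: mult.assoc)
 next
  case False
  then have "y i = 0" using k by (simp add: ok_def supp_below_def)
  then show ?thesis using k K(1) c' by (simp add: ok_def)
 qed
 then show ?thesis using K(1) c' by (intro exI[of _ "K * c'"]) (auto simp: ok_def)
qed

lemma bounded_subsequence:
 assumes X: "!!n. X n \<in> supp_below N" and M: "!!n e. e \<in> E ==> eval NF (ed e) (X n) <= M"
 shows "EX l r. strict_mono (r :: nat => nat) & l \<in> supp_below N & (ALL i. (%n. X (r n) i) \<longlonglongrightarrow> l i)"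
proof -
 define M' where "M' = max M 0"
 obtain c where c: "!!y M i. y \<in> supp_below N ==> M >= 0 ==> (ALL e:E. eval NF (ed e) y <= M) ==> \<bar>y i\<bar> <= c * M"
  using bounded_by_edges by blast
 have B: "\<bar>X n i\<bar> <= c * M'" for n i
  by (rule c) (use X M in \<open>auto simp: M'_def le_max_iff_disj\<close>)
 obtain l r where lr: "strict_mono (r :: nat => nat)" "!!i. i < N ==> (%n. X (r n) i) \<longlonglongrightarrow> l i"
  using finite_coordinates_subsequence[of N X, OF B] by blast
 define l' where "l' i = (if i < N then l i else 0)" for i
 have "(%n. X (r n) i) \<longlonglongrightarrow> l' i" for i
 proof (cases "i < N")
  case False
  then have "X (r n) i = 0" for n using X[of "r n"] by (simp add: supp_below_def)
  then show ?thesis using False by (simp add: l'_def)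
 qed (use lr(2) in \<open>simp add: l'_def\<close>)
 moreover have "l' \<in> supp_below N" by (simp add: l'_def supp_below_def)
 ultimately show ?thesis using lr(1) by blast
qed

definition fibre :: "(nat => real) => (nat => real) set" where
 "fibre p = {y \<in> supp_below N. ALL e:E. eval NF (ed e) y = eval NF (ed e) p}"

text \<open>For \<open>p\<close> without edges of length zero, a compact neighbourhood of its fibre
  on which edge lengths stay positive. The margin allows a trajectory to be followed before it is
  known to remain in the fibre.\<close>

definition tube :: "(nat => real) => (nat => real) set" where
 "tube p = {y \<in> supp_below N. ALL e:E. eval NF (ed e) p / 2 <= eval NF (ed e) y & eval NF (ed e) y <= 2 * eval NF (ed e) p}"

lemma eval_ed_nonneg: "eval NF (ed e) y >= 0"
 by (simp add: eval_ed)

lemma fibre_tube: "fibre p \<subseteq> tube p"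
 using eval_ed_nonneg by (auto simp: fibre_def tube_def)

lemma fibre_self: "p \<in> supp_below N ==> p \<in> fibre p"
 by (simp add: fibre_def)

lemma fibre_eq: "y \<in> fibre p ==> fibre y = fibre p"
 by (auto simp: fibre_def)

lemma fibre_act: "lin_iso g ==> y \<in> fibre p ==> act g y \<in> fibre p"
 by (simp add: fibre_def act_supp even_N eval_ed_act)

lemma tube_edge_nonzero: "p \<in> edge_nonzero E ==> y \<in> tube p ==> y \<in> edge_nonzero E"
 unfolding edge_nonzero_iff_ed tube_def by (smt (verit) half_gt_zero mem_Collect_eq)

lemma fibre_edge_nonzero: "p \<in> edge_nonzero E ==> y \<in> fibre p ==> y \<in> edge_nonzero E"
 by (simp add: edge_nonzero_iff_ed fibre_def)

lemma fibre_supp: "y \<in> fibre p ==> y \<in> supp_below N"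
 by (simp add: fibre_def)

lemma eval_ed_tendsto: "(!!i. ((%n. X n i) \<longlongrightarrow> l i) G) ==> ((%n. eval NF (ed e) (X n)) \<longlongrightarrow> eval NF (ed e) l) G"
 unfolding eval_ed by (intro tendsto_norm tendsto_diff pos_tendsto)

lemma tube_closed:
 assumes "!!n. X n \<in> tube p" "!!i. (%n. X n i) \<longlonglongrightarrow> l i"
 shows "l \<in> tube p"
proof -
 have "l i = 0" if "i >= N" for i
 proof -
  have "X n i = 0" for n using assms(1)[of n] that by (simp add: tube_def supp_below_def)
  then show ?thesis using LIMSEQ_unique[OF assms(2)[of i], of 0] by simp
 qed
 moreover have "eval NF (ed e) p / 2 <= eval NF (ed e) l & eval NF (ed e) l <= 2 * eval NF (ed e) p" if "e \<in> E" for e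
 proof -
  have "(%n. eval NF (ed e) (X n)) \<longlonglongrightarrow> eval NF (ed e) l" by (rule eval_ed_tendsto[where X = X]) (rule assms(2))
  moreover have "eval NF (ed e) p / 2 <= eval NF (ed e) (X n) & eval NF (ed e) (X n) <= 2 * eval NF (ed e) p" for n
   using assms(1)[of n] that unfolding tube_def by blast
  ultimately show ?thesis using LIMSEQ_le_const LIMSEQ_le_const2 by metis
 qed
 ultimately show ?thesis by (simp add: tube_def supp_below_def)
qed

lemma fibre_closed:
 assumes "!!n. X n \<in> fibre (P n)" "!!i. (%n. X n i) \<longlonglongrightarrow> l i" "!!i. (%n. P n i) \<longlonglongrightarrow> p i"
 shows "l \<in> fibre p"
proof -
 have "l i = 0" if "i >= N" for i
 proof -
  have "X n i = 0" for n using assms(1)[of n] that by (simp add: fibre_def supp_below_def)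
  then show ?thesis using LIMSEQ_unique[OF assms(2)[of i], of 0] by simp
 qed
 moreover have "eval NF (ed e) l = eval NF (ed e) p" if "e \<in> E" for e
 proof -
  have eq: "eval NF (ed e) (X n) = eval NF (ed e) (P n)" for n using assms(1)[of n] that unfolding fibre_def by blast
  have "(%n. eval NF (ed e) (X n)) \<longlonglongrightarrow> eval NF (ed e) l" by (rule eval_ed_tendsto[where X = X]) (rule assms(2))
  moreover have "(%n. eval NF (ed e) (P n)) \<longlonglongrightarrow> eval NF (ed e) p" by (rule eval_ed_tendsto[where X = P]) (rule assms(3))
  ultimately show ?thesis unfolding eq by (rule LIMSEQ_unique)
 qed
 ultimately show ?thesis by (simp add: fibre_def supp_below_def)
qed

lemma tube_subsequence:
 assumes "!!n. X n \<in> tube p"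
 shows "EX l r. strict_mono (r :: nat => nat) & l \<in> tube p & (ALL i. (%n. X (r n) i) \<longlonglongrightarrow> l i)"
proof -
 have "EX M. ALL e:E. 2 * eval NF (ed e) p <= M"
  using finite_E by (intro exI[of _ "\<Sum>e\<in>E. 2 * eval NF (ed e) p"] ballI member_le_sum) (auto simp: eval_ed_nonneg)
 then obtain M where "!!e. e \<in> E ==> 2 * eval NF (ed e) p <= M" by blast
 moreover have "eval NF (ed e) (X n) <= 2 * eval NF (ed e) p" if "e \<in> E" for n e
  using assms[of n] that unfolding tube_def by blast
 ultimately have "!!n e. e \<in> E ==> eval NF (ed e) (X n) <= M" using order_trans by blast
 moreover have "!!n. X n \<in> supp_below N" using assms by (simp add: tube_def)
 ultimately obtain l r where lr: "strict_mono (r :: nat => nat)" "!!i. (%n. X (r n) i) \<longlonglongrightarrow> l i"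
  using bounded_subsequence by blast
 moreover have "l \<in> tube p" by (rule tube_closed[of "%n. X (r n)", OF assms lr(2)])
 ultimately show ?thesis by blast
qed

lemma tube_bounded:
 assumes "p \<in> edge_nonzero E" "edges_in E e"
 shows "EX M. ALL y:tube p. \<bar>eval NF e y\<bar> <= M"
proof (rule ccontr)
 assume "\<not> ?thesis"
 then have "ALL n::nat. EX y. y \<in> tube p & \<bar>eval NF e y\<bar> > real n" by (meson not_le)
 then obtain X where X: "!!n. X n \<in> tube p" "!!n. \<bar>eval NF e (X n)\<bar> > real n" by metis
 obtain l r where lr: "strict_mono (r :: nat => nat)" "l \<in> tube p" "!!i. (%n. X (r n) i) \<longlonglongrightarrow> l i"
  using tube_subsequence[of X, OF X(1)] by blast
 have "(%n. eval NF e (X (r n))) \<longlonglongrightarrow> eval NF e l"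
  by (rule eval_tendsto[OF assms(2) tube_edge_nonzero[OF assms(1) lr(2)] lr(3)]) (use X lr in \<open>auto simp: tube_def\<close>)
 then have "Bseq (%n. eval NF e (X (r n)))" by (meson convergentI convergent_imp_Bseq)
 then obtain K where K: "!!n. \<bar>eval NF e (X (r n))\<bar> <= K" by (auto simp: Bseq_def)
 obtain n where n: "K < real n" using reals_Archimedean2 by blast
 have "n <= r n" using lr(1) by (simp add: seq_suble)
 then show False using X(2)[of "r n"] K[of n] n by linarith
qed

text \<open>The tube is compact but need not be convex, so local constants cannot be added up along
  segments. Instead a sequence of pairs with growing slopes is considered: bounded values force the
  two points of a pair together, and near their limit the local Lipschitz bound is violated.\<close>

lemma tube_lipschitz:
 assumes p: "p \<in> edge_nonzero E" and e: "edges_in E e"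
 shows "EX L. ALL a:tube p. ALL b:tube p. \<bar>eval NF e a - eval NF e b\<bar> <= L * (\<Sum>i<N. \<bar>a i - b i\<bar>)"
proof (rule ccontr)
 assume "\<not> ?thesis"
 then have "ALL n::nat. EX a b. a \<in> tube p & b \<in> tube p & \<bar>eval NF e a - eval NF e b\<bar> > real n * (\<Sum>i<N. \<bar>a i - b i\<bar>)" by (meson not_le)
 then obtain X Y where X: "!!n. X n \<in> tube p" "!!n. Y n \<in> tube p"
  "!!n. \<bar>eval NF e (X n) - eval NF e (Y n)\<bar> > real n * (\<Sum>i<N. \<bar>X n i - Y n i\<bar>)" by metis
 obtain M where M: "!!y. y \<in> tube p ==> \<bar>eval NF e y\<bar> <= M" using tube_bounded[OF p e] by blast
 obtain l r where lr: "strict_mono (r :: nat => nat)" "l \<in> tube p" "!!i. (%n. X (r n) i) \<longlonglongrightarrow> l i"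
  using tube_subsequence[of X, OF X(1)] by blast
 have supp: "X n \<in> supp_below N" "Y n \<in> supp_below N" "l \<in> supp_below N" for n using X lr by (simp_all add: tube_def)
 obtain s C where s: "s > 0" "C >= 0" and L: "!!a b dlt. (ALL i. \<bar>a i - l i\<bar> < s) & (ALL i. \<bar>b i - l i\<bar> < s) & (ALL i. \<bar>b i - a i\<bar> <= dlt) ==>
   \<bar>eval NF e b - eval NF e a\<bar> <= C * dlt" using eval_local_lipschitz[OF e tube_edge_nonzero[OF p lr(2)]] by blast
 have "\<forall>\<^sub>F n in sequentially. ALL i. \<bar>X (r n) i - l i\<bar> < s / 2"
  by (rule config_tendsto_uniform[of "%n. X (r n)" l N]) (use lr(3) supp s in auto)
 then obtain n0 where n0: "!!n i. n >= n0 ==> \<bar>X (r n) i - l i\<bar> < s / 2" by (auto simp: eventually_sequentially)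
 obtain n1 where n1: "real n1 > 4 * \<bar>M\<bar> / s + C" using reals_Archimedean2 by blast
 define n where "n = max n0 n1"
 define D where "D = (\<Sum>i<N. \<bar>X (r n) i - Y (r n) i\<bar>)"
 have D: "\<bar>X (r n) i - Y (r n) i\<bar> <= D" for i
 proof (cases "i < N")
  case True then show ?thesis unfolding D_def by (intro member_le_sum) auto
 next
  case False then show ?thesis using supp(1)[of "r n"] supp(2)[of "r n"] by (simp add: supp_below_def D_def sum_nonneg)
 qed
 have D0: "D >= 0" by (simp add: D_def sum_nonneg)
 have "real (r n) >= real n" using lr(1) by (simp add: seq_suble)
 then have rn: "real (r n) > 4 * \<bar>M\<bar> / s + C" using n1 by (simp add: n_def)
 have big: "real (r n) * D < \<bar>eval NF e (X (r n)) - eval NF e (Y (r n))\<bar>" using X(3)[of "r n"] by (simp add: D_def)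
 also have "... <= 2 * \<bar>M\<bar>" using M[OF X(1), of "r n"] M[OF X(2), of "r n"] by linarith
 finally have "real (r n) * D < 2 * \<bar>M\<bar>" .
 moreover have "(4 * \<bar>M\<bar> / s) * D <= real (r n) * D" using rn s D0 by (intro mult_right_mono) auto
 ultimately have "(4 * \<bar>M\<bar> / s) * D < 2 * \<bar>M\<bar>" by linarith
 then have "4 * \<bar>M\<bar> * D < 2 * \<bar>M\<bar> * s" using s by (simp add: pos_divide_less_eq)
 then have "\<bar>M\<bar> * (2 * D) < \<bar>M\<bar> * s" by (simp add: mult_ac)
 then have Ds: "D < s / 2" by (auto simp: mult_less_cancel_left)
 have "\<bar>eval NF e (X (r n)) - eval NF e (Y (r n))\<bar> <= C * D"
 proof (rule L, intro conjI allI)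
  fix i
  have near: "\<bar>X (r n) i - l i\<bar> < s / 2" using n0[of n i] by (simp add: n_def)
  show "\<bar>X (r n) i - l i\<bar> < s" using near s by linarith
  show "\<bar>Y (r n) i - l i\<bar> < s" using near D[of i] Ds by linarith
  show "\<bar>X (r n) i - Y (r n) i\<bar> <= D" by (rule D)
 qed
 also have "... <= real (r n) * D"
 proof (rule mult_right_mono[OF _ D0])
  have "4 * \<bar>M\<bar> / s >= 0" using s by simp
  then show "C <= real (r n)" using rn by linarith
 qed
 finally show False using big by linarith
qed

end

section \<open>Flows\<close>

text \<open>The topology is the discrete one, so bounded real sequences are bounded continuous
  functions and form the Banach space in which differential equations are solved.\<close>

instantiation nat :: metric_space
begin

definition dist_nat :: "nat => nat => real" where "dist_nat m n = \<bar>real m - real n\<bar>"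

definition uniformity_nat :: "(nat \<times> nat) filter" where
 "uniformity_nat = (INF e\<in>{0<..}. principal {(x, y). dist x y < e})"

instance
proof
 have "eventually (%(x::nat, y). x = y) uniformity"
  unfolding uniformity_nat_def
  by (rule eventually_INF1[of 1]) (auto simp: eventually_principal dist_nat_def)
 then have "eventually (%(x', y). x' = x --> y \<in> U) uniformity" if "x \<in> U" for x :: nat and U
  by (rule eventually_mono) (use that in auto)
 then show "open U \<longleftrightarrow> (ALL x:U. eventually (%(x', y). x' = x --> y \<in> U) uniformity)" for U :: "nat set"
  using open_discrete by blast
qed (auto simp: uniformity_nat_def dist_nat_def)

end

instance bcontfun :: (metric_space, banach) banach ..

text \<open>The integral from 0 to \<open>t\<close> for either sign of \<open>t\<close>, since
  trajectories are followed in both directions of time.\<close>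

definition signed_integral :: "(real => 'b::banach) => real => 'b" where
 "signed_integral g t = (if t >= 0 then integral {0..t} g else - integral {t..0} g)"

lemma signed_integral_0 [simp]: "signed_integral g 0 = 0"
 by (simp add: signed_integral_def)

lemma signed_integral_vector_derivative:
 fixes g :: "real => 'b::banach"
 assumes "continuous_on UNIV g"
 shows "(signed_integral g has_vector_derivative g t) (at t)"
proof -
 have cont: "continuous_on S g" for S using assms by (rule continuous_on_subset) auto
 have int: "g integrable_on {a..b}" for a b by (rule integrable_continuous_interval[OF cont])
 define T where "T = \<bar>t\<bar> + 1"
 have eq: "signed_integral g s = integral {-T..s} g - integral {-T..0} g" if "s \<in> {-T..T}" for s
 proof (cases "s >= 0")
  case True
  then have "integral {-T..0} g + integral {0..s} g = integral {-T..s} g"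
   using Henstock_Kurzweil_Integration.integral_combine[of "-T" 0 s g] int by (simp add: T_def)
  then show ?thesis using True by (simp add: signed_integral_def algebra_simps)
 next
  case False
  then have "integral {-T..s} g + integral {s..0} g = integral {-T..0} g"
   using Henstock_Kurzweil_Integration.integral_combine[of "-T" s 0 g] int that by simp
  then show ?thesis using False by (simp add: signed_integral_def algebra_simps)
 qed
 have t: "t \<in> {-T..T}" by (auto simp: T_def)
 have "((%s. integral {-T..s} g - integral {-T..0} g) has_vector_derivative g t) (at t within {-T..T})"
  using has_vector_derivative_diff[OF integral_has_vector_derivative[OF cont t] has_vector_derivative_const] by simp
 then have "(signed_integral g has_vector_derivative g t) (at t within {-T..T})"
  by (rule has_vector_derivative_transform[OF t, rotated]) (use eq in auto)
 moreover have "t \<in> interior {-T..T}" by (simp add: T_def) arith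
 ultimately show ?thesis using at_within_interior by metis
qed

lemma signed_integral_bound:
 fixes g :: "real => 'b::banach"
 assumes "continuous_on UNIV g" and "!!s. norm (g s) <= h \<bar>s\<bar>"
  and H: "!!s. s >= 0 ==> (H has_real_derivative h s) (at s)"
 shows "norm (signed_integral g t) <= H \<bar>t\<bar> - H 0"
proof -
 have cont: "continuous_on S g" for S using assms(1) by (rule continuous_on_subset) auto
 have int: "g integrable_on {a..b}" for a b by (rule integrable_continuous_interval[OF cont])
 show ?thesis
 proof (cases "t >= 0")
  case True
  have ft: "(h has_integral (H t - H 0)) {0..t}"
   by (rule fundamental_theorem_of_calculus[OF True])
    (auto intro!: has_field_derivative_at_within H simp flip: has_real_derivative_iff_has_vector_derivative)
  have b: "norm (g s) <= h s" if "s \<in> {0..t}" for s using assms(2)[of s] that by simp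
  have "norm (integral {0..t} g) <= integral {0..t} h"
   by (rule integral_norm_bound_integral[OF int _ b]) (use ft in auto)
  then show ?thesis using True ft by (simp add: signed_integral_def integral_unique)
 next
  case False
  have D: "((%s. - H (- s)) has_real_derivative h (- s)) (at s)" if "s <= 0" for s
   using DERIV_minus[OF DERIV_chain2[OF H[of "- s"] DERIV_minus[OF DERIV_ident, of s UNIV]]] that by simp
  have ft: "((%s. h (- s)) has_integral (- H (- 0) - - H (- t))) {t..0}"
   by (rule fundamental_theorem_of_calculus)
    (use False in \<open>auto intro!: has_field_derivative_at_within D simp flip: has_real_derivative_iff_has_vector_derivative\<close>)
  have b: "norm (g s) <= h (- s)" if "s \<in> {t..0}" for s using assms(2)[of s] that by simp
  have "norm (integral {t..0} g) <= integral {t..0} (%s. h (- s))"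
   by (rule integral_norm_bound_integral[OF int _ b]) (use ft in auto)
  then show ?thesis using False ft by (simp add: signed_integral_def integral_unique)
 qed
qed

text \<open>Picard's theorem; the factor \<open>exp (- 2 L \<bar>t\<bar>)\<close> makes the integral operator a contraction on the
 whole line at once.\<close>

lemma picard_global:
 fixes V :: "'b::banach => 'b"
 assumes L: "L > 0" and lip: "!!x y. norm (V x - V y) <= L * norm (x - y)"
  and M: "!!x. norm (V x) <= M"
 shows "EX phi. phi 0 = z & (ALL t. (phi has_vector_derivative V (phi t)) (at t))"
proof -
 have Vcont: "continuous_on UNIV V"
 proof (rule lipschitz_on_continuous_on)
  show "L-lipschitz_on UNIV V" using lip L by (auto simp: lipschitz_on_def dist_norm)
 qed
 have M0: "M >= 0" using M[of 0] norm_ge_zero order_trans by blast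
 \<comment> \<open>\<open>psi\<close> is the weighted unknown: the path itself is \<open>z\<close>
   plus \<open>exp (2 * L * |s|)\<close> times \<open>psi\<close>.\<close>
 define g where "g psi s = V (z + exp (2 * L * \<bar>s\<bar>) *\<^sub>R psi s)" for psi :: "real => 'b" and s
 define T where "T psi t = exp (- (2 * L * \<bar>t\<bar>)) *\<^sub>R signed_integral (g psi) t" for psi :: "real => 'b" and t
 have gcont: "continuous_on UNIV (g psi)" if "continuous_on UNIV psi" for psi
  unfolding g_def by (rule continuous_on_compose2[OF Vcont]) (auto intro!: continuous_intros that)
 have sd: "(signed_integral (g psi) has_vector_derivative g psi t) (at t)" if "continuous_on UNIV psi" for psi t
  by (rule signed_integral_vector_derivative[OF gcont[OF that]])
 have Tcont: "continuous_on UNIV (T psi)" if "continuous_on UNIV psi" for psi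
 proof -
  have "continuous_on UNIV (signed_integral (g psi))"
   using sd[OF that] by (intro continuous_at_imp_continuous_on ballI has_vector_derivative_continuous) blast
  then show ?thesis unfolding T_def by (intro continuous_intros)
 qed
 \<comment> \<open>As \<open>V\<close> is bounded, the integral grows at most linearly, so the
   weighted one is bounded and \<open>T\<close> acts on bounded continuous functions.\<close>
 have Tbound: "norm (T psi t) <= M / (2 * L)" if "continuous_on UNIV psi" for psi t
 proof -
  have "norm (signed_integral (g psi) t) <= M * \<bar>t\<bar> - M * 0"
   by (rule signed_integral_bound[OF gcont[OF that], of "%_. M"])
    (auto simp: g_def intro!: M derivative_eq_intros)
  then have "norm (T psi t) <= exp (- (2 * L * \<bar>t\<bar>)) * (M * \<bar>t\<bar>)"
   by (simp add: T_def)
  also have "... <= M / (2 * L)"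
  proof -
   have "2 * L * \<bar>t\<bar> <= exp (2 * L * \<bar>t\<bar>)" using exp_ge_add_one_self[of "2 * L * \<bar>t\<bar>"] by linarith
   then have "M * (2 * L * \<bar>t\<bar>) <= M * exp (2 * L * \<bar>t\<bar>)" using M0 by (rule mult_left_mono)
   then show ?thesis using L by (simp add: exp_minus field_simps)
  qed
  finally show ?thesis .
 qed
 have Tmem: "T (apply_bcontfun psi) \<in> bcontfun" for psi :: "real \<Rightarrow>\<^sub>C 'b"
  by (rule bcontfun_normI[OF Tcont Tbound]) auto
 define TT where "TT psi = Bcontfun (T (apply_bcontfun psi))" for psi :: "real \<Rightarrow>\<^sub>C 'b"
 have TT: "apply_bcontfun (TT psi) = T (apply_bcontfun psi)" for psi
  unfolding TT_def by (rule Bcontfun_inverse[OF Tmem])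
 have contr: "dist (TT psi) (TT eta) <= 1/2 * dist psi eta" for psi eta
 proof (rule dist_bound)
  fix t
  let ?k = "dist psi eta"
  let ?g = "%s. g (apply_bcontfun psi) s - g (apply_bcontfun eta) s"
  have c: "continuous_on UNIV ?g" by (intro continuous_intros gcont) auto
  have int: "g (apply_bcontfun psi) integrable_on {a..b}" for a b psi
   by (rule integrable_continuous_interval[OF continuous_on_subset[OF gcont]]) auto
  have diff: "signed_integral ?g t = signed_integral (g (apply_bcontfun psi)) t - signed_integral (g (apply_bcontfun eta)) t"
   unfolding signed_integral_def by (auto simp: integral_diff int)
  \<comment> \<open>\<open>L\<close> times the weight integrates to half the weight, whence the
    contraction factor 1/2.\<close>
  have "norm (signed_integral ?g t) <= ?k / 2 * exp (2 * L * \<bar>t\<bar>) - ?k / 2 * exp (2 * L * 0)"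
  proof (rule signed_integral_bound[OF c, of "%s. L * ?k * exp (2 * L * s)"])
   fix s
   have "norm (?g s) <= L * norm (exp (2 * L * \<bar>s\<bar>) *\<^sub>R (apply_bcontfun psi s - apply_bcontfun eta s))"
    using lip[of "z + exp (2 * L * \<bar>s\<bar>) *\<^sub>R apply_bcontfun psi s" "z + exp (2 * L * \<bar>s\<bar>) *\<^sub>R apply_bcontfun eta s"]
    by (simp add: g_def scaleR_diff_right)
   also have "... = L * exp (2 * L * \<bar>s\<bar>) * dist (apply_bcontfun psi s) (apply_bcontfun eta s)"
    by (simp add: dist_norm)
   also have "... <= L * exp (2 * L * \<bar>s\<bar>) * ?k"
    using L by (intro mult_left_mono dist_bounded) auto
   finally show "norm (?g s) <= L * ?k * exp (2 * L * \<bar>s\<bar>)" by (simp add: mult_ac)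
  next
   fix s :: real assume "s >= 0"
   show "((%s. ?k / 2 * exp (2 * L * s)) has_real_derivative L * ?k * exp (2 * L * s)) (at s)"
    by (auto intro!: derivative_eq_intros)
  qed
  then have "norm (signed_integral ?g t) <= ?k / 2 * exp (2 * L * \<bar>t\<bar>)" 
   using zero_le_dist[of psi eta] by (simp only: mult_zero_right exp_zero mult_1_right)
  then have "exp (- (2 * L * \<bar>t\<bar>)) * norm (signed_integral ?g t) <= exp (- (2 * L * \<bar>t\<bar>)) * (?k / 2 * exp (2 * L * \<bar>t\<bar>))"
   by (intro mult_left_mono) auto
  also have "... = ?k / 2" by (simp add: exp_minus field_simps)
  finally show "dist (apply_bcontfun (TT psi) t) (apply_bcontfun (TT eta) t) <= 1/2 * ?k"
   unfolding TT T_def dist_norm diff by (simp flip: scaleR_diff_right)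
 qed
 have "EX! psi. TT psi = psi"
  by (rule banach_fix_type[of "1/2"]) (use contr in auto)
 then obtain psi where psi: "TT psi = psi" by blast
 define phi where "phi t = z + exp (2 * L * \<bar>t\<bar>) *\<^sub>R apply_bcontfun psi t" for t
 have "phi = (%t. z + signed_integral (g (apply_bcontfun psi)) t)"
 proof
  fix t
  have "apply_bcontfun psi t = exp (- (2 * L * \<bar>t\<bar>)) *\<^sub>R signed_integral (g (apply_bcontfun psi)) t"
   using fun_cong[OF TT[of psi], of t] psi by (simp add: T_def)
  then show "phi t = z + signed_integral (g (apply_bcontfun psi)) t"
   by (simp add: phi_def exp_minus)
 qed
 moreover have "g (apply_bcontfun psi) t = V (phi t)" for t by (simp add: g_def phi_def)
 ultimately have "(phi has_vector_derivative V (phi t)) (at t)" for t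
  using has_vector_derivative_add[OF has_vector_derivative_const[of z] sd[of "apply_bcontfun psi" t]] by simp
 moreover have "phi 0 = z" using \<open>phi = _\<close> by simp
 ultimately show ?thesis by blast
qed

text \<open>The system is read as one equation for a bounded sequence in the supremum norm;
  evaluation at an index is a bounded linear map and returns the single equations.\<close>

lemma ode_exists:
 fixes V :: "(nat => real) => nat => real"
 assumes L: "L > 0" and lip: "!!x y dlt i. (!!j. \<bar>x j - y j\<bar> <= dlt) ==> \<bar>V x i - V y i\<bar> <= L * dlt"
  and M: "!!x i. \<bar>V x i\<bar> <= M" and y0: "!!i. \<bar>y0 i\<bar> <= B"
 shows "EX x. x 0 = y0 & (ALL t i. ((%s. x s i) has_real_derivative V (x t) i) (at t))"
proof -
 have mem: "V x \<in> bcontfun" for x by (rule bcontfun_normI[of _ M]) (use M in auto)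
 have y0m: "y0 \<in> bcontfun" by (rule bcontfun_normI[of _ B]) (use y0 in auto)
 define W where "W x = Bcontfun (V (apply_bcontfun x))" for x :: "nat \<Rightarrow>\<^sub>C real"
 have W: "apply_bcontfun (W x) = V (apply_bcontfun x)" for x
  unfolding W_def by (rule Bcontfun_inverse[OF mem])
 have "EX phi. phi 0 = Bcontfun y0 & (ALL t. (phi has_vector_derivative W (phi t)) (at t))"
 proof (rule picard_global[where V=W and z="Bcontfun y0" and L=L and M=M])
  show "L > 0" by (rule L)
  fix x y
  show "norm (W x - W y) <= L * norm (x - y)"
   unfolding dist_norm[symmetric]
  proof (rule dist_bound)
   fix i
   have "\<bar>V (apply_bcontfun x) i - V (apply_bcontfun y) i\<bar> <= L * dist x y"
    by (rule lip) (use dist_bounded[of x _ y] in \<open>simp add: dist_real_def\<close>)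
   then show "dist (apply_bcontfun (W x) i) (apply_bcontfun (W y) i) <= L * dist x y"
    by (simp add: W dist_real_def)
  qed
  show "norm (W x) <= M" by (rule norm_bound) (use M in \<open>simp add: W\<close>)
 qed
 then obtain phi where phi: "phi 0 = Bcontfun y0" "!!t. (phi has_vector_derivative W (phi t)) (at t)" by blast
 have bl: "bounded_linear (%f :: nat \<Rightarrow>\<^sub>C real. apply_bcontfun f i)" for i
 proof (rule bounded_linear_intro[of _ 1])
  show "norm (apply_bcontfun f i) <= norm f * 1" for f :: "nat \<Rightarrow>\<^sub>C real" using norm_bounded[of f i] by simp
 qed auto
 have "((%s. apply_bcontfun (phi s) i) has_real_derivative V (apply_bcontfun (phi t)) i) (at t)" for t i
  using bounded_linear.has_vector_derivative[OF bl phi(2)[of t], of i]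
  by (simp add: W has_real_derivative_iff_has_vector_derivative)
 moreover have "apply_bcontfun (phi 0) = y0" unfolding phi(1) by (rule Bcontfun_inverse[OF y0m])
 ultimately show ?thesis by (intro exI[of _ "%t. apply_bcontfun (phi t)"]) auto
qed

text \<open>On a time interval of radius \<open>tau\<close> the largest difference of the two
  solutions is at most half of itself, hence zero; steps of length \<open>tau\<close> reach every
  time.\<close>

lemma ode_unique:
 fixes V :: "(nat => real) => nat => real"
 assumes L: "L > 0" and lip: "!!x y dlt i. (!!j. \<bar>x j - y j\<bar> <= dlt) ==> \<bar>V x i - V y i\<bar> <= L * dlt"
  and x: "!!t i. ((%s. x s i) has_real_derivative V (x t) i) (at t)"
  and y: "!!t i. ((%s. y s i) has_real_derivative V (y t) i) (at t)"
  and supp: "!!t i. i >= N ==> x t i = 0" "!!t i. i >= N ==> y t i = 0"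
  and init: "x t0 = y t0"
 shows "x t = y t"
proof -
 define w where "w s i = x s i - y s i" for s i
 define W where "W s = (\<Sum>i<N. \<bar>w s i\<bar>)" for s
 have dw: "((%s. w s i) has_real_derivative V (x t) i - V (y t) i) (at t)" for t i
  unfolding w_def by (intro DERIV_diff x y)
 have contW: "continuous_on S W" for S
  unfolding W_def
  by (intro continuous_intros continuous_at_imp_continuous_on ballI DERIV_isCont[OF dw])
 have wW: "\<bar>w s i\<bar> <= W s" for s i
 proof (cases "i < N")
  case True then show ?thesis unfolding W_def by (intro member_le_sum) auto
 next
  case False then show ?thesis using supp by (auto simp: w_def W_def sum_nonneg)
 qed
 have W0: "W s = 0 \<longleftrightarrow> x s = y s" for s
 proof
  assume "W s = 0"
  then have "w s i = 0" for i using wW[of s i] by simp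
  then show "x s = y s" by (auto simp: w_def fun_eq_iff)
 qed (simp add: W_def w_def)
 define tau where "tau = 1 / (2 * (real N * L + 1))"
 have NL: "real N * L + 1 > 0" using L by (simp add: add_nonneg_pos)
 have tau: "tau > 0" using NL by (simp add: tau_def)
 have loc: "W s = 0" if a: "W a = 0" and s: "s \<in> {a - tau..a + tau}" for a s
 proof -
  obtain m where m: "m \<in> {a - tau..a + tau}" "!!s. s \<in> {a - tau..a + tau} ==> W s <= W m"
   using continuous_attains_sup[of "{a - tau..a + tau}" W] tau contW by auto
  have wa: "w a i = 0" for i using wW[of a i] a by simp
  have "\<bar>w m i\<bar> <= tau * L * W m" for i
  proof -
   have "norm (w m i - w a i) <= (L * W m) * norm (m - a)"
   proof (rule field_differentiable_bound[of "{a - tau..a + tau}"])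
    show "((%s. w s i) has_field_derivative V (x z) i - V (y z) i) (at z within {a - tau..a + tau})" for z
     by (rule has_field_derivative_at_within[OF dw])
    fix z assume z: "z \<in> {a - tau..a + tau}"
    show "norm (V (x z) i - V (y z) i) <= L * W m"
     using lip[of "x z" "y z" "W m" i] wW[of z] m(2)[OF z] order_trans unfolding w_def real_norm_def by meson
   qed (use m tau in auto)
   also have "... <= (L * W m) * tau"
    using m L by (intro mult_left_mono) (auto simp: W_def sum_nonneg)
   finally show ?thesis using wa by (simp add: mult_ac)
  qed
  then have "W m <= (\<Sum>i<N. tau * L * W m)" unfolding W_def[of m] by (intro sum_mono) (simp add: W_def)
  also have "... = (tau * (real N * L)) * W m" by simp
  also have "... <= 1/2 * W m"
  proof (rule mult_right_mono)
   show "tau * (real N * L) <= 1/2" using NL by (simp add: tau_def field_simps)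
  qed (simp add: W_def sum_nonneg)
  finally have "W m <= 0" by simp
  moreover have "W s >= 0" by (simp add: W_def sum_nonneg)
  ultimately show ?thesis using m(2)[OF s] by linarith
 qed
 have steps: "W s = 0" if "\<bar>s - t0\<bar> <= real k * tau" for s k
  using that
 proof (induction k arbitrary: s)
  case 0 then show ?case using init W0 by simp
 next
  case (Suc k)
  show ?case
  proof (cases "\<bar>s - t0\<bar> <= real k * tau")
   case False
   define a where "a = (if s >= t0 then t0 + real k * tau else t0 - real k * tau)"
   have "W a = 0" by (rule Suc.IH) (use tau in \<open>auto simp: a_def\<close>)
   moreover have "s \<in> {a - tau..a + tau}" using Suc.prems False by (auto simp: a_def algebra_simps abs_if split: if_splits)
   ultimately show ?thesis by (rule loc)
  qed (rule Suc.IH)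
 qed
 obtain k where "\<bar>t - t0\<bar> / tau <= real k" using real_arch_simple by blast
 then have "\<bar>t - t0\<bar> <= real k * tau" using tau by (simp add: field_simps)
 then show ?thesis using steps W0 by blast
qed

section \<open>Counting critical values\<close>

text \<open>A finite form of Sard's theorem. \<open>A\<close> is a set of critical points controlled
  by \<open>m\<close> coordinates \<open>x\<close>: at each of its points some combination of the
  \<open>m\<close> functions \<open>f\<close> varies only quadratically. \<open>Y\<close> sends a
  box of dimension \<open>m\<close> into \<open>A\<close>, and a box point is recovered from the
  values of \<open>f\<close>. Points of a grid of mesh \<open>rho / (M * R)\<close> are labelled by
  a cell of size \<open>1 / R\<close> in \<open>A\<close> and by rounded values of all but one of
  the functions, relative to a representative of the cell. Labels determine grid points, but there
  are only about \<open>R ^ m * M ^ (m - 1)\<close> labels for \<open>(M * R) ^ m\<close>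
  points.\<close>

lemma grid_counting:
 fixes f :: "nat => 'x => real" and x :: "nat => 'x => real" and D :: "'x => 'x => real"
  and Y :: "(nat => real) => 'x" and Cn :: nat
 assumes fin: "finite I" "finite K" "finite H" and card: "card I = m" "card K = m" "card H = m" and m: "m >= 1"
  and Cn: "Cn >= 1" and C: "C = real Cn" and rho: "rho > 0"
  and A1: "!!a i. a \<in> A ==> i \<in> K ==> \<bar>x i a\<bar> <= C"
  and D0: "!!a b. D a b >= 0"
  and A2: "!!a b. a \<in> A ==> b \<in> A ==> D a b <= C * (\<Sum>i\<in>K. \<bar>x i a - x i b\<bar>)"
  and A3: "!!a. a \<in> A ==> EX c i0. i0 \<in> I & \<bar>c i0\<bar> = 1 & (ALL i:I. \<bar>c i\<bar> <= 1) &
    (ALL b:A. \<bar>\<Sum>i\<in>I. c i * (f i b - f i a)\<bar> <= C * (D a b)\<^sup>2)"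
  and A4: "!!a b i. a \<in> A ==> b \<in> A ==> i \<in> I ==> \<bar>f i a - f i b\<bar> <= C * D a b"
  and Y: "!!p. (ALL i:H. p0 i <= p i & p i <= p0 i + rho) ==> (ALL i. i \<notin> H --> p i = p0 i) ==> Y p \<in> A"
  and sep: "!!p p' i. (ALL i:H. p0 i <= p i & p i <= p0 i + rho) ==> (ALL i. i \<notin> H --> p i = p0 i) ==>
    (ALL i:H. p0 i <= p' i & p' i <= p0 i + rho) ==> (ALL i. i \<notin> H --> p' i = p0 i) ==> i \<in> H ==>
    \<bar>p i - p' i\<bar> <= C * (\<Sum>i\<in>I. \<bar>f i (Y p) - f i (Y p')\<bar>)"
 shows False
proof -
 have C1: "C >= 1" using Cn C by simp
 \<comment> \<open>Within a cell \<open>f\<close> differs from its value at the representative by at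
   most \<open>C ^ 2 * m / R\<close>, which is at most \<open>Q * M\<close> rounding steps
   \<open>s\<close>.\<close>
 define Q where "Q = nat \<lceil>4 * real m ^ 2 * C ^ 3 / rho\<rceil>"
 have Q: "4 * real m ^ 2 * C ^ 3 / rho <= real Q" unfolding Q_def by linarith
 \<comment> \<open>One more than the upper bound for \<open>M\<close> that the final count would
   force.\<close>
 define M where "M = (2 * Cn + 2) ^ m * (2 * Q + 2) ^ (m - 1) + 1"
 have M1: "M >= 1" by (simp add: M_def)
 \<comment> \<open>\<open>R\<close> is chosen after \<open>M\<close>, so that the quadratic error in
   a cell, of order \<open>1 / R ^ 2\<close>, is below the mesh, of order
   \<open>1 / (M * R)\<close>.\<close>
 define R where "R = nat \<lceil>4 * C ^ 4 * real m ^ 2 * real M / rho\<rceil> + 1"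
 have R1: "R >= 1" by (simp add: R_def)
 have R: "4 * C ^ 4 * real m ^ 2 * real M / rho < real R" unfolding R_def by linarith
 define s where "s = rho / (4 * real m * C * real M * real R)"
 have s: "s > 0" using rho m C1 M1 R1 by (simp add: s_def)
 define G where "G = H \<rightarrow>\<^sub>E {..<M * R}"
 define P where "P g = (%i. if i \<in> H then p0 i + rho * real (g i) / real (M * R) else p0 i)" for g :: "nat => nat"
 have MR: "real (M * R) > 0" using M1 R1 by simp
 have P: "ALL i:H. p0 i <= P g i & P g i <= p0 i + rho" "ALL i. i \<notin> H --> P g i = p0 i" if "g \<in> G" for g
 proof -
  have "real (g i) <= real (M * R)" if "i \<in> H" for i
  proof -
   have "g i < M * R" using \<open>g \<in> G\<close> that unfolding G_def by (auto dest: PiE_mem)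
   then show ?thesis by linarith
  qed
  then have "rho * real (g i) / real (M * R) <= rho" if "i \<in> H" for i
   using that MR rho by (subst divide_le_eq) (auto intro: mult_left_mono)
  then show "ALL i:H. p0 i <= P g i & P g i <= p0 i + rho"
   using rho MR unfolding P_def by auto
  show "ALL i. i \<notin> H --> P g i = p0 i" by (simp add: P_def)
 qed
 have YA: "Y (P g) \<in> A" if "g \<in> G" for g using Y[OF P[OF that]] .
 define cell where "cell g = restrict (%i. \<lfloor>real R * x i (Y (P g))\<rfloor>) K" for g
 define rep where "rep c = (SOME g. g \<in> G & cell g = c)" for c
 have rep: "rep (cell g) \<in> G" "cell (rep (cell g)) = cell g" if "g \<in> G" for g
  using someI[of "%h. h \<in> G & cell h = cell g" g] that unfolding rep_def by auto
 define aa where "aa c = Y (P (rep c))" for c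
 have aa: "aa (cell g) \<in> A" if "g \<in> G" for g using YA[OF rep(1)[OF that]] by (simp add: aa_def)
 have "EX ci. aa (cell g) \<in> A --> snd ci \<in> I & \<bar>fst ci (snd ci)\<bar> = 1 & (ALL i:I. \<bar>fst ci i\<bar> <= (1::real)) &
    (ALL b:A. \<bar>\<Sum>i\<in>I. fst ci i * (f i b - f i (aa (cell g)))\<bar> <= C * (D (aa (cell g)) b)\<^sup>2)" for g
  using A3[of "aa (cell g)"] by force
 define ci where "ci c = (SOME ci. aa c \<in> A --> snd ci \<in> I & \<bar>fst ci (snd ci)\<bar> = 1 & (ALL i:I. \<bar>fst ci i\<bar> <= (1::real)) &
    (ALL b:A. \<bar>\<Sum>i\<in>I. fst ci i * (f i b - f i (aa c))\<bar> <= C * (D (aa c) b)\<^sup>2))" for c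
 define cc where "cc c = fst (ci c)" for c
 define i0 where "i0 c = snd (ci c)" for c
 have cc: "i0 (cell g) \<in> I" "\<bar>cc (cell g) (i0 (cell g))\<bar> = 1" "ALL i:I. \<bar>cc (cell g) i\<bar> <= 1"
   "ALL b:A. \<bar>\<Sum>i\<in>I. cc (cell g) i * (f i b - f i (aa (cell g)))\<bar> <= C * (D (aa (cell g)) b)\<^sup>2" if "g \<in> G" for g
 proof -
  have "EX ci. aa (cell g) \<in> A --> snd ci \<in> I & \<bar>fst ci (snd ci)\<bar> = 1 & (ALL i:I. \<bar>fst ci i\<bar> <= (1::real)) &
    (ALL b:A. \<bar>\<Sum>i\<in>I. fst ci i * (f i b - f i (aa (cell g)))\<bar> <= C * (D (aa (cell g)) b)\<^sup>2)"
   using A3[of "aa (cell g)"] by force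
  from someI_ex[OF this] aa[OF that]
  show "i0 (cell g) \<in> I" "\<bar>cc (cell g) (i0 (cell g))\<bar> = 1" "ALL i:I. \<bar>cc (cell g) i\<bar> <= 1"
   "ALL b:A. \<bar>\<Sum>i\<in>I. cc (cell g) i * (f i b - f i (aa (cell g)))\<bar> <= C * (D (aa (cell g)) b)\<^sup>2"
   unfolding ci_def[symmetric] cc_def i0_def by auto
 qed
 \<comment> \<open>The entry at \<open>i0\<close> is set to 0: that value follows from the others up
   to the quadratic error.\<close>
 define fkey where "fkey g = restrict (%i. if i = i0 (cell g) then 0 else \<lfloor>(f i (Y (P g)) - f i (aa (cell g))) / s\<rfloor>) I" for g
 have floor_eq: "\<bar>u - v\<bar> <= 1" if "\<lfloor>u\<rfloor> = \<lfloor>v\<rfloor>" for u v :: real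
  using that by linarith
 have cellD: "D (Y (P g)) (Y (P h)) <= C * real m / real R" if gh: "g \<in> G" "h \<in> G" "cell g = cell h" for g h
 proof -
  have "\<bar>x i (Y (P g)) - x i (Y (P h))\<bar> <= 1 / real R" if "i \<in> K" for i
  proof -
   have "cell g i = cell h i" using gh by simp
   then have "\<bar>real R * x i (Y (P g)) - real R * x i (Y (P h))\<bar> <= 1"
    using that by (intro floor_eq) (simp add: cell_def)
   then have "real R * \<bar>x i (Y (P g)) - x i (Y (P h))\<bar> <= 1"
    by (simp add: abs_mult flip: right_diff_distrib)
   then show ?thesis using R1 by (simp add: field_simps)
  qed
  then have "(\<Sum>i\<in>K. \<bar>x i (Y (P g)) - x i (Y (P h))\<bar>) <= (\<Sum>i\<in>K. 1 / real R)" by (rule sum_mono)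
  also have "... = real m / real R" using card by simp
  finally have "C * (\<Sum>i\<in>K. \<bar>x i (Y (P g)) - x i (Y (P h))\<bar>) <= C * (real m / real R)"
   using C1 by (intro mult_left_mono) auto
  then show ?thesis using A2[OF YA YA, OF gh(1,2)] by simp
 qed
 have repD: "D (aa (cell g)) (Y (P g)) <= C * real m / real R" if "g \<in> G" for g
  unfolding aa_def by (rule cellD) (use rep that in auto)
 have inj: "g = h" if gh: "g \<in> G" "h \<in> G" "cell g = cell h" "fkey g = fkey h" for g h
 proof -
  let ?a = "aa (cell g)" and ?i = "i0 (cell g)" and ?c = "cc (cell g)"
  let ?d = "%i. f i (Y (P g)) - f i (Y (P h))"
  have small: "\<bar>?d i\<bar> <= s" if "i \<in> I" "i ~= ?i" for i
  proof -
   have "fkey g i = fkey h i" using gh by simp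
   then have "\<bar>(f i (Y (P g)) - f i ?a) / s - (f i (Y (P h)) - f i ?a) / s\<bar> <= 1"
    using that gh(3) by (intro floor_eq) (simp add: fkey_def)
   then have "\<bar>?d i / s\<bar> <= 1" by (simp flip: diff_divide_distrib)
   then show ?thesis using s by (simp add: abs_divide)
  qed
  have q: "\<bar>\<Sum>i\<in>I. ?c i * (f i b - f i ?a)\<bar> <= C * (C * real m / real R)\<^sup>2"
   if "b \<in> A" "D ?a b <= C * real m / real R" for b
  proof -
   have "C * (D ?a b)\<^sup>2 <= C * (C * real m / real R)\<^sup>2"
    using that D0 C1 by (intro mult_left_mono power_mono) auto
   then show ?thesis using cc(4)[OF gh(1)] that by force
  qed
  have "\<bar>\<Sum>i\<in>I. ?c i * (f i (Y (P g)) - f i ?a)\<bar> <= C * (C * real m / real R)\<^sup>2"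
   by (rule q) (use YA[OF gh(1)] repD[OF gh(1)] in auto)
  moreover have "\<bar>\<Sum>i\<in>I. ?c i * (f i (Y (P h)) - f i ?a)\<bar> <= C * (C * real m / real R)\<^sup>2"
   by (rule q) (use YA[OF gh(2)] repD[OF gh(2)] gh(3) in auto)
  moreover have "(\<Sum>i\<in>I. ?c i * ?d i) =
    (\<Sum>i\<in>I. ?c i * (f i (Y (P g)) - f i ?a)) - (\<Sum>i\<in>I. ?c i * (f i (Y (P h)) - f i ?a))"
   by (simp add: algebra_simps flip: sum_subtractf)
  ultimately have tot: "\<bar>\<Sum>i\<in>I. ?c i * ?d i\<bar> <= 2 * C * (C * real m / real R)\<^sup>2" by linarith
  have split: "(\<Sum>i\<in>I. w i) = w ?i + (\<Sum>i\<in>I - {?i}. w i)" for w :: "nat => real"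
   using cc(1)[OF gh(1)] fin by (simp add: sum.remove)
  have rest: "(\<Sum>i\<in>I - {?i}. \<bar>?d i\<bar>) <= (real m - 1) * s"
  proof -
   have "(\<Sum>i\<in>I - {?i}. \<bar>?d i\<bar>) <= (\<Sum>i\<in>I - {?i}. s)" by (rule sum_mono) (use small in auto)
   also have "... = (real m - 1) * s" using card cc(1)[OF gh(1)] fin m by (simp add: of_nat_diff)
   finally show ?thesis .
  qed
  have "\<bar>\<Sum>i\<in>I - {?i}. ?c i * ?d i\<bar> <= (\<Sum>i\<in>I - {?i}. \<bar>?d i\<bar>)"
  proof (rule order_trans[OF sum_abs sum_mono])
   fix i assume "i \<in> I - {?i}"
   then show "\<bar>?c i * ?d i\<bar> <= \<bar>?d i\<bar>" using cc(3)[OF gh(1)] by (auto simp: abs_mult intro: mult_left_le_one_le)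
  qed
  then have "\<bar>?c ?i * ?d ?i\<bar> <= (real m - 1) * s + 2 * C * (C * real m / real R)\<^sup>2"
   using tot rest split[of "%i. ?c i * ?d i"] by linarith
  then have "\<bar>?d ?i\<bar> <= (real m - 1) * s + 2 * C * (C * real m / real R)\<^sup>2"
   using cc(2)[OF gh(1)] by (simp add: abs_mult)
  then have "(\<Sum>i\<in>I. \<bar>?d i\<bar>) <= 2 * (real m - 1) * s + 2 * C * (C * real m / real R)\<^sup>2"
   using rest split[of "%i. \<bar>?d i\<bar>"] by linarith
  also have "... <= 2 * real m * s + 2 * C * (C * real m / real R)\<^sup>2" using s by (simp add: algebra_simps)
  finally have S: "C * (\<Sum>i\<in>I. \<bar>?d i\<bar>) <= C * (2 * real m * s + 2 * C * (C * real m / real R)\<^sup>2)"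
   using C1 by (intro mult_left_mono) auto
  have e1: "C * (2 * real m * s) = rho / (2 * real (M * R))"
   using C1 m M1 R1 by (simp add: s_def field_simps)
  have e2: "C * (2 * C * (C * real m / real R)\<^sup>2) < rho / (2 * real (M * R))"
  proof -
   have R0: "real R > 0" "real M > 0" using R1 M1 by auto
   have base: "4 * (C ^ 4 * ((real m)\<^sup>2 * real M)) < rho * real R" using R rho by (simp add: field_simps)
   have "C * (2 * C * (C * real m / real R)\<^sup>2) = 2 * C ^ 4 * real m ^ 2 / real R ^ 2"
    by (simp add: power_divide power2_eq_square power4_eq_xxxx)
   then show ?thesis using R0 base
    by (simp add: divide_less_eq less_divide_eq power2_eq_square power4_eq_xxxx field_simps)
  qed
  have half: "C * (2 * real m * s + 2 * C * (C * real m / real R)\<^sup>2) < rho / real (M * R)"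
  proof -
   have "rho / real (M * R) = rho / (2 * real (M * R)) + rho / (2 * real (M * R))" by simp
   then show ?thesis using e1 e2 by (simp only: distrib_left)
  qed
  have "g i = h i" if "i \<in> H" for i
  proof (rule ccontr)
   assume ne: "g i ~= h i"
   have "P g i - P h i = rho / real (M * R) * (real (g i) - real (h i))"
    using that by (simp add: P_def diff_divide_distrib right_diff_distrib)
   moreover have "\<bar>real (g i) - real (h i)\<bar> >= 1" using ne by linarith
   then have "rho / real (M * R) * 1 <= rho / real (M * R) * \<bar>real (g i) - real (h i)\<bar>"
    using rho MR by (intro mult_left_mono) auto
   ultimately have "\<bar>P g i - P h i\<bar> >= rho / real (M * R)"
    using rho MR by (simp add: abs_mult del: of_nat_mult)
   then show False using sep[OF P[OF gh(1)] P[OF gh(2)] that] S half by linarith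
  qed
  then show "g = h" using gh(1,2) unfolding G_def by (intro PiE_ext[of g H _ h]) auto
 qed
 define CS where "CS = K \<rightarrow>\<^sub>E {- int (Cn * R) - 1..int (Cn * R)}"
 define FS where "FS c = (\<Pi>\<^sub>E i\<in>I. if i = i0 c then {0} else {- int (Q * M) - 1..int (Q * M)})" for c :: "nat => int"
 have mem: "cell g \<in> CS" "fkey g \<in> FS (cell g)" if g: "g \<in> G" for g
 proof -
  have "\<lfloor>real R * x i (Y (P g))\<rfloor> \<in> {- int (Cn * R) - 1..int (Cn * R)}" if "i \<in> K" for i
  proof -
   have "real R * \<bar>x i (Y (P g))\<bar> <= real R * C" using A1[OF YA[OF g] that] by (rule mult_left_mono) simp
   then have "\<bar>real R * x i (Y (P g))\<bar> <= real (Cn * R)" using C by (simp add: abs_mult mult.commute)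
   then show ?thesis by (simp add: le_floor_iff floor_le_iff abs_le_iff)
  qed
  then show "cell g \<in> CS" unfolding CS_def cell_def by (auto simp: restrict_def)
  have "\<lfloor>(f i (Y (P g)) - f i (aa (cell g))) / s\<rfloor> \<in> {- int (Q * M) - 1..int (Q * M)}" if "i \<in> I" for i
  proof -
   have "\<bar>f i (Y (P g)) - f i (aa (cell g))\<bar> <= C * D (aa (cell g)) (Y (P g))"
    using A4[OF aa[OF g] YA[OF g] that] by (simp add: abs_minus_commute)
   also have "... <= C * (C * real m / real R)" using repD[OF g] C1 by (intro mult_left_mono) auto
   finally have le: "\<bar>f i (Y (P g)) - f i (aa (cell g))\<bar> <= C * (C * real m / real R)" .
   have "\<bar>(f i (Y (P g)) - f i (aa (cell g))) / s\<bar> <= C * (C * real m / real R) / s"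
    unfolding abs_divide abs_of_pos[OF s] by (rule divide_right_mono[OF le]) (use s in simp)
   also have "... = (4 * real m ^ 2 * C ^ 3 / rho) * real M"
    using R1 M1 m C1 rho by (simp add: s_def field_simps power2_eq_square power3_eq_cube)
   also have "... <= real Q * real M" using Q by (intro mult_right_mono) auto
   also have "... = real (Q * M)" by simp
   finally have le2: "\<bar>(f i (Y (P g)) - f i (aa (cell g))) / s\<bar> <= real (Q * M)" .
   define q where "q = (f i (Y (P g)) - f i (aa (cell g))) / s"
   have "- real (Q * M) <= q" "q <= real (Q * M)" using le2 unfolding q_def by linarith+
   then have "- int (Q * M) - 1 <= \<lfloor>q\<rfloor>" "\<lfloor>q\<rfloor> <= int (Q * M)" by linarith+
   then show ?thesis unfolding q_def by simp
  qed
  then show "fkey g \<in> FS (cell g)" unfolding FS_def fkey_def by (auto simp: restrict_def)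
 qed
 have finCS: "finite CS" unfolding CS_def using fin by (intro finite_PiE) auto
 have finFS: "finite (FS c)" for c unfolding FS_def using fin by (intro finite_PiE) auto
 have cardFS: "card (FS c) <= (2 * (Q * M) + 2) ^ (m - 1)" if "c \<in> cell ` G" for c
 proof -
  have ic: "i0 c \<in> I" using that cc(1) by auto
  have "card (FS c) = (\<Prod>i\<in>I. card (if i = i0 c then {0} else {- int (Q * M) - 1..int (Q * M)}))"
   unfolding FS_def using fin by (simp add: card_PiE)
  also have "... = card {0::int} * (\<Prod>i\<in>I - {i0 c}. card {- int (Q * M) - 1..int (Q * M)})"
   using ic fin by (subst prod.remove[of _ "i0 c"]) (auto intro!: prod.cong)
  also have "... = (nat (2 * int (Q * M) + 2)) ^ (m - 1)"
   using ic fin card by (simp add: algebra_simps)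
  also have "nat (2 * int (Q * M) + 2) = 2 * (Q * M) + 2" by linarith
  finally show ?thesis by simp
 qed
 have cardCS: "card CS = (2 * (Cn * R) + 2) ^ m"
 proof -
  have "card CS = (nat (2 * int (Cn * R) + 2)) ^ m"
   unfolding CS_def using fin card by (simp add: card_PiE algebra_simps)
  also have "nat (2 * int (Cn * R) + 2) = 2 * (Cn * R) + 2" by linarith
  finally show ?thesis .
 qed
 have finG: "finite G" unfolding G_def using fin by (intro finite_PiE) auto
 have "card G <= card (Sigma (cell ` G) FS)"
 proof (rule card_inj_on_le[where f="%g. (cell g, fkey g)"])
  show "inj_on (%g. (cell g, fkey g)) G" using inj by (auto simp: inj_on_def)
  show "(%g. (cell g, fkey g)) ` G \<subseteq> Sigma (cell ` G) FS" using mem by auto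
  show "finite (Sigma (cell ` G) FS)" using finG finFS by auto
 qed
 also have "... = (\<Sum>c\<in>cell ` G. card (FS c))" using finG finFS by (intro card_SigmaI) auto
 also have "... <= (\<Sum>c\<in>cell ` G. (2 * (Q * M) + 2) ^ (m - 1))" by (rule sum_mono) (use cardFS in auto)
 also have "... = card (cell ` G) * (2 * (Q * M) + 2) ^ (m - 1)" by simp
 also have "... <= card CS * (2 * (Q * M) + 2) ^ (m - 1)"
  using mem finCS by (intro mult_right_mono card_mono) auto
 also have "... = (2 * (Cn * R) + 2) ^ m * (2 * (Q * M) + 2) ^ (m - 1)" by (simp add: cardCS)
 also have "... <= ((2 * Cn + 2) * R) ^ m * ((2 * Q + 2) * M) ^ (m - 1)"
  using R1 M1 by (intro mult_mono power_mono) (auto simp: algebra_simps)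
 finally have "(M * R) ^ m <= ((2 * Cn + 2) * R) ^ m * ((2 * Q + 2) * M) ^ (m - 1)"
  unfolding G_def using fin card by (simp add: card_PiE)
 moreover have "M ^ m = M * M ^ (m - 1)" using m by (cases m) auto
 ultimately have "M * (M ^ (m - 1) * R ^ m) <= ((2 * Cn + 2) ^ m * (2 * Q + 2) ^ (m - 1)) * (M ^ (m - 1) * R ^ m)"
  unfolding power_mult_distrib by (simp only: mult_ac)
 moreover have "M ^ (m - 1) * R ^ m > 0" using M1 R1 by simp
 ultimately have "M <= (2 * Cn + 2) ^ m * (2 * Q + 2) ^ (m - 1)" by (simp only: mult_le_cancel2)
 then show False by (simp add: M_def)
qed

text \<open>McShane's formula, the infimum of cones over the given values, followed by truncation to
  [-M, M]. The sum metric in the hypothesis against the maximum metric in the conclusion costs the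
  factor \<open>real N\<close>.\<close>

lemma lipschitz_extension:
 fixes g :: "(nat => real) => real"
 assumes K: "K ~= {}" and L: "L >= 0" and M: "!!a. a \<in> K ==> \<bar>g a\<bar> <= M"
  and lip: "!!a b. a \<in> K ==> b \<in> K ==> \<bar>g a - g b\<bar> <= L * (\<Sum>i<N. \<bar>a i - b i\<bar>)"
 shows "EX G. (ALL a:K. G a = g a) & (ALL x. \<bar>G x\<bar> <= M) &
  (ALL x y dlt. (ALL j. \<bar>x j - y j\<bar> <= dlt) --> \<bar>G x - G y\<bar> <= L * real N * dlt)"
proof -
 define d where "d x y = (\<Sum>i<N. \<bar>x i - y i\<bar>)" for x y :: "nat => real"
 define h where "h x = (INF a\<in>K. g a + L * d x a)" for x
 define G where "G x = max (- M) (min M (h x))" for x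
 have d0: "d x y >= 0" for x y by (simp add: d_def sum_nonneg)
 have tri: "d x z <= d x y + d y z" for x y z
  unfolding d_def sum.distrib[symmetric] by (intro sum_mono) linarith
 have bdd: "bdd_below ((%a. g a + L * d x a) ` K)" for x
 proof (rule bdd_belowI2)
  fix a assume "a \<in> K"
  then show "- M <= g a + L * d x a" using M[of a] mult_nonneg_nonneg[OF L d0, of x a] by linarith
 qed
 have hle: "h x <= h y + L * d x y" for x y
 proof -
  have "h x - L * d x y <= h y" unfolding h_def[of y]
  proof (rule cINF_greatest[OF K])
   fix a assume "a \<in> K"
   then have "h x <= g a + L * d x a" unfolding h_def by (intro cINF_lower[OF bdd])
   moreover have "L * d x a <= L * d x y + L * d y a"
    using mult_left_mono[OF tri L, of x a y] by (simp add: algebra_simps)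
   ultimately show "h x - L * d x y <= g a + L * d y a" by linarith
  qed
  then show ?thesis by linarith
 qed
 have sym: "d x y = d y x" for x y by (simp add: d_def abs_minus_commute)
 have hlip: "\<bar>h x - h y\<bar> <= L * d x y" for x y using hle[of x y] hle[of y x] sym[of x y] by (simp add: abs_le_iff)
 have hK: "h a = g a" if a: "a \<in> K" for a
 proof (rule antisym)
  have "h a <= g a + L * d a a" unfolding h_def by (intro cINF_lower[OF bdd] a)
  then show "h a <= g a" by (simp add: d_def)
  show "g a <= h a" unfolding h_def
  proof (rule cINF_greatest[OF K])
   fix b assume "b \<in> K"
   then show "g a <= g b + L * d a b" using lip[OF a, of b] unfolding d_def by linarith
  qed
 qed
 have M0: "M >= 0" using K M by (meson abs_ge_zero ex_in_conv order_trans)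
 have "\<bar>G x - G y\<bar> <= L * real N * dlt" if "ALL j. \<bar>x j - y j\<bar> <= dlt" for x y dlt
 proof -
  have "\<bar>G x - G y\<bar> <= \<bar>h x - h y\<bar>" unfolding G_def by (auto simp: max_def min_def)
  also have "... <= L * d x y" by (rule hlip)
  also have "d x y <= (\<Sum>i<N. dlt)" unfolding d_def using that by (intro sum_mono) auto
  then have "L * d x y <= L * (real N * dlt)" using L by (intro mult_left_mono) auto
  finally show ?thesis by (simp add: mult.assoc)
 qed
 moreover have "\<bar>G x\<bar> <= M" for x using M0 by (auto simp: G_def max_def min_def abs_le_iff)
 moreover have "G a = g a" if "a \<in> K" for a using hK[OF that] M[OF that] by (auto simp: G_def max_def min_def abs_le_iff)
 ultimately show ?thesis by blast
qed

section \<open>Tangent fields and their integral curves\<close>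

context connected_framework begin

definition tangent_field :: "((nat => real) => nat => real) => bool" where
 "tangent_field v \<longleftrightarrow> (ALL k. representable E (%y. v y k)) & (ALL y. v y \<in> supp_below N) &
  (ALL y:supp_below N \<inter> edge_nonzero E. ALL e:E. eval NF (Du (v y) (ed e)) y = 0)"

definition integral_curve :: "((nat => real) => nat => real) => (nat => real) => (real => nat => real) => bool" where
 "integral_curve v p phi \<longleftrightarrow> (ALL t. phi t \<in> fibre p) & (ALL t k. ((%s. phi s k) has_real_derivative v (phi t) k) (at t))"

lemma integral_curve_shift: "integral_curve v p phi ==> integral_curve v p (%t. phi (c + t))"
proof -
 assume ic: "integral_curve v p phi"
 have "((%s. phi (c + s) k) has_real_derivative v (phi (c + t)) k) (at t)" for t k
 proof -
  have "((%s. phi s k) has_real_derivative v (phi (c + t)) k) (at (c + t))" using ic by (simp add: integral_curve_def)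
  then have "((%s. phi s k) has_real_derivative v (phi (c + t)) k) (at (t + c))" by (simp add: add.commute)
  then show ?thesis unfolding DERIV_shift by (simp add: add.commute)
 qed
 then show ?thesis using ic by (simp add: integral_curve_def)
qed

text \<open>The field is analytic only off edges of length zero. Extending its restriction to the
  tube to a bounded, globally Lipschitz field makes the global existence theorem applicable.\<close>

lemma field_extension:
 assumes v: "tangent_field v" and p: "p \<in> supp_below N" "p \<in> edge_nonzero E"
 shows "EX V L M. L > 0 & (ALL x y dlt i. (ALL j. \<bar>x j - y j\<bar> <= dlt) --> \<bar>V x i - V y i\<bar> <= L * dlt) &
  (ALL x i. \<bar>V x i\<bar> <= M) & (ALL y:tube p. V y = v y) & (ALL y k. k >= N --> V y k = 0)"
proof -
 have ne: "tube p ~= {}" using fibre_tube fibre_self[OF p(1)] by blast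
 define ok where "ok k G L M \<longleftrightarrow> (ALL a:tube p. G a = v a k) & (ALL x. \<bar>G x\<bar> <= M) &
  (ALL x y dlt. (ALL j. \<bar>x j - y j\<bar> <= dlt) --> \<bar>G x - G y\<bar> <= L * dlt)" for k and G :: "(nat => real) => real" and L M
 have "EX G L M. ok k G L M" for k
 proof -
  have "representable E (%y. v y k)" using v unfolding tangent_field_def by blast
  then obtain e where e: "edges_in E e" "!!y. eval NF e y = v y k" unfolding representable_def by blast
  obtain M where M: "!!y. y \<in> tube p ==> \<bar>v y k\<bar> <= M" using tube_bounded[OF p(2) e(1)] e(2) by auto
  obtain L where L: "!!a b. a \<in> tube p ==> b \<in> tube p ==> \<bar>v a k - v b k\<bar> <= L * (\<Sum>i<N. \<bar>a i - b i\<bar>)"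
   using tube_lipschitz[OF p(2) e(1)] unfolding e(2) by blast
  have "\<bar>v a k - v b k\<bar> <= \<bar>L\<bar> * (\<Sum>i<N. \<bar>a i - b i\<bar>)" if "a \<in> tube p" "b \<in> tube p" for a b
   using L[OF that] mult_right_mono[OF abs_ge_self[of L] sum_nonneg[of "{..<N}" "%i. \<bar>a i - b i\<bar>"]] by simp
  from lipschitz_extension[OF ne abs_ge_zero M this] show ?thesis unfolding ok_def by blast
 qed
 then obtain G L M where G: "!!k. ok k (G k) (L k) (M k)" by metis
 define V where "V x k = (if k < N then G k x else 0)" for x k
 have "\<bar>V x i - V y i\<bar> <= ((\<Sum>k<N. \<bar>L k\<bar>) + 1) * dlt" if xy: "ALL j. \<bar>x j - y j\<bar> <= dlt" for x y dlt i
 proof -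
  have dlt: "dlt >= 0" using xy[rule_format, of 0] by linarith
  have S0: "(\<Sum>k<N. \<bar>L k\<bar>) >= 0" by (simp add: sum_nonneg)
  show ?thesis
  proof (cases "i < N")
   case True
   then have "\<bar>L i\<bar> <= (\<Sum>k<N. \<bar>L k\<bar>)" by (intro member_le_sum) auto
   then have "L i * dlt <= ((\<Sum>k<N. \<bar>L k\<bar>) + 1) * dlt" using dlt by (intro mult_right_mono) auto
   moreover have "\<bar>G i x - G i y\<bar> <= L i * dlt" using G[of i] xy by (auto simp: ok_def)
   ultimately show ?thesis using True by (simp add: V_def)
  qed (use dlt S0 in \<open>simp add: V_def\<close>)
 qed
 moreover have "\<bar>V x i\<bar> <= (\<Sum>k<N. \<bar>M k\<bar>)" for x i
 proof (cases "i < N")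
  case True
  then have "\<bar>M i\<bar> <= (\<Sum>k<N. \<bar>M k\<bar>)" by (intro member_le_sum) auto
  moreover have "\<bar>G i x\<bar> <= M i" using G[of i] by (auto simp: ok_def)
  ultimately show ?thesis using True by (simp add: V_def)
 qed (simp add: V_def sum_nonneg)
 moreover have "V y = v y" if "y \<in> tube p" for y
 proof
  fix k show "V y k = v y k"
  proof (cases "k < N")
   case True then show ?thesis using G[of k] that by (simp add: V_def ok_def)
  next
   case False then show ?thesis using v by (simp add: V_def tangent_field_def supp_below_def)
  qed
 qed
 moreover have "(\<Sum>k<N. \<bar>L k\<bar>) + 1 > 0" by (intro add_nonneg_pos sum_nonneg) auto
 moreover have "ALL y k. k >= N --> V y k = 0" by (simp add: V_def)
 ultimately show ?thesis by (intro exI[of _ V] exI[of _ "(\<Sum>k<N. \<bar>L k\<bar>) + 1"] exI[of _ "\<Sum>k<N. \<bar>M k\<bar>"]) blast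
qed

lemma integral_curve_unique:
 assumes v: "tangent_field v" and p: "p \<in> supp_below N" "p \<in> edge_nonzero E"
  and phi: "integral_curve v p phi" and psi: "integral_curve v p psi" and eq: "phi t0 = psi t0"
 shows "phi t = psi t"
proof -
 obtain V L M where V: "L > 0" "!!x y dlt i. (ALL j. \<bar>x j - y j\<bar> <= dlt) ==> \<bar>V x i - V y i\<bar> <= L * dlt"
  "!!x i. \<bar>V x i\<bar> <= M" "!!y. y \<in> tube p ==> V y = v y" "!!y k. k >= N ==> V y k = 0"
  using field_extension[OF v p] by blast
 have fib: "phi t \<in> fibre p" "psi t \<in> fibre p" for t using phi psi by (simp_all add: integral_curve_def)
 have tube: "phi t \<in> tube p" "psi t \<in> tube p" for t using fib fibre_tube by blast+
 show ?thesis
 proof (rule ode_unique[OF V(1), where V = V and N = N])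
  show "((%s. phi s i) has_real_derivative V (phi t) i) (at t)" for t i
   using phi by (simp add: V(4)[OF tube(1)] integral_curve_def)
  show "((%s. psi s i) has_real_derivative V (psi t) i) (at t)" for t i
   using psi by (simp add: V(4)[OF tube(2)] integral_curve_def)
  show "phi t i = 0" "psi t i = 0" if "i >= N" for t i
   using fibre_supp[OF fib(1), of t] fibre_supp[OF fib(2), of t] that by (simp_all add: supp_below_def)
 qed (use V(2) eq in auto)
qed

text \<open>The equation is solved for the extended field. The times at which the solution lies in
  the fibre form a closed set; it is open as well, because around such a time the solution is in the
  tube, where the field annihilates the edge lengths.\<close>

lemma integral_curve_exists:
 assumes v: "tangent_field v" and p: "p \<in> supp_below N" "p \<in> edge_nonzero E"
 shows "EX phi. phi 0 = p & integral_curve v p phi"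
proof -
 obtain V L M where V: "L > 0" "!!x y dlt i. (ALL j. \<bar>x j - y j\<bar> <= dlt) ==> \<bar>V x i - V y i\<bar> <= L * dlt"
  "!!x i. \<bar>V x i\<bar> <= M" "!!y. y \<in> tube p ==> V y = v y" "!!y k. k >= N ==> V y k = 0"
  using field_extension[OF v p] by blast
 have "\<bar>p i\<bar> <= (\<Sum>i<N. \<bar>p i\<bar>)" for i
 proof (cases "i < N")
  case True then show ?thesis by (intro member_le_sum) auto
 next
  case False then show ?thesis using p(1) by (simp add: supp_below_def sum_nonneg)
 qed
 then obtain phi where phi: "phi 0 = p" "!!t i. ((%s. phi s i) has_real_derivative V (phi t) i) (at t)"
  using ode_exists[of L V M p "\<Sum>i<N. \<bar>p i\<bar>"] V(1,2,3) by blast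
 have supp: "phi t \<in> supp_below N" for t
 proof -
  have "phi t k = phi 0 k" if "k >= N" for k
   by (rule DERIV_isconst_all) (use phi(2)[of k] V(5)[OF that] in simp)
  then show ?thesis using phi(1) p(1) by (simp add: supp_below_def)
 qed
 have cont: "((%s. phi s i) \<longlongrightarrow> phi t i) (at t)" for t i
  using DERIV_isCont[OF phi(2)[of i t]] by (simp add: isCont_def)
 define T where "T = {t. phi t \<in> fibre p}"
 have "closed T" unfolding closed_sequential_limits
 proof (intro allI impI)
  fix s t assume s: "(ALL n. s n \<in> T) & s \<longlonglongrightarrow> t"
  have "phi t \<in> fibre p"
  proof (rule fibre_closed[where X = "%n. phi (s n)" and P = "%_. p"])
   show "(%n. phi (s n) i) \<longlonglongrightarrow> phi t i" for i
    using isCont_tendsto_compose[OF DERIV_isCont[OF phi(2)[of i t]]] s by blast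
  qed (use s in \<open>auto simp: T_def\<close>)
  then show "t \<in> T" by (simp add: T_def)
 qed
 moreover have "open T" unfolding open_dist
 proof
  fix t0 assume "t0 \<in> T"
  then have t0: "phi t0 \<in> fibre p" by (simp add: T_def)
  have "\<forall>\<^sub>F s in at t0. ALL e:E. eval NF (ed e) p / 2 < eval NF (ed e) (phi s) & eval NF (ed e) (phi s) < 2 * eval NF (ed e) p"
  proof (intro eventually_ball_finite finite_E ballI)
   fix e assume e: "e \<in> E"
   have "((%s. eval NF (ed e) (phi s)) \<longlongrightarrow> eval NF (ed e) (phi t0)) (at t0)"
    by (rule eval_ed_tendsto[where X = phi]) (rule cont)
   moreover have "eval NF (ed e) (phi t0) = eval NF (ed e) p" using t0 e by (simp add: fibre_def)
   moreover have "eval NF (ed e) p > 0" using p(2) e by (simp add: edge_nonzero_iff_ed)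
   ultimately show "\<forall>\<^sub>F s in at t0. eval NF (ed e) p / 2 < eval NF (ed e) (phi s) & eval NF (ed e) (phi s) < 2 * eval NF (ed e) p"
    by (intro eventually_conj order_tendstoD[where y = "eval NF (ed e) p"]) auto
  qed
  then obtain eps where eps: "eps > 0" "!!s e. s ~= t0 ==> dist s t0 < eps ==> e \<in> E ==>
    eval NF (ed e) p / 2 < eval NF (ed e) (phi s) & eval NF (ed e) (phi s) < 2 * eval NF (ed e) p"
   unfolding eventually_at by blast
  have tube: "phi s \<in> tube p" if s: "dist s t0 < eps" for s
  proof (cases "s = t0")
   case True then show ?thesis using t0 fibre_tube by blast
  next
   case False
   then show ?thesis using eps(2)[OF False s] supp unfolding tube_def by (simp add: less_imp_le)
  qed
  have "phi s \<in> fibre p" if s: "dist s t0 < eps" for s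
  proof -
   have "eval NF (ed e) (phi s) = eval NF (ed e) p" if e: "e \<in> E" for e
   proof -
    have "((%s. eval NF (ed e) (phi s)) has_field_derivative 0) (at x within ball t0 eps)" if x: "x \<in> ball t0 eps" for x
    proof -
     have tx: "phi x \<in> tube p" using tube x by (simp add: dist_commute)
     have nz: "phi x \<in> edge_nonzero E" by (rule tube_edge_nonzero[OF p(2) tx])
     have d: "((%s. phi s k) has_real_derivative v (phi x) k) (at x)" for k using phi(2)[of k x] V(4)[OF tx] by simp
     have "((%s. eval NF (ed e) (phi s)) has_real_derivative eval NF (Du (v (phi x)) (ed e)) (phi x)) (at x)"
      by (rule eval_has_derivative_curve[where x = phi and t = x and E = E, OF _ nz d]) (simp add: edges_in_ed e)
     moreover have "eval NF (Du (v (phi x)) (ed e)) (phi x) = 0" using v supp nz e by (simp add: tangent_field_def)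
     ultimately show ?thesis by (simp add: has_field_derivative_at_within)
    qed
    from has_field_derivative_zero_constant[OF convex_ball this]
    obtain c where c: "!!x. x \<in> ball t0 eps ==> eval NF (ed e) (phi x) = c" by blast
    have "eval NF (ed e) (phi s) = eval NF (ed e) (phi t0)" using c[of s] c[of t0] s eps(1) by (simp add: dist_commute)
    then show ?thesis using t0 e by (simp add: fibre_def)
   qed
   then show ?thesis using supp by (simp add: fibre_def)
  qed
  then show "EX e>0. ALL y. dist y t0 < e --> y \<in> T" using eps(1) by (auto simp: T_def)
 qed
 moreover have "0 \<in> T" using phi(1) fibre_self[OF p(1)] by (simp add: T_def)
 ultimately have "T = UNIV" using clopen[of T] by blast
 then have fib: "phi t \<in> fibre p" for t by (auto simp: T_def)
 moreover have "V (phi t) = v (phi t)" for t using V(4) fib fibre_tube by blast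
 ultimately have "integral_curve v p phi" using phi(2) unfolding integral_curve_def by metis
 then show ?thesis using phi(1) by blast
qed

lemma integral_curve_tendsto:
 assumes "integral_curve v p phi" shows "((%s. phi s i) \<longlongrightarrow> phi t i) (at t)"
 using assms DERIV_isCont unfolding integral_curve_def isCont_def by blast

end

text \<open>Strict monotonicity of a continuous injection, in the two forms used: the direction of
  the crossing at 0, and the values covered around \<open>f 0\<close>.\<close>

lemma injective_real_crossing:
 fixes f :: "real => real"
 assumes eps: "eps > 0" and cont: "continuous_on {-eps..eps} f" and inj: "inj_on f {-eps..eps}"
 shows "EX sig. \<bar>sig\<bar> = 1 & (ALL t. 0 < t & t <= eps --> sig * (f t - f 0) > 0) & (ALL t. - eps <= t & t < 0 --> sig * (f t - f 0) < 0)"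
  and "EX eta>0. ALL y. \<bar>y - f 0\<bar> < eta --> (EX t:{-eps..eps}. f t = y)"
proof -
 have mono: "(f (- eps) < f 0 & f 0 < f t) \<or> (f t < f 0 & f 0 < f (- eps))" if "0 < t" "t <= eps" for t
 proof -
  have sub: "{-eps..t} \<subseteq> {-eps..eps}" using that by auto
  show ?thesis using continuous_inj_imp_mono[of "-eps" 0 t f] that eps continuous_on_subset[OF cont sub] inj_on_subset[OF inj sub] by auto
 qed
 have mono': "(f t < f 0 & f 0 < f eps) \<or> (f eps < f 0 & f 0 < f t)" if "- eps <= t" "t < 0" for t
 proof -
  have sub: "{t..eps} \<subseteq> {-eps..eps}" using that by auto
  show ?thesis using continuous_inj_imp_mono[of t 0 eps f] that eps continuous_on_subset[OF cont sub] inj_on_subset[OF inj sub] by auto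
 qed
 define sig where "sig = sgn (f eps - f 0)"
 have ne: "f eps ~= f 0" using mono[of eps] eps by auto
 have "sig * (f t - f 0) > 0" if "0 < t" "t <= eps" for t
  using mono[OF that] mono[of eps] eps by (auto simp: sig_def sgn_if)
 moreover have "sig * (f t - f 0) < 0" if "- eps <= t" "t < 0" for t
  using mono'[OF that] by (auto simp: sig_def sgn_if)
 moreover have "\<bar>sig\<bar> = 1" using ne by (simp add: sig_def sgn_if)
 ultimately show "EX sig. \<bar>sig\<bar> = 1 & (ALL t. 0 < t & t <= eps --> sig * (f t - f 0) > 0) & (ALL t. - eps <= t & t < 0 --> sig * (f t - f 0) < 0)"
  by blast
 define eta where "eta = min \<bar>f eps - f 0\<bar> \<bar>f (- eps) - f 0\<bar>"
 have "eta > 0" using mono[of eps] eps by (auto simp: eta_def)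
 moreover have "EX t:{-eps..eps}. f t = y" if y: "\<bar>y - f 0\<bar> < eta" for y
 proof -
  consider "f (- eps) < f 0" "f 0 < f eps" | "f eps < f 0" "f 0 < f (- eps)" using mono[of eps] eps by auto
  then show ?thesis
  proof cases
   case 1
   then have "f (- eps) <= y" "y <= f eps" using y unfolding eta_def by linarith+
   then show ?thesis using IVT'[of f "-eps" y eps] cont eps by auto
  next
   case 2
   then have "f eps <= y" "y <= f (- eps)" using y unfolding eta_def by linarith+
   then show ?thesis using IVT2'[of f eps y "-eps"] cont eps by auto
  qed
 qed
 ultimately show "EX eta>0. ALL y. \<bar>y - f 0\<bar> < eta --> (EX t:{-eps..eps}. f t = y)" by blast
qed

section \<open>The derivative of the norm\<close>

context analytic_plane begin

definition norm_deriv :: "'a => 'a => real" where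
 "norm_deriv x d = co1 d * partial NF 1 0 (co1 x) (co2 x) + co2 d * partial NF 0 1 (co1 x) (co2 x)"

lemma norm_deriv_linear: "norm_deriv x (r *\<^sub>R d + s *\<^sub>R d') = r * norm_deriv x d + s * norm_deriv x d'"
 by (simp add: norm_deriv_def co_simps algebra_simps)

lemma eval_Du_ed: "eval NF (Du u (ed (a, b))) y = norm_deriv (pos a y - pos b y) (pos a u - pos b u)"
 by (simp add: ed_def norm_deriv_def co_simps pos_def)

text \<open>The norm of \<open>x\<close> is the length of a single edge from vertex 0 at
  \<open>x\<close> to vertex 1 at the origin, so the derivative rule for expressions
  applies.\<close>

lemma norm_has_derivative:
 fixes x d :: 'a
 assumes "x ~= 0"
 shows "((%tau. norm (x + tau *\<^sub>R d)) has_real_derivative norm_deriv x d) (at 0)"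
proof -
 define c where "c z i = (if i = 0 then co1 z else if i = 1 then co2 z else 0)" for z :: 'a and i :: nat
 have p: "pos 0 (c z) = z" "pos 1 (c z) = 0" for z by (simp_all add: pos_def c_def)
 have line: "(%i. c x i + tau * c d i) = c (x + tau *\<^sub>R d)" for tau by (auto simp: c_def co_simps)
 have line0: "(%i. c x i + 0 * c d i) = c x" by simp
 have nz: "(%i. c x i + 0 * c d i) \<in> edge_nonzero {(0, 1)}" unfolding line0 edge_nonzero_iff using assms p by simp
 have "((%s. eval NF (ed (0, 1)) (%i. c x i + s * c d i)) has_real_derivative eval NF (Du (c d) (ed (0, 1))) (%i. c x i + 0 * c d i)) (at 0)"
  by (rule eval_line_DERIV[OF _ nz]) (simp add: edges_in_ed)
 then show ?thesis unfolding line0 eval_Du_ed unfolding line eval_ed using p by simp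
qed

lemma norm_deriv_iso:
 assumes "lin_iso g" "x ~= 0"
 shows "norm_deriv (g x) (g d) = norm_deriv x d"
proof -
 have "g x ~= 0" using lin_isoD(2)[OF assms(1), of x] assms(2) by auto
 from norm_has_derivative[OF this, of "g d"]
 have "((%tau. norm (g (x + tau *\<^sub>R d))) has_real_derivative norm_deriv (g x) (g d)) (at 0)"
  by (simp add: linear_add[OF lin_isoD(1)[OF assms(1)]] linear_scale[OF lin_isoD(1)[OF assms(1)]])
 then show ?thesis using norm_has_derivative[OF assms(2), of d] lin_isoD(2)[OF assms(1)] DERIV_unique by auto
qed

text \<open>By homogeneity of the norm the kernel of its derivative depends only on the line through
  \<open>x\<close>; negative factors are included.\<close>

lemma norm_deriv_scale_zero:
 assumes "x ~= 0" "r ~= 0" "norm_deriv x d = 0"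
 shows "norm_deriv (r *\<^sub>R x) d = 0"
proof -
 have "((%tau. norm (x + tau *\<^sub>R ((1 / r) *\<^sub>R d))) has_real_derivative norm_deriv x ((1 / r) *\<^sub>R d)) (at 0)"
  by (rule norm_has_derivative[OF assms(1)])
 moreover have "norm_deriv x ((1 / r) *\<^sub>R d) = 0" using norm_deriv_linear[of x "1/r" d 0 d] assms(3) by simp
 ultimately have "((%tau. \<bar>r\<bar> * norm (x + tau *\<^sub>R ((1 / r) *\<^sub>R d))) has_real_derivative \<bar>r\<bar> * 0) (at 0)"
  by (intro DERIV_cmult) simp
 moreover have "\<bar>r\<bar> * norm (x + tau *\<^sub>R ((1 / r) *\<^sub>R d)) = norm (r *\<^sub>R x + tau *\<^sub>R d)" for tau
 proof -
  have "r *\<^sub>R (x + tau *\<^sub>R ((1 / r) *\<^sub>R d)) = r *\<^sub>R x + tau *\<^sub>R d" using assms(2) by (simp add: scaleR_add_right)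
  then show ?thesis by (metis norm_scaleR)
 qed
 ultimately have "((%tau. norm (r *\<^sub>R x + tau *\<^sub>R d)) has_real_derivative 0) (at 0)" by simp
 moreover have "r *\<^sub>R x ~= 0" using assms by simp
 ultimately show ?thesis using norm_has_derivative[of "r *\<^sub>R x" d] DERIV_unique by blast
qed

lemma norm_deriv_kernel: "EX d. d ~= 0 & norm_deriv x d = 0"
proof (cases "partial NF 1 0 (co1 x) (co2 x) = 0 & partial NF 0 1 (co1 x) (co2 x) = 0")
 case True
 have "pt 1 0 ~= 0" using pt_eq_0[of 1 0] by auto
 then show ?thesis using True by (intro exI[of _ "pt 1 0"]) (simp add: norm_deriv_def)
next
 case False
 define d where "d = pt (- partial NF 0 1 (co1 x) (co2 x)) (partial NF 1 0 (co1 x) (co2 x))"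
 have "d ~= 0" using False pt_eq_0 unfolding d_def by fastforce
 then show ?thesis by (intro exI[of _ d]) (simp add: norm_deriv_def d_def)
qed

lemma act_linear:
 assumes "lin_iso g"
 shows "EX A B. ALL y. act g y k = A * y (2 * (k div 2)) + B * y (2 * (k div 2) + 1)"
proof -
 have "g (pos a y) = y (2 * a) *\<^sub>R g b1 + y (2 * a + 1) *\<^sub>R g b2" for a y
  unfolding pos_def by (rule lin_iso_pt[OF assms])
 then show ?thesis
  by (intro exI[of _ "if even k then co1 (g b1) else co2 (g b1)"] exI[of _ "if even k then co1 (g b2) else co2 (g b2)"])
   (simp add: act_def co_simps mult.commute)
qed

lemma lin_iso_fix_independent:
 assumes g: "lin_iso g" and "g x = x" "g y = y" "cr x y ~= 0"
 shows "g z = z"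
proof -
 have z: "z = (cr z y / cr x y) *\<^sub>R x + (cr x z / cr x y) *\<^sub>R y"
  using cramer[of x y z] assms(4) by (metis (no_types, lifting) divide_inverse_commute scaleR_add_right scaleR_one scaleR_scaleR left_inverse)
 have "g z = (cr z y / cr x y) *\<^sub>R g x + (cr x z / cr x y) *\<^sub>R g y"
  by (subst z) (simp add: linear_add[OF lin_isoD(1)[OF g]] linear_scale[OF lin_isoD(1)[OF g]])
 then show ?thesis using z assms by simp
qed

end

context connected_framework begin

lemma integral_curve_fibre: "integral_curve v p phi ==> phi t \<in> fibre p"
 by (simp add: integral_curve_def)

lemma integral_curve_near:
 assumes "integral_curve v p phi" "r > 0"
 shows "EX eps>0. ALL t. \<bar>t - t0\<bar> <= eps --> phi t \<in> nbox N (phi t0) r"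
proof -
 have "\<forall>\<^sub>F s in at t0. ALL i:{..<N}. \<bar>phi s i - phi t0 i\<bar> < r"
  using integral_curve_tendsto[OF assms(1)] assms(2)
  by (intro eventually_ball_finite) (auto simp: tendsto_iff dist_real_def)
 then obtain eps where eps: "eps > 0" "!!s i. s ~= t0 ==> dist s t0 < eps ==> i < N ==> \<bar>phi s i - phi t0 i\<bar> < r"
  unfolding eventually_at by blast
 have "phi t \<in> nbox N (phi t0) r" if t: "\<bar>t - t0\<bar> <= eps / 2" for t
 proof -
  have "\<bar>phi t i - phi t0 i\<bar> < r" if "i < N" for i
   using eps(2)[of t i] t eps(1) assms(2) that by (cases "t = t0") (auto simp: dist_real_def)
  then show ?thesis using fibre_supp[OF integral_curve_fibre[OF assms(1)]] by (simp add: nbox_def)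
 qed
 then show ?thesis using eps(1) by (intro exI[of _ "eps / 2"]) auto
qed

lemma integral_curve_coordinate_inj:
 assumes v: "tangent_field v" and phi: "integral_curve v p phi" and p: "p \<in> edge_nonzero E" and nz: "v (phi 0) k ~= 0"
 shows "EX eps>0. inj_on (%t. phi t k) {-eps..eps}"
proof -
 have "representable E (%y. v y k)" using v unfolding tangent_field_def by blast
 then obtain e where e: "edges_in E e" "!!y. eval NF e y = v y k" unfolding representable_def by blast
 have fib: "phi t \<in> fibre p" for t by (rule integral_curve_fibre[OF phi])
 obtain r where r: "r > 0" "!!w. w \<in> nbox N (phi 0) r ==> v w k ~= 0"
  using eval_nonzero_open[OF e(1) fibre_edge_nonzero[OF p fib] fibre_supp[OF fib], of 0] e(2) nz by auto
 obtain eps where eps: "eps > 0" "!!t. \<bar>t - 0\<bar> <= eps ==> phi t \<in> nbox N (phi 0) r"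
  using integral_curve_near[OF phi r(1)] by blast
 have "phi a k ~= phi b k" if ab: "a < b" "-eps <= a" "b <= eps" for a b
 proof
  assume eq: "phi a k = phi b k"
  have "EX z>a. z < b & phi b k - phi a k = (b - a) * v (phi z) k"
   by (rule MVT2[OF ab(1)]) (use phi in \<open>auto simp: integral_curve_def\<close>)
  then obtain z where z: "a < z" "z < b" "v (phi z) k = 0" using eq ab(1) by auto
  have "\<bar>z - 0\<bar> <= eps" using z ab by auto
  then show False using r(2)[OF eps(2)] z(3) by blast
 qed
 then have "inj_on (%t. phi t k) {-eps..eps}" unfolding inj_on_def
  by (metis atLeastAtMost_iff linorder_neqE_linordered_idom)
 then show ?thesis using eps(1) by blast
qed

lemma integral_curve_continuous_on:
 assumes "integral_curve v p phi" shows "continuous_on S (%t. phi t k)" "continuous_on S (%t. pos a (phi t))"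
proof -
 have c: "continuous_on S (%t. phi t k)" for k
  using integral_curve_tendsto[OF assms] by (intro continuous_at_imp_continuous_on) (auto simp: isCont_def)
 show "continuous_on S (%t. phi t k)" "continuous_on S (%t. pos a (phi t))"
  unfolding pos_def pt_def by (intro c continuous_intros)+
qed

end

section \<open>Rigidity of fibres\<close>

text \<open>\<open>rigid\<close> is global rigidity of the full graph after pinning, on an open set
  \<open>U\<close>: the fibre fixes all edges except \<open>v1 v2\<close>, whose length is required
  separately. \<open>U_spanning\<close> makes the stabiliser of a placement in the group of linear
  isometries trivial.\<close>

locale rigid_framework = connected_framework b1 b2 N E for b1 b2 :: "'a::real_normed_vector" and N E +
 fixes v1 v2 :: nat and U :: "(nat => real) set"
 assumes N4: "N >= 4"
  and U_open: "y \<in> U ==> EX r>0. nbox N y r \<subseteq> U"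
  and U_supp: "y \<in> U ==> y \<in> supp_below N"
  and U_nonzero: "y \<in> U ==> y \<in> edge_nonzero E"
  and U_spanning: "y \<in> U ==> cr (pos 0 y) (pos 1 y) ~= 0"
  and rigid: "y \<in> U ==> y' \<in> fibre y ==> norm (pos v1 y' - pos v2 y') = norm (pos v1 y - pos v2 y) ==>
   EX g. lin_iso g & y' = act g y"
begin

definition h :: "(nat => real) => real" where "h y = norm (pos v1 y - pos v2 y)"

lemma h_act: "lin_iso g ==> h (act g y) = h y"
 by (simp add: h_def lin_iso_diff lin_isoD(2))

text \<open>By finiteness the isometries that move vertex 0 or 1 of \<open>p\<close> displace the
  two by a least amount \<open>m\<close> in total. The others fix two independent vectors and are
  trivial.\<close>

lemma near_act_trivial:
 assumes p: "p \<in> U"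
 shows "EX r>0. ALL y:nbox N p r. ALL g. lin_iso g --> act g y \<in> nbox N p r --> act g y = y"
proof -
 have ps: "p \<in> supp_below N" by (rule U_supp[OF p])
 define G where "G = {g. lin_iso g & (g (pos 0 p) ~= pos 0 p \<or> g (pos 1 p) ~= pos 1 p)}"
 have finG: "finite G" by (rule finite_subset[OF _ finite_lin_iso]) (auto simp: G_def)
 define D where "D g = norm (g (pos 0 p) - pos 0 p) + norm (g (pos 1 p) - pos 1 p)" for g
 define B where "B = norm b1 + norm b2"
 have "EX m>0. ALL g:G. m <= D g"
 proof (cases "G = {}")
  case False
  have "D g > 0" if "g \<in> G" for g using that by (auto simp: G_def D_def add_pos_nonneg add_nonneg_pos)
  then show ?thesis using False finG by (intro exI[of _ "Min (D ` G)"]) auto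
 qed (auto intro: exI[of _ 1])
 then obtain m where m: "m > 0" "!!g. g \<in> G ==> m <= D g" by blast
 have B: "B >= 0" by (simp add: B_def)
 \<comment> \<open>An isometry taking one point of the box to another displaces each vertex of
   \<open>p\<close> by at most \<open>2 * (r * B)\<close>, hence two of them by less than
   \<open>m\<close>.\<close>
 define r where "r = m / (4 * B + 1)"
 have r: "r > 0" using m B by (simp add: r_def add_nonneg_pos)
 have rm: "4 * (r * B) < m"
 proof -
  have "r * (4 * B + 1) = m" using B by (simp add: r_def add_nonneg_eq_0_iff)
  then show ?thesis using r by (simp add: algebra_simps)
 qed
 have "act g y = y" if y: "y \<in> nbox N p r" and g: "lin_iso g" and gy: "act g y \<in> nbox N p r" for y g
 proof -
  have mv: "norm (g (pos a p) - pos a p) <= 2 * (r * B)" for a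
  proof -
   have "norm (pos a p - pos a y) <= r * B" unfolding B_def
    by (rule pos_diff_le) (use nboxD[OF y ps r] in \<open>simp add: less_imp_le abs_minus_commute\<close>)
   then have "norm (g (pos a p) - g (pos a y)) <= r * B" by (simp add: lin_iso_diff[OF g] lin_isoD(2)[OF g])
   moreover have "norm (pos a (act g y) - pos a p) <= r * B" unfolding B_def
    by (rule pos_diff_le) (use nboxD[OF gy ps r] in \<open>simp add: less_imp_le\<close>)
   ultimately show ?thesis using norm_triangle_ineq[of "g (pos a p) - g (pos a y)" "g (pos a y) - pos a p"] by simp
  qed
  have "g \<notin> G"
  proof
   assume "g \<in> G"
   from m(2)[OF this] show False using mv[of 0] mv[of 1] rm unfolding D_def by linarith
  qed
  then have "g (pos 0 p) = pos 0 p" "g (pos 1 p) = pos 1 p" using g by (auto simp: G_def)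
  then have "g z = z" for z by (rule lin_iso_fix_independent[OF g _ _ U_spanning[OF p]])
  then show ?thesis by (intro pos_eqI) simp
 qed
 then show ?thesis using r by blast
qed

text \<open>Points of the fibre with equal \<open>h\<close> differ by a linear isometry, and if both
  are near \<open>p\<close> it acts trivially. So \<open>h\<close> is injective on the fibre near
  \<open>p\<close>.\<close>

lemma level_set_near:
 assumes p: "p \<in> U"
 shows "EX r>0. ALL y:nbox N p r \<inter> fibre p. ALL y':nbox N p r \<inter> fibre p. h y = h y' --> y = y'"
proof -
 obtain r1 where r1: "r1 > 0" "!!y g. y \<in> nbox N p r1 ==> lin_iso g ==> act g y \<in> nbox N p r1 ==> act g y = y"
  using near_act_trivial[OF p] by blast
 obtain r2 where r2: "r2 > 0" "nbox N p r2 \<subseteq> U" using U_open[OF p] by blast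
 define r where "r = min r1 r2"
 have sub: "nbox N p r \<subseteq> nbox N p r1" "nbox N p r \<subseteq> U"
  using nbox_mono[of r r1 N p] nbox_mono[of r r2 N p] r2(2) by (auto simp: r_def)
 have "y = y'" if y: "y \<in> nbox N p r" "y \<in> fibre p" and y': "y' \<in> nbox N p r" "y' \<in> fibre p" and eq: "h y = h y'" for y y'
 proof -
  have "y \<in> U" using sub(2) y(1) by blast
  moreover have "y' \<in> fibre y" using y' fibre_eq[OF y(2)] by simp
  ultimately obtain g where g: "lin_iso g" "y' = act g y" using rigid[of y y'] eq by (auto simp: h_def)
  have "act g y = y" by (rule r1(2)) (use sub(1) y(1) y'(1) g in auto)
  then show ?thesis using g by simp
 qed
 moreover have "r > 0" using r1 r2 by (simp add: r_def)
 ultimately show ?thesis by blast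
qed

lemma h_continuous:
 assumes "integral_curve v p phi" shows "continuous_on S (%t. h (phi t))"
 unfolding h_def by (intro continuous_intros integral_curve_continuous_on[OF assms])

lemma level_curve:
 assumes v: "tangent_field v" and p: "p \<in> U" and phi: "integral_curve v p phi" "phi 0 = p" and nz: "v p k ~= 0" and r: "r > 0"
 shows "EX eps>0. inj_on (%t. h (phi t)) {-eps..eps} & inj_on (%t. phi t k) {-eps..eps} & (ALL t:{-eps..eps}. phi t \<in> nbox N p r)"
proof -
 obtain r1 where r1: "r1 > 0" "!!y y'. y \<in> nbox N p r1 \<inter> fibre p ==> y' \<in> nbox N p r1 \<inter> fibre p ==> h y = h y' ==> y = y'"
  using level_set_near[OF p] by blast
 define s where "s = min r r1"
 have s: "s > 0" using r r1 by (simp add: s_def)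
 obtain eps1 where eps1: "eps1 > 0" "!!t. \<bar>t - 0\<bar> <= eps1 ==> phi t \<in> nbox N (phi 0) s"
  using integral_curve_near[OF phi(1) s] by blast
 obtain eps2 where eps2: "eps2 > 0" "inj_on (%t. phi t k) {-eps2..eps2}"
  using integral_curve_coordinate_inj[OF v phi(1) U_nonzero[OF p], of k] nz phi(2) by auto
 define eps where "eps = min eps1 eps2"
 have near: "phi t \<in> nbox N p s" if "t \<in> {-eps..eps}" for t
  using eps1(2)[of t] that phi(2) by (auto simp: eps_def abs_le_iff)
 have inj: "inj_on (%t. phi t k) {-eps..eps}" by (rule inj_on_subset[OF eps2(2)]) (auto simp: eps_def)
 have "inj_on (%t. h (phi t)) {-eps..eps}"
 proof (rule inj_onI)
  fix a b assume ab: "a \<in> {-eps..eps}" "b \<in> {-eps..eps}" "h (phi a) = h (phi b)"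
  have sub: "nbox N p s \<subseteq> nbox N p r1" by (rule nbox_mono) (simp add: s_def)
  have "phi a = phi b" by (rule r1(2)) (use near[OF ab(1)] near[OF ab(2)] sub ab(3) integral_curve_fibre[OF phi(1)] in auto)
  then show "a = b" using inj_onD[OF inj, of a b] ab by simp
 qed
 moreover have "nbox N p s \<subseteq> nbox N p r" by (rule nbox_mono) (simp add: s_def)
 moreover have "eps > 0" using eps1(1) eps2(1) by (simp add: eps_def)
 ultimately show ?thesis using near inj by blast
qed

text \<open>Along both curves the missing length is a local parameter, so the two curves would coincide.\<close>

lemma no_two_dimensional_fibre:
 assumes v: "tangent_field v" and w: "tangent_field w" and p: "p \<in> U"
  and nz: "v p k ~= 0" "w p l ~= 0" and const: "!!y. v y l = 0"
 shows False
proof -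
 have ps: "p \<in> supp_below N" "p \<in> edge_nonzero E" by (rule U_supp[OF p], rule U_nonzero[OF p])
 obtain r where r: "r > 0" "!!y y'. y \<in> nbox N p r \<inter> fibre p ==> y' \<in> nbox N p r \<inter> fibre p ==> h y = h y' ==> y = y'"
  using level_set_near[OF p] by blast
 obtain phi where phi: "phi 0 = p" "integral_curve v p phi" using integral_curve_exists[OF v ps] by blast
 obtain psi where psi: "psi 0 = p" "integral_curve w p psi" using integral_curve_exists[OF w ps] by blast
 obtain eps where eps: "eps > 0" "inj_on (%t. h (phi t)) {-eps..eps}" "!!t. t \<in> {-eps..eps} ==> phi t \<in> nbox N p r"
  using level_curve[OF v p phi(2,1) nz(1) r(1)] by blast
 obtain eps' where eps': "eps' > 0" "inj_on (%t. psi t l) {-eps'..eps'}" "!!t. t \<in> {-eps'..eps'} ==> psi t \<in> nbox N p r"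
  using level_curve[OF w p psi(2,1) nz(2) r(1)] by blast
 obtain eta where eta: "eta > 0" "!!y. \<bar>y - h p\<bar> < eta ==> EX t:{-eps..eps}. h (phi t) = y"
  using injective_real_crossing(2)[OF eps(1) h_continuous[OF phi(2)] eps(2)] phi(1) by auto
 have "isCont (%t. h (psi t)) 0"
  using h_continuous[OF psi(2), of UNIV] continuous_on_eq_continuous_at[OF open_UNIV] by blast
 then obtain d where d: "d > 0" "!!t. \<bar>t\<bar> < d ==> \<bar>h (psi t) - h p\<bar> < eta"
  using eta(1) psi(1) unfolding continuous_at_eps_delta by (fastforce simp: dist_real_def)
 define s where "s = min eps' (d / 2)"
 have s: "s > 0" "s \<in> {-eps'..eps'}" "\<bar>s\<bar> < d" using eps' d by (auto simp: s_def)
 \<comment> \<open>Along \<open>phi\<close> the values of \<open>h\<close> cover a neighbourhood of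
   \<open>h p\<close>, so some point of \<open>phi\<close> has the same \<open>h\<close> as
   \<open>psi s\<close> and equals it. But coordinate \<open>l\<close> is constant on
   \<open>phi\<close> and injective on \<open>psi\<close>.\<close>
 obtain t where t: "t \<in> {-eps..eps}" "h (phi t) = h (psi s)" using eta(2)[OF d(2)[OF s(3)]] by blast
 have "phi t = psi s"
  by (rule r(2)) (use eps(3)[OF t(1)] eps'(3)[OF s(2)] t(2) integral_curve_fibre[OF phi(2)] integral_curve_fibre[OF psi(2)] in auto)
 moreover have "((%s. phi s l) has_real_derivative 0) (at t)" for t
  using phi(2) const[of "phi t"] unfolding integral_curve_def by metis
 then have "phi t l = phi 0 l" using DERIV_isconst_all[of "%s. phi s l"] by blast
 ultimately have "psi s l = psi 0 l" using phi(1) psi(1) by simp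
 then show False using inj_onD[OF eps'(2), of s 0] s eps'(1) by auto
qed

text \<open>A fibre without equilibria is compact, so some trajectory segment returns close to itself; as the
 fibre is locally a curve, the trajectory is periodic.\<close>

lemma integral_curve_periodic:
 assumes v: "tangent_field v" and p: "p \<in> supp_below N" "p \<in> edge_nonzero E" and phi: "integral_curve v p phi"
  and nz: "!!m. m \<in> fibre p ==> EX k<N. v m k ~= 0"
  and loc: "!!m k. m \<in> fibre p ==> v m k ~= 0 ==> k < N ==>
   EX r>0. ALL y:nbox N m r \<inter> fibre p. ALL y':nbox N m r \<inter> fibre p. y k = y' k --> y = y'"
 shows "EX P>0. ALL t. phi (P + t) = phi t"
proof -
 have "phi (real n) \<in> tube p" for n using integral_curve_fibre[OF phi] fibre_tube by blast
 from tube_subsequence[of "%n. phi (real n)", OF this]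
 obtain m s where ms: "strict_mono (s :: nat => nat)" "!!i. (%n. phi (real (s n)) i) \<longlonglongrightarrow> m i" by blast
 have m: "m \<in> fibre p"
  by (rule fibre_closed[where X = "%n. phi (real (s n))" and P = "%_. p"]) (use ms(2) integral_curve_fibre[OF phi] in auto)
 have msupp: "m \<in> supp_below N" by (rule fibre_supp[OF m])
 obtain k where k: "k < N" "v m k ~= 0" using nz[OF m] by blast
 obtain r where r: "r > 0" "!!y y'. y \<in> nbox N m r \<inter> fibre p ==> y' \<in> nbox N m r \<inter> fibre p ==> y k = y' k ==> y = y'"
  using loc[OF m k(2,1)] by blast
 obtain mu where mu: "mu 0 = m" "integral_curve v m mu"
  using integral_curve_exists[OF v msupp fibre_edge_nonzero[OF p(2) m]] by blast
 have mup: "integral_curve v p mu" using mu(2) fibre_eq[OF m] by (simp add: integral_curve_def)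
 obtain eps1 where eps1: "eps1 > 0" "!!t. \<bar>t - 0\<bar> <= eps1 ==> mu t \<in> nbox N (mu 0) r"
  using integral_curve_near[OF mup r(1)] by blast
 obtain eps2 where eps2: "eps2 > 0" "inj_on (%t. mu t k) {-eps2..eps2}"
  using integral_curve_coordinate_inj[OF v mup p(2), of k] k(2) mu(1) by auto
 \<comment> \<open>The bound 1/4 keeps the correction \<open>a - b\<close> below the gap of at least
   1 between the two times, so that the period is positive.\<close>
 define eps where "eps = min (min eps1 eps2) (1/4)"
 have eps: "eps > 0" "eps <= 1/4" using eps1(1) eps2(1) by (simp_all add: eps_def)
 have inj: "inj_on (%t. mu t k) {-eps..eps}" by (rule inj_on_subset[OF eps2(2)]) (auto simp: eps_def)
 obtain eta where eta: "eta > 0" "!!y. \<bar>y - m k\<bar> < eta ==> EX t:{-eps..eps}. mu t k = y"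
  using injective_real_crossing(2)[OF eps(1) integral_curve_continuous_on(1)[OF mup] inj] mu(1) by auto
 have "\<forall>\<^sub>F n in sequentially. ALL i. \<bar>phi (real (s n)) i - m i\<bar> < min r eta"
  by (rule config_tendsto_uniform[of "%n. phi (real (s n))" m N])
   (use ms(2) msupp fibre_supp[OF integral_curve_fibre[OF phi]] r(1) eta(1) in auto)
 then obtain n0 where n0: "!!n i. n >= n0 ==> \<bar>phi (real (s n)) i - m i\<bar> < min r eta" by (auto simp: eventually_sequentially)
 \<comment> \<open>Near \<open>m\<close> coordinate \<open>k\<close> determines a point of the
   fibre, and \<open>mu\<close> takes all nearby values of it; so the approximating points lie on
   \<open>mu\<close> at small times.\<close>
 have hit: "EX a:{-eps..eps}. phi (real (s n)) = mu a" if n: "n >= n0" for n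
 proof -
  obtain a where a: "a \<in> {-eps..eps}" "mu a k = phi (real (s n)) k" using eta(2)[of "phi (real (s n)) k"] n0[OF n, of k] by auto
  have "phi (real (s n)) \<in> nbox N m r" using n0[OF n] fibre_supp[OF integral_curve_fibre[OF phi]] by (auto simp: nbox_def)
  moreover have "mu a \<in> nbox N m r" using eps1(2)[of a] a(1) mu(1) by (auto simp: eps_def abs_le_iff)
  ultimately have "phi (real (s n)) = mu a"
   by (intro r(2)) (use a(2) integral_curve_fibre[OF phi] integral_curve_fibre[OF mup] in auto)
  then show ?thesis using a(1) by blast
 qed
 obtain a where a: "a \<in> {-eps..eps}" "phi (real (s n0)) = mu a" using hit[of n0] by blast
 obtain b where b: "b \<in> {-eps..eps}" "phi (real (s (Suc n0))) = mu b" using hit[of "Suc n0"] by auto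
 define c d where "c = real (s n0)" "d = real (s (Suc n0))"
 have cd: "d >= c + 1" using strict_monoD[OF ms(1), of n0 "Suc n0"] by (simp add: c_d_def)
 have ct: "phi (c + t) = mu (a + t)" for t
  by (rule integral_curve_unique[OF v p integral_curve_shift[OF phi] integral_curve_shift[OF mup], where ?t0.0 = 0])
   (use a(2) in \<open>simp add: c_d_def\<close>)
 have dt: "phi (d + t) = mu (b + t)" for t
  by (rule integral_curve_unique[OF v p integral_curve_shift[OF phi] integral_curve_shift[OF mup], where ?t0.0 = 0])
   (use b(2) in \<open>simp add: c_d_def\<close>)
 define P where "P = d - c - b + a"
 have "P > 0" using cd a(1) b(1) eps(2) by (auto simp: P_def)
 moreover have "phi (P + t) = phi t" for t
  using dt[of "t - c - b + a"] ct[of "t - c"] by (simp add: P_def algebra_simps)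
 ultimately show ?thesis by blast
qed

text \<open>At the first return of the missing length, the trajectory has reached an isometric copy of its
 starting point. An orientation preserving isometry would repeat the crossing direction, while an
 orientation reversing one fixes the configuration halfway, which then lies on a line.\<close>

lemma no_circular_fibre:
 assumes v: "tangent_field v" and p: "p \<in> U"
  and nz: "!!m. m \<in> fibre p ==> EX k<N. v m k ~= 0"
  and loc: "!!m k. m \<in> fibre p ==> v m k ~= 0 ==> k < N ==>
   EX r>0. ALL y:nbox N m r \<inter> fibre p. ALL y':nbox N m r \<inter> fibre p. y k = y' k --> y = y'"
  and equi: "!!g. lin_iso g ==> EX c. c ~= 0 & (c < 0 --> g ~= id) & (ALL y:fibre p. ALL k. act g (v y) k = c * v (act g y) k)"
  and ker: "!!m k u. m \<in> fibre p ==> v m k ~= 0 ==> u \<in> supp_below N ==> (!!e. e \<in> E ==> eval NF (Du u (ed e)) m = 0) ==>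
   u = (%i. u k / v m k * v m i)"
 shows False
proof -
 have ps: "p \<in> supp_below N" "p \<in> edge_nonzero E" by (rule U_supp[OF p], rule U_nonzero[OF p])
 obtain phi where phi: "phi 0 = p" "integral_curve v p phi" using integral_curve_exists[OF v ps] by blast
 have fib: "phi t \<in> fibre p" for t by (rule integral_curve_fibre[OF phi(2)])
 obtain P where P: "P > 0" "!!t. phi (P + t) = phi t" using integral_curve_periodic[OF v ps phi(2) nz loc] by blast
 obtain k where k: "v p k ~= 0" using nz[OF fibre_self[OF ps(1)]] by blast
 obtain eps where eps: "eps > 0" "inj_on (%t. h (phi t)) {-eps..eps}"
  using level_curve[OF v p phi(2,1) k, of 1] by auto
 obtain sig where sig: "\<bar>sig\<bar> = 1" "!!t. 0 < t ==> t <= eps ==> sig * (h (phi t) - h (phi 0)) > 0"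
  "!!t. - eps <= t ==> t < 0 ==> sig * (h (phi t) - h (phi 0)) < 0"
  using injective_real_crossing(1)[OF eps(1) h_continuous[OF phi(2)] eps(2)] by blast
 \<comment> \<open>Normalised to pass from negative to positive at time 0. Up to its first later
   zero \<open>t1\<close> it stays positive.\<close>
 define f where "f t = sig * (h (phi t) - h p)" for t
 have f: "f t > 0" if "0 < t" "t <= eps" for t using sig(2)[OF that] phi(1) by (simp add: f_def)
 have f': "f t < 0" if "- eps <= t" "t < 0" for t using sig(3)[OF that] phi(1) by (simp add: f_def)
 have cont: "continuous_on S f" for S unfolding f_def by (intro continuous_intros h_continuous[OF phi(2)])
 have fP: "f P = 0" using P(2)[of 0] phi(1) by (simp add: f_def)
 have epsP: "eps < P" using f[of P] fP P(1) by linarith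
 define Z where "Z = {t \<in> {eps..P}. f t = 0}"
 have "closed Z" unfolding Z_def by (rule continuous_closed_preimage_constant[OF cont closed_atLeastAtMost])
 then have "compact Z" using compact_Int_closed[OF compact_Icc, of Z eps P] by (simp add: Z_def Int_absorb1 Collect_mono_iff subset_eq)
 moreover have "Z ~= {}" using fP epsP by (auto simp: Z_def intro: exI[of _ P])
 ultimately have "EX t:Z. ALL u:Z. t <= u" by (rule compact_attains_inf)
 then obtain t1 where t1: "t1 \<in> Z" "!!t. t \<in> Z ==> t1 <= t" by blast
 have t1': "t1 >= eps" "f t1 = 0" "t1 > 0" using t1(1) eps(1) by (auto simp: Z_def)
 have fpos: "f t > 0" if t: "0 < t" "t < t1" for t
 proof (rule ccontr)
  assume n: "\<not> f t > 0"
  have teps: "eps < t" using n f[of t] t by linarith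
  have "f eps >= 0" using f[of eps] eps(1) by simp
  then obtain z where z: "eps <= z" "z <= t" "f z = 0" using IVT2'[of f t 0 eps] n teps cont by (auto simp: not_less)
  then have "z \<in> Z" using t t1(1) by (auto simp: Z_def)
  then show False using t1(2)[of z] z t by linarith
 qed
 have "h (phi t1) = h p" using t1'(2) sig(1) by (auto simp: f_def)
 then obtain g where g: "lin_iso g" "phi t1 = act g p" using rigid[OF p fib, of t1] by (auto simp: h_def)
 obtain c0 where c0: "c0 ~= 0" "c0 < 0 ==> g ~= id" "!!y k. y \<in> fibre p ==> act g (v y) k = c0 * v (act g y) k"
  using equi[OF g(1)] by blast
 define c where "c = 1 / c0"
 have cc: "c0 * c = 1" "c ~= 0" using c0(1) by (simp_all add: c_def)
 \<comment> \<open>The isometric image of the trajectory, run at speed \<open>c\<close>, is again a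
   trajectory, and it starts where \<open>phi\<close> is at time \<open>t1\<close>.\<close>
 have "integral_curve v p (%t. act g (phi (c * t)))" unfolding integral_curve_def
 proof (intro conjI allI)
  fix t show "act g (phi (c * t)) \<in> fibre p" by (rule fibre_act[OF g(1) fib])
  fix i
  obtain A B where AB: "!!y. act g y i = A * y (2 * (i div 2)) + B * y (2 * (i div 2) + 1)"
   using act_linear[OF g(1)] by blast
  have d: "((%s. phi (c * s) j) has_real_derivative v (phi (c * t)) j * c) (at t)" for j
  proof -
   have "((%s. phi s j) has_real_derivative v (phi (c * t)) j) (at (c * t))" using phi(2) by (simp add: integral_curve_def)
   from DERIV_chain2[OF this DERIV_cmult_Id] show ?thesis .
  qed
  have "((%s. act g (phi (c * s)) i) has_real_derivative
    A * (v (phi (c * t)) (2 * (i div 2)) * c) + B * (v (phi (c * t)) (2 * (i div 2) + 1) * c)) (at t)"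
   unfolding AB by (intro DERIV_add DERIV_cmult d)
  moreover have "A * (v (phi (c * t)) (2 * (i div 2)) * c) + B * (v (phi (c * t)) (2 * (i div 2) + 1) * c) = act g (v (phi (c * t))) i * c"
   unfolding AB by (simp add: algebra_simps)
  moreover have "act g (v (phi (c * t))) i * c = v (act g (phi (c * t))) i"
   unfolding c0(3)[OF fib] using cc by (simp add: mult.commute mult.left_commute)
  ultimately show "((%s. act g (phi (c * s)) i) has_real_derivative v (act g (phi (c * t))) i) (at t)" by simp
 qed
 from integral_curve_unique[OF v ps this integral_curve_shift[OF phi(2), of t1], where ?t0.0 = 0]
 have sym: "act g (phi (c * t)) = phi (t1 + t)" for t using g(2) phi(1) by simp
 then have fsym: "f (c * t) = f (t1 + t)" for t unfolding f_def by (metis h_act[OF g(1)])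
 show False
 proof (cases "c > 0")
  case True
  \<comment> \<open>Just before time 0 the function \<open>f\<close> is negative and just before
    \<open>t1\<close> it is positive, yet for \<open>c > 0\<close> the symmetry identifies such
    values.\<close>
  define tau where "tau = min eps (eps / c) / 2"
  have tau: "tau > 0" "tau < eps" "tau * c <= eps"
  proof -
   show "tau > 0" "tau < eps" using eps(1) True by (auto simp: tau_def)
   have half: "min a b / 2 <= b" if "a > 0" "b > 0" for a b :: real using that by (auto simp: min_def)
   have "eps / c > 0" using eps(1) True by simp
   then have "tau <= eps / c" unfolding tau_def by (rule half[OF eps(1)])
   then show "tau * c <= eps" using True by (simp add: pos_le_divide_eq)
  qed
  have "f (- (tau * c)) = f (t1 - tau)" using fsym[of "- tau"] by (simp add: mult.commute)
  moreover have "f (- (tau * c)) < 0" by (rule f') (use tau True in auto)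
  moreover have "f (t1 - tau) > 0" by (rule fpos) (use tau t1'(1) in auto)
  ultimately show False by simp
 next
  case False
  then have cm: "c < 0" "c0 < 0" using cc c0(1) by (auto simp: c_def not_less divide_le_0_iff)
  \<comment> \<open>The solution of \<open>c * t = t1 + t\<close>, at which the reversed trajectory
    meets the original one.\<close>
  define t where "t = t1 / (c - 1)"
  have "(c - 1) * t = t1" using cm by (simp add: t_def)
  then have ct: "c * t = t1 + t" by (simp add: algebra_simps)
  define m where "m = phi (c * t)"
  have gm: "act g m = m" using sym[of t] ct by (simp add: m_def)
  have mf: "m \<in> fibre p" using fib by (simp add: m_def)
  have gfix: "g (pos a m) = pos a m" for a using pos_act[of a g m] gm by simp
  have cr0: "cr (pos a m) (pos b m) = 0" for a b
  proof (rule ccontr)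
   assume ne: "cr (pos a m) (pos b m) ~= 0"
   have "g z = z" for z by (rule lin_iso_fix_independent[OF g(1) gfix gfix ne])
   then have "g = id" by auto
   then show False using c0(2)[OF cm(2)] by simp
  qed
  have "E ~= {}"
  proof
   assume "E = {}"
   moreover have "(0, N div 2) \<in> {(a, b). (a, b) \<in> E \<or> (b, a) \<in> E}\<^sup>*" using conn N4 by (simp add: pinned_connected_def)
   ultimately have "N div 2 = 0" by simp
   then show False using N4 by simp
  qed
  then obtain e where "e \<in> E" by blast
  then have "pos (fst e) m ~= pos (snd e) m" using fibre_edge_nonzero[OF ps(2) mf] by (simp add: edge_nonzero_iff)
  then obtain a0 where z: "pos a0 m ~= 0" by metis
  define z where "z = pos a0 m"
  have "EX s. pos a m = s *\<^sub>R z" for a using cr_eq_0[OF cr0 z] unfolding z_def by blast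
  then obtain s where s: "!!a. pos a m = s a *\<^sub>R z" by metis
  \<comment> \<open>All edges are parallel to \<open>z\<close>, so moving a single vertex in the
    direction \<open>d\<close> changes no edge length to first order. Vertices 0 and 1 are free
    since \<open>N >= 4\<close>, and their two motions are independent, whereas the kernel is the
    line spanned by \<open>v m\<close>.\<close>
  obtain d where d: "d ~= 0" "norm_deriv z d = 0" using norm_deriv_kernel by blast
  define u where "u a i = (if i = 2 * a then co1 d else if i = 2 * a + 1 then co2 d else 0)" for a i :: nat
  have pu: "pos b (u a) = (if b = a then 1 else 0) *\<^sub>R d" for a b
  proof -
   have "2 * b ~= 2 * a + 1" "2 * b + 1 ~= 2 * a" by presburger+
   then show ?thesis by (auto simp: pos_def u_def)
  qed
  obtain k where k: "v m k ~= 0" using nz[OF mf] by blast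
  have us: "u a = (%i. u a k / v m k * v m i)" if a: "a < 2" for a
  proof (rule ker[OF mf k])
   show "u a \<in> supp_below N" using a N4 by (auto simp: supp_below_def u_def)
   fix e assume e: "e \<in> E"
   obtain x y where xy: "e = (x, y)" by fastforce
   have ne: "s x ~= s y" using fibre_edge_nonzero[OF ps(2) mf] e xy by (auto simp: edge_nonzero_iff s)
   have 0: "norm_deriv ((s x - s y) *\<^sub>R z) d = 0" by (rule norm_deriv_scale_zero) (use z z_def ne d in auto)
   have "norm_deriv ((s x - s y) *\<^sub>R z) (q *\<^sub>R d - q' *\<^sub>R d) = 0" for q q'
    using norm_deriv_linear[of "(s x - s y) *\<^sub>R z" q d "- q'" d] 0 by simp
   then show "eval NF (Du (u a) (ed e)) m = 0" unfolding xy eval_Du_ed pu s scaleR_diff_left[symmetric] by (simp add: scaleR_diff_left)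
  qed
  have unz: "u a k ~= 0" if a: "a < 2" for a
  proof
   assume "u a k = 0"
   then have "u a i = 0" for i using fun_cong[OF us[OF a], of i] by simp
   then have "pos a (u a) = 0" by (simp add: pos_def)
   then show False using pu[of a a] d(1) by simp
  qed
  \<comment> \<open>The one coordinate \<open>k\<close> would have to belong to both
    vertices.\<close>
  show False using unz[of 0] unz[of 1] by (auto simp: u_def split: if_splits)
 qed
qed

end

section \<open>Regular fibres\<close>

definition coordinate_box :: "nat set => (nat => real) => real => (nat => real) set" where
 "coordinate_box H c rho = {p. (ALL i:H. \<bar>p i - c i\<bar> <= rho) & (ALL i. i \<notin> H --> p i = c i)}"

text \<open>Baire's theorem by nested boxes: if no box were contained in any \<open>Z n\<close>,
  each step could shrink to a box missing the next set, and a limit of the centres would lie in none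
  of them.\<close>

lemma baire_boxes:
 fixes c0 :: "nat => real" and Z :: "nat => (nat => real) set"
 assumes H: "H \<subseteq> {..<N}" and rho0: "rho0 > 0"
  and closed: "!!n X l. (!!m. X m \<in> Z n) ==> (!!i. (%m. X m i) \<longlonglongrightarrow> l i) ==> l \<in> Z n"
  and cover: "coordinate_box H c0 rho0 \<subseteq> (\<Union>n. Z n)"
 shows "EX n c rho. rho > 0 & coordinate_box H c rho \<subseteq> Z n & coordinate_box H c rho \<subseteq> coordinate_box H c0 rho0"
proof (rule ccontr)
 assume neg: "\<not> ?thesis"
 have step: "EX s'. snd s' > 0 & coordinate_box H (fst s') (snd s') \<subseteq> coordinate_box H (fst s) (snd s) & coordinate_box H (fst s') (snd s') \<inter> Z n = {}"
  if s: "snd s > 0" "coordinate_box H (fst s) (snd s) \<subseteq> coordinate_box H c0 rho0" for n and s :: "(nat => real) \<times> real"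
 proof -
  have half: "coordinate_box H (fst s) (snd s / 2) \<subseteq> coordinate_box H (fst s) (snd s)" using s(1) by (fastforce simp: coordinate_box_def)
  then have "\<not> coordinate_box H (fst s) (snd s / 2) \<subseteq> Z n" using neg s by (meson half_gt_zero order_trans)
  then obtain p where p: "p \<in> coordinate_box H (fst s) (snd s / 2)" "p \<notin> Z n" by blast
  have "EX m. coordinate_box H p (snd s / (2 * (real m + 1))) \<inter> Z n = {}"
  proof (rule ccontr)
   assume "\<not> ?thesis"
   then have "ALL m. EX x. x \<in> coordinate_box H p (snd s / (2 * (real m + 1))) \<inter> Z n" by blast
   then obtain X where X: "!!m. X m \<in> coordinate_box H p (snd s / (2 * (real m + 1))) \<inter> Z n" by metis
   have lim0: "(%m. snd s / (2 * (real m + 1))) \<longlonglongrightarrow> 0" by real_asymp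
   have "(%m. X m i) \<longlonglongrightarrow> p i" for i
   proof (rule LIM_zero_cancel, rule Lim_null_comparison[OF always_eventually lim0], rule allI)
    fix m show "norm (X m i - p i) <= snd s / (2 * (real m + 1))"
     using X[of m] s(1) by (cases "i \<in> H") (auto simp: coordinate_box_def)
   qed
   then show False using closed[of X n p] X p(2) by blast
  qed
  then obtain m where m: "coordinate_box H p (snd s / (2 * (real m + 1))) \<inter> Z n = {}" by blast
  have le: "snd s / (2 * (real m + 1)) <= snd s / 2" using s(1) by (intro divide_left_mono) auto
  have "coordinate_box H p (snd s / (2 * (real m + 1))) \<subseteq> coordinate_box H (fst s) (snd s)"
  proof
   fix x assume x: "x \<in> coordinate_box H p (snd s / (2 * (real m + 1)))"
   have "\<bar>x i - fst s i\<bar> <= snd s" if i: "i \<in> H" for i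
   proof -
    have "\<bar>x i - p i\<bar> <= snd s / (2 * (real m + 1))" "\<bar>p i - fst s i\<bar> <= snd s / 2" using x p(1) i by (auto simp: coordinate_box_def)
    then show ?thesis using le by linarith
   qed
   then show "x \<in> coordinate_box H (fst s) (snd s)" using x p(1) by (auto simp: coordinate_box_def)
  qed
  moreover have "snd s / (2 * (real m + 1)) > 0" using s(1) by simp
  ultimately show ?thesis using m by (intro exI[of _ "(p, snd s / (2 * (real m + 1)))"]) simp
 qed
 define ok where "ok s \<longleftrightarrow> snd s > 0 & coordinate_box H (fst s) (snd s) \<subseteq> coordinate_box H c0 rho0" for s
 define Q where "Q n s s' \<longleftrightarrow> snd s' > 0 & coordinate_box H (fst s') (snd s') \<subseteq> coordinate_box H (fst s) (snd s) &
   coordinate_box H (fst s') (snd s') \<inter> Z n = {}" for n and s s' :: "(nat => real) \<times> real"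
 define F where "F n s = (SOME s'. Q n s s')" for n s
 have "Q n s (F n s)" if "ok s" for n s
  unfolding F_def by (rule someI_ex) (use step[of s n] that in \<open>auto simp: ok_def Q_def\<close>)
 then have F: "!!n s. ok s ==> snd (F n s) > 0 & coordinate_box H (fst (F n s)) (snd (F n s)) \<subseteq> coordinate_box H (fst s) (snd s) &
   coordinate_box H (fst (F n s)) (snd (F n s)) \<inter> Z n = {}" unfolding Q_def .
 define S where "S = rec_nat (c0, rho0) F"
 have S0: "S 0 = (c0, rho0)" and SS: "S (Suc n) = F n (S n)" for n by (simp_all add: S_def)
 have okS: "ok (S n)" for n
 proof (induction n)
  case 0 then show ?case using rho0 by (simp add: S0 ok_def)
 next
  case (Suc n) then show ?case using F[OF Suc, of n] unfolding SS ok_def by blast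
 qed
 define B where "B n = coordinate_box H (fst (S n)) (snd (S n))" for n
 have dec: "B (Suc n) \<subseteq> B n" for n unfolding B_def using F[OF okS, of n] SS by simp
 have decm: "B m \<subseteq> B n" if "n <= m" for n m using that lift_Suc_antimono_le[of B, OF dec] by blast
 have cB: "fst (S n) \<in> B n" for n using okS[of n] by (simp add: B_def coordinate_box_def ok_def)
 have "\<bar>fst (S n) i\<bar> <= (\<Sum>i<N. \<bar>c0 i\<bar>) + rho0" if "i < N" for n i
 proof -
  have "fst (S n) \<in> coordinate_box H c0 rho0" using decm[of 0 n] cB[of n] by (auto simp: B_def S0)
  then have "\<bar>fst (S n) i - c0 i\<bar> <= rho0" using rho0 by (cases "i \<in> H") (auto simp: coordinate_box_def)
  moreover have "\<bar>c0 i\<bar> <= (\<Sum>i<N. \<bar>c0 i\<bar>)" using that by (intro member_le_sum) auto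
  ultimately show ?thesis by linarith
 qed
 then obtain l r where lr: "strict_mono (r :: nat => nat)" "!!i. i < N ==> (%n. fst (S (r n)) i) \<longlonglongrightarrow> l i"
  using finite_coordinates_subsequence[of N "%n. fst (S n)"] by blast
 define q where "q i = (if i \<in> H then l i else c0 i)" for i
 have qB: "q \<in> B n" for n
 proof -
  have in_B: "fst (S (r m)) \<in> B n" if "m >= n" for m
   using decm[of n "r m"] cB[of "r m"] seq_suble[OF lr(1), of m] that by auto
  have "\<bar>q i - fst (S n) i\<bar> <= snd (S n)" if i: "i \<in> H" for i
  proof (rule LIMSEQ_le_const2)
   show "(%m. \<bar>fst (S (r m)) i - fst (S n) i\<bar>) \<longlonglongrightarrow> \<bar>q i - fst (S n) i\<bar>"
    using lr(2)[of i] i H by (intro tendsto_intros) (auto simp: q_def)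
   show "EX M. ALL m>=M. \<bar>fst (S (r m)) i - fst (S n) i\<bar> <= snd (S n)" using in_B i by (auto simp: B_def coordinate_box_def)
  qed
  moreover have "q i = fst (S n) i" if "i \<notin> H" for i
  proof -
   have "fst (S n) \<in> coordinate_box H c0 rho0" using decm[of 0 n] cB[of n] by (auto simp: B_def S0)
   then show ?thesis using that by (simp add: coordinate_box_def q_def)
  qed
  ultimately show ?thesis by (simp add: B_def coordinate_box_def)
 qed
 have "q \<in> coordinate_box H c0 rho0" using qB[of 0] by (simp add: B_def S0)
 then obtain n where "q \<in> Z n" using cover by blast
 moreover have "B (Suc n) \<inter> Z n = {}" unfolding B_def using F[OF okS, of n] SS by simp
 ultimately show False using qB[of "Suc n"] by blast
qed

context analytic_plane_function begin

text \<open>The local hypotheses of \<open>grid_counting\<close> for a critical set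
  \<open>S\<close>: coordinate \<open>k\<close> is controlled by the others, at each point a
  combination of the rows other than \<open>j\<close> is stationary, and the rows are
  Lipschitz.\<close>

definition critical_chart :: "nat => (nat => expr) => nat => (nat => real) set => nat => real => bool" where
 "critical_chart N rw j S k C \<longleftrightarrow>
  (ALL a:S. ALL b:S. (\<Sum>i<N. \<bar>a i - b i\<bar>) <= C * (\<Sum>i\<in>{..<N} - {k}. \<bar>a i - b i\<bar>)) &
  (ALL a:S. EX c i0. i0 \<in> {..<N} - {j} & \<bar>c i0\<bar> = 1 & (ALL i:{..<N} - {j}. \<bar>c i\<bar> <= 1) &
    (ALL b:S. \<bar>\<Sum>i\<in>{..<N} - {j}. c i * (eval F (rw i) b - eval F (rw i) a)\<bar> <= C * (\<Sum>i<N. \<bar>a i - b i\<bar>)\<^sup>2)) &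
  (ALL a:S. ALL b:S. ALL i<N. \<bar>eval F (rw i) a - eval F (rw i) b\<bar> <= C * (\<Sum>i<N. \<bar>a i - b i\<bar>))"

lemma critical_chart_subset:
 assumes ch: "critical_chart N rw j S k C" and T: "T \<subseteq> S"
 shows "critical_chart N rw j T k C"
 unfolding critical_chart_def
proof (intro conjI ballI allI impI)
 fix a b assume ab: "a \<in> T" "b \<in> T"
 show "(\<Sum>i<N. \<bar>a i - b i\<bar>) <= C * (\<Sum>i\<in>{..<N} - {k}. \<bar>a i - b i\<bar>)"
  using ch ab T unfolding critical_chart_def by (meson subsetD)
 show "\<bar>eval F (rw i) a - eval F (rw i) b\<bar> <= C * (\<Sum>i<N. \<bar>a i - b i\<bar>)" if "i < N" for i
  using ch ab T that unfolding critical_chart_def by (meson subsetD)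
next
 fix a assume "a \<in> T"
 then have "a \<in> S" using T by blast
 then obtain c i0 where "i0 \<in> {..<N} - {j}" "\<bar>c i0\<bar> = 1" "ALL i:{..<N} - {j}. \<bar>c i\<bar> <= 1"
  "ALL b:S. \<bar>\<Sum>i\<in>{..<N} - {j}. c i * (eval F (rw i) b - eval F (rw i) a)\<bar> <= C * (\<Sum>i<N. \<bar>a i - b i\<bar>)\<^sup>2"
  using ch unfolding critical_chart_def by blast
 then show "EX c i0. i0 \<in> {..<N} - {j} & \<bar>c i0\<bar> = 1 & (ALL i:{..<N} - {j}. \<bar>c i\<bar> <= 1) &
   (ALL b:T. \<bar>\<Sum>i\<in>{..<N} - {j}. c i * (eval F (rw i) b - eval F (rw i) a)\<bar> <= C * (\<Sum>i<N. \<bar>a i - b i\<bar>)\<^sup>2)"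
  using T by blast
qed

text \<open>Near a zero of the nonzero analytic function \<open>e\<close> its zeros lie on a hypersurface on which the
 coordinate \<open>k\<close> is a Lipschitz function of the others. The rows dependent at a point of the cofactor
 zero set make the corresponding combination of edge lengths vary only quadratically.\<close>

lemma critical_zero_chart:
 assumes E: "valid_edges N E" and rw: "!!i. i < N ==> edges_in E (rw i)" and j: "j < N" and e: "edges_in E e"
  and p: "p \<in> supp_below N" "p \<in> edge_nonzero E" "eval F e p ~= 0"
  and y: "y \<in> supp_below N" "y \<in> edge_nonzero E" "eval F e y = 0"
 shows "EX ks k s C. k < N & s > 0 & eval F (iter_partial ks e) y = 0 & nbox N y s \<subseteq> edge_nonzero E &
  critical_chart N rw j {a \<in> nbox N y s. (ALL k<N. cofv N rw j a k = 0) & eval F (iter_partial ks e) a = 0} k C"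
proof -
 \<comment> \<open>The length of a shortest iterated derivative that is nonzero at \<open>y\<close>.
   Undoing its outermost derivative, in direction \<open>k\<close>, leaves \<open>zet\<close>, which
   vanishes at \<open>y\<close> but has a nonzero derivative in that direction.\<close>
 define len where "len = (LEAST n. EX ks. set ks \<subseteq> {..<N} & length ks = n & eval F (iter_partial ks e) y ~= 0)"
 have "EX n ks. set ks \<subseteq> {..<N} & length ks = n & eval F (iter_partial ks e) y ~= 0"
  using exists_nonzero_derivative[OF E e p y(1,2)] by blast
 then obtain ks0 where ks0: "set ks0 \<subseteq> {..<N}" "length ks0 = len" "eval F (iter_partial ks0 e) y ~= 0"
  using LeastI_ex[of "%n. EX ks. set ks \<subseteq> {..<N} & length ks = n & eval F (iter_partial ks e) y ~= 0"] unfolding len_def by blast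
 then obtain k ks where ks: "ks0 = k # ks" using y(3) by (cases ks0) (auto simp: iter_partial_def)
 have k: "k < N" using ks0(1) ks by simp
 define zet where "zet = iter_partial ks e"
 have zet0: "eval F zet y = 0"
 proof (rule ccontr)
  assume "eval F zet y ~= 0"
  then have "len <= length ks" unfolding len_def zet_def using ks0(1) ks by (intro Least_le) auto
  then show False using ks0(2) ks by simp
 qed
 define m where "m = \<bar>eval F (Du (unit_coord k) zet) y\<bar>"
 have m: "m > 0" using ks0(3) ks by (simp add: m_def zet_def iter_partial_def)
 have ezet: "edges_in E zet" using e by (simp add: zet_def)
 define X where "X = {zet} \<union> rw ` {..<N} \<union> (%k. Du (unit_coord k) zet) ` {..<N}"
 have "EX r>0. EX C>=0. ALL x:X. second_order y x r C"
  by (rule second_order_uniform[OF _ _ y(2)]) (use ezet rw in \<open>auto simp: X_def\<close>)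
 then obtain r C where r: "r > 0" "C >= 0" and so: "!!x. x \<in> X ==> second_order y x r C" by blast
 obtain r' where r': "r' > 0" "!!w. (ALL i. \<bar>w i - y i\<bar> < r') ==> w \<in> edge_nonzero E"
  using edge_nonzero_open[OF _ y(2)] E by (auto simp: valid_edges_def)
 define d where "d a b = (\<Sum>i<N. \<bar>a i - b i\<bar>)" for a b :: "nat => real"
 have N0: "real N >= 1" using j by simp
 \<comment> \<open>\<open>s\<close> keeps distances at most 1, and keeps both the variation of the
   derivative in direction \<open>k\<close> and the remainder relative to the distance below
   \<open>m / 4\<close>.\<close>
 define s where "s = min (min r r') (min (1 / (2 * real N)) (m / (8 * real N * (C + 1))))"
 have s: "s > 0" "s <= r" "s <= r'" using r r' m N0 by (simp_all add: s_def)
 have "s <= 1 / (2 * real N)" "s <= m / (8 * real N * (C + 1))" by (simp_all add: s_def)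
 moreover have "2 * real N > 0" "8 * real N * (C + 1) > 0" using N0 r(2) by (simp_all add: add_nonneg_pos)
 ultimately have "s * (2 * real N) <= 1" and s2: "s * (8 * real N * (C + 1)) <= m"
  by (simp_all only: pos_le_divide_eq)
 then have s1: "2 * real N * s <= 1" by (simp add: mult.commute)
 have s2': "2 * real N * s * C <= m / 4"
 proof -
  have "s * (8 * real N * C) <= s * (8 * real N * (C + 1))" using s(1) by (intro mult_left_mono) auto
  then show ?thesis using s2 by (simp add: mult_ac)
 qed
 have s3: "2 * C * s <= m / 4"
 proof -
  have "1 * (2 * C * s) <= real N * (2 * C * s)" using N0 s(1) r(2) by (intro mult_right_mono) auto
  then show ?thesis using s2' by (simp add: mult_ac)
 qed
 have s4: "s <= 1"
 proof -
  have "1 * s <= 2 * real N * s" using N0 s(1) by (intro mult_right_mono) auto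
  then show ?thesis using s1 by simp
 qed
 have near: "\<bar>a i - y i\<bar> < s" if "a \<in> nbox N y s" for a i using nboxD[OF that y(1) s(1)] .
 have nearr: "\<bar>a i - y i\<bar> < r" if "a \<in> nbox N y s" for a i using near[OF that, of i] s(2) by linarith
 have dle: "\<bar>b i - a i\<bar> <= d a b" if "a \<in> nbox N y s" "b \<in> nbox N y s" for a b i
 proof (cases "i < N")
  case True
  then have "\<bar>a i - b i\<bar> <= d a b" unfolding d_def by (intro member_le_sum) auto
  then show ?thesis by (simp add: abs_minus_commute)
 next
  case False
  then show ?thesis using nbox_supp[OF that(1)] nbox_supp[OF that(2)] by (simp add: supp_below_def d_def sum_nonneg)
 qed
 have dub: "d a b <= 2 * real N * s" if "a \<in> nbox N y s" "b \<in> nbox N y s" for a b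
 proof -
  have "\<bar>a i - b i\<bar> <= 2 * s" for i using near[OF that(1), of i] near[OF that(2), of i] by linarith
  then have "d a b <= (\<Sum>i<N. 2 * s)" unfolding d_def by (intro sum_mono) auto
  then show ?thesis by simp
 qed
 have d0: "d a b >= 0" for a b by (simp add: d_def sum_nonneg)
 have est: "\<bar>eval F x a\<bar> <= C & \<bar>eval F (Du (%i. b i - a i) x) a\<bar> <= C * d a b &
   \<bar>eval F x b - eval F x a - eval F (Du (%i. b i - a i) x) a\<bar> <= C * (d a b)\<^sup>2"
  if "x \<in> X" "a \<in> nbox N y s" "b \<in> nbox N y s" for x a b
 proof -
  have "d a b <= 1" using dub[OF that(2,3)] s1 by linarith
  then show ?thesis
   using so[OF that(1), unfolded second_order_def, rule_format, of a b "d a b"] nearr[OF that(2)] nearr[OF that(3)] dle[OF that(2,3)] by blast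
 qed
 have lin: "eval F (Du (%i. b i - a i) x) a = (\<Sum>k<N. (b k - a k) * eval F (Du (unit_coord k) x) a)"
  if "a \<in> nbox N y s" "b \<in> nbox N y s" for a b x
  by (rule eval_Du_linear) (use nbox_supp[OF that(1)] nbox_supp[OF that(2)] in simp)
 have A4: "\<bar>eval F (rw i) a - eval F (rw i) b\<bar> <= 2 * C * d a b" if "a \<in> nbox N y s" "b \<in> nbox N y s" "i < N" for a b i
 proof -
  have x: "rw i \<in> X" using that by (auto simp: X_def)
  have "d a b <= 1" using dub[OF that(1,2)] s1 by linarith
  then have "C * (d a b)\<^sup>2 <= C * d a b" using d0[of a b] r(2) by (intro mult_left_mono) (simp_all add: power2_eq_square mult_left_le)
  then show ?thesis using est[OF x that(1,2)] by linarith
 qed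
 have low: "\<bar>eval F (Du (unit_coord k) zet) a\<bar> >= m / 2" if a: "a \<in> nbox N y s" for a
 proof -
  have x: "Du (unit_coord k) zet \<in> X" using k by (auto simp: X_def)
  have ys: "y \<in> nbox N y s" by (rule nbox_self[OF y(1) s(1)])
  have "\<bar>eval F (Du (%i. a i - y i) (Du (unit_coord k) zet)) y\<bar> <= C * s &
    \<bar>eval F (Du (unit_coord k) zet) a - eval F (Du (unit_coord k) zet) y - eval F (Du (%i. a i - y i) (Du (unit_coord k) zet)) y\<bar> <= C * s\<^sup>2"
   using so[OF x, unfolded second_order_def, rule_format, of y a s] nearr[OF ys] nearr[OF a] near[OF a] s4 by (auto intro: less_imp_le)
  moreover have "C * s\<^sup>2 <= C * s" using s(1) s4 r(2) by (intro mult_left_mono) (simp_all add: power2_eq_square mult_left_le)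
  ultimately have "\<bar>eval F (Du (unit_coord k) zet) a - eval F (Du (unit_coord k) zet) y\<bar> <= m / 4" using s3 by linarith
  then show ?thesis unfolding m_def by linarith
 qed
 have A2: "d a b <= (4 * C / m + 2) * (\<Sum>i\<in>{..<N} - {k}. \<bar>a i - b i\<bar>)"
  if a: "a \<in> nbox N y s" and b: "b \<in> nbox N y s" and z: "eval F zet a = 0" "eval F zet b = 0" for a b
 proof -
  define S where "S = (\<Sum>i\<in>{..<N} - {k}. \<bar>a i - b i\<bar>)"
  have dS: "d a b = \<bar>a k - b k\<bar> + S" unfolding d_def S_def using k by (subst sum.remove[of _ k]) auto
  have x: "zet \<in> X" by (simp add: X_def)
  have xk: "Du (unit_coord i) zet \<in> X" if "i < N" for i using that by (auto simp: X_def)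
  have q: "\<bar>eval F (Du (%i. b i - a i) zet) a\<bar> <= C * (d a b)\<^sup>2" using est[OF x a b] z by simp
  have "eval F (Du (%i. b i - a i) zet) a = (b k - a k) * eval F (Du (unit_coord k) zet) a +
    (\<Sum>i\<in>{..<N} - {k}. (b i - a i) * eval F (Du (unit_coord i) zet) a)"
   unfolding lin[OF a b] using k by (subst sum.remove[of _ k]) auto
  moreover have "\<bar>\<Sum>i\<in>{..<N} - {k}. (b i - a i) * eval F (Du (unit_coord i) zet) a\<bar> <= C * S"
  proof -
   have "\<bar>\<Sum>i\<in>{..<N} - {k}. (b i - a i) * eval F (Du (unit_coord i) zet) a\<bar> <= (\<Sum>i\<in>{..<N} - {k}. \<bar>(b i - a i) * eval F (Du (unit_coord i) zet) a\<bar>)"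
    by (rule sum_abs)
   also have "... <= (\<Sum>i\<in>{..<N} - {k}. C * \<bar>a i - b i\<bar>)"
   proof (rule sum_mono)
    fix i assume "i \<in> {..<N} - {k}"
    then have "\<bar>eval F (Du (unit_coord i) zet) a\<bar> <= C" using est[OF xk a a, of i] by simp
    then show "\<bar>(b i - a i) * eval F (Du (unit_coord i) zet) a\<bar> <= C * \<bar>a i - b i\<bar>"
     unfolding abs_mult by (metis abs_ge_zero abs_minus_commute mult.commute mult_left_mono)
   qed
   finally show ?thesis by (simp add: S_def sum_distrib_left)
  qed
  moreover have "C * (d a b)\<^sup>2 <= m / 4 * d a b"
  proof -
   have "C * d a b <= C * (2 * real N * s)" using dub[OF a b] r(2) by (intro mult_left_mono) auto
   also have "... <= m / 4" using s2' by (simp add: mult_ac)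
   finally have "C * d a b * d a b <= m / 4 * d a b" using d0 by (intro mult_right_mono) auto
   then show ?thesis by (simp add: power2_eq_square mult.assoc)
  qed
  ultimately have "\<bar>(b k - a k) * eval F (Du (unit_coord k) zet) a\<bar> <= C * S + m / 4 * d a b" using q by linarith
  moreover have "\<bar>b k - a k\<bar> * (m / 2) <= \<bar>(b k - a k) * eval F (Du (unit_coord k) zet) a\<bar>"
   unfolding abs_mult using low[OF a] by (intro mult_left_mono) auto
  ultimately have "\<bar>b k - a k\<bar> * (m / 2) <= C * S + m / 4 * (\<bar>a k - b k\<bar> + S)" unfolding dS by linarith
  then have "m * \<bar>a k - b k\<bar> <= (4 * C + m) * S" by (simp add: abs_minus_commute algebra_simps)
  then have "\<bar>a k - b k\<bar> <= (4 * C + m) * S / m" using m by (simp add: field_simps)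
  also have "... = (4 * C / m + 1) * S" using m by (simp add: field_simps)
  finally show ?thesis unfolding dS S_def[symmetric] by (simp add: algebra_simps)
 qed
 have A3: "EX c i0. i0 \<in> {..<N} - {j} & \<bar>c i0\<bar> = 1 & (ALL i:{..<N} - {j}. \<bar>c i\<bar> <= 1) &
    (ALL b:nbox N y s. \<bar>\<Sum>i\<in>{..<N} - {j}. c i * (eval F (rw i) b - eval F (rw i) a)\<bar> <= real N * C * (d a b)\<^sup>2)"
  if a: "a \<in> nbox N y s" and z: "!!k. k < N ==> cofv N rw j a k = 0" for a
 proof -
  obtain c i1 where c: "i1 \<in> {..<N} - {j}" "c i1 ~= 0" "!!k. k < N ==> (\<Sum>i\<in>{..<N} - {j}. c i * jac rw a i k) = 0"
   using cofv_zero_dependent[of j N rw a, OF j z] by blast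
  define I where "I = {..<N} - {j}"
  \<comment> \<open>Division by the largest coefficient makes one of them 1 in absolute value and
    bounds the rest by 1.\<close>
  define Mx where "Mx = Max ((%i. \<bar>c i\<bar>) ` I)"
  have finI: "finite I" "I ~= {}" using c(1) by (auto simp: I_def)
  have "Mx \<in> (%i. \<bar>c i\<bar>) ` I" unfolding Mx_def using finI by (intro Max_in) auto
  then obtain i0 where i0: "i0 \<in> I" "Mx = \<bar>c i0\<bar>" by blast
  have le: "\<bar>c i\<bar> <= Mx" if "i \<in> I" for i unfolding Mx_def using finI that by (intro Max_ge) auto
  have M0: "Mx > 0" using le[of i1] c(1,2) by (simp add: I_def)
  define c' where "c' i = c i / Mx" for i
  have c1: "\<bar>c' i0\<bar> = 1" using i0 M0 by (simp add: c'_def)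
  have c2: "\<bar>c' i\<bar> <= 1" if "i \<in> I" for i using le[OF that] M0 by (simp add: c'_def)
  have "\<bar>\<Sum>i\<in>I. c' i * (eval F (rw i) b - eval F (rw i) a)\<bar> <= real N * C * (d a b)\<^sup>2" if b: "b \<in> nbox N y s" for b
  proof -
   define lf where "lf i = eval F (Du (%i. b i - a i) (rw i)) a" for i
   have "(\<Sum>i\<in>I. c' i * lf i) = (\<Sum>i\<in>I. \<Sum>k<N. (b k - a k) / Mx * (c i * jac rw a i k))"
    unfolding lf_def lin[OF a b] by (simp add: c'_def jac_def sum_distrib_left mult_ac)
   also have "... = (\<Sum>k<N. (b k - a k) / Mx * (\<Sum>i\<in>I. c i * jac rw a i k))"
    by (subst sum.swap) (simp add: sum_distrib_left)
   also have "... = 0" using c(3) by (simp add: I_def)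
   finally have z: "(\<Sum>i\<in>I. c' i * lf i) = 0" .
   have "(\<Sum>i\<in>I. c' i * (eval F (rw i) b - eval F (rw i) a)) = (\<Sum>i\<in>I. c' i * (eval F (rw i) b - eval F (rw i) a - lf i))"
    using z by (simp add: right_diff_distrib sum_subtractf)
   also have "\<bar>...\<bar> <= (\<Sum>i\<in>I. \<bar>c' i * (eval F (rw i) b - eval F (rw i) a - lf i)\<bar>)" by (rule sum_abs)
   also have "... <= (\<Sum>i\<in>I. C * (d a b)\<^sup>2)"
   proof (rule sum_mono)
    fix i assume i: "i \<in> I"
    then have x: "rw i \<in> X" by (auto simp: X_def I_def)
    have "\<bar>eval F (rw i) b - eval F (rw i) a - lf i\<bar> <= C * (d a b)\<^sup>2" using est[OF x a b] by (simp add: lf_def)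
    then show "\<bar>c' i * (eval F (rw i) b - eval F (rw i) a - lf i)\<bar> <= C * (d a b)\<^sup>2"
     unfolding abs_mult using c2[OF i] by (meson abs_ge_zero mult_left_le_one_le order_trans)
   qed
   also have "... = real (card I) * (C * (d a b)\<^sup>2)" by simp
   also have "... <= real N * (C * (d a b)\<^sup>2)"
    using r(2) card_mono[of "{..<N}" I] by (intro mult_right_mono) (auto simp: I_def)
   finally show ?thesis by (simp add: mult.assoc)
  qed
  then show ?thesis using c1 c2 i0 unfolding I_def by blast
 qed
 define C' where "C' = (4 * C / m + 2) + real N * C + 2 * C"
 have CC: "4 * C / m + 2 <= C'" "real N * C <= C'" "2 * C <= C'" using r(2) m by (simp_all add: C'_def add_nonneg_nonneg)
 have sub: "nbox N y s \<subseteq> edge_nonzero E"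
 proof
  fix w assume "w \<in> nbox N y s"
  then show "w \<in> edge_nonzero E" using near s(3) by (intro r'(2)) (auto intro: less_le_trans)
 qed
 have B2: "d a b <= C' * (\<Sum>i\<in>{..<N} - {k}. \<bar>a i - b i\<bar>)"
  if "a \<in> nbox N y s" "b \<in> nbox N y s" "eval F zet a = 0" "eval F zet b = 0" for a b
  using A2[OF that] mult_right_mono[OF CC(1) sum_nonneg[of "{..<N} - {k}" "%i. \<bar>a i - b i\<bar>"]] by simp
 have B3: "EX c i0. i0 \<in> {..<N} - {j} & \<bar>c i0\<bar> = 1 & (ALL i:{..<N} - {j}. \<bar>c i\<bar> <= 1) &
    (ALL b:nbox N y s. \<bar>\<Sum>i\<in>{..<N} - {j}. c i * (eval F (rw i) b - eval F (rw i) a)\<bar> <= C' * (d a b)\<^sup>2)"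
  if a: "a \<in> nbox N y s" and z: "ALL k<N. cofv N rw j a k = 0" for a
 proof -
  obtain c i0 where c: "i0 \<in> {..<N} - {j}" "\<bar>c i0\<bar> = 1" "ALL i:{..<N} - {j}. \<bar>c i\<bar> <= 1"
   "!!b. b \<in> nbox N y s ==> \<bar>\<Sum>i\<in>{..<N} - {j}. c i * (eval F (rw i) b - eval F (rw i) a)\<bar> <= real N * C * (d a b)\<^sup>2"
   using A3[OF a] z by blast
  have "\<bar>\<Sum>i\<in>{..<N} - {j}. c i * (eval F (rw i) b - eval F (rw i) a)\<bar> <= C' * (d a b)\<^sup>2" if "b \<in> nbox N y s" for b
   using c(4)[OF that] mult_right_mono[OF CC(2), of "(d a b)\<^sup>2"] by simp
  then show ?thesis using c(1-3) by blast
 qed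
 have B4: "\<bar>eval F (rw i) a - eval F (rw i) b\<bar> <= C' * d a b" if "a \<in> nbox N y s" "b \<in> nbox N y s" "i < N" for a b i
  using A4[OF that] mult_right_mono[OF CC(3) d0, of a b] by simp
 have "critical_chart N rw j {a \<in> nbox N y s. (ALL k<N. cofv N rw j a k = 0) & eval F (iter_partial ks e) a = 0} k C'"
  unfolding critical_chart_def d_def[symmetric] zet_def[symmetric]
 proof (intro conjI ballI allI impI, goal_cases)
  case (1 a b) then show ?case using B2[of a b] by blast
 next
  case (2 a)
  then obtain c i0 where "i0 \<in> {..<N} - {j}" "\<bar>c i0\<bar> = 1" "ALL i:{..<N} - {j}. \<bar>c i\<bar> <= 1"
   "ALL b:nbox N y s. \<bar>\<Sum>i\<in>{..<N} - {j}. c i * (eval F (rw i) b - eval F (rw i) a)\<bar> <= C' * (d a b)\<^sup>2"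
   using B3[of a] by blast
  then show ?case by blast
 next
  case (3 a b i) then show ?case using B4[of a b i] by blast
 qed
 then show ?thesis using k s(1) zet0 sub unfolding zet_def by blast
qed

end

context connected_framework begin

text \<open>A quantitative Sard argument: the set of bad values is covered by countably many closed sets, so by
 Baire one of them contains a box, which is too large to be the image of a set of critical points
 lying on a Lipschitz graph.\<close>

lemma regular_fibre_exists:
 assumes l: "l < N" and j: "j < N" and N2: "N >= 2" and rwj: "rw j = Coord l"
  and rwE: "!!i. i < N ==> i ~= j ==> EX e:E. rw i = ed e" and det: "ddet N (jac rw p) ~= 0"
  and p: "p \<in> supp_below N" "p \<in> edge_nonzero E" and r0: "r0 > 0"
 shows "EX p':nbox N p r0. ALL y:fibre p'. EX k<N. cofv N rw j y k ~= 0"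
proof (rule ccontr)
 assume neg: "\<not> ?thesis"
 have bad: "EX y:fibre p'. ALL k<N. cofv N rw j y k = 0" if "p' \<in> nbox N p r0" for p' using neg that by blast
 have rw: "edges_in E (rw i)" if "i < N" for i
  using rwE[OF that] rwj by (cases "i = j") (auto simp: edges_in_ed)
 obtain r1 C1 where r1: "r1 > 0" "C1 > 0" and bil: "!!a b k. a \<in> nbox N p r1 ==> b \<in> nbox N p r1 ==>
   \<bar>a k - b k\<bar> <= C1 * (\<Sum>i<N. \<bar>eval NF (rw i) a - eval NF (rw i) b\<bar>)"
  using local_bi_lipschitz[OF rw p det] by blast
 obtain r2 where r2: "r2 > 0" "!!w. (ALL i. \<bar>w i - p i\<bar> < r2) ==> w \<in> edge_nonzero E"
  using edge_nonzero_open[OF finite_E p(2)] by blast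
 have repr: "EX e. edges_in E e & (ALL y. eval NF e y = cofv N rw j y k)" for k
  using representable_cofv[of N E rw j k] rw unfolding representable_def by blast
 \<comment> \<open>Component \<open>l\<close> of the field. At \<open>p\<close> it is the Jacobian
   determinant, so this is a nontrivial expression that vanishes at all critical points.\<close>
 then obtain e where e: "edges_in E e" "!!y. eval NF e y = cofv N rw j y l" by blast
 have "cofv N rw j p l = ddet N (jac (rw(j := Coord l)) p)" using eval_Du_cofv[OF j, of rw p "Coord l"] by simp
 also have "rw(j := Coord l) = rw" using rwj by auto
 finally have ep: "eval NF e p ~= 0" using det e(2) by simp
 \<comment> \<open>Closed cubes with rational centre and radius \<open>1 / M\<close> cut the
   critical set into countably many pieces, each with one vanishing derivative \<open>ks\<close> and
   one chart.\<close>
 define cb where "cb qs M = {a \<in> supp_below N. ALL i<N. \<bar>a i - of_rat (qs ! i)\<bar> <= 1 / real M}" for qs :: "rat list" and M :: nat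
 define A where "A ks qs M = {a \<in> cb qs M. (ALL k<N. cofv N rw j a k = 0) & eval NF (iter_partial ks e) a = 0}" for ks qs M
 define good where "good omg = (case omg of (ks, k, qs, M) => k < N & M > 0 & cb qs M \<subseteq> edge_nonzero E & (EX C. critical_chart N rw j (A ks qs M) k C))"
  for omg :: "nat list \<times> nat \<times> rat list \<times> nat"
 \<comment> \<open>\<open>Z n\<close> collects the placements whose fibre meets the piece with code
   \<open>n\<close>; it is empty unless that piece has a chart.\<close>
 define Z where "Z n = (case (from_nat n :: nat list \<times> nat \<times> rat list \<times> nat) of (ks, k, qs, M) =>
  {p' \<in> supp_below N. good (ks, k, qs, M) & (EX y:fibre p'. y \<in> A ks qs M)})" for n
 \<comment> \<open>Coordinate \<open>l\<close> is frozen because row \<open>j\<close> is that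
   coordinate: on such a slice the \<open>N - 1\<close> edge rows determine a placement near
   \<open>p\<close>.\<close>
 define H where "H = {..<N} - {l}"
 define rho0 where "rho0 = min r0 (min r1 r2) / 2"
 have rho0: "rho0 > 0" "rho0 < r0" "rho0 < r1" "rho0 < r2" using r0 r1 r2 by (auto simp: rho0_def)
 have box: "w \<in> nbox N p r0 & w \<in> nbox N p r1 & w \<in> edge_nonzero E & w \<in> supp_below N" if w: "w \<in> coordinate_box H p rho0" for w
 proof -
  have d: "\<bar>w i - p i\<bar> <= rho0" for i using w rho0(1) by (cases "i \<in> H") (auto simp: coordinate_box_def)
  have "w i = 0" if "i >= N" for i using w p(1) that by (simp add: coordinate_box_def H_def supp_below_def)
  then have "w \<in> supp_below N" by (simp add: supp_below_def)
  moreover have "\<bar>w i - p i\<bar> < r0" "\<bar>w i - p i\<bar> < r1" "\<bar>w i - p i\<bar> < r2" for i using d[of i] rho0 by linarith+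
  ultimately show ?thesis using r2(2) by (simp add: nbox_def)
 qed
 have "EX n c rho. rho > 0 & coordinate_box H c rho \<subseteq> Z n & coordinate_box H c rho \<subseteq> coordinate_box H p rho0"
 proof (rule baire_boxes[where N = N])
  show "H \<subseteq> {..<N}" by (auto simp: H_def)
  show "rho0 > 0" by (rule rho0)
  show "coordinate_box H p rho0 \<subseteq> (\<Union>n. Z n)"
  proof
   fix p' assume p': "p' \<in> coordinate_box H p rho0"
   obtain y where y: "y \<in> fibre p'" "!!k. k < N ==> cofv N rw j y k = 0" using bad[of p'] box[OF p'] by blast
   have ys: "y \<in> supp_below N" "y \<in> edge_nonzero E"
    using fibre_supp[OF y(1)] fibre_edge_nonzero[OF _ y(1)] box[OF p'] by auto
   have ey: "eval NF e y = 0" using e(2) y(2)[OF l] by simp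
   obtain ks k s C where ch: "k < N" "s > 0" "eval NF (iter_partial ks e) y = 0" "nbox N y s \<subseteq> edge_nonzero E"
    "critical_chart N rw j {a \<in> nbox N y s. (ALL k<N. cofv N rw j a k = 0) & eval NF (iter_partial ks e) a = 0} k C"
    using critical_zero_chart[where rw = rw, OF valid _ j e(1) p ep ys ey] rw by blast
   obtain M where M: "real M > 2 / s" using reals_Archimedean2 by blast
   have "2 / s > 0" using ch(2) by simp
   then have M0: "M > 0" using M by (metis gr0I less_asym of_nat_0)
   have Ms: "2 / real M < s"
   proof -
    have "2 < real M * s" using M ch(2) by (simp add: pos_divide_less_eq)
    then show ?thesis using M0 by (simp add: pos_divide_less_eq mult.commute)
   qed
   have "EX q::rat. \<bar>y i - of_rat q\<bar> <= 1 / real M" for i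
   proof -
    have "y i - 1 / real M < y i" using M0 by simp
    then obtain q :: rat where "y i - 1 / real M < of_rat q" "of_rat q < y i" using of_rat_dense by blast
    then show ?thesis by (intro exI[of _ q]) auto
   qed
   then obtain q :: "nat => rat" where q: "!!i. \<bar>y i - of_rat (q i)\<bar> <= 1 / real M" by metis
   define qs where "qs = map q [0..<N]"
   have ycb: "y \<in> cb qs M" using ys q by (auto simp: cb_def qs_def)
   have sub: "cb qs M \<subseteq> nbox N y s"
   proof
    fix a assume a: "a \<in> cb qs M"
    have "\<bar>a i - y i\<bar> < s" if i: "i < N" for i
    proof -
     have "\<bar>a i - of_rat (q i)\<bar> <= 1 / real M" using a i by (auto simp: cb_def qs_def)
     then have "\<bar>a i - y i\<bar> <= 1 / real M + 1 / real M" using q[of i] by linarith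
     then show ?thesis using Ms by simp
    qed
    then show "a \<in> nbox N y s" using a by (simp add: nbox_def cb_def)
   qed
   have "critical_chart N rw j (A ks qs M) k C" by (rule critical_chart_subset[OF ch(5)]) (use sub in \<open>auto simp: A_def\<close>)
   then have "good (ks, k, qs, M)" using ch(1,4) M0 sub by (auto simp: good_def)
   moreover have "y \<in> A ks qs M" using ycb y(2) ch(3) by (simp add: A_def)
   ultimately have "p' \<in> Z (to_nat (ks, k, qs, M))" using y(1) box[OF p'] by (auto simp: Z_def)
   then show "p' \<in> (\<Union>n. Z n)" by blast
  qed
  \<comment> \<open>The critical points chosen in the fibres stay in a fixed closed cube, and the
    limit of a subsequence is a critical point in the limit fibre.\<close>
  show "lp \<in> Z n" if X: "!!m. X m \<in> Z n" and lim: "!!i. (%m. X m i) \<longlonglongrightarrow> lp i" for n X lp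
  proof -
   obtain ks k qs M where n: "(from_nat n :: nat list \<times> nat \<times> rat list \<times> nat) = (ks, k, qs, M)" using prod_cases4 by blast
   have gd: "good (ks, k, qs, M)" and Xs: "X m \<in> supp_below N" and ex: "EX y. y \<in> fibre (X m) & y \<in> A ks qs M" for m
    using X[of m] n by (auto simp: Z_def)
   obtain Y where Y: "!!m. Y m \<in> fibre (X m)" "!!m. Y m \<in> A ks qs M" using ex by metis
   have Ycb: "Y m \<in> supp_below N" "!!i. i < N ==> \<bar>Y m i - of_rat (qs ! i)\<bar> <= 1 / real M" for m
    using Y(2)[of m] by (auto simp: A_def cb_def)
   have "\<bar>Y m i\<bar> <= (\<Sum>i<N. \<bar>of_rat (qs ! i)\<bar>) + 1 / real M" if i: "i < N" for m i
   proof -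
    have "\<bar>of_rat (qs ! i) :: real\<bar> <= (\<Sum>i<N. \<bar>of_rat (qs ! i)\<bar>)" using i by (intro member_le_sum) auto
    then show ?thesis using Ycb(2)[OF i, of m] by linarith
   qed
   then obtain z r where zr: "strict_mono (r :: nat => nat)" "!!i. i < N ==> (%m. Y (r m) i) \<longlonglongrightarrow> z i"
    using finite_coordinates_subsequence[of N Y] by blast
   define y where "y i = (if i < N then z i else 0)" for i
   have ylim: "(%m. Y (r m) i) \<longlonglongrightarrow> y i" for i
   proof (cases "i < N")
    case False
    then have "Y (r m) i = 0" for m using Ycb(1)[of "r m"] by (simp add: supp_below_def)
    then show ?thesis using False by (simp add: y_def)
   qed (use zr(2) in \<open>simp add: y_def\<close>)
   have ys: "y \<in> supp_below N" by (simp add: y_def supp_below_def)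
   have ycb: "y \<in> cb qs M"
   proof -
    have "\<bar>y i - of_rat (qs ! i)\<bar> <= 1 / real M" if i: "i < N" for i
     by (rule LIMSEQ_le_const2[of "%m. \<bar>Y (r m) i - of_rat (qs ! i)\<bar>"])
      (use Ycb(2)[OF i] in \<open>auto intro!: tendsto_intros ylim\<close>)
    then show ?thesis using ys by (simp add: cb_def)
   qed
   then have ynz: "y \<in> edge_nonzero E" using gd by (auto simp: good_def)
   have ev0: "eval NF x y = 0" if "edges_in E x" "!!m. eval NF x (Y m) = 0" for x
   proof -
    have "(%m. eval NF x (Y (r m))) \<longlonglongrightarrow> eval NF x y"
     by (rule eval_tendsto[OF that(1) ynz ylim Ycb(1) ys])
    then show ?thesis using that(2) LIMSEQ_unique[OF _ tendsto_const[of 0]] by simp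
   qed
   have "cofv N rw j y i = 0" if i: "i < N" for i
   proof -
    obtain x where x: "edges_in E x" "!!y. eval NF x y = cofv N rw j y i" using repr by blast
    show ?thesis using ev0[OF x(1)] Y(2) i by (simp add: x(2) A_def)
   qed
   moreover have "eval NF (iter_partial ks e) y = 0" by (rule ev0) (use e(1) Y(2) in \<open>auto simp: A_def\<close>)
   ultimately have yA: "y \<in> A ks qs M" using ycb by (simp add: A_def)
   have lim': "(%m. X (r m) i) \<longlonglongrightarrow> lp i" for i using LIMSEQ_subseq_LIMSEQ[OF lim zr(1), of i] by (simp add: comp_def)
   have "y \<in> fibre lp" by (rule fibre_closed[of "%m. Y (r m)" "%m. X (r m)", OF Y(1) ylim lim'])
   moreover have "lp \<in> supp_below N"
   proof -
    have "lp i = 0" if "i >= N" for i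
    proof -
     have "X m i = 0" for m using Xs[of m] that by (simp add: supp_below_def)
     then show ?thesis using LIMSEQ_unique[OF lim[of i], of 0] by simp
    qed
    then show ?thesis by (simp add: supp_below_def)
   qed
   ultimately show ?thesis using yA gd n by (auto simp: Z_def)
  qed
 qed
 then obtain n c rho where c: "rho > 0" "coordinate_box H c rho \<subseteq> Z n" "coordinate_box H c rho \<subseteq> coordinate_box H p rho0" by blast
 obtain ks k qs M where n: "(from_nat n :: nat list \<times> nat \<times> rat list \<times> nat) = (ks, k, qs, M)" using prod_cases4 by blast
 have "c \<in> coordinate_box H c rho" using c(1) by (simp add: coordinate_box_def)
 then have "c \<in> Z n" using c(2) by blast
 then have "good (ks, k, qs, M)" using n by (auto simp: Z_def)
 then obtain C where k: "k < N" "M > 0" "critical_chart N rw j (A ks qs M) k C" by (auto simp: good_def)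
 define Cn where "Cn = nat \<lceil>\<bar>C\<bar> + C1 + (\<Sum>i<N. \<bar>of_rat (qs ! i) :: real\<bar>) + 2\<rceil>"
 define C' where "C' = real Cn"
 have S0: "(\<Sum>i<N. \<bar>of_rat (qs ! i) :: real\<bar>) >= 0" by (simp add: sum_nonneg)
 have "C' >= \<bar>C\<bar> + C1 + (\<Sum>i<N. \<bar>of_rat (qs ! i) :: real\<bar>) + 2" unfolding C'_def Cn_def by (rule real_nat_ceiling_ge)
 then have C': "C <= C'" "C1 <= C'" "(\<Sum>i<N. \<bar>of_rat (qs ! i) :: real\<bar>) + 1 <= C'" "C' >= 1" using S0 r1(2) by linarith+
 have Yex: "EX y. y \<in> fibre p' & y \<in> A ks qs M" if "p' \<in> coordinate_box H c rho" for p'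
  using c(2) that n by (auto simp: Z_def)
 define Y where "Y p' = (SOME y. y \<in> fibre p' & y \<in> A ks qs M)" for p'
 have Y: "Y p' \<in> fibre p' & Y p' \<in> A ks qs M" if "p' \<in> coordinate_box H c rho" for p'
  unfolding Y_def by (rule someI_ex[OF Yex[OF that]])
 \<comment> \<open>The lower corner, since the counting uses one-sided boxes, here of side
   \<open>2 * rho\<close>.\<close>
 define p0 where "p0 i = (if i \<in> H then c i - rho else c i)" for i
 have inbox: "p' \<in> coordinate_box H c rho" if "ALL i:H. p0 i <= p' i & p' i <= p0 i + 2 * rho" "ALL i. i \<notin> H --> p' i = p0 i" for p'
  using that by (auto simp: coordinate_box_def p0_def abs_le_iff)
 have sumnn: "(\<Sum>i\<in>S. \<bar>a i - b i\<bar>) >= 0" for S and a b :: "nat => real" by (simp add: sum_nonneg)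
 show False
 proof (rule grid_counting[where I = "{..<N} - {j}" and K = "{..<N} - {k}" and H = H and m = "N - 1" and Cn = Cn and C = C' and rho = "2 * rho"
   and A = "A ks qs M" and x = "%i a. a i" and f = "%i. eval NF (rw i)" and D = "%a b. \<Sum>i<N. \<bar>a i - b i\<bar>" and ?p0.0 = p0 and Y = Y])
  show "finite ({..<N} - {j})" "finite ({..<N} - {k})" "finite H" by (simp_all add: H_def)
  show "card ({..<N} - {j}) = N - 1" "card ({..<N} - {k}) = N - 1" "card H = N - 1" using j k(1) l by (simp_all add: H_def)
  show "N - 1 >= 1" using N2 by simp
  show "Cn >= 1" using C'(4) by (simp add: C'_def)
  show "C' = real Cn" by (simp add: C'_def)
  show "2 * rho > 0" using c(1) by simp
  show "\<bar>a i\<bar> <= C'" if a: "a \<in> A ks qs M" and i: "i \<in> {..<N} - {k}" for a i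
  proof -
   have "\<bar>a i - of_rat (qs ! i)\<bar> <= 1 / real M" using a i by (auto simp: A_def cb_def)
   moreover have "1 / real M <= 1" using k(2) by simp
   moreover have "\<bar>of_rat (qs ! i) :: real\<bar> <= (\<Sum>i<N. \<bar>of_rat (qs ! i)\<bar>)" using i by (intro member_le_sum) auto
   ultimately show ?thesis using C'(3) by linarith
  qed
  show "(\<Sum>i<N. \<bar>a i - b i\<bar>) >= 0" for a b :: "nat => real" by (simp add: sum_nonneg)
  show "(\<Sum>i<N. \<bar>a i - b i\<bar>) <= C' * (\<Sum>i\<in>{..<N} - {k}. \<bar>a i - b i\<bar>)" if "a \<in> A ks qs M" "b \<in> A ks qs M" for a b
   using k(3) that mult_right_mono[OF C'(1) sumnn[of a b "{..<N} - {k}"]] unfolding critical_chart_def by (meson order_trans)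
  show "\<bar>eval NF (rw i) a - eval NF (rw i) b\<bar> <= C' * (\<Sum>i<N. \<bar>a i - b i\<bar>)"
   if "a \<in> A ks qs M" "b \<in> A ks qs M" "i \<in> {..<N} - {j}" for a b i
   using k(3) that mult_right_mono[OF C'(1) sumnn[of a b "{..<N}"]] unfolding critical_chart_def by (meson DiffD1 lessThan_iff order_trans)
  show "EX c i0. i0 \<in> {..<N} - {j} & \<bar>c i0\<bar> = 1 & (ALL i:{..<N} - {j}. \<bar>c i\<bar> <= 1) &
    (ALL b:A ks qs M. \<bar>\<Sum>i\<in>{..<N} - {j}. c i * (eval NF (rw i) b - eval NF (rw i) a)\<bar> <= C' * (\<Sum>i<N. \<bar>a i - b i\<bar>)\<^sup>2)"
   if a: "a \<in> A ks qs M" for a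
  proof -
   obtain c i0 where c: "i0 \<in> {..<N} - {j}" "\<bar>c i0\<bar> = 1" "ALL i:{..<N} - {j}. \<bar>c i\<bar> <= 1"
    "!!b. b \<in> A ks qs M ==> \<bar>\<Sum>i\<in>{..<N} - {j}. c i * (eval NF (rw i) b - eval NF (rw i) a)\<bar> <= C * (\<Sum>i<N. \<bar>a i - b i\<bar>)\<^sup>2"
    using k(3) a unfolding critical_chart_def by blast
   have "\<bar>\<Sum>i\<in>{..<N} - {j}. c i * (eval NF (rw i) b - eval NF (rw i) a)\<bar> <= C' * (\<Sum>i<N. \<bar>a i - b i\<bar>)\<^sup>2" if "b \<in> A ks qs M" for b
    using c(4)[OF that] mult_right_mono[OF C'(1), of "(\<Sum>i<N. \<bar>a i - b i\<bar>)\<^sup>2"] by simp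
   then show ?thesis using c(1-3) by blast
  qed
  show "Y p' \<in> A ks qs M" if "ALL i:H. p0 i <= p' i & p' i <= p0 i + 2 * rho" "ALL i. i \<notin> H --> p' i = p0 i" for p'
   using Y[OF inbox[OF that]] by simp
  show "\<bar>p' i - p'' i\<bar> <= C' * (\<Sum>i\<in>{..<N} - {j}. \<bar>eval NF (rw i) (Y p') - eval NF (rw i) (Y p'')\<bar>)"
   if p': "ALL i:H. p0 i <= p' i & p' i <= p0 i + 2 * rho" "ALL i. i \<notin> H --> p' i = p0 i"
    and p'': "ALL i:H. p0 i <= p'' i & p'' i <= p0 i + 2 * rho" "ALL i. i \<notin> H --> p'' i = p0 i" for p' p'' i
  proof -
   have b: "p' \<in> coordinate_box H c rho" "p'' \<in> coordinate_box H c rho" using inbox p' p'' by blast+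
   have nb: "p' \<in> nbox N p r1" "p'' \<in> nbox N p r1" using b c(3) box by blast+
   \<comment> \<open>\<open>Y q\<close> lies in the fibre of \<open>q\<close>, so edge rows agree.
     With coordinate \<open>l\<close> frozen, the estimate near \<open>p\<close> then separates box
     points by the edge lengths of their images under \<open>Y\<close>.\<close>
   have eq: "eval NF (rw i) (Y q) = eval NF (rw i) q" if q: "q \<in> coordinate_box H c rho" and i: "i < N" "i ~= j" for q i
   proof -
    obtain x where x: "x \<in> E" "rw i = ed x" using rwE[OF i] by blast
    show ?thesis using Y[OF q] x by (simp add: fibre_def)
   qed
   have "p' l = p'' l" using p'(2) p''(2) by (simp add: H_def)
   then have "eval NF (rw j) p' = eval NF (rw j) p''" by (simp add: rwj)
   then have "(\<Sum>i<N. \<bar>eval NF (rw i) p' - eval NF (rw i) p''\<bar>) = (\<Sum>i\<in>{..<N} - {j}. \<bar>eval NF (rw i) p' - eval NF (rw i) p''\<bar>)"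
    using j by (subst sum.remove[of _ j]) auto
   also have "... = (\<Sum>i\<in>{..<N} - {j}. \<bar>eval NF (rw i) (Y p') - eval NF (rw i) (Y p'')\<bar>)"
    by (rule sum.cong) (use eq[OF b(1)] eq[OF b(2)] in auto)
   finally have "\<bar>p' i - p'' i\<bar> <= C1 * (\<Sum>i\<in>{..<N} - {j}. \<bar>eval NF (rw i) (Y p') - eval NF (rw i) (Y p'')\<bar>)" using bil[OF nb, of i] by simp
   also have "... <= C' * (\<Sum>i\<in>{..<N} - {j}. \<bar>eval NF (rw i) (Y p') - eval NF (rw i) (Y p'')\<bar>)"
    using C'(2) by (intro mult_right_mono sum_nonneg) auto
   finally show ?thesis .
  qed
 qed
qed

end

section \<open>Independent edges\<close>

text \<open>Without \<open>Der\<close> terms no placement is excluded, so by the identity theorem a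
  polynomial that is nonzero somewhere is nonzero on a dense set.\<close>

lemma (in analytic_plane_function) dense_open_polynomial:
 assumes e: "edges_in {} e" and N: "even N" and z: "z \<in> supp_below N" "eval F e z ~= 0"
 shows "dense_open N (%w. eval F e w ~= 0)"
proof -
 have UN: "edge_nonzero {} = UNIV" by (simp add: edge_nonzero_def)
 have val: "valid_edges N {}" using N by (simp add: valid_edges_def)
 show ?thesis unfolding dense_open_def
 proof (intro conjI ballI allI impI)
  fix w assume "w \<in> supp_below N" "eval F e w ~= 0"
  then show "EX r>0. ALL v:nbox N w r. eval F e v ~= 0" using eval_nonzero_open[OF e] UN by auto
 next
  fix w and r :: real assume w: "w \<in> supp_below N" "r > 0"
  show "EX v:nbox N w r. eval F e v ~= 0"
  proof (rule ccontr)
   assume "\<not> ?thesis"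
   then have "eval F e z = 0" using identity_global[OF val e w _ z(1)] UN by auto
   then show False using z(2) by simp
  qed
 qed
qed

lemma dense_openD:
 assumes "dense_open N Q"
 shows "w \<in> supp_below N ==> Q w ==> EX r>0. ALL v:nbox N w r. Q v"
  and "w \<in> supp_below N ==> r > 0 ==> EX v:nbox N w r. Q v"
 using assms by (simp_all add: dense_open_def)

lemma (in analytic_plane_function) representable_jac_ddet:
 assumes "!!i. i < N ==> edges_in E (rw i)"
 shows "representable E (%y. ddet N (jac rw y))"
 by (rule representable_ddet) (use assms in \<open>auto simp: jac_def intro!: representable_eval\<close>)

context rigid_framework begin

lemma act_supp_linear:
 assumes g: "lin_iso g" and u: "u \<in> supp_below N"
 shows "act g u i = (\<Sum>k<N. act g (unit_coord k) i * u k)"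
proof -
 obtain A B where AB: "!!y. act g y i = A * y (2 * (i div 2)) + B * y (2 * (i div 2) + 1)"
  using act_linear[OF g] by blast
 have ux: "u x = (\<Sum>k<N. unit_coord k x * u k)" for x
 proof (cases "x < N")
  case True
  then have "(\<Sum>k<N. unit_coord k x * u k) = (\<Sum>k<N. if k = x then u k else 0)" by (intro sum.cong) (auto simp: unit_coord_def)
  then show ?thesis using True by simp
 next
  case False
  then have "u x = 0" using u by (simp add: supp_below_def)
  moreover have "(\<Sum>k<N. unit_coord k x * u k) = 0" using False by (intro sum.neutral) (auto simp: unit_coord_def)
  ultimately show ?thesis by simp
 qed
 show ?thesis unfolding AB by (subst (1 2) ux) (simp add: sum_distrib_left sum.distrib distrib_right mult.assoc)
qed

text \<open>For edge rows the Jacobian at \<open>act g y\<close> times the matrix of the action is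
  the Jacobian at \<open>y\<close>, as edge lengths are invariant, while a unit row \<open>k\<close>
  becomes row \<open>k\<close> of that matrix. Taking determinants identifies \<open>c\<close> as
  the determinant of the action, which is 1 for the identity.\<close>

lemma cofv_equivariant:
 assumes g: "lin_iso g" and j: "j < N" and rwE: "!!i. i < N ==> i ~= j ==> EX e:E. rw i = ed e"
 shows "EX c. c ~= 0 & (c < 0 --> g ~= id) &
  (ALL y:supp_below N \<inter> edge_nonzero E. ALL k. act g (cofv N rw j y) k = c * cofv N rw j (act g y) k)"
proof -
 define G where "G g i k = act g (unit_coord k) i" for g i k
 have lin: "act g u i = (\<Sum>k<N. G g i k * u k)" if "lin_iso g" "u \<in> supp_below N" for g u i
  unfolding G_def by (rule act_supp_linear[OF that])
 define c where "c = ddet N (G g)"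
 obtain g' where g': "lin_iso g'" "!!x. g (g' x) = x" using lin_iso_inverse[OF g] by blast
 have "ddet N (%i j. \<Sum>k<N. G g i k * G g' k j) = ddet N unit_coord"
 proof (rule ddet_cong)
  fix i l assume il: "i < N" "l < N"
  have "(\<Sum>k<N. G g i k * G g' k l) = act g (act g' (unit_coord l)) i"
   by (subst lin[OF g act_supp[OF g'(1) unit_coord_supp[OF il(2)] even_N]]) (simp add: G_def)
  also have "act g (act g' (unit_coord l)) = unit_coord l" by (rule pos_eqI) (simp add: g'(2))
  finally show "(\<Sum>k<N. G g i k * G g' k l) = unit_coord i l" by (auto simp: unit_coord_def)
 qed
 then have "c * ddet N (G g') = 1" unfolding ddet_mult ddet_unit c_def .
 then have c0: "c ~= 0" by auto
 have cid: "c = 1" if "g = id"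
 proof -
  have "act id (unit_coord k) = unit_coord k" for k by (rule pos_eqI) simp
  then have "c = ddet N unit_coord" unfolding c_def by (intro ddet_cong) (auto simp: G_def that unit_coord_def)
  then show ?thesis by (simp add: ddet_unit)
 qed
 have "act g (cofv N rw j y) k = c * cofv N rw j (act g y) k" if y: "y \<in> supp_below N" "y \<in> edge_nonzero E" for y k
 proof (cases "k < N")
  case False
  then show ?thesis using act_supp[OF g cofv_supp even_N, of rw j y] by (simp add: supp_below_def cofv_def)
 next
  case True
  have "c * cofv N rw j (act g y) k = ddet N ((jac rw (act g y))(j := unit_coord k)) * ddet N (G g)"
   using True by (simp add: cofv_def c_def)
  also have "... = ddet N (%i l. \<Sum>m<N. ((jac rw (act g y))(j := unit_coord k)) i m * G g m l)"
   by (rule ddet_mult[symmetric])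
  also have "... = ddet N ((jac rw y)(j := G g k))"
  proof (rule ddet_cong)
   fix i l assume il: "i < N" "l < N"
   show "(\<Sum>m<N. ((jac rw (act g y))(j := unit_coord k)) i m * G g m l) = ((jac rw y)(j := G g k)) i l"
   proof (cases "i = j")
    case True
    have "(\<Sum>m<N. unit_coord k m * G g m l) = (\<Sum>m<N. if m = k then G g m l else 0)"
     by (intro sum.cong) (auto simp: unit_coord_def)
    then show ?thesis using True \<open>k < N\<close> by simp
   next
    case False
    then obtain e where e: "e \<in> E" "rw i = ed e" using rwE[OF il(1)] by blast
    obtain a b where ab: "e = (a, b)" by fastforce
    have ne: "pos a y - pos b y ~= 0" using y(2) e(1) ab by (auto simp: edge_nonzero_iff)
    have "(\<Sum>m<N. jac rw (act g y) i m * G g m l) = eval NF (Du (act g (unit_coord l)) (rw i)) (act g y)"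
     by (subst eval_Du_linear[OF act_supp[OF g unit_coord_supp[OF il(2)] even_N]]) (simp add: G_def jac_def mult.commute)
    also have "... = norm_deriv (g (pos a y) - g (pos b y)) (g (pos a (unit_coord l)) - g (pos b (unit_coord l)))"
     unfolding e(2) ab eval_Du_ed pos_act ..
    also have "... = norm_deriv (pos a y - pos b y) (pos a (unit_coord l) - pos b (unit_coord l))"
     unfolding lin_iso_diff[OF g] by (rule norm_deriv_iso[OF g ne])
    also have "... = jac rw y i l" unfolding jac_def e(2) ab eval_Du_ed ..
    finally show ?thesis using False by simp
   qed
  qed
  also have "... = (\<Sum>l<N. G g k l * cofv N rw j y l)" by (rule cofv_dot[OF j, symmetric])
  also have "... = act g (cofv N rw j y) k" by (rule lin[OF g cofv_supp, symmetric])
  finally show ?thesis by simp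
 qed
 then show ?thesis using c0 cid by (intro exI[of _ c]) auto
qed

text \<open>Start with coordinate functions and replace them by edge lengths as long as possible.\<close>

lemma exists_independent_edges:
 assumes "U ~= {}"
 shows "EX p:U. EX rw. (ALL i<N. EX e:E. rw i = ed e) & ddet N (jac rw p) ~= 0"
proof -
 define isE where "isE x \<longleftrightarrow> (EX e:E. x = ed e)" for x
 define P where "P s \<longleftrightarrow> snd s \<in> U & (ALL i<N. isE (fst s i) \<or> (EX l<N. fst s i = Coord l)) & ddet N (jac (fst s) (snd s)) ~= 0"
  for s :: "(nat => expr) \<times> (nat => real)"
 define ct where "ct s = card {i. i < N & isE (fst s i)}" for s :: "(nat => expr) \<times> (nat => real)"
 obtain u where u: "u \<in> U" using assms by blast
 have "ddet N (jac Coord u) = ddet N unit_coord"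
  by (rule ddet_cong) (auto simp: jac_def unit_coord_def)
 then have P0: "P (Coord, u)" using u by (auto simp: P_def ddet_unit)
 have bd: "ct s < Suc N" for s
  using card_mono[of "{..<N}" "{i. i < N & isE (fst s i)}"] by (auto simp: ct_def less_Suc_eq_le)
 \<comment> \<open>A system with the greatest number of edge rows exists since that number is at
   most \<open>N\<close>; the base point competes along with the rows.\<close>
 obtain s where s: "P s" "!!s'. P s' ==> ct s' <= ct s"
  using ex_has_greatest_nat[of P "(Coord, u)" ct "Suc N"] P0 bd by blast
 obtain rw p where rp: "s = (rw, p)" by fastforce
 have p: "p \<in> U" and rows: "!!i. i < N ==> isE (rw i) \<or> (EX l<N. rw i = Coord l)" and det: "ddet N (jac rw p) ~= 0"
  using s(1) rp by (auto simp: P_def)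
 have ps: "p \<in> supp_below N" "p \<in> edge_nonzero E" by (rule U_supp[OF p], rule U_nonzero[OF p])
 have rwi: "edges_in E (rw i)" if "i < N" for i using rows[OF that] by (auto simp: isE_def edges_in_ed)
 have tangent: "tangent_field (cofv N rw j)" and val: "cofv N rw j p l ~= 0"
  if j: "j < N" "rw j = Coord l" for j l
 proof -
  have nE: "\<not> isE (rw j)" using j(2) by (auto simp: isE_def ed_def)
  \<comment> \<open>By maximality the determinant with an edge in place of row \<open>j\<close>
    vanishes on \<open>U\<close>, hence on all placements without zero edges. This is needed because
    trajectories may leave \<open>U\<close>.\<close>
  have zero: "ddet N (jac (rw(j := ed e)) y) = 0" if e: "e \<in> E" and y: "y \<in> supp_below N" "y \<in> edge_nonzero E" for e y
  proof -
   have zU: "ddet N (jac (rw(j := ed e)) w) = 0" if w: "w \<in> U" for w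
   proof (rule ccontr)
    assume nz: "ddet N (jac (rw(j := ed e)) w) ~= 0"
    have "P (rw(j := ed e), w)" using w nz rows e by (auto simp: P_def isE_def)
    then have "ct (rw(j := ed e), w) <= ct s" by (rule s(2))
    moreover have "{i. i < N & isE ((rw(j := ed e)) i)} = insert j {i. i < N & isE (rw i)}"
     using j(1) e by (auto simp: isE_def)
    ultimately show False using nE rp by (simp add: ct_def)
   qed
   have "representable E (%y. ddet N (jac (rw(j := ed e)) y))"
    by (rule representable_jac_ddet) (use rwi e in \<open>auto simp: edges_in_ed\<close>)
   then obtain x where x: "edges_in E x" "!!y. eval NF x y = ddet N (jac (rw(j := ed e)) y)" unfolding representable_def by blast
   obtain r where r: "r > 0" "nbox N p r \<subseteq> U" using U_open[OF p] by blast
   have "eval NF x w = 0" if "w \<in> nbox N p r" for w unfolding x(2) by (rule zU) (use that r(2) in blast)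
   from identity_global[OF valid x(1) ps(1) r(1) this y] show ?thesis unfolding x(2) by blast
  qed
  show "tangent_field (cofv N rw j)" unfolding tangent_field_def
  proof (intro conjI allI ballI)
   show "representable E (%y. cofv N rw j y k)" for k by (rule representable_cofv) (rule rwi)
   show "cofv N rw j y \<in> supp_below N" for y by simp
   show "eval NF (Du (cofv N rw j y) (ed e)) y = 0" if "y \<in> supp_below N \<inter> edge_nonzero E" "e \<in> E" for y e
    unfolding eval_Du_cofv[OF j(1)] using zero that by blast
  qed
  have "cofv N rw j p l = ddet N (jac (rw(j := Coord l)) p)" using eval_Du_cofv[OF j(1), of rw p "Coord l"] by simp
  also have "rw(j := Coord l) = rw" using j(2) by auto
  finally show "cofv N rw j p l ~= 0" using det by simp
 qed
 show ?thesis
 proof (cases "ALL i<N. isE (rw i)")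
  case True
  then show ?thesis using p det unfolding isE_def by blast
 next
  case False
  then obtain j l where j: "j < N" "rw j = Coord l" "l < N" using rows by blast
  have False
  proof (cases "EX j'<N. j' ~= j & \<not> isE (rw j')")
   case True
   then obtain j' l' where j': "j' < N" "j' ~= j" "rw j' = Coord l'" using rows by blast
   \<comment> \<open>The field of row \<open>j\<close> leaves the coordinate in row
     \<open>j'\<close> unchanged, and the field of row \<open>j'\<close> moves it: two tangent
     directions.\<close>
   have "cofv N rw j y l' = 0" for y using eval_Du_cofv_row[OF j(1) j'(1,2), of rw y] j'(3) by simp
   then show False
    by (rule no_two_dimensional_fibre[OF tangent[OF j(1,2)] tangent[OF j'(1,3)] p val[OF j(1,2)] val[OF j'(1,3)]])
  next
   case False
   then have rwE: "EX e:E. rw i = ed e" if "i < N" "i ~= j" for i using that by (auto simp: isE_def)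
   obtain r where r: "r > 0" "nbox N p r \<subseteq> U" using U_open[OF p] by blast
   have "N >= 2" using N4 by simp
   then obtain p' where p': "p' \<in> nbox N p r" "!!y. y \<in> fibre p' ==> EX k<N. cofv N rw j y k ~= 0"
    using regular_fibre_exists[OF j(3,1) _ j(2) rwE det ps r(1)] by blast
   have pU: "p' \<in> U" using p'(1) r(2) by blast
   have fs: "m \<in> supp_below N" "m \<in> edge_nonzero E" if "m \<in> fibre p'" for m
    using fibre_supp[OF that] fibre_edge_nonzero[OF U_nonzero[OF pU] that] .
   show False
   proof (rule no_circular_fibre[OF tangent[OF j(1,2)] pU p'(2)])
    fix m k assume m: "m \<in> fibre p'" and k: "cofv N rw j m k ~= 0" "k < N"
    have d: "ddet N (jac (rw(j := Coord k)) m) ~= 0" using eval_Du_cofv[OF j(1), of rw m "Coord k"] k(1) by simp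
    have "EX r>0. EX C>0. ALL a:nbox N m r. ALL b:nbox N m r. ALL i.
      \<bar>a i - b i\<bar> <= C * (\<Sum>i<N. \<bar>eval NF ((rw(j := Coord k)) i) a - eval NF ((rw(j := Coord k)) i) b\<bar>)"
     by (rule local_bi_lipschitz[OF _ fs[OF m] d]) (use rwi in auto)
    then obtain r C where r: "r > 0" "!!a b i. a \<in> nbox N m r ==> b \<in> nbox N m r ==>
      \<bar>a i - b i\<bar> <= C * (\<Sum>i<N. \<bar>eval NF ((rw(j := Coord k)) i) a - eval NF ((rw(j := Coord k)) i) b\<bar>)" by blast
    have "y = y'" if y: "y \<in> nbox N m r" "y \<in> fibre p'" and y': "y' \<in> nbox N m r" "y' \<in> fibre p'" and eq: "y k = y' k" for y y'
    proof
     fix i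
     have "eval NF ((rw(j := Coord k)) i) y = eval NF ((rw(j := Coord k)) i) y'" if i: "i < N" for i
     proof (cases "i = j")
      case False
      then obtain e where "e \<in> E" "rw i = ed e" using rwE[OF i] by blast
      then show ?thesis using False y(2) y'(2) by (simp add: fibre_def)
     qed (use eq in simp)
     then show "y i = y' i" using r(2)[OF y(1) y'(1), of i] by simp
    qed
    then show "EX r>0. ALL y:nbox N m r \<inter> fibre p'. ALL y':nbox N m r \<inter> fibre p'. y k = y' k --> y = y'" using r(1) by blast
   next
    fix g :: "'a => 'a" assume g: "lin_iso g"
    obtain c where "c ~= 0" "c < 0 --> g ~= id"
     "ALL y:supp_below N \<inter> edge_nonzero E. ALL k. act g (cofv N rw j y) k = c * cofv N rw j (act g y) k"
     using cofv_equivariant[where rw = rw, OF g j(1)] rwE by blast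
    then show "EX c. c ~= 0 & (c < 0 --> g ~= id) & (ALL y:fibre p'. ALL k. act g (cofv N rw j y) k = c * cofv N rw j (act g y) k)"
     using fs by (intro exI[of _ c]) blast
   next
    fix m k u assume m: "m \<in> fibre p'" and k: "cofv N rw j m k ~= 0" and u: "u \<in> supp_below N"
     and ker: "!!e. e \<in> E ==> eval NF (Du u (ed e)) m = 0"
    show "u = (%i. u k / cofv N rw j m k * cofv N rw j m i)"
     by (rule cofv_kernel[OF j(1) k u]) (use rwE ker in fastforce)
   qed
  qed
  then show ?thesis ..
 qed
qed

end

section \<open>From rigidity on an open set to independent edges\<close>

context analytic_plane begin

lemma infinite_sphere:
 assumes d: "d ~= 0"
 shows "infinite {x :: 'a. norm x = norm d}"
proof -
 define z where "z t = (norm d / norm (pt 1 t)) *\<^sub>R pt 1 t" for t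
 have ne: "pt 1 t ~= 0" for t using pt_eq_0[of 1 t] by auto
 have "norm (z t) = norm d" for t using ne[of t] by (simp add: z_def)
 then have sub: "range z \<subseteq> {x. norm x = norm d}" by auto
 have "inj z"
 proof (rule injI)
  fix s t assume eq: "z s = z t"
  have c: "co1 (z t) = norm d / norm (pt 1 t)" "co2 (z t) = norm d / norm (pt 1 t) * t" for t
   by (simp_all add: z_def co_simps)
  have nz: "norm d / norm (pt 1 t) ~= 0" for t using ne d by simp
  have "norm d / norm (pt 1 s) = norm d / norm (pt 1 t)" unfolding c(1)[symmetric] eq ..
  moreover have "norm d / norm (pt 1 s) * s = norm d / norm (pt 1 t) * t" unfolding c(2)[symmetric] eq ..
  ultimately show "s = t" using nz[of t] by simp
 qed
 then have "infinite (range z)" using finite_imageD infinite_UNIV_char_0 by blast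
 then show ?thesis using sub finite_subset by blast
qed

text \<open>A part of the graph not linked to the pinned vertex could be translated. Even if it
  separates \<open>v1\<close> from \<open>v2\<close>, their difference can run over a sphere without
  changing its length. So infinitely many placements would be copies of one under a finite
  group.\<close>

lemma rigid_imp_connected:
 assumes val: "valid_edges N E" and v: "v1 ~= v2" "2 * v1 <= N" "2 * v2 <= N"
  and q0: "q0 \<in> supp_below N" "r0 > 0"
  and rigid: "!!y y'. y \<in> nbox N q0 r0 ==> y' \<in> supp_below N ==> (!!e. e \<in> E ==> eval NF (ed e) y' = eval NF (ed e) y) ==>
   norm (pos v1 y' - pos v2 y') = norm (pos v1 y - pos v2 y) ==> EX g. lin_iso g & y' = act g y"
 shows "pinned_connected N E"
proof (rule ccontr)
 define R where "R = {(a, b). (a, b) \<in> E \<or> (b, a) \<in> E}"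
 define B where "B = {b. 2 * b < N & (b, N div 2) \<notin> R\<^sup>*}"
 assume "\<not> pinned_connected N E"
 then obtain a where a: "a \<in> B" by (auto simp: pinned_connected_def B_def R_def)
 have eN: "even N" using val by (simp add: valid_edges_def)
 have edgeB: "x \<in> B \<longleftrightarrow> y \<in> B" if e: "(x, y) \<in> E" for x y
 proof -
  have xy: "(x, y) \<in> R" "(y, x) \<in> R" using e by (auto simp: R_def)
  have le: "2 * x <= N" "2 * y <= N" using val e by (auto simp: valid_edges_def)
  have "w \<in> B \<longleftrightarrow> (w, N div 2) \<notin> R\<^sup>*" if "2 * w <= N" for w
  proof -
   have "w = N div 2" if "\<not> 2 * w < N" using that \<open>2 * w <= N\<close> eN by auto
   then show ?thesis by (auto simp: B_def)
  qed
  then show ?thesis using le xy by (meson converse_rtrancl_into_rtrancl)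
 qed
 have "valid_edges N {(v1, v2)}" using v eN by (simp add: valid_edges_def)
 from dense_openD(2)[OF dense_open_edge_nonzero[OF this] q0]
 obtain y where y: "y \<in> nbox N q0 r0" "pos v1 y ~= pos v2 y" by (auto simp: edge_nonzero_iff)
 have ys: "y \<in> supp_below N" by (rule nbox_supp[OF y(1)])
 define d where "d = pos v1 y - pos v2 y"
 define sh where "sh x i = y i + (if i div 2 \<in> B then if even i then co1 x else co2 x else 0)" for x :: 'a and i
 have psh: "pos b (sh x) = pos b y + (if b \<in> B then x else 0)" for b x
  by (rule co_eqI) (auto simp: pos_def sh_def co_simps)
 have shs: "sh x \<in> supp_below N" for x
 proof -
  have "i div 2 \<notin> B" if "i >= N" for i using that eN by (cases "even i") (auto simp: B_def elim!: evenE oddE)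
  then show ?thesis using ys by (simp add: supp_below_def sh_def)
 qed
 \<comment> \<open>If exactly one of \<open>v1\<close> and \<open>v2\<close> moves, their difference
   becomes \<open>z\<close>; otherwise it does not change, and every shift is admissible.\<close>
 define x where "x z = (if v1 \<in> B then z - d else d - z)" for z
 have inj: "inj (%z. sh (x z))"
 proof (rule injI)
  fix z z' assume "sh (x z) = sh (x z')"
  then have "pos a (sh (x z)) = pos a (sh (x z'))" by simp
  then show "z = z'" using a by (simp add: psh x_def split: if_splits)
 qed
 have "sh (x z) \<in> (%g. act g y) ` {g. lin_iso g}" if z: "norm z = norm d" for z
 proof -
  have "eval NF (ed e) (sh (x z)) = eval NF (ed e) y" if "e \<in> E" for e
   using edgeB[of "fst e" "snd e"] that by (simp add: eval_ed psh)
  moreover have "norm (pos v1 (sh (x z)) - pos v2 (sh (x z))) = norm (pos v1 y - pos v2 y)"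
  proof -
   consider "v1 \<in> B" "v2 \<in> B" | "v1 \<in> B" "v2 \<notin> B" | "v1 \<notin> B" "v2 \<in> B" | "v1 \<notin> B" "v2 \<notin> B" by blast
   then show ?thesis
   proof cases
    case 2
    then have "pos v1 (sh (x z)) - pos v2 (sh (x z)) = z" by (simp add: psh x_def d_def)
    then show ?thesis using z by (simp add: d_def)
   next
    case 3
    then have "pos v1 (sh (x z)) - pos v2 (sh (x z)) = z" by (simp add: psh x_def d_def)
    then show ?thesis using z by (simp add: d_def)
   qed (simp_all add: psh)
  qed
  ultimately show ?thesis using rigid[OF y(1) shs] by blast
 qed
 then have "(%z. sh (x z)) ` {z. norm z = norm d} \<subseteq> (%g. act g y) ` {g. lin_iso g}" by blast
 then have "finite ((%z. sh (x z)) ` {z. norm z = norm d})" using finite_lin_iso finite_subset by blast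
 then have "finite {z :: 'a. norm z = norm d}" using finite_imageD inj_on_subset[OF inj] by blast
 then show False using infinite_sphere[of d] y(2) by (simp add: d_def)
qed

theorem rigid_imp_independent_edges:
 assumes val: "valid_edges N E" and v: "v1 ~= v2" "2 * v1 <= N" "2 * v2 <= N" "(v1, v2) \<notin> E" "(v2, v1) \<notin> E"
  and q0: "q0 \<in> supp_below N" "r0 > 0"
  and rigid: "!!y y'. y \<in> nbox N q0 r0 ==> y' \<in> supp_below N ==> (!!e. e \<in> E ==> eval NF (ed e) y' = eval NF (ed e) y) ==>
   norm (pos v1 y' - pos v2 y') = norm (pos v1 y - pos v2 y) ==> EX g. lin_iso g & y' = act g y"
 shows "pinned_connected N E"
  and "N >= 4"
  and "EX p:nbox N q0 r0. p \<in> edge_nonzero E & (EX rw. (ALL i<N. EX e:E. rw i = ed e) & ddet N (jac rw p) ~= 0)"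
proof -
 show conn: "pinned_connected N E" by (rule rigid_imp_connected[OF val v(1,2,3) q0 rigid])
 have eN: "even N" using val by (simp add: valid_edges_def)
 \<comment> \<open>With one free vertex the only possible edge is the deleted one, and nothing is
   left to connect the vertices.\<close>
 show N4: "N >= 4"
 proof (rule ccontr)
  assume "\<not> N >= 4"
  then have "N = 0 \<or> N = 2" using eN by presburger
  then have N2: "N = 2" using v by auto
  have "(0, N div 2) \<in> {(a, b). (a, b) \<in> E \<or> (b, a) \<in> E}\<^sup>*" using conn N2 by (simp add: pinned_connected_def)
  then obtain b where b: "(0, b) \<in> E \<or> (b, 0) \<in> E" using N2 by (auto elim: converse_rtranclE)
  have vE: "a ~= b & 2 * a <= N & 2 * b <= N" if "(a, b) \<in> E" for a b using val that by (auto simp: valid_edges_def)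
  have "b ~= 0 & 2 * b <= 2" using b vE[of 0 b] vE[of b 0] N2 by auto
  then have "b = 1" by simp
  with b have "(0, 1) \<in> E \<or> (1, 0) \<in> E" by simp
  moreover have "v1 = 0 & v2 = 1 \<or> v1 = 1 & v2 = 0" using v N2 by auto
  ultimately show False using v by auto
 qed
 \<comment> \<open>The cross product of vertices 0 and 1 as a polynomial expression.\<close>
 define x where "x = Add (Mul (Coord 0) (Coord 3)) (Mul (Const (-1)) (Mul (Coord 1) (Coord 2)))"
 have x: "eval NF x w = cr (pos 0 w) (pos 1 w)" for w by (simp add: x_def pos_def cr_def numeral_3_eq_3)
 define z :: "nat => real" where "z i = (if i = 0 \<or> i = 3 then 1 else 0)" for i
 have "z \<in> supp_below N" using N4 by (auto simp: z_def supp_below_def)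
 moreover have "eval NF x z ~= 0" by (simp add: x_def z_def)
 moreover have "edges_in {} x" by (simp add: x_def)
 ultimately have "dense_open N (%w. cr (pos 0 w) (pos 1 w) ~= 0)" using dense_open_polynomial[of x N z] eN unfolding x by blast
 then have dn: "dense_open N (%w. w \<in> edge_nonzero E & cr (pos 0 w) (pos 1 w) ~= 0)"
  by (rule dense_open_conj[OF dense_open_edge_nonzero[OF val]])
 define U where "U = {w \<in> nbox N q0 r0. w \<in> edge_nonzero E & cr (pos 0 w) (pos 1 w) ~= 0}"
 interpret rigid_framework b1 b2 N E v1 v2 U
 proof
  show "valid_edges N E" "pinned_connected N E" "4 <= N" by (fact val conn N4)+
  show "EX r>0. nbox N y r \<subseteq> U" if y: "y \<in> U" for y
  proof -
   obtain s where s: "s > 0" "nbox N y s \<subseteq> nbox N q0 r0" using nbox_subset[of y N q0 r0] y by (auto simp: U_def)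
   obtain t where t: "t > 0" "!!w. w \<in> nbox N y t ==> w \<in> edge_nonzero E & cr (pos 0 w) (pos 1 w) ~= 0"
    using dense_openD(1)[OF dn, of y] y nbox_supp by (auto simp: U_def)
   have "nbox N y (min s t) \<subseteq> U" using s(2) t(2) nbox_mono[of "min s t" s N y] nbox_mono[of "min s t" t N y] by (auto simp: U_def)
   then show ?thesis using s(1) t(1) by (intro exI[of _ "min s t"]) simp
  qed
  show "y \<in> supp_below N" if "y \<in> U" for y using that nbox_supp by (auto simp: U_def)
  show "y \<in> edge_nonzero E" "cr (pos 0 y) (pos 1 y) ~= 0" if "y \<in> U" for y using that by (auto simp: U_def)
 next
  fix y y' assume y: "y \<in> U" and y': "y' \<in> connected_framework.fibre b1 b2 N E y"
   and eq: "norm (pos v1 y' - pos v2 y') = norm (pos v1 y - pos v2 y)"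
  interpret connected_framework b1 b2 N E by unfold_locales (fact val conn)+
  show "EX g. lin_iso g & y' = act g y" using rigid[of y y'] y y' eq by (simp add: U_def fibre_def)
 qed
 have "U ~= {}" using dense_openD(2)[OF dn q0] by (auto simp: U_def)
 from exists_independent_edges[OF this]
 show "EX p:nbox N q0 r0. p \<in> edge_nonzero E & (EX rw. (ALL i<N. EX e:E. rw i = ed e) & ddet N (jac rw p) ~= 0)"
  by (auto simp: U_def)
qed

end

section \<open>Placing the two new vertices\<close>

context analytic_plane begin

lemma norm_deriv_le:
 assumes "x ~= 0"
 shows "\<bar>norm_deriv x d\<bar> <= norm d"
proof -
 have lim: "((%t. (norm (x + (0 + t) *\<^sub>R d) - norm (x + 0 *\<^sub>R d)) / t) \<longlongrightarrow> norm_deriv x d) (at 0)"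
  using norm_has_derivative[OF assms, of d] unfolding DERIV_def .
 have "\<bar>(norm (x + (0 + t) *\<^sub>R d) - norm (x + 0 *\<^sub>R d)) / t\<bar> <= norm d" for t
 proof (cases "t = 0")
  case False
  have "\<bar>norm (x + t *\<^sub>R d) - norm x\<bar> <= norm (x + t *\<^sub>R d - x)" by (rule norm_triangle_ineq3)
  then show ?thesis using False by (simp add: abs_divide divide_le_eq mult.commute)
 qed simp
 then show ?thesis using tendsto_upperbound[OF tendsto_rabs[OF lim]] by (simp add: always_eventually)
qed

lemma norm_deriv_self:
 assumes "x ~= 0"
 shows "norm_deriv x x = norm x"
proof -
 have "((%t. norm (x + t *\<^sub>R x)) has_real_derivative norm x) (at 0)"
 proof (rule DERIV_cong_ev[THEN iffD2, OF refl _ refl])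
  show "\<forall>\<^sub>F t in nhds 0. norm (x + t *\<^sub>R x) = norm x + t * norm x"
   unfolding eventually_nhds_metric
  proof (intro exI[of _ 1] conjI allI impI)
   fix t :: real assume "dist t 0 < 1"
   then have "1 + t > 0" by (auto simp: dist_real_def)
   moreover have "x + t *\<^sub>R x = (1 + t) *\<^sub>R x" by (simp add: scaleR_left_distrib)
   ultimately have "norm (x + t *\<^sub>R x) = (1 + t) * norm x" by (simp only: norm_scaleR abs_of_pos)
   then show "norm (x + t *\<^sub>R x) = norm x + t * norm x" by (simp add: algebra_simps)
  qed simp
  show "((%t. norm x + t * norm x) has_real_derivative norm x) (at 0)" by (auto intro!: derivative_eq_intros)
 qed
 then show ?thesis using norm_has_derivative[OF assms, of x] DERIV_unique by blast
qed

text \<open>A dependence would make one functional attain its norm at two different unit vectors,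
  one taken with a sign, hence also at their midpoint, which is shorter by strict convexity.\<close>

lemma norm_deriv_independent:
 assumes xy: "cr x y ~= 0" and dep: "!!d. r * norm_deriv x d + s * norm_deriv y d = 0"
 shows "r = 0 & s = 0"
proof -
 have nz: "x ~= 0" "y ~= 0" using xy by (auto simp: cr_simps(1-7,9,10))
 have s: "s = 0" if "r = 0" using dep[of y] that norm_deriv_self[OF nz(2)] nz by simp
 have r: "r = 0" if "s = 0" using dep[of x] that norm_deriv_self[OF nz(1)] nz by simp
 show ?thesis
 proof (rule ccontr)
  assume "\<not> ?thesis"
  then have rs: "r ~= 0" "s ~= 0" using r s by auto
  define l where "l = - r / s"
  have l: "norm_deriv y d = l * norm_deriv x d" for d using dep[of d] rs by (simp add: l_def field_simps)
  have l0: "l ~= 0" using rs by (simp add: l_def)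
  have "\<bar>l\<bar> * norm x <= 1 * norm x" using norm_deriv_le[OF nz(2), of x] norm_deriv_self[OF nz(1)] by (simp add: l abs_mult)
  then have l1: "\<bar>l\<bar> <= 1" using nz(1) by simp
  have ly: "l * norm_deriv x y = norm y" using norm_deriv_self[OF nz(2)] l by simp
  then have "\<bar>l\<bar> * \<bar>norm_deriv x y\<bar> = norm y" by (metis abs_mult abs_norm_cancel)
  moreover have "\<bar>l\<bar> * \<bar>norm_deriv x y\<bar> <= \<bar>l\<bar> * norm y" using norm_deriv_le[OF nz(1)] by (intro mult_left_mono) auto
  ultimately have "1 * norm y <= \<bar>l\<bar> * norm y" by simp
  then have "\<bar>l\<bar> = 1" using l1 nz(2) by simp
  then have ll: "l * l = 1" by (metis abs_mult_self_eq mult_1)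
  then have xy': "norm_deriv x y = l * norm y" using ly by (metis mult.assoc mult_1)
  define u v where "u = (1 / norm x) *\<^sub>R x" "v = (l / norm y) *\<^sub>R y"
  have nu: "norm u = 1" "norm v = 1" using nz \<open>\<bar>l\<bar> = 1\<close> by (simp_all add: u_v_def)
  have "u ~= v"
  proof
   assume "u = v"
   then have "cr u v = 0" by (simp add: cr_simps(1-7,9,10))
   then show False using xy nz l0 by (simp add: u_v_def cr_simps(1-7,9,10))
  qed
  from strictly_convex[OF _ this] have "norm ((1/2) *\<^sub>R (u + v)) < 1" using nu by simp
  moreover have "norm_deriv x ((1/2) *\<^sub>R (u + v)) = 1"
  proof -
   have "(1/2) *\<^sub>R (u + v) = (1 / (2 * norm x)) *\<^sub>R x + (l / (2 * norm y)) *\<^sub>R y"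
    by (simp add: u_v_def scaleR_add_right)
   then show ?thesis using nz ll by (simp add: norm_deriv_linear norm_deriv_self xy')
  qed
  ultimately show False using norm_deriv_le[OF nz(1), of "(1/2) *\<^sub>R (u + v)"] by simp
 qed
qed

text \<open>After translating the second centre to the origin, the two distances and the coordinates
  of the first centre form a square system of size 4, nonsingular since the two gradients are
  independent. Counting that centre among the unknowns makes the result uniform in the
  centres.\<close>

lemma two_distances_injective:
 assumes ind: "cr (u - c1) (u - c2) ~= 0"
 shows "EX dlt>0. ALL c1' c2' z z'. norm (c1' - c1) < dlt --> norm (c2' - c2) < dlt --> norm (z - u) < dlt --> norm (z' - u) < dlt -->
  norm (z - c1') = norm (z' - c1') --> norm (z - c2') = norm (z' - c2') --> z = z'"
proof -
 define cfg where "cfg z c i = (if i = 0 then co1 z else if i = 1 then co2 z else if i = 2 then co1 c else if i = 3 then co2 c else 0)"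
  for z c :: 'a and i :: nat
 have pc: "pos 0 (cfg z c) = z" "pos 1 (cfg z c) = c" "pos 2 (cfg z c) = 0" "pos (Suc 0) (cfg z c) = c" for z c
  by (simp_all add: pos_def cfg_def numeral_3_eq_3)
 have cs: "cfg z c \<in> supp_below 4" for z c by (simp add: cfg_def supp_below_def)
 define rw where "rw i = (if i = 0 then ed (0, 1) else if i = 1 then ed (0, 2) else Coord i)" for i :: nat
 define y where "y = cfg (u - c2) (c1 - c2)"
 have nz: "u - c1 ~= 0" "u - c2 ~= 0" using ind by (auto simp: cr_simps(1-7,9,10))
 have yE: "y \<in> edge_nonzero {(0, 1), (0, 2)}" using nz by (simp add: edge_nonzero_iff y_def pc)
 have det: "ddet 4 (jac rw y) ~= 0"
 proof
  assume "ddet 4 (jac rw y) = 0"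
  from ddet_0_imp_dependent_rows[OF this] obtain c where
   c: "EX i<4. c i ~= 0" "!!k. k < 4 ==> (\<Sum>i<4. c i * jac rw y i k) = 0" by blast
  have sum4: "(\<Sum>i<4. f i) = f 0 + f 1 + f 2 + f (3::nat)" for f :: "nat => real" by (simp add: eval_nat_numeral)
  have pu: "pos 0 (unit_coord 0) = pt 1 0" "pos 0 (unit_coord 1) = pt 0 1" "pos 1 (unit_coord 0) = 0" "pos 1 (unit_coord 1) = 0"
   "pos 2 (unit_coord 0) = 0" "pos 2 (unit_coord 1) = 0" by (simp_all add: pos_def unit_coord_def)
  have py: "pos 0 y - pos 1 y = u - c1" "pos 0 y - pos 2 y = u - c2" by (simp_all add: y_def pc)
  have j01: "jac rw y 0 k = norm_deriv (u - c1) (pos 0 (unit_coord k) - pos 1 (unit_coord k))"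
   "jac rw y 1 k = norm_deriv (u - c2) (pos 0 (unit_coord k) - pos 2 (unit_coord k))" for k
   unfolding jac_def rw_def by (simp_all add: eval_Du_ed py py[unfolded One_nat_def])
  have j23: "jac rw y 2 k = unit_coord k 2" "jac rw y 3 k = unit_coord k 3" for k
   unfolding jac_def rw_def by simp_all
  have e: "c 0 * norm_deriv (u - c1) (pt 1 0) + c 1 * norm_deriv (u - c2) (pt 1 0) = 0"
   "c 0 * norm_deriv (u - c1) (pt 0 1) + c 1 * norm_deriv (u - c2) (pt 0 1) = 0"
   using c(2)[of 0] c(2)[of 1] unfolding sum4 j01 j23 pu by (simp_all add: unit_coord_def)
  have "c 0 * norm_deriv (u - c1) d + c 1 * norm_deriv (u - c2) d = 0" for d
  proof -
   have "norm_deriv x d = co1 d * norm_deriv x (pt 1 0) + co2 d * norm_deriv x (pt 0 1)" for x by (simp add: norm_deriv_def)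
   then have "c 0 * norm_deriv (u - c1) d + c 1 * norm_deriv (u - c2) d =
     co1 d * (c 0 * norm_deriv (u - c1) (pt 1 0) + c 1 * norm_deriv (u - c2) (pt 1 0)) +
     co2 d * (c 0 * norm_deriv (u - c1) (pt 0 1) + c 1 * norm_deriv (u - c2) (pt 0 1))"
    by (simp add: algebra_simps)
   then show ?thesis using e by simp
  qed
  from norm_deriv_independent[OF ind this] have c01: "c 0 = 0" "c 1 = 0" by auto
  have "c 2 = 0" "c 3 = 0" using c(2)[of 2] c(2)[of 3] c01 unfolding sum4 j23 by (simp_all add: unit_coord_def)
  then have "c i = 0" if "i < 4" for i using c01 that by (auto simp: eval_nat_numeral less_Suc_eq)
  then show False using c(1) by blast
 qed
 have "EX r>0. EX C>0. ALL a:nbox 4 y r. ALL b:nbox 4 y r. ALL k. \<bar>a k - b k\<bar> <= C * (\<Sum>i<4. \<bar>eval NF (rw i) a - eval NF (rw i) b\<bar>)"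
  by (rule local_bi_lipschitz[OF _ _ yE det]) (auto simp: rw_def edges_in_ed y_def cs)
 then obtain r C where r: "r > 0" "!!a b k. a \<in> nbox 4 y r ==> b \<in> nbox 4 y r ==> \<bar>a k - b k\<bar> <= C * (\<Sum>i<4. \<bar>eval NF (rw i) a - eval NF (rw i) b\<bar>)"
  by blast
 obtain K where K: "K > 0" "!!x. \<bar>co1 x\<bar> + \<bar>co2 x\<bar> <= K * norm x" using coords_bounded by blast
 define dlt where "dlt = r / (2 * K)"
 have dlt: "dlt > 0" using r(1) K(1) by (simp add: dlt_def)
 have co: "\<bar>co1 x\<bar> < r" "\<bar>co2 x\<bar> < r" if "norm x < 2 * dlt" for x
 proof -
  have "K * norm x < K * (2 * dlt)" using that K(1) by (intro mult_strict_left_mono) auto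
  also have "... = r" using K(1) by (simp add: dlt_def)
  finally show "\<bar>co1 x\<bar> < r" "\<bar>co2 x\<bar> < r" using K(2)[of x] by linarith+
 qed
 have mem: "cfg (z - c2') (c1' - c2') \<in> nbox 4 y r"
  if h: "norm (c1' - c1) < dlt" "norm (c2' - c2) < dlt" "norm (z - u) < dlt" for z c1' c2'
 proof -
  have "norm ((z - c2') - (u - c2)) <= norm (z - u) + norm (c2' - c2)"
   using norm_triangle_ineq4[of "z - u" "c2' - c2"] by (simp add: algebra_simps)
  then have n1: "norm ((z - c2') - (u - c2)) < 2 * dlt" using h by simp
  have "norm ((c1' - c2') - (c1 - c2)) <= norm (c1' - c1) + norm (c2' - c2)"
   using norm_triangle_ineq4[of "c1' - c1" "c2' - c2"] by (simp add: algebra_simps)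
  then have n2: "norm ((c1' - c2') - (c1 - c2)) < 2 * dlt" using h by simp
  show ?thesis using co[OF n1] co[OF n2] r(1) cs unfolding nbox_def by (auto simp: y_def cfg_def co_simps)
 qed
 have "z = z'" if h: "norm (c1' - c1) < dlt" "norm (c2' - c2) < dlt" "norm (z - u) < dlt" "norm (z' - u) < dlt"
   "norm (z - c1') = norm (z' - c1')" "norm (z - c2') = norm (z' - c2')" for c1' c2' z z'
 proof -
  let ?a = "cfg (z - c2') (c1' - c2')" and ?b = "cfg (z' - c2') (c1' - c2')"
  have "eval NF (rw i) ?a = eval NF (rw i) ?b" if "i < 4" for i
   using h(5,6) by (auto simp: rw_def eval_ed pc cfg_def)
  then have "?a k = ?b k" for k using r(2)[OF mem[OF h(1,2,3)] mem[OF h(1,2,4)], of k] by simp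
  then have "?a = ?b" by auto
  then have "pos 0 ?a = pos 0 ?b" by simp
  then show ?thesis by (simp add: pc)
 qed
 then show ?thesis using dlt by blast
qed

text \<open>Shortening the longer vector to the length of the other reduces equality to the strict
  midpoint inequality.\<close>

lemma strict_triangle:
 fixes x y :: 'a
 assumes eq: "norm (x + y) = norm x + norm y" and nz: "x ~= 0" "y ~= 0"
 shows "EX c>0. y = c *\<^sub>R x"
proof -
 have main: "EX c>0. y = c *\<^sub>R x" if eq: "norm (x + y) = norm x + norm y" and nz: "x ~= 0" "y ~= 0" and le: "norm x <= norm y" for x y :: 'a
 proof -
  define c where "c = norm x / norm y"
  have c: "c > 0" "c <= 1" using nz le by (simp_all add: c_def)
  have nc: "norm (c *\<^sub>R y) = norm x" using nz by (simp add: c_def)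
  have "x = c *\<^sub>R y"
  proof (rule ccontr)
   assume "x ~= c *\<^sub>R y"
   then have "norm ((1/2) *\<^sub>R (x + c *\<^sub>R y)) < norm x" by (intro strictly_convex) (use nc in auto)
   then have lt: "norm (x + c *\<^sub>R y) < 2 * norm x" by simp
   have "norm (x + y) <= norm (x + c *\<^sub>R y) + norm ((1 - c) *\<^sub>R y)"
    using norm_triangle_ineq[of "x + c *\<^sub>R y" "(1 - c) *\<^sub>R y"] by (simp add: algebra_simps)
   also have "norm ((1 - c) *\<^sub>R y) = norm y - norm x" using c nz by (simp add: c_def left_diff_distrib)
   finally show False using lt eq by simp
  qed
  then have "y = (1 / c) *\<^sub>R x" using c(1) by simp
  then show ?thesis using c(1) by (intro exI[of _ "1 / c"]) auto
 qed
 show ?thesis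
 proof (cases "norm x <= norm y")
  case False
  then obtain c where c: "c > 0" "x = c *\<^sub>R y" using main[of y x] eq nz by (auto simp: add.commute)
  then have "y = (1 / c) *\<^sub>R x" by simp
  then show ?thesis using c(1) by (intro exI[of _ "1 / c"]) auto
 qed (rule main[OF eq nz])
qed

lemma off_line_strict:
 assumes off: "cr e U ~= 0"
 shows "norm e < norm U + norm (U - e)" "\<bar>norm U - norm (U - e)\<bar> < norm e"
proof -
 have par: "norm (x + y) < norm x + norm y" if "cr x y ~= 0" for x y
 proof (rule ccontr)
  assume "\<not> ?thesis"
  then have "norm (x + y) = norm x + norm y" using norm_triangle_ineq[of x y] by simp
  moreover have "x ~= 0" "y ~= 0" using that by (auto simp: cr_simps(1-7,9,10))
  ultimately obtain c where "y = c *\<^sub>R x" using strict_triangle by blast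
  then show False using that by (simp add: cr_simps(1-7,9,10))
 qed
 have "cr U (e - U) ~= 0" using off cr_simps(8)[of U e] by (simp add: cr_simps(1,6))
 from par[OF this] show "norm e < norm U + norm (U - e)" by (simp add: norm_minus_commute)
 have "cr (U - e) e ~= 0" using off cr_simps(8)[of U e] by (simp add: cr_simps(1,7))
 from par[OF this] have 1: "norm U < norm (U - e) + norm e" by simp
 have "cr U (- e) ~= 0" using off cr_simps(8)[of U e] cr_simps(2)[of U "-1" e] by simp
 from par[OF this] have 2: "norm (U - e) < norm U + norm e" by simp
 show "\<bar>norm U - norm (U - e)\<bar> < norm e" using 1 2 by linarith
qed

lemma on_line_degenerate:
 assumes "cr e Z = 0" "e ~= 0"
 shows "norm e = norm Z + norm (Z - e) \<or> \<bar>norm Z - norm (Z - e)\<bar> = norm e"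
proof -
 obtain s where s: "Z = s *\<^sub>R e" using cr_eq_0[OF assms] by blast
 have "Z - e = (s - 1) *\<^sub>R e" by (simp add: s scaleR_diff_left)
 then have n: "norm Z = \<bar>s\<bar> * norm e" "norm (Z - e) = \<bar>s - 1\<bar> * norm e" by (simp_all add: s)
 consider "0 <= s & s <= 1" | "s > 1" | "s < 0" by linarith
 then show ?thesis by cases (auto simp: n algebra_simps)
qed

lemma plane_subsequence:
 fixes X :: "nat => 'a"
 assumes "!!n. norm (X n) <= B"
 shows "EX l r. strict_mono (r :: nat => nat) & (%n. X (r n)) \<longlonglongrightarrow> l"
proof -
 obtain K where K: "K > 0" "!!x. \<bar>co1 x\<bar> + \<bar>co2 x\<bar> <= K * norm x" using coords_bounded by blast
 define Y where "Y n i = (if i = 0 then co1 (X n) else co2 (X n))" for n and i :: nat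
 have "\<bar>Y n i\<bar> <= K * B" for n i
 proof -
  have "K * norm (X n) <= K * B" using assms K(1) by (intro mult_left_mono) auto
  then have "\<bar>co1 (X n)\<bar> <= K * B" "\<bar>co2 (X n)\<bar> <= K * B" using K(2)[of "X n"] by linarith+
  then show ?thesis by (simp add: Y_def)
 qed
 then obtain l r where lr: "strict_mono (r :: nat => nat)" "!!i. i < 2 ==> (%n. Y (r n) i) \<longlonglongrightarrow> l i"
  using finite_coordinates_subsequence[of 2 Y] by blast
 have "(%n. pt (Y (r n) 0) (Y (r n) 1)) \<longlonglongrightarrow> pt (l 0) (l 1)"
  unfolding pt_def by (intro tendsto_intros lr(2)) auto
 then show ?thesis using lr(1) by (auto simp: Y_def)
qed

text \<open>Lying off the line through \<open>a\<close> and \<open>b\<close> can be read off from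
  the two distances, by strictness of the triangle inequalities. Infinitely many solutions would
  accumulate at a solution off the line, where two distances determine a point locally.\<close>

lemma two_circles_finite:
 assumes off: "cr (b - a) (u - a) ~= 0"
 shows "finite {z. norm (z - a) = norm (u - a) & norm (z - b) = norm (u - b)}" (is "finite ?T")
  and "!!z. norm (z - a) = norm (u - a) ==> norm (z - b) = norm (u - b) ==> cr (b - a) (z - a) ~= 0"
proof -
 show offz: "cr (b - a) (z - a) ~= 0" if z: "norm (z - a) = norm (u - a)" "norm (z - b) = norm (u - b)" for z
 proof
  assume "cr (b - a) (z - a) = 0"
  moreover have "b - a ~= 0" using off by (auto simp: cr_simps(1-7,9,10))
  ultimately show False using on_line_degenerate[of "b - a" "z - a"] off_line_strict[OF off] z by auto
 qed
 show "finite ?T"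
 proof (rule ccontr)
  assume "infinite ?T"
  then obtain f :: "nat => 'a" where f: "inj f" "range f \<subseteq> ?T" using infinite_countable_subset by blast
  have fT: "norm (f n - a) = norm (u - a)" "norm (f n - b) = norm (u - b)" for n using f(2) by auto
  have "norm (f n) <= norm (u - a) + norm a" for n using norm_triangle_ineq[of "f n - a" a] fT(1)[of n] by simp
  then obtain l r where lr: "strict_mono (r :: nat => nat)" "(%n. f (r n)) \<longlonglongrightarrow> l" using plane_subsequence by blast
  have lim: "(%n. norm (f (r n) - c)) \<longlonglongrightarrow> norm (l - c)" for c by (intro tendsto_intros lr(2))
  have l: "norm (l - a) = norm (u - a)" "norm (l - b) = norm (u - b)"
   using lim[of a] lim[of b] by (simp_all add: fT LIMSEQ_const_iff)
  have "cr (l - a) (l - b) = cr (b - a) (l - a)" by (simp add: cr_def co_simps algebra_simps)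
  then have "cr (l - a) (l - b) ~= 0" using offz[OF l] by simp
  from two_distances_injective[OF this] obtain dlt where dlt: "dlt > 0" "!!z z'. norm (z - l) < dlt ==> norm (z' - l) < dlt ==>
   norm (z - a) = norm (z' - a) ==> norm (z - b) = norm (z' - b) ==> z = z'" by (metis cancel_comm_monoid_add_class.diff_cancel norm_zero)
  have "\<forall>\<^sub>F n in sequentially. dist (f (r n)) l < dlt" by (rule tendstoD[OF lr(2) dlt(1)])
  then obtain n where n: "!!m. m >= n ==> norm (f (r m) - l) < dlt" by (auto simp: eventually_sequentially dist_norm)
  have "f (r n) = f (r (Suc n))" by (rule dlt(2)) (use n fT in auto)
  then have "r n = r (Suc n)" using f(1) by (simp add: inj_eq)
  then show False using lr(1) by (metis lessI less_irrefl strict_monoD)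
 qed
qed

text \<open>If two points off a line are equidistant from all its points, then they agree or are exchanged by a
 linear isometry reversing the line.\<close>

lemma equidistant_line:
 assumes off: "cr e U ~= 0" and eq: "!!t. norm (U - t *\<^sub>R e) = norm (Z - t *\<^sub>R e)"
  and asym: "!!g. lin_iso g ==> g e = e ==> g = id"
 shows "Z = U"
proof -
 obtain C where C: "C > 0" "!!x y. \<bar>cr x y\<bar> <= C * norm x * norm y" using cr_bounded by blast
 have e0: "e ~= 0" and U0: "U ~= 0" using off by (auto simp: cr_simps(1-7,9,10))
 define gam kap where "gam = cr Z U / cr e U" "kap = cr e Z / cr e U"
 have Z: "Z = kap *\<^sub>R U + gam *\<^sub>R e"
 proof -
  have "cr e U *\<^sub>R Z = cr e U *\<^sub>R (kap *\<^sub>R U + gam *\<^sub>R e)"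
   using cramer[of e U Z] off by (simp add: gam_kap_def scaleR_add_right add.commute)
  then show ?thesis using off by simp
 qed
 define f where "f t = norm (U - t *\<^sub>R e)" for t
 \<comment> \<open>The distance of \<open>U\<close> from the line, positive because \<open>U\<close>
   is off it.\<close>
 define m where "m = (INF t. f t)"
 have low: "f t >= \<bar>cr e U\<bar> / (C * norm e)" for t
 proof -
  have "\<bar>cr e U\<bar> = \<bar>cr e (U - t *\<^sub>R e)\<bar>" by (simp add: cr_simps(1,2,6))
  also have "... <= C * norm e * f t" unfolding f_def by (rule C(2))
  finally show ?thesis using C(1) e0 by (simp add: divide_le_eq mult.commute)
 qed
 have bdd: "bdd_below (range f)" by (rule bdd_belowI2) (rule low)
 have mle: "m <= f t" for t unfolding m_def by (rule cINF_lower[OF bdd]) simp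
 have "\<bar>cr e U\<bar> / (C * norm e) <= m" unfolding m_def by (rule cINF_greatest) (use low in auto)
 moreover have "\<bar>cr e U\<bar> / (C * norm e) > 0" using off C(1) e0 by simp
 ultimately have m: "m > 0" by linarith
 have k0: "kap ~= 0"
 proof
  assume "kap = 0"
  then have "f gam = 0" using eq[of gam] Z by (simp add: f_def)
  then show False using mle[of gam] m by simp
 qed
 \<comment> \<open>Passing from \<open>U\<close> to \<open>Z\<close> rescales the distances to
   points of the line by |kap|; comparing infima gives |kap| = 1.\<close>
 have scale: "f (kap * s + gam) = \<bar>kap\<bar> * f s" for s
 proof -
  have "Z - (kap * s + gam) *\<^sub>R e = kap *\<^sub>R (U - s *\<^sub>R e)" by (simp add: Z algebra_simps)
  then show ?thesis using eq[of "kap * s + gam"] by (simp add: f_def)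
 qed
 have "m >= \<bar>kap\<bar> * m" unfolding m_def[of] 
 proof (rule cINF_greatest)
  fix t
  have "f t = \<bar>kap\<bar> * f ((t - gam) / kap)" using scale[of "(t - gam) / kap"] k0 by simp
  then show "\<bar>kap\<bar> * (INF t. f t) <= f t" using mle[of "(t - gam) / kap"] by (simp add: m_def[symmetric] mult_left_mono)
 qed simp
 then have k1: "\<bar>kap\<bar> <= 1" using m by (simp add: mult_le_cancel_right)
 have "m >= m / \<bar>kap\<bar>" unfolding m_def[of]
 proof (rule cINF_greatest)
  fix t
  have "m <= \<bar>kap\<bar> * f t" using scale[of t] mle[of "kap * t + gam"] by simp
  then show "(INF t. f t) / \<bar>kap\<bar> <= f t" using k0 by (simp add: m_def[symmetric] divide_le_eq mult.commute)
 qed simp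
 then have "\<bar>kap\<bar> = 1" using m k0 k1 by (simp add: divide_le_eq)
 then consider "kap = 1" | "kap = - 1" by linarith
 then show ?thesis
 proof cases
  case 1
  \<comment> \<open>For \<open>kap = 1\<close> the function \<open>f\<close> repeats under shifts by
    \<open>gam\<close>, which its growth excludes unless \<open>gam = 0\<close>.\<close>
  have per: "f (real n * gam) = f 0" for n
  proof (induction n)
   case (Suc n)
   have "f (real (Suc n) * gam) = f (1 * (real n * gam) + gam)" by (simp add: algebra_simps)
   then show ?case using scale[of "real n * gam"] 1 Suc by simp
  qed simp
  have "gam = 0"
  proof (rule ccontr)
   assume g: "gam ~= 0"
   obtain n where n: "real n > 2 * norm U / (\<bar>gam\<bar> * norm e)" using reals_Archimedean2 by blast
   have "2 * norm U < real n * (\<bar>gam\<bar> * norm e)" using n g e0 by (simp add: divide_less_eq)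
   moreover have "norm ((real n * gam) *\<^sub>R e) <= f (real n * gam) + norm U"
    unfolding f_def using norm_triangle_ineq4[of U "U - (real n * gam) *\<^sub>R e"] by simp
   ultimately show False using per[of n] by (simp add: f_def abs_mult mult.assoc)
  qed
  then show ?thesis using Z 1 by simp
 next
  case 2
  have refl: "f (gam - s) = f s" for s using scale[of s] 2 by (simp add: algebra_simps)
  \<comment> \<open>The linear map that fixes \<open>e\<close> and sends \<open>U\<close> to
    \<open>gam *\<^sub>R e - U\<close>; by \<open>refl\<close> it preserves the norm.\<close>
  define g where "g y = (cr y U / cr e U) *\<^sub>R e - (cr e y / cr e U) *\<^sub>R (U - gam *\<^sub>R e)" for y
  have lin: "linear g"
   by (rule linearI) (simp_all add: g_def cr_simps(2-5) add_divide_distrib algebra_simps)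
  have "norm (g y) = norm y" for y
  proof -
   define s t where "s = cr e y / cr e U" "t = cr y U / cr e U"
   have y: "y = s *\<^sub>R U + t *\<^sub>R e"
   proof -
    have "cr e U *\<^sub>R y = cr e U *\<^sub>R (s *\<^sub>R U + t *\<^sub>R e)"
     using cramer[of e U y] off by (simp add: s_t_def scaleR_add_right add.commute)
    then show ?thesis using off by simp
   qed
   have gy: "g y = t *\<^sub>R e - s *\<^sub>R (U - gam *\<^sub>R e)" by (simp add: g_def s_t_def)
   show ?thesis
   proof (cases "s = 0")
    case True then show ?thesis using y gy by simp
   next
    case False
    have "g y = (- s) *\<^sub>R (U - (gam + t / s) *\<^sub>R e)" using False by (simp add: gy algebra_simps)
    then have "norm (g y) = \<bar>s\<bar> * f (gam - (- (t / s)))" by (simp add: f_def)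
    also have "... = \<bar>s\<bar> * f (- (t / s))" by (simp only: refl)
    also have "... = norm (s *\<^sub>R (U - (- (t / s)) *\<^sub>R e))" by (simp add: f_def)
    also have "s *\<^sub>R (U - (- (t / s)) *\<^sub>R e) = y" using False by (simp add: y algebra_simps)
    finally show ?thesis .
   qed
  qed
  then have "lin_iso g" using lin by (simp add: lin_iso_def)
  moreover have "g e = e" using off by (simp add: g_def cr_simps(1))
  ultimately have "g = id" by (rule asym)
  then have "g U = U" by simp
  then have "- U + gam *\<^sub>R e = U" using off by (simp add: g_def cr_simps(1))
  then have "cr e (- U + gam *\<^sub>R e) = cr e U" by simp
  then have "cr e U = 0" by (simp add: cr_simps(1,2,6))
  then show ?thesis using off by simp
 qed
qed

end

section \<open>Generic placement of the new vertices\<close>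

context analytic_plane begin

text \<open>For each \<open>Z\<close> the two distances are analytic in \<open>t\<close> and cannot
  agree on an interval. Taking the points one after another, the interval of good parameters is
  shrunk each time.\<close>

lemma equidistant_generic:
 assumes off: "cr e U ~= 0" and asym: "!!g. lin_iso g ==> g e = e ==> g = id"
  and S: "finite S" "!!Z. Z \<in> S ==> cr e Z ~= 0 & Z ~= U"
 shows "EX t. 0 < t & t < 1 & (ALL Z:S. norm (U - t *\<^sub>R e) ~= norm (Z - t *\<^sub>R e))"
proof -
 have "EX t0 eta. eta > 0 & (ALL t. \<bar>t - t0\<bar> < eta --> 0 < t & t < 1 & (ALL Z:S. norm (U - t *\<^sub>R e) ~= norm (Z - t *\<^sub>R e)))"
  using S
 proof (induction S rule: finite_induct)
  case empty
  show ?case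
  proof (intro exI[of _ "1/2 :: real"] conjI allI impI)
   fix t :: real assume t: "\<bar>t - 1/2\<bar> < 1/2"
   show "0 < t" using t by linarith
   show "t < 1" using t by linarith
  qed simp_all
 next
  case (insert Z S)
  have "EX t0 eta. eta > 0 & (ALL t. \<bar>t - t0\<bar> < eta --> 0 < t & t < 1 & (ALL Z:S. norm (U - t *\<^sub>R e) ~= norm (Z - t *\<^sub>R e)))"
   by (rule insert.IH) (use insert.prems in blast)
  then obtain t0 eta where IH: "eta > 0" "!!t. \<bar>t - t0\<bar> < eta ==> 0 < t & t < 1 & (ALL Z:S. norm (U - t *\<^sub>R e) ~= norm (Z - t *\<^sub>R e))"
   by blast
  have Z: "cr e Z ~= 0" "Z ~= U" using insert.prems[of Z] by auto
  have off0: "W + t *\<^sub>R (- e) ~= 0" if "cr e W ~= 0" for W t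
  proof
   assume "W + t *\<^sub>R (- e) = 0"
   then have "W = t *\<^sub>R e" by simp
   then show False using that by (simp add: cr_simps(1,2))
  qed
  have "EX t. \<bar>t - t0\<bar> < eta & norm (U - t *\<^sub>R e) ~= norm (Z - t *\<^sub>R e)"
  proof (rule ccontr)
   assume "\<not> ?thesis"
   then have loc: "norm (U + t *\<^sub>R (- e)) = 1 * norm (Z + t *\<^sub>R (- e)) + 0" if "\<bar>t - t0\<bar> < eta" for t using that by auto
   have "norm (U + t *\<^sub>R (- e)) = 1 * norm (Z + t *\<^sub>R (- e)) + 0" for t
    by (rule norm_lines_identity[OF off0[OF off] off0[OF Z(1)] IH(1) loc])
   then have "norm (U - t *\<^sub>R e) = norm (Z - t *\<^sub>R e)" for t by simp
   from equidistant_line[OF off this asym] show False using Z(2) by simp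
  qed
  then obtain t1 where t1: "\<bar>t1 - t0\<bar> < eta" "norm (U - t1 *\<^sub>R e) - norm (Z - t1 *\<^sub>R e) ~= 0" by auto
  have "isCont (%t. norm (U - t *\<^sub>R e) - norm (Z - t *\<^sub>R e)) t1" by (intro continuous_intros)
  from continuous_at_avoid[OF this t1(2)]
  obtain d where d: "d > 0" "!!t. dist t1 t < d ==> norm (U - t *\<^sub>R e) - norm (Z - t *\<^sub>R e) ~= 0" by blast
  define eta' where "eta' = min d (eta - \<bar>t1 - t0\<bar>)"
  have "eta' > 0" using d(1) t1(1) by (simp add: eta'_def)
  moreover have "0 < t & t < 1 & (ALL Z:insert Z S. norm (U - t *\<^sub>R e) ~= norm (Z - t *\<^sub>R e))" if t: "\<bar>t - t1\<bar> < eta'" for t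
  proof -
   have "\<bar>t - t0\<bar> < eta" "dist t1 t < d" using t unfolding eta'_def dist_real_def by linarith+
   then show ?thesis using IH(2)[of t] d(2)[of t] by auto
  qed
  ultimately show ?case by blast
 qed
 then obtain t0 eta where "eta > 0" "!!t. \<bar>t - t0\<bar> < eta ==> 0 < t & t < 1 & (ALL Z:S. norm (U - t *\<^sub>R e) ~= norm (Z - t *\<^sub>R e))" by blast
 then show ?thesis by (intro exI[of _ t0]) simp
qed

text \<open>The two distances add up to that of the ends, so strictness of the triangle inequality
  leaves no other point.\<close>

lemma segment_point_unique:
 fixes a b z :: 'a
 assumes ab: "a ~= b" and t: "0 < t" "t < 1"
  and z: "norm (z - a) = norm (t *\<^sub>R (b - a))" "norm (z - b) = norm ((1 - t) *\<^sub>R (b - a))"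
 shows "z = a + t *\<^sub>R (b - a)"
proof -
 have n: "norm (z - a) = t * norm (b - a)" "norm (b - z) = (1 - t) * norm (b - a)" using z t by (simp_all add: norm_minus_commute)
 have "norm ((z - a) + (b - z)) = norm (z - a) + norm (b - z)" unfolding n by (simp add: algebra_simps)
 moreover have "t * norm (b - a) > 0" "(1 - t) * norm (b - a) > 0" using ab t by simp_all
 then have "z - a ~= 0" "b - z ~= 0" using n by (metis less_irrefl norm_zero)+
 ultimately obtain c where c: "c > 0" "b - z = c *\<^sub>R (z - a)" using strict_triangle[of "z - a" "b - z"] by blast
 have ba: "b - a = (1 + c) *\<^sub>R (z - a)" using c(2) by (simp add: algebra_simps)
 then have "norm (b - a) = (1 + c) * norm (z - a)" using c(1) by simp
 then have "1 * norm (b - a) = ((1 + c) * t) * norm (b - a)" using n(1) by simp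
 then have "(1 + c) * t = 1" using ab by simp
 then have "t *\<^sub>R (b - a) = z - a" unfolding ba by (simp add: mult.commute)
 then show ?thesis by simp
qed

lemma tendsto_inverse_bound:
 fixes l :: "'b::real_normed_vector"
 assumes "!!n. norm (X n - l) < inverse (real (Suc n))"
 shows "X \<longlonglongrightarrow> l"
 by (rule LIM_zero_cancel, rule Lim_null_comparison[OF always_eventually LIMSEQ_inverse_real_of_nat])
  (use assms in \<open>auto intro: less_imp_le\<close>)

text \<open>Placing \<open>u2\<close> on the segment forces it; the generic position of \<open>u2\<close> then separates \<open>u1\<close> from the
 finitely many other points with the same distances to \<open>a\<close> and \<open>b\<close>.\<close>

lemma diamond_rigid:
 assumes ab: "a ~= b" and asym: "!!g. lin_iso g ==> g (b - a) = b - a ==> g = id" and eps: "eps > 0"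
 shows "EX u1 u2 dlt. dlt > 0 & norm (u1 - b) < eps & (ALL a' b' p q z1 z2.
  norm (a' - a) < dlt & norm (b' - b) < dlt & norm (p - u1) < dlt & norm (q - u2) < dlt &
  norm (z1 - a') = norm (p - a') & norm (z1 - b') = norm (p - b') &
  norm (z2 - a') = norm (q - a') & norm (z2 - b') = norm (q - b') & norm (z1 - z2) = norm (p - q) --> z1 = p & z2 = q)"
proof -
 define e where "e = b - a"
 have e0: "e ~= 0" using ab by (simp add: e_def)
 have "EX m. cr e m ~= 0"
 proof (rule ccontr)
  assume "\<not> ?thesis"
  then have "cr e (pt 1 0) = 0" "cr e (pt 0 1) = 0" by auto
  then have "co1 e = 0" "co2 e = 0" by (simp_all add: cr_def)
  then show False using e0 co_eqI[of e 0] by (simp add: co_simps)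
 qed
 then obtain m where m: "cr e m ~= 0" by blast
 then have m0: "m ~= 0" by (auto simp: cr_simps(10))
 \<comment> \<open>Close to \<open>b\<close>, as demanded, and off the line because \<open>m\<close>
   is not parallel to \<open>e\<close>.\<close>
 define u1 where "u1 = b + (eps / (2 * norm m)) *\<^sub>R m"
 have near: "norm (u1 - b) < eps" using eps m0 by (simp add: u1_def)
 have "u1 - a = e + (eps / (2 * norm m)) *\<^sub>R m" by (simp add: u1_def e_def)
 then have "cr e (u1 - a) = eps / (2 * norm m) * cr e m" by (simp add: cr_simps(1,2,4))
 then have off: "cr e (u1 - a) ~= 0" using m m0 eps by simp
 define T where "T = {z. norm (z - a) = norm (u1 - a) & norm (z - b) = norm (u1 - b)}"
 define S where "S = (%z. z - a) ` (T - {u1})"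
 have finS: "finite S" unfolding S_def T_def using two_circles_finite(1)[of b a u1] off by (simp add: e_def)
 have "cr e Z ~= 0 & Z ~= u1 - a" if "Z \<in> S" for Z
  using that two_circles_finite(2)[of b a u1] off by (auto simp: S_def T_def e_def)
 from equidistant_generic[OF off asym[folded e_def] finS this]
 obtain t where t: "0 < t" "t < 1" "!!Z. Z \<in> S ==> norm ((u1 - a) - t *\<^sub>R e) ~= norm (Z - t *\<^sub>R e)" by blast
 define w where "w = a + t *\<^sub>R e"
 have wa: "w - a = t *\<^sub>R e" by (simp add: w_def)
 have wb: "w - b = - ((1 - t) *\<^sub>R e)" by (simp add: w_def e_def algebra_simps)
 have sep: "z = u1" if z: "norm (z - a) = norm (u1 - a)" "norm (z - b) = norm (u1 - b)" "norm (z - w) = norm (u1 - w)" for z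
 proof (rule ccontr)
  assume "z ~= u1"
  then have "z - a \<in> S" using z by (auto simp: S_def T_def)
  from t(3)[OF this] show False using z(3) by (simp add: w_def diff_diff_eq)
 qed
 have "cr (u1 - a) (u1 - b) = cr e (u1 - a)" by (simp add: cr_def co_simps e_def algebra_simps)
 then have "cr (u1 - a) (u1 - b) ~= 0" using off by simp
 from two_distances_injective[OF this] obtain dlt1 where dlt1: "dlt1 > 0"
  "!!a' b' z z'. norm (a' - a) < dlt1 ==> norm (b' - b) < dlt1 ==> norm (z - u1) < dlt1 ==> norm (z' - u1) < dlt1 ==>
   norm (z - a') = norm (z' - a') ==> norm (z - b') = norm (z' - b') ==> z = z'" by blast
 \<comment> \<open>Seen from \<open>w\<close> the points \<open>a\<close> and \<open>b\<close> lie
   in parallel directions, so their distances give no independent gradients there; \<open>u1\<close>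
   replaces \<open>b\<close> as second centre.\<close>
 have "cr (w - a) (w - u1) = - t * cr e (u1 - a)" by (simp add: cr_def co_simps w_def algebra_simps)
 then have "cr (w - a) (w - u1) ~= 0" using off t(1) by simp
 from two_distances_injective[OF this] obtain dlt2 where dlt2: "dlt2 > 0"
  "!!a' b' z z'. norm (a' - a) < dlt2 ==> norm (b' - u1) < dlt2 ==> norm (z - w) < dlt2 ==> norm (z' - w) < dlt2 ==>
   norm (z - a') = norm (z' - a') ==> norm (z - b') = norm (z' - b') ==> z = z'" by blast
 \<comment> \<open>Violations of the claim at scale \<open>dlt\<close>. If they existed at every
   scale, a limit would be an exact solution, in which the second point is forced to
   \<open>w\<close> and then the first to \<open>u1\<close>; near that solution two distances
   determine a point.\<close>
 define bad where "bad dlt a' b' p q z1 z2 \<longleftrightarrow> norm (a' - a) < dlt & norm (b' - b) < dlt & norm (p - u1) < dlt & norm (q - w) < dlt &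
  norm (z1 - a') = norm (p - a') & norm (z1 - b') = norm (p - b') &
  norm (z2 - a') = norm (q - a') & norm (z2 - b') = norm (q - b') & norm (z1 - z2) = norm (p - q) & \<not> (z1 = p & z2 = q)"
  for dlt a' b' p q z1 z2
 have "EX dlt>0. ALL a' b' p q z1 z2. \<not> bad dlt a' b' p q z1 z2"
 proof (rule ccontr)
  assume neg: "\<not> ?thesis"
  have "EX s. case s of (a', b', p, q, z1, z2) => bad (inverse (real (Suc n))) a' b' p q z1 z2" for n
  proof -
   have "inverse (real (Suc n)) > 0" by simp
   then obtain a' b' p q z1 z2 where "bad (inverse (real (Suc n))) a' b' p q z1 z2" using neg by blast
   then show ?thesis by (intro exI[of _ "(a', b', p, q, z1, z2)"]) simp
  qed
  then have "ALL n. EX s. case s of (a', b', p, q, z1, z2) => bad (inverse (real (Suc n))) a' b' p q z1 z2" by blast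
  from choice[OF this] obtain s where s: "!!n. case s n of (a', b', p, q, z1, z2) => bad (inverse (real (Suc n))) a' b' p q z1 z2" by blast
  define A B P Q Z1 Z2 where "A n = fst (s n)" "B n = fst (snd (s n))" "P n = fst (snd (snd (s n)))" "Q n = fst (snd (snd (snd (s n))))"
   "Z1 n = fst (snd (snd (snd (snd (s n)))))" "Z2 n = snd (snd (snd (snd (snd (s n)))))" for n
  have bd: "bad (inverse (real (Suc n))) (A n) (B n) (P n) (Q n) (Z1 n) (Z2 n)" for n
   using s[of n] by (simp add: A_B_P_Q_Z1_Z2_def split: prod.splits)
  have A: "A \<longlonglongrightarrow> a" and B: "B \<longlonglongrightarrow> b" and P: "P \<longlonglongrightarrow> u1" and Q: "Q \<longlonglongrightarrow> w"
   by (rule tendsto_inverse_bound, use bd in \<open>simp add: bad_def\<close>)+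
  have eqs: "norm (Z1 n - A n) = norm (P n - A n)" "norm (Z1 n - B n) = norm (P n - B n)"
   "norm (Z2 n - A n) = norm (Q n - A n)" "norm (Z2 n - B n) = norm (Q n - B n)" "norm (Z1 n - Z2 n) = norm (P n - Q n)" for n
   using bd[of n] by (simp_all add: bad_def)
  have inv1: "inverse (real (Suc n)) <= 1" for n by (simp add: inverse_le_1_iff)
  have bdn: "norm X <= norm l + 1" if "norm (X - l) < inverse (real (Suc n))" for X l :: 'a and n
   using that inv1[of n] norm_triangle_sub[of X l] by linarith
  have AB: "norm (A n) <= norm a + 1" "norm (P n) <= norm u1 + 1" "norm (Q n) <= norm w + 1" for n
   using bd[of n] by (auto simp: bad_def intro!: bdn)
  have "norm (Z1 n) <= (norm a + 1) + (norm a + 1) + (norm u1 + 1)" for n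
   using eqs(1)[of n] AB(1,2)[of n] norm_triangle_sub[of "Z1 n" "A n"] norm_triangle_ineq4[of "P n" "A n"] by linarith
  then obtain l1 r where lr: "strict_mono (r :: nat => nat)" "(%n. Z1 (r n)) \<longlonglongrightarrow> l1" using plane_subsequence by blast
  have "norm (Z2 (r n)) <= (norm a + 1) + (norm a + 1) + (norm w + 1)" for n
   using eqs(3)[of "r n"] AB(1,3)[of "r n"] norm_triangle_sub[of "Z2 (r n)" "A (r n)"] norm_triangle_ineq4[of "Q (r n)" "A (r n)"] by linarith
  then obtain l2 r' where lr': "strict_mono (r' :: nat => nat)" "(%n. Z2 (r (r' n))) \<longlonglongrightarrow> l2"
   using plane_subsequence[of "%n. Z2 (r n)"] by blast
  define k where "k n = r (r' n)" for n
  have km: "strict_mono k" using lr(1) lr'(1) by (simp add: k_def strict_mono_def)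
  have sub: "(%n. X (k n)) \<longlonglongrightarrow> l" if "X \<longlonglongrightarrow> l" for X :: "nat => 'a" and l
   using LIMSEQ_subseq_LIMSEQ[OF that km] by (simp add: comp_def)
  have Z1: "(%n. Z1 (k n)) \<longlonglongrightarrow> l1" using LIMSEQ_subseq_LIMSEQ[OF lr(2) lr'(1)] by (simp add: comp_def k_def)
  have Z2: "(%n. Z2 (k n)) \<longlonglongrightarrow> l2" using lr'(2) by (simp add: k_def)
  have lim: "norm (x - y) = norm (x' - y')"
   if "X \<longlonglongrightarrow> x" "Y \<longlonglongrightarrow> y" "X' \<longlonglongrightarrow> x'" "Y' \<longlonglongrightarrow> y'" "!!n. norm (X n - Y n) = norm (X' n - Y' n)"
   for X Y X' Y' :: "nat => 'a" and x y x' y'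
  proof -
   have "(%n. norm (X n - Y n)) \<longlonglongrightarrow> norm (x - y)" "(%n. norm (X' n - Y' n)) \<longlonglongrightarrow> norm (x' - y')"
    by (intro tendsto_intros that)+
   then show ?thesis unfolding that(5) by (rule LIMSEQ_unique)
  qed
  have E: "norm (l1 - a) = norm (u1 - a)" "norm (l1 - b) = norm (u1 - b)" "norm (l2 - a) = norm (w - a)" "norm (l2 - b) = norm (w - b)"
   "norm (l1 - l2) = norm (u1 - w)"
   by (rule lim[OF Z1 sub[OF A] sub[OF P] sub[OF A] eqs(1)], rule lim[OF Z1 sub[OF B] sub[OF P] sub[OF B] eqs(2)],
     rule lim[OF Z2 sub[OF A] sub[OF Q] sub[OF A] eqs(3)], rule lim[OF Z2 sub[OF B] sub[OF Q] sub[OF B] eqs(4)],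
     rule lim[OF Z1 Z2 sub[OF P] sub[OF Q] eqs(5)])
  have l2: "l2 = w" unfolding w_def e_def
   by (rule segment_point_unique[OF ab t(1,2)]) (use E(3,4) wa wb in \<open>simp_all add: e_def\<close>)
  have l1: "l1 = u1" by (rule sep) (use E l2 in auto)
  define dlt where "dlt = min dlt1 dlt2"
  have dlt: "dlt > 0" using dlt1(1) dlt2(1) by (simp add: dlt_def)
  have "\<forall>\<^sub>F n in sequentially. dist (A (k n)) a < dlt & dist (B (k n)) b < dlt & dist (P (k n)) u1 < dlt & dist (Q (k n)) w < dlt &
    dist (Z1 (k n)) u1 < dlt & dist (Z2 (k n)) w < dlt"
   using dlt by (intro eventually_conj tendstoD[OF sub[OF A]] tendstoD[OF sub[OF B]] tendstoD[OF sub[OF P]] tendstoD[OF sub[OF Q]]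
     tendstoD[OF Z1[unfolded l1]] tendstoD[OF Z2[unfolded l2]])
  then obtain n where n: "norm (A (k n) - a) < dlt" "norm (B (k n) - b) < dlt" "norm (P (k n) - u1) < dlt" "norm (Q (k n) - w) < dlt"
    "norm (Z1 (k n) - u1) < dlt" "norm (Z2 (k n) - w) < dlt"
   unfolding eventually_sequentially dist_norm by blast
  have 1: "Z1 (k n) = P (k n)"
   by (rule dlt1(2)[of "A (k n)" "B (k n)"]) (use n eqs[of "k n"] in \<open>auto simp: dlt_def\<close>)
  have 2: "Z2 (k n) = Q (k n)"
   by (rule dlt2(2)[of "A (k n)" "P (k n)"]) (use n eqs[of "k n"] 1 in \<open>auto simp: dlt_def norm_minus_commute\<close>)
  show False using bd[of "k n"] 1 2 by (simp add: bad_def)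
 qed
 then obtain dlt where "dlt > 0" "!!a' b' p q z1 z2. \<not> bad dlt a' b' p q z1 z2" by blast
 then show ?thesis using near unfolding bad_def by (intro exI[of _ u1] exI[of _ w] exI[of _ dlt]) blast
qed

text \<open>If a nonzero vector is fixed, all fixed vectors are parallel to it; otherwise only 0 is
  fixed and any nonzero \<open>z\<close> serves.\<close>

lemma fixed_line:
 assumes g: "lin_iso g" "g ~= id"
 shows "EX z. z ~= 0 & (ALL x. g x = x --> cr x z = 0)"
proof (cases "EX z. z ~= 0 & g z = z")
 case True
 then obtain z where z: "z ~= 0" "g z = z" by blast
 have "cr x z = 0" if "g x = x" for x
 proof (rule ccontr)
  assume "cr x z ~= 0"
  then have "g y = y" for y by (rule lin_iso_fix_independent[OF g(1) that z(2)])
  then show False using g(2) by auto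
 qed
 then show ?thesis using z(1) by blast
next
 case False
 have "pt 1 0 ~= 0" using pt_eq_0[of 1 0] by auto
 then show ?thesis using False by (metis cr_simps(9))
qed

text \<open>The finitely many nontrivial isometries have finitely many lines of fixed vectors, which
  the difference of the two vertices can avoid.\<close>

lemma dense_open_asymmetric:
 assumes v: "v1 ~= v2" "2 * v1 <= N" "2 * v2 <= N" "even N"
 shows "ALL w:supp_below N. ALL r>0. EX w':nbox N w r. pos v1 w' ~= pos v2 w' & (ALL g. lin_iso g --> g (pos v2 w' - pos v1 w') = pos v2 w' - pos v1 w' --> g = id)"
proof -
 define F where "F = {g. lin_iso g} - {id}"
 have finF: "finite F" using finite_lin_iso by (simp add: F_def)
 have "EX z. z ~= 0 & (ALL x. g x = x --> cr x z = 0)" if "g \<in> F" for g using fixed_line that by (auto simp: F_def)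
 then obtain z where z: "!!g. g \<in> F ==> z g ~= 0 & (ALL x. g x = x --> cr x (z g) = 0)" by metis
 have "dense_open N (%w. (w (2 * v2) - w (2 * v1)) * co2 (z g) - (w (2 * v2+1) - w (2 * v1+1)) * co1 (z g) ~= 0)" if "g \<in> F" for g
 proof (rule dense_open_cross)
  show "(co1 (z g), co2 (z g)) ~= (0, 0)" using z[OF that] co_eqI[of "z g" 0] by (auto simp: co_simps)
 qed (use v in auto)
 then have "dense_open N (%w. ALL g:F. (w (2 * v2) - w (2 * v1)) * co2 (z g) - (w (2 * v2+1) - w (2 * v1+1)) * co1 (z g) ~= 0)"
  by (rule dense_open_ball[OF finF])
 then have "dense_open N (%w. ALL g:F. cr (pos v2 w - pos v1 w) (z g) ~= 0)" by (simp add: cr_def pos_def co_simps)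
 moreover have "dense_open N (%w. w \<in> edge_nonzero {(v1, v2)})"
  by (rule dense_open_edge_nonzero) (use v in \<open>simp add: valid_edges_def\<close>)
 ultimately have dn: "dense_open N (%w. w \<in> edge_nonzero {(v1, v2)} & (ALL g:F. cr (pos v2 w - pos v1 w) (z g) ~= 0))"
  by (intro dense_open_conj)
 show ?thesis
 proof (intro ballI allI impI)
  fix w and r :: real assume w: "w \<in> supp_below N" "r > 0"
  obtain w' where w': "w' \<in> nbox N w r" "w' \<in> edge_nonzero {(v1, v2)}" "!!g. g \<in> F ==> cr (pos v2 w' - pos v1 w') (z g) ~= 0"
   using dense_openD(2)[OF dn w] by blast
  have "g = id" if g: "lin_iso g" "g (pos v2 w' - pos v1 w') = pos v2 w' - pos v1 w'" for g
  proof (rule ccontr)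
   assume "g ~= id"
   then have "g \<in> F" using g by (simp add: F_def)
   then show False using z w'(3) g(2) by blast
  qed
  then show "EX w':nbox N w r. pos v1 w' ~= pos v2 w' & (ALL g. lin_iso g --> g (pos v2 w' - pos v1 w') = pos v2 w' - pos v1 w' --> g = id)"
   using w'(1,2) by (auto simp: edge_nonzero_iff)
 qed
qed

end

section \<open>Stability of rigidity near a regular placement\<close>

context connected_framework begin

text \<open>Given counterexamples \<open>P n\<close>, \<open>Q n\<close> with \<open>P n\<close>
  tending to \<open>p\<close>, bounded edge lengths make a subsequence of \<open>Q n\<close>
  converge to a placement in the fibre of \<open>p\<close> with the same missing length, an
  isometric copy of \<open>p\<close>. Undoing the isometry brings \<open>Q n\<close> close to
  \<open>p\<close>, where the nonsingular rows force it to equal \<open>P n\<close>.\<close>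

lemma near_congruent:
 assumes p: "p \<in> supp_below N" "p \<in> edge_nonzero E" and rw: "!!i. i < N ==> EX e:E. rw i = ed e" and det: "ddet N (jac rw p) ~= 0"
  and rigid: "!!q. q \<in> fibre p ==> norm (pos v1 q - pos v2 q) = norm (pos v1 p - pos v2 p) ==> EX g. lin_iso g & q = act g p"
 shows "EX eps>0. ALL p':nbox N p eps. ALL q:fibre p'. \<bar>norm (pos v1 q - pos v2 q) - norm (pos v1 p' - pos v2 p')\<bar> < eps -->
  (EX g. lin_iso g & q = act g p')"
proof (rule ccontr)
 assume neg: "\<not> ?thesis"
 have rwi: "edges_in E (rw i)" if "i < N" for i using rw[OF that] by (auto simp: edges_in_ed)
 define R where "R n x \<longleftrightarrow> fst x \<in> nbox N p (inverse (real (Suc n))) & snd x \<in> fibre (fst x) &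
  \<bar>norm (pos v1 (snd x) - pos v2 (snd x)) - norm (pos v1 (fst x) - pos v2 (fst x))\<bar> < inverse (real (Suc n)) &
  (ALL g. lin_iso g --> snd x ~= act g (fst x))" for n and x :: "(nat => real) \<times> (nat => real)"
 have "EX x. R n x" for n
 proof -
  have "inverse (real (Suc n)) > 0" by simp
  then obtain p' q where "p' \<in> nbox N p (inverse (real (Suc n)))" "q \<in> fibre p'"
   "\<bar>norm (pos v1 q - pos v2 q) - norm (pos v1 p' - pos v2 p')\<bar> < inverse (real (Suc n))" "ALL g. lin_iso g --> q ~= act g p'"
   using neg by blast
  then show ?thesis unfolding R_def by (intro exI[of _ "(p', q)"]) simp
 qed
 then have "ALL n. EX x. R n x" by blast
 from choice[OF this] obtain s where s: "!!n. R n (s n)" by blast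
 define P Q where "P n = fst (s n)" "Q n = snd (s n)" for n
 have PQ: "P n \<in> nbox N p (inverse (real (Suc n)))" "Q n \<in> fibre (P n)"
  "norm ((norm (pos v1 (Q n) - pos v2 (Q n)) - norm (pos v1 (P n) - pos v2 (P n))) - 0) < inverse (real (Suc n))"
  "lin_iso g ==> Q n ~= act g (P n)" for n g using s[of n] by (simp_all add: P_Q_def R_def)
 have Ps: "P n \<in> supp_below N" "Q n \<in> supp_below N" for n using nbox_supp[OF PQ(1)] fibre_supp[OF PQ(2)] by auto
 have P: "(%n. P n i) \<longlonglongrightarrow> p i" for i
  by (rule tendsto_inverse_bound) (use nboxD[OF PQ(1) p(1)] in simp)
 obtain M where M: "!!n e. e \<in> E ==> eval NF (ed e) (Q n) <= M"
 proof -
  have "EX M. ALL n. eval NF (ed e) (P n) <= M" for e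
  proof -
   have "(%n. eval NF (ed e) (P n)) \<longlonglongrightarrow> eval NF (ed e) p" by (rule eval_ed_tendsto[where X = P]) (rule P)
   then have "Bseq (%n. eval NF (ed e) (P n))" by (meson convergentI convergent_imp_Bseq)
   then show ?thesis by (auto simp: Bseq_def abs_le_iff)
  qed
  then obtain M where M: "!!e n. eval NF (ed e) (P n) <= M e" by metis
  have "eval NF (ed e) (Q n) <= (\<Sum>e\<in>E. \<bar>M e\<bar>)" if e: "e \<in> E" for e n
  proof -
   have "eval NF (ed e) (Q n) = eval NF (ed e) (P n)" using PQ(2)[of n] e by (simp add: fibre_def)
   also have "... <= \<bar>M e\<bar>" using M[of e n] by linarith
   also have "... <= (\<Sum>e\<in>E. \<bar>M e\<bar>)" using e finite_E by (intro member_le_sum) auto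
   finally show ?thesis .
  qed
  then show ?thesis using that by blast
 qed
 obtain l r where lr: "strict_mono (r :: nat => nat)" "l \<in> supp_below N" "!!i. (%n. Q (r n) i) \<longlonglongrightarrow> l i"
  using bounded_subsequence[of Q M, OF Ps(2) M] by blast
 have Pr: "(%n. P (r n) i) \<longlonglongrightarrow> p i" for i using LIMSEQ_subseq_LIMSEQ[OF P lr(1), of i] by (simp add: comp_def)
 have lf: "l \<in> fibre p" by (rule fibre_closed[of "%n. Q (r n)" "%n. P (r n)", OF PQ(2) lr(3) Pr])
 have "norm (pos v1 l - pos v2 l) = norm (pos v1 p - pos v2 p)"
 proof -
  have "(%n. norm (pos v1 (Q n) - pos v2 (Q n)) - norm (pos v1 (P n) - pos v2 (P n))) \<longlonglongrightarrow> 0"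
   by (rule tendsto_inverse_bound) (rule PQ(3))
  from LIMSEQ_subseq_LIMSEQ[OF this lr(1)]
  have "(%n. norm (pos v1 (Q (r n)) - pos v2 (Q (r n))) - norm (pos v1 (P (r n)) - pos v2 (P (r n)))) \<longlonglongrightarrow> 0" by (simp add: comp_def)
  moreover have "(%n. norm (pos v1 (Q (r n)) - pos v2 (Q (r n))) - norm (pos v1 (P (r n)) - pos v2 (P (r n)))) \<longlonglongrightarrow>
    norm (pos v1 l - pos v2 l) - norm (pos v1 p - pos v2 p)"
   by (intro tendsto_intros pos_tendsto[where X = "%n. Q (r n)"] pos_tendsto[where X = "%n. P (r n)"] lr(3) Pr)
  ultimately have "0 = norm (pos v1 l - pos v2 l) - norm (pos v1 p - pos v2 p)" by (rule LIMSEQ_unique)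
  then show ?thesis by simp
 qed
 from rigid[OF lf this] obtain g where g: "lin_iso g" "l = act g p" by blast
 obtain g' where g': "lin_iso g'" "!!x. g (g' x) = x" "!!x. g' (g x) = x" using lin_iso_inverse[OF g(1)] by blast
 have cancel: "act g' (act g y) = y" "act g (act g' y) = y" for y by (rule pos_eqI, simp add: g')+
 have W: "(%n. act g' (Q (r n)) i) \<longlonglongrightarrow> p i" for i
 proof -
  obtain A B where AB: "!!y. act g' y i = A * y (2 * (i div 2)) + B * y (2 * (i div 2) + 1)" using act_linear[OF g'(1)] by blast
  have "(%n. act g' (Q (r n)) i) \<longlonglongrightarrow> act g' l i" unfolding AB by (intro tendsto_intros lr(3))
  then show ?thesis by (simp add: g(2) cancel)
 qed
 obtain rho C where rho: "rho > 0" "!!a b k. a \<in> nbox N p rho ==> b \<in> nbox N p rho ==>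
   \<bar>a k - b k\<bar> <= C * (\<Sum>i<N. \<bar>eval NF (rw i) a - eval NF (rw i) b\<bar>)"
  using local_bi_lipschitz[OF rwi p det] by blast
 have Ws: "act g' (Q n) \<in> supp_below N" for n by (rule act_supp[OF g'(1) Ps(2) even_N])
 have "\<forall>\<^sub>F n in sequentially. (ALL i. \<bar>act g' (Q (r n)) i - p i\<bar> < rho) & (ALL i. \<bar>P (r n) i - p i\<bar> < rho)"
  using config_tendsto_uniform[of "%n. act g' (Q (r n))" p N rho, OF W Ws p(1) rho(1)]
   config_tendsto_uniform[of "%n. P (r n)" p N rho, OF Pr Ps(1) p(1) rho(1)] by (rule eventually_conj)
 then obtain n where n: "!!i. \<bar>act g' (Q (r n)) i - p i\<bar> < rho" "!!i. \<bar>P (r n) i - p i\<bar> < rho" by (auto simp: eventually_sequentially)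
 have "act g' (Q (r n)) = P (r n)"
 proof
  fix k
  have "eval NF (rw i) (act g' (Q (r n))) = eval NF (rw i) (P (r n))" if "i < N" for i
   using rw[OF that] PQ(2)[of "r n"] by (auto simp: eval_ed_act[OF g'(1)] fibre_def)
  moreover have "act g' (Q (r n)) \<in> nbox N p rho" "P (r n) \<in> nbox N p rho" using n Ws Ps by (simp_all add: nbox_def)
  ultimately show "act g' (Q (r n)) k = P (r n) k" using rho(2)[of "act g' (Q (r n))" "P (r n)" k] by simp
 qed
 then have "Q (r n) = act g (P (r n))" using cancel(2)[of "Q (r n)"] by simp
 then show False using PQ(4)[OF g(1)] by blast
qed

end

section \<open>Extensions\<close>

context analytic_plane begin

text \<open>Between equivalent placements the length of \<open>v1 v2\<close> changes by at most
  twice the short length from \<open>v2\<close> to the first new vertex, by the triangle inequality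
  with that vertex. This is within the tolerance under which the old part is congruent; once its
  isometry is undone, the new vertices are determined.\<close>

lemma extension_rigid:
 assumes val: "valid_edges N E" and v: "v1 ~= v2" "2 * v1 <= N" "2 * v2 <= N" "(v1, v2) \<notin> E" "(v2, v1) \<notin> E"
  and q0: "q0 \<in> supp_below N" "r0 > 0"
  and rigid: "!!y y'. y \<in> nbox N q0 r0 ==> y' \<in> supp_below N ==> (!!e. e \<in> E ==> eval NF (ed e) y' = eval NF (ed e) y) ==>
   norm (pos v1 y' - pos v2 y') = norm (pos v1 y - pos v2 y) ==> EX g. lin_iso g & y' = act g y"
 shows "EX p u1 u2 dlt. p \<in> supp_below N & dlt > 0 & (ALL p':nbox N p dlt. ALL p1 p2. ALL q:supp_below N. ALL z1 z2.
  norm (p1 - u1) < dlt & norm (p2 - u2) < dlt & (ALL e:E. eval NF (ed e) q = eval NF (ed e) p') &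
  norm (pos v1 q - z1) = norm (pos v1 p' - p1) & norm (pos v2 q - z1) = norm (pos v2 p' - p1) &
  norm (pos v1 q - z2) = norm (pos v1 p' - p2) & norm (pos v2 q - z2) = norm (pos v2 p' - p2) & norm (z1 - z2) = norm (p1 - p2) -->
  (EX g. lin_iso g & q = act g p' & z1 = g p1 & z2 = g p2))"
proof -
 have conn: "pinned_connected N E" by (rule rigid_imp_independent_edges(1)[OF val v q0 rigid])
 have eN: "even N" using val by (simp add: valid_edges_def)
 interpret connected_framework b1 b2 N E by unfold_locales (fact val conn)+
 obtain p rw where p: "p \<in> nbox N q0 r0" "p \<in> edge_nonzero E" and rw: "!!i. i < N ==> EX e:E. rw i = ed e"
  and det: "ddet N (jac rw p) ~= 0" using rigid_imp_independent_edges(3)[OF val v q0 rigid] by blast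
 have ps: "p \<in> supp_below N" by (rule nbox_supp[OF p(1)])
 have "representable E (%y. ddet N (jac rw y))"
  by (rule representable_jac_ddet) (use rw in \<open>force simp: edges_in_ed\<close>)
 then obtain x where x: "edges_in E x" "!!y. eval NF x y = ddet N (jac rw y)" unfolding representable_def by blast
 obtain s1 where s1: "s1 > 0" "!!w. w \<in> nbox N p s1 ==> ddet N (jac rw w) ~= 0"
  using eval_nonzero_open[OF x(1) p(2) ps] det unfolding x(2) by blast
 obtain s2 where s2: "s2 > 0" "!!w. (ALL i. \<bar>w i - p i\<bar> < s2) ==> w \<in> edge_nonzero E"
  using edge_nonzero_open[OF finite_E p(2)] by blast
 obtain s3 where s3: "s3 > 0" "nbox N p s3 \<subseteq> nbox N q0 r0" using nbox_subset[OF p(1)] by blast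
 define s where "s = min s1 (min s2 s3)"
 have s: "s > 0" "s <= s1" "s <= s2" "s <= s3" using s1(1) s2(1) s3(1) by (simp_all add: s_def)
 \<comment> \<open>A small perturbation of \<open>p\<close> makes every nontrivial isometry move the
   vector from \<open>v1\<close> to \<open>v2\<close>, while the determinant stays nonzero and the
   placement stays in the rigid box.\<close>
 obtain w where w: "w \<in> nbox N p s" "pos v1 w ~= pos v2 w"
  "!!g. lin_iso g ==> g (pos v2 w - pos v1 w) = pos v2 w - pos v1 w ==> g = id"
  using dense_open_asymmetric[OF v(1,2,3) eN] ps s(1) by blast
 have ws: "w \<in> supp_below N" by (rule nbox_supp[OF w(1)])
 have w1: "ddet N (jac rw w) ~= 0" using s1(2) w(1) nbox_mono[OF s(2)] by blast
 have w2: "w \<in> edge_nonzero E"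
 proof (rule s2(2), rule allI)
  fix i show "\<bar>w i - p i\<bar> < s2" using nboxD[OF w(1) ps s(1), of i] s(3) by linarith
 qed
 have w3: "w \<in> nbox N q0 r0" using s3(2) w(1) nbox_mono[OF s(4)] by blast
 have "EX g. lin_iso g & q = act g w" if "q \<in> fibre w" "norm (pos v1 q - pos v2 q) = norm (pos v1 w - pos v2 w)" for q
  using rigid[OF w3, of q] that by (auto simp: fibre_def)
 from near_congruent[of w rw v1 v2, OF ws w2 rw w1 this]
 obtain eps where eps: "eps > 0" "!!p' q. p' \<in> nbox N w eps ==> q \<in> fibre p' ==>
  \<bar>norm (pos v1 q - pos v2 q) - norm (pos v1 p' - pos v2 p')\<bar> < eps ==> EX g. lin_iso g & q = act g p'" by blast
 \<comment> \<open>The length from \<open>v2\<close> to the first new vertex is made up of three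
   contributions below \<open>eps / 8\<close>, and twice their sum is below
   \<open>eps\<close>.\<close>
 have "eps / 8 > 0" using eps(1) by simp
 from diamond_rigid[OF w(2) w(3) this] obtain u1 u2 dlt0 where u: "dlt0 > 0" "norm (u1 - pos v2 w) < eps / 8"
  "!!a' b' p q z1 z2. norm (a' - pos v1 w) < dlt0 ==> norm (b' - pos v2 w) < dlt0 ==> norm (p - u1) < dlt0 ==> norm (q - u2) < dlt0 ==>
  norm (z1 - a') = norm (p - a') ==> norm (z1 - b') = norm (p - b') ==>
  norm (z2 - a') = norm (q - a') ==> norm (z2 - b') = norm (q - b') ==> norm (z1 - z2) = norm (p - q) ==> z1 = p & z2 = q" by blast
 define B where "B = norm b1 + norm b2"
 have B: "B >= 0" by (simp add: B_def)
 define mu where "mu = min dlt0 (eps / 8)"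
 have mu: "mu > 0" "mu <= dlt0" "mu <= eps / 8" using u(1) eps(1) by (simp_all add: mu_def)
 define nu where "nu = mu / 2"
 define dlt where "dlt = nu / (B + 1)"
 have dlt: "dlt > 0" using mu(1) B by (simp add: dlt_def nu_def)
 have "dlt * (B + 1) = nu" using B by (simp add: dlt_def)
 then have "dlt * B + dlt = mu / 2" by (simp add: distrib_left nu_def)
 moreover have "dlt * B >= 0" using dlt B by simp
 ultimately have dltmu: "dlt < mu" "dlt * B < mu" using dlt mu(1) by linarith+
 have "EX g. lin_iso g & q = act g p' & z1 = g p1 & z2 = g p2"
  if p': "p' \<in> nbox N w dlt" and q: "q \<in> supp_below N" and n: "norm (p1 - u1) < dlt" "norm (p2 - u2) < dlt"
   and eq: "ALL e:E. eval NF (ed e) q = eval NF (ed e) p'"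
    "norm (pos v1 q - z1) = norm (pos v1 p' - p1)" "norm (pos v2 q - z1) = norm (pos v2 p' - p1)"
    "norm (pos v1 q - z2) = norm (pos v1 p' - p2)" "norm (pos v2 q - z2) = norm (pos v2 p' - p2)" "norm (z1 - z2) = norm (p1 - p2)"
  for p' p1 p2 q z1 z2
 proof -
  have peps: "p' \<in> nbox N w eps" using p' nbox_mono[of dlt eps N w] dltmu mu eps(1) by auto
  have qf: "q \<in> fibre p'" using q eq(1) by (simp add: fibre_def)
  have pm: "norm (pos a p' - pos a w) < mu" for a
  proof -
   have "norm (pos a p' - pos a w) <= dlt * B" unfolding B_def
    by (rule pos_diff_le) (use nboxD[OF p' ws dlt] in \<open>simp add: less_imp_le\<close>)
   then show ?thesis using dltmu(2) by linarith
  qed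
  have small: "norm (pos v2 p' - p1) < 3 * (eps / 8)"
  proof -
   have "norm (pos v2 p' - p1) = norm ((pos v2 p' - pos v2 w) - (u1 - pos v2 w) - (p1 - u1))" by simp
   also have "... <= norm (pos v2 p' - pos v2 w) + norm (u1 - pos v2 w) + norm (p1 - u1)"
    using norm_triangle_ineq4[of "(pos v2 p' - pos v2 w) - (u1 - pos v2 w)" "p1 - u1"]
     norm_triangle_ineq4[of "pos v2 p' - pos v2 w" "u1 - pos v2 w"] by linarith
   finally show ?thesis using pm[of v2] u(2) n(1) dltmu(1) mu(3) by linarith
  qed
  have tri: "\<bar>norm (x - y) - norm (x - z)\<bar> <= norm (y - z)" for x y z :: 'a
   using norm_triangle_ineq3[of "x - y" "x - z"] by (simp add: norm_minus_commute)
  have "\<bar>norm (pos v1 q - pos v2 q) - norm (pos v1 p' - pos v2 p')\<bar> < eps"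
   using tri[of "pos v1 q" "pos v2 q" z1] tri[of "pos v1 p'" "pos v2 p'" p1] eq(2,3) small eps(1) by linarith
  from eps(2)[OF peps qf this] obtain g where g: "lin_iso g" "q = act g p'" by blast
  obtain g' where g': "lin_iso g'" "!!x. g (g' x) = x" "!!x. g' (g x) = x" using lin_iso_inverse[OF g(1)] by blast
  have pull: "norm (g' x - y) = norm (g y - x)" for x y
  proof -
   have "norm (g' x - y) = norm (g (g' x - y))" by (simp add: lin_isoD(2)[OF g(1)])
   also have "g (g' x - y) = x - g y" using lin_iso_diff[OF g(1), of "g' x" y] by (simp add: g'(2))
   finally show ?thesis by (simp add: norm_minus_commute)
  qed
  have "g' z1 = p1 & g' z2 = p2"
  proof (rule u(3)[of "pos v1 p'" "pos v2 p'"])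
   show "norm (pos v1 p' - pos v1 w) < dlt0" "norm (pos v2 p' - pos v2 w) < dlt0" using pm[of v1] pm[of v2] mu(2) by linarith+
   show "norm (p1 - u1) < dlt0" "norm (p2 - u2) < dlt0" using n dltmu(1) mu(2) by linarith+
   show "norm (g' z1 - pos v1 p') = norm (p1 - pos v1 p')" "norm (g' z1 - pos v2 p') = norm (p1 - pos v2 p')"
    "norm (g' z2 - pos v1 p') = norm (p2 - pos v1 p')" "norm (g' z2 - pos v2 p') = norm (p2 - pos v2 p')"
    using eq g(2) by (simp_all add: pull norm_minus_commute)
   show "norm (g' z1 - g' z2) = norm (p1 - p2)" using eq(6) by (simp add: lin_iso_diff[OF g'(1)] lin_isoD(2)[OF g'(1)])
  qed
  then have "z1 = g p1" "z2 = g p2" using g'(2) by auto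
  then show ?thesis using g by blast
 qed
 then show ?thesis using ws dlt by (intro exI[of _ w] exI[of _ u1] exI[of _ u2] exI[of _ dlt]) blast
qed

lemma lin_iso_affine_isometry:
 assumes "lin_iso g"
 shows "isometry (%x. g (x - a) + b)"
proof -
 obtain h where h: "!!x. g (h x) = x" "!!x. h (g x) = x" using lin_iso_inverse[OF assms] by blast
 have "bij (%x. g (x - a) + b)"
  by (rule bij_betw_byWitness[where f' = "%y. h (y - b) + a"]) (simp_all add: h)
 moreover have "norm ((g (x - a) + b) - (g (y - a) + b)) = norm (x - y)" for x y
 proof -
  have "(g (x - a) + b) - (g (y - a) + b) = g (x - y)" using lin_iso_diff[OF assms, of "x - a" "y - a"] by simp
  then show ?thesis by (simp add: lin_isoD(2)[OF assms])
 qed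
 ultimately show ?thesis by (simp add: isometry_def)
qed

end

text \<open>A neighbourhood in the product contains a product of open sets, and over the finite set
  \<open>V\<close> one radius serves all factors.\<close>

lemma interior_product_box:
 fixes p0 :: "'v => 'a::real_normed_vector"
 assumes V: "finite V" and p0: "p0 \<in> product_topology (%_. euclidean) V interior_of S"
 shows "EX r>0. ALL p:V \<rightarrow>\<^sub>E UNIV. (ALL v:V. norm (p v - p0 v) < r) --> p \<in> S"
proof -
 obtain T where T: "openin (product_topology (%_. euclidean) V) T" "p0 \<in> T" "T \<subseteq> S" using p0 by (auto simp: interior_of_def)
 have "EX U. finite {i \<in> V. U i ~= topspace (euclidean :: 'a topology)} & (ALL i:V. openin euclidean (U i)) & p0 \<in> Pi\<^sub>E V U & Pi\<^sub>E V U \<subseteq> T"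
  using T(1)[unfolded openin_product_topology_alt] T(2) by (rule bspec)
 then obtain U where U: "ALL i:V. openin euclidean (U i)" "p0 \<in> Pi\<^sub>E V U" "Pi\<^sub>E V U \<subseteq> T" by blast
 have "EX r>0. ALL x. norm (x - p0 v) < r --> x \<in> U v" if v: "v \<in> V" for v
 proof -
  have "openin euclidean (U v)" using U(1) v by blast
  then have "open (U v)" by (simp only: open_openin)
  moreover have "p0 v \<in> U v" using U(2) v by (rule PiE_mem)
  ultimately show ?thesis unfolding open_dist dist_norm by blast
 qed
 then obtain r where r: "!!v. v \<in> V ==> r v > 0" "!!v x. v \<in> V ==> norm (x - p0 v) < r v ==> x \<in> U v" by metis
 define rho where "rho = Min (insert 1 (r ` V))"
 have rho: "rho > 0" "!!v. v \<in> V ==> rho <= r v" using V r(1) by (auto simp: rho_def)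
 have "p \<in> S" if p: "p \<in> V \<rightarrow>\<^sub>E UNIV" "ALL v:V. norm (p v - p0 v) < rho" for p
 proof -
  have "p v \<in> U v" if v: "v \<in> V" for v
   by (rule r(2)[OF v]) (use p(2) rho(2)[OF v] v in force)
  then have "p \<in> Pi\<^sub>E V U" using p(1) by (auto simp: PiE_iff)
  then show ?thesis using U(3) T(3) by blast
 qed
 then show ?thesis using rho(1) by blast
qed

theorem theorem7p5:
  fixes V V' :: "'v set" and E E' :: "'v set set"
  assumes "analytic_normed_plane TYPE('a::real_normed_vector)"
    and "simple_graph V E"
    and "globally_rigid_in TYPE('a) V E"
    and "K4_minus_extension V E V' E'"
  shows "globally_rigid_in TYPE('a) V' E'"
proof -
 obtain b1 b2 :: 'a where b: "b1 ~= b2" "independent {b1, b2}" "span {b1, b2} = UNIV"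
  and ser: "!!x. x ~= 0 ==> EX (c :: nat => nat => real) r. r > 0 & (ALL s t. \<bar>s\<bar> < r & \<bar>t\<bar> < r -->
    ((%(i, j). c i j * s ^ i * t ^ j) has_sum norm (x + s *\<^sub>R b1 + t *\<^sub>R b2)) UNIV)"
  using assms(1) unfolding analytic_normed_plane_def real_analytic_on_plane_def by auto
 interpret analytic_plane b1 b2
  by unfold_locales (use b ser assms(1) in \<open>auto simp: analytic_normed_plane_def\<close>)
 have finV: "finite V" and EV: "!!e. e \<in> E ==> e \<subseteq> V & card e = 2" using assms(2) by (auto simp: simple_graph_def)
 obtain v1 v2 u1 u2 where ext: "{v1, v2} \<in> E" "u1 \<notin> V" "u2 \<notin> V" "u1 ~= u2" "V' = V \<union> {u1, u2}"
  "E' = (E - {{v1, v2}}) \<union> {{v1, u1}, {v1, u2}, {v2, u1}, {v2, u2}, {u1, u2}}"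
  using assms(4) unfolding K4_minus_extension_def by blast
 have EVd: "v \<in> V & w \<in> V & v ~= w" if "{v, w} \<in> E" for v w using EV[OF that] by (cases "v = w") auto
 have v: "v1 \<in> V" "v2 \<in> V" "v1 ~= v2" using EVd[OF ext(1)] by auto
 define n where "n = card V"
 obtain f where "bij_betw f V {0..<card V}" using ex_bij_betw_finite_nat[OF finV] by blast
 then have f: "bij_betw f V {..<n}" by (simp add: n_def atLeast0LessThan)
 have finj: "inj_on f V" and fimg: "f ` V = {..<n}" using f by (auto simp: bij_betw_def)
 define vtx where "vtx = inv_into V f"
 have vf: "vtx (f x) = x" if "x \<in> V" for x using finj that by (simp add: vtx_def)
 have fv: "f (vtx i) = i" "vtx i \<in> V" if "i < n" for i
  using that fimg by (simp_all add: vtx_def f_inv_into_f inv_into_into)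
 have fn: "f x < n" if "x \<in> V" for x using fimg that by auto
 have n0: "n > 0" using fn[OF v(1)] by simp
 \<comment> \<open>Two coordinates for every vertex but the last, \<open>w0\<close>, which is
   pinned.\<close>
 define N where "N = 2 * (n - 1)"
 define w0 where "w0 = vtx (n - 1)"
 have w0: "w0 \<in> V" "f w0 = n - 1" using fv[of "n - 1"] n0 by (simp_all add: w0_def)
 have fN: "2 * f x <= N" if "x \<in> V" for x using fn[OF that] by (simp add: N_def)
 \<comment> \<open>Every edge other than \<open>v1 v2\<close> occurs with both orientations.\<close>
 define IE where "IE = (%(x, y). (f x, f y)) ` {(x, y). {x, y} \<in> E - {{v1, v2}}}"
 have IEI: "(f x, f y) \<in> IE" if "{x, y} \<in> E" "{x, y} ~= {v1, v2}" for x y using that by (auto simp: IE_def)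
 have IEE: "EX x y. e = (f x, f y) & {x, y} \<in> E & {x, y} ~= {v1, v2} & x \<in> V & y \<in> V & x ~= y" if e: "e \<in> IE" for e
 proof -
  obtain q where q: "q \<in> {(x, y). {x, y} \<in> E - {{v1, v2}}}" "e = (%(x, y). (f x, f y)) q" using e unfolding IE_def by (rule imageE) auto
  obtain x y where "q = (x, y)" by fastforce
  then have "e = (f x, f y)" "{x, y} \<in> E" "{x, y} ~= {v1, v2}" using q by simp_all
  then show ?thesis using EVd[of x y] by blast
 qed
 have valid: "valid_edges N IE" unfolding valid_edges_def
 proof (intro conjI)
  have "IE \<subseteq> {..<n} \<times> {..<n}" using IEE fn by fastforce
  then show "finite IE" using finite_subset by blast
  show "even N" by (simp add: N_def)
  show "ALL (a, b):IE. a ~= b & 2 * a <= N & 2 * b <= N"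
  proof (clarify)
   fix a b assume "(a, b) \<in> IE"
   from IEE[OF this] obtain x y where "a = f x" "b = f y" "x \<in> V" "y \<in> V" "x ~= y" by blast
   then show "a ~= b & 2 * a <= N & 2 * b <= N" using fN finj by (auto dest: inj_onD)
  qed
 qed
 have notIE: "(f v1, f v2) \<notin> IE" "(f v2, f v1) \<notin> IE"
 proof -
  have False if IE: "(f x, f y) \<in> IE" and xy: "x \<in> V" "y \<in> V" "{x, y} = {v1, v2}" for x y
  proof -
   obtain x' y' where x': "(f x, f y) = (f x', f y')" "{x', y'} ~= {v1, v2}" "x' \<in> V" "y' \<in> V" using IEE[OF IE] by blast
   have "x = x'" "y = y'" using x'(1) inj_onD[OF finj _ xy(1) x'(3)] inj_onD[OF finj _ xy(2) x'(4)] by simp_all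
   then show False using x'(2) xy(3) by simp
  qed
  from this[of v1 v2] this[of v2 v1] show "(f v1, f v2) \<notin> IE" "(f v2, f v1) \<notin> IE" using v insert_commute[of v2 v1 "{}"] by auto
 qed
 have fv12: "f v1 ~= f v2" using v finj by (auto dest: inj_onD)
 \<comment> \<open>The coordinates of a placement after translating \<open>w0\<close> to the
   origin.\<close>
 define cfg where "cfg p i = (if i < N then if even i then co1 (p (vtx (i div 2)) - p w0) else co2 (p (vtx (i div 2)) - p w0) else 0)"
  for p :: "'v => 'a" and i
 have cs: "cfg p \<in> supp_below N" for p by (simp add: cfg_def supp_below_def)
 have pc: "pos (f x) (cfg p) = p x - p w0" if x: "x \<in> V" for x p
 proof (cases "2 * f x < N")
  case True
  then have "2 * f x + 1 < N" by (simp add: N_def)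
  then show ?thesis using True x by (simp add: pos_def cfg_def vf)
 next
  case False
  then have "f x = f w0" using fN[OF x] by (simp add: w0(2) N_def)
  then have "x = w0" using finj x w0(1) by (auto dest: inj_onD)
  then show ?thesis using False pos_pinned[OF cs, of "f x" p] by simp
 qed
 define B where "B = norm b1 + norm b2"
 have B: "B >= 0" by (simp add: B_def)
 obtain p0 where p0: "p0 \<in> product_topology (%_. euclidean :: 'a topology) V interior_of
    {p \<in> V \<rightarrow>\<^sub>E (UNIV :: 'a set). globally_rigid_framework V E p}" using assms(3) unfolding globally_rigid_in_def by blast
 from interior_product_box[OF finV this] obtain r where "r > 0"
  "ALL p:V \<rightarrow>\<^sub>E UNIV. (ALL v:V. norm (p v - p0 v) < r) --> p \<in> {p \<in> V \<rightarrow>\<^sub>E (UNIV :: 'a set). globally_rigid_framework V E p}" by (elim exE conjE)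
 then have r: "r > 0" "!!p. p \<in> V \<rightarrow>\<^sub>E UNIV ==> (!!v. v \<in> V ==> norm (p v - p0 v) < r) ==> globally_rigid_framework V E p" by simp_all
 define r0 where "r0 = r / (B + 1)"
 have r0: "r0 > 0" "r0 * B < r"
 proof -
  show "r0 > 0" using r(1) B by (simp add: r0_def)
  moreover have "r0 * (B + 1) = r" using B by (simp add: r0_def)
  ultimately show "r0 * B < r" by (simp add: distrib_left)
 qed
 have rigid: "EX g. lin_iso g & y' = act g y"
  if y: "y \<in> nbox N (cfg p0) r0" and y': "y' \<in> supp_below N" and eqE: "!!e. e \<in> IE ==> eval NF (ed e) y' = eval NF (ed e) y"
   and eqh: "norm (pos (f v1) y' - pos (f v2) y') = norm (pos (f v1) y - pos (f v2) y)" for y y'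
 proof -
  \<comment> \<open>The inverse passage from coordinates to placements, translated back so that
    \<open>w0\<close> sits at \<open>p0 w0\<close>.\<close>
  define P where "P = (%y. restrict (%x. pos (f x) y + p0 w0) V)"
  have PE: "P y \<in> V \<rightarrow>\<^sub>E UNIV" for y by (simp add: P_def)
  have Px: "P y x = pos (f x) y + p0 w0" if "x \<in> V" for x y using that by (simp add: P_def)
  have gr: "globally_rigid_framework V E (P y)"
  proof (rule r(2)[OF PE])
   fix x assume x: "x \<in> V"
   have "norm (pos (f x) y - pos (f x) (cfg p0)) <= r0 * (norm b1 + norm b2)"
    by (rule pos_diff_le) (use nboxD[OF y cs r0(1)] in \<open>simp add: less_imp_le\<close>)
   moreover have "P y x - p0 x = pos (f x) y - pos (f x) (cfg p0)" by (simp add: Px[OF x] pc[OF x])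
   ultimately show "norm (P y x - p0 x) < r" using r0(2) by (simp add: B_def)
  qed
  have eqv: "equivalent_frameworks E (P y) (P y')" unfolding equivalent_frameworks_def
  proof (intro allI impI)
   fix x z assume e: "{x, z} \<in> E"
   have xz: "x \<in> V" "z \<in> V" using EVd[OF e] by auto
   have "norm (pos (f x) y - pos (f z) y) = norm (pos (f x) y' - pos (f z) y')"
   proof (cases "{x, z} = {v1, v2}")
    case True
    then have "x = v1 & z = v2 \<or> x = v2 & z = v1" by (auto simp: doubleton_eq_iff)
    then show ?thesis using eqh by (auto simp: norm_minus_commute)
   next
    case False
    from eqE[OF IEI[OF e False]] show ?thesis by (simp add: eval_ed)
   qed
   then show "norm (P y x - P y z) = norm (P y' x - P y' z)" by (simp add: Px xz)
  qed
  obtain g0 where g0: "isometry g0" "!!x. x \<in> V ==> P y' x = g0 (P y x)"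
   using gr[unfolded globally_rigid_framework_def, THEN bspec, OF PE, THEN mp, OF eqv] unfolding congruent_frameworks_def by blast
  \<comment> \<open>Conjugating with the translation gives an isometry that fixes 0, since
    \<open>w0\<close> has the same position in both placements; it is therefore linear.\<close>
  define g where "g x = g0 (x + p0 w0) - p0 w0" for x
  have ys: "y \<in> supp_below N" by (rule nbox_supp[OF y])
  have pin: "pos (f w0) z = 0" if "z \<in> supp_below N" for z by (rule pos_pinned[OF that]) (simp add: w0 N_def)
  have "g0 (p0 w0) = p0 w0" using g0(2)[OF w0(1)] by (simp add: Px[OF w0(1)] pin ys y')
  then have g_0: "g 0 = 0" by (simp add: g_def)
  have "bij g"
  proof -
   have "bij (%x. x + p0 w0)" "bij (%x. x - p0 w0)" by (rule bij_plus_right bij_diff_right)+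
   moreover have "g = (%x. x - p0 w0) \<circ> g0 \<circ> (%x. x + p0 w0)" by (auto simp: g_def)
   ultimately show ?thesis using g0(1) by (simp add: isometry_def bij_comp)
  qed
  then have "isometry g" using g0(1) by (simp add: isometry_def g_def)
  then have g: "lin_iso g" using g_0 by (rule isometry_fixing_0_linear)
  have "y' = act g y"
  proof (rule pos_eqI)
   fix a
   show "pos a y' = pos a (act g y)"
   proof (cases "a < n")
    case True
    have "P y' (vtx a) = g0 (P y (vtx a))" by (rule g0(2)[OF fv(2)[OF True]])
    then have "pos a y' + p0 w0 = g0 (pos a y + p0 w0)" by (simp add: Px[OF fv(2)[OF True]] fv(1)[OF True])
    then show ?thesis by (simp add: g_def eq_diff_eq)
   next
    case False
    then have "2 * a >= N" by (simp add: N_def)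
    then show ?thesis using pos_pinned[OF y'] pos_pinned[OF ys] g_0 by simp
   qed
  qed
  then show ?thesis using g by blast
 qed
 have "EX p c1 c2 dlt. p \<in> supp_below N & dlt > 0 & (ALL p':nbox N p dlt. ALL p1 p2. ALL q:supp_below N. ALL z1 z2.
  norm (p1 - c1) < dlt & norm (p2 - c2) < dlt & (ALL e:IE. eval NF (ed e) q = eval NF (ed e) p') &
  norm (pos (f v1) q - z1) = norm (pos (f v1) p' - p1) & norm (pos (f v2) q - z1) = norm (pos (f v2) p' - p1) &
  norm (pos (f v1) q - z2) = norm (pos (f v1) p' - p2) & norm (pos (f v2) q - z2) = norm (pos (f v2) p' - p2) & norm (z1 - z2) = norm (p1 - p2) -->
  (EX g. lin_iso g & q = act g p' & z1 = g p1 & z2 = g p2))"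
  by (rule extension_rigid[OF valid fv12 fN[OF v(1)] fN[OF v(2)] notIE cs[of p0] r0(1)], rule rigid)
 then obtain p c1 c2 dlt where p: "p \<in> supp_below N" "dlt > 0" and glue: "ALL p':nbox N p dlt. ALL p1 p2. ALL q:supp_below N. ALL z1 z2.
  norm (p1 - c1) < dlt & norm (p2 - c2) < dlt & (ALL e:IE. eval NF (ed e) q = eval NF (ed e) p') &
  norm (pos (f v1) q - z1) = norm (pos (f v1) p' - p1) & norm (pos (f v2) q - z1) = norm (pos (f v2) p' - p1) &
  norm (pos (f v1) q - z2) = norm (pos (f v1) p' - p2) & norm (pos (f v2) q - z2) = norm (pos (f v2) p' - p2) & norm (z1 - z2) = norm (p1 - p2) -->
  (EX g. lin_iso g & q = act g p' & z1 = g p1 & z2 = g p2)" by (elim exE conjE)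
 obtain K where K: "K > 0" "!!x. \<bar>co1 x\<bar> + \<bar>co2 x\<bar> <= K * norm x" using coords_bounded by blast
 define nu where "nu = dlt / 2"
 \<comment> \<open>Subtracting the position of \<open>w0\<close> doubles the error of a vertex to
   \<open>2 * eta\<close>, and passing to coordinates multiplies it by \<open>K\<close>; both must
   stay below \<open>dlt\<close>.\<close>
 define eta where "eta = nu / (K + 1)"
 have eta: "eta > 0" using p(2) K(1) by (simp add: eta_def nu_def)
 have "eta * (K + 1) = nu" using K(1) by (simp add: eta_def)
 then have "2 * (eta * (K + 1)) = dlt" by (simp add: nu_def)
 then have etadlt: "2 * eta + K * (2 * eta) = dlt" by (simp add: algebra_simps)
 have Keta: "2 * eta < dlt" "K * (2 * eta) < dlt"
 proof -
  have "K * (2 * eta) > 0" using K(1) eta by simp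
  then show "2 * eta < dlt" "K * (2 * eta) < dlt" using etadlt eta by linarith+
 qed
 define Pc where "Pc x = (if x = u1 then c1 else if x = u2 then c2 else pos (f x) p)" for x
 \<comment> \<open>The open set of placements: a ball of radius \<open>eta\<close> around each
   vertex of the centre \<open>Pc\<close>, in which the pinned vertex \<open>w0\<close> may move
   too.\<close>
 define W where "W = Pi\<^sub>E V' (%x. ball (Pc x) eta)"
 have finV': "finite V'" using finV ext(5) by simp
 have "openin (product_topology (%_. euclidean) V') W" unfolding W_def
  by (simp add: openin_PiE finV')
 moreover have "W \<subseteq> {P \<in> V' \<rightarrow>\<^sub>E UNIV. globally_rigid_framework V' E' P}"
 proof
  fix P assume P: "P \<in> W"
  have Pb: "norm (P x - Pc x) < eta" if "x \<in> V'" for x using P that by (auto simp: W_def PiE_iff dist_norm norm_minus_commute)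
  have PE: "P \<in> V' \<rightarrow>\<^sub>E UNIV" using P by (auto simp: W_def PiE_iff)
  have VV: "x \<in> V'" if "x \<in> V" for x using that ext(5) by simp
  have pw: "Pc x = pos (f x) p" if "x \<in> V" for x using that ext(2,3) by (auto simp: Pc_def)
  have Pw0: "Pc w0 = 0" using pos_pinned[OF p(1), of "f w0"] by (simp add: pw[OF w0(1)] w0(2) N_def)
  have nd: "norm ((P x - P w0) - Pc x) < 2 * eta" if "x \<in> V'" for x
  proof -
   have "(P x - P w0) - Pc x = (P x - Pc x) - (P w0 - Pc w0)" by (simp add: Pw0)
   then have "norm ((P x - P w0) - Pc x) <= norm (P x - Pc x) + norm (P w0 - Pc w0)" by (simp only: norm_triangle_ineq4)
   then show ?thesis using Pb[OF that] Pb[OF VV[OF w0(1)]] by linarith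
  qed
  have Pn: "cfg P \<in> nbox N p dlt"
  proof -
   have "\<bar>cfg P i - p i\<bar> < dlt" if i: "i < N" for i
   proof -
    have a: "i div 2 < n" using i by (simp add: N_def)
    define x where "x = vtx (i div 2)"
    have x: "x \<in> V" "f x = i div 2" using fv[OF a] by (simp_all add: x_def)
    define d where "d = (P x - P w0) - Pc x"
    have "K * norm d < K * (2 * eta)" using nd[OF VV[OF x(1)]] K(1) by (simp add: d_def)
    then have d: "\<bar>co1 d\<bar> < dlt" "\<bar>co2 d\<bar> < dlt" using K(2)[of d] Keta(2) by linarith+
    have c: "d = pos (i div 2) (cfg P) - pos (i div 2) p" using pc[OF x(1), of P] x(2) by (simp add: d_def pw[OF x(1)])
    show ?thesis
    proof (cases "even i")
     case True
     then have "co1 d = cfg P i - p i" by (simp add: c pos_def co_simps)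
     then show ?thesis using d by simp
    next
     case False
     then have "co2 d = cfg P i - p i" by (simp add: c pos_def co_simps odd_two_times_div_two_succ)
     then show ?thesis using d by simp
    qed
   qed
   then show ?thesis using cs by (simp add: nbox_def)
  qed
  have "globally_rigid_framework V' E' P" unfolding globally_rigid_framework_def
  proof (intro ballI impI)
   fix Q assume Q: "Q \<in> V' \<rightarrow>\<^sub>E UNIV" and eqv: "equivalent_frameworks E' P Q"
   have eq: "norm (P x - P y) = norm (Q x - Q y)" if "{x, y} \<in> E'" for x y using eqv that by (simp add: equivalent_frameworks_def)
   have nE: "{v1, u1} \<in> E'" "{v1, u2} \<in> E'" "{v2, u1} \<in> E'" "{v2, u2} \<in> E'" "{u1, u2} \<in> E'" by (simp_all add: ext(6))
   have "EX g. lin_iso g & cfg Q = act g (cfg P) & Q u1 - Q w0 = g (P u1 - P w0) & Q u2 - Q w0 = g (P u2 - P w0)"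
   proof (rule glue[THEN bspec, OF Pn, THEN spec, THEN spec, THEN bspec, OF cs, THEN spec, THEN spec, THEN mp], intro conjI)
    have "u1 \<in> V'" "u2 \<in> V'" "Pc u1 = c1" "Pc u2 = c2" using ext(4,5) by (simp_all add: Pc_def)
    then show "norm (P u1 - P w0 - c1) < dlt" "norm (P u2 - P w0 - c2) < dlt" using nd[of u1] nd[of u2] Keta(1) by simp_all
    show "ALL e:IE. eval NF (ed e) (cfg Q) = eval NF (ed e) (cfg P)"
    proof
     fix e assume "e \<in> IE"
     from IEE[OF this] obtain x y where e: "e = (f x, f y)" "{x, y} \<in> E" "{x, y} ~= {v1, v2}" "x \<in> V" "y \<in> V" by blast
     then have "{x, y} \<in> E'" by (simp add: ext(6))
     from eq[OF this] show "eval NF (ed e) (cfg Q) = eval NF (ed e) (cfg P)" by (simp add: eval_ed e(1) pc e(4,5))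
    qed
   qed (simp_all add: pc v eq[OF nE(1)] eq[OF nE(2)] eq[OF nE(3)] eq[OF nE(4)] eq[OF nE(5)])
   then obtain g where g: "lin_iso g" "cfg Q = act g (cfg P)" "Q u1 - Q w0 = g (P u1 - P w0)" "Q u2 - Q w0 = g (P u2 - P w0)" by blast
   have "Q x = g (P x - P w0) + Q w0" if "x \<in> V'" for x
   proof (cases "x \<in> V")
    case True
    have "pos (f x) (cfg Q) = g (pos (f x) (cfg P))" using g(2) by simp
    then show ?thesis by (simp add: pc[OF True] diff_eq_eq)
   next
    case False
    then have "x = u1 \<or> x = u2" using that ext(5) by simp
    then show ?thesis using g(3,4) by (auto simp: diff_eq_eq)
   qed
   then show "congruent_frameworks V' P Q"
    unfolding congruent_frameworks_def using lin_iso_affine_isometry[OF g(1), of "P w0" "Q w0"] by blast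
  qed
  then show "P \<in> {P \<in> V' \<rightarrow>\<^sub>E UNIV. globally_rigid_framework V' E' P}" using PE by simp
 qed
 moreover have "restrict Pc V' \<in> W" using eta by (simp add: W_def)
 ultimately have "restrict Pc V' \<in> product_topology (%_. euclidean :: 'a topology) V' interior_of
    {P \<in> V' \<rightarrow>\<^sub>E (UNIV :: 'a set). globally_rigid_framework V' E' P}" unfolding interior_of_def by blast
 then show ?thesis unfolding globally_rigid_in_def by blast
qed

end
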